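(* Let $\mathfrak{M}$ be a homogeneous smooth matchbox manifold. Then $\mathfrak{M}$ is homeomorphic to a McCord solenoid. In particular, $\mathfrak{M}$ is minimal, i.e. every leaf of its foliation $\mathcal{F}$ is dense in $\mathfrak{M}$.
   Context: Homogeneous: a topological space $X$ is homogeneous if for all $x,y\in X$ there is a homeomorphism $h\colon X\to X$ with $h(x)=y$. Foliated spaces: a continuum is a compact, connected, non-empty metrizable space. A continuum $\mathfrak{M}$ is a foliated space of dimension $n$ if there is a compact separable metric space $\mathfrak{X}$ and, for each $x\in\mathfrak{M}$, a compact subset $\mathfrak{T}_x\subset\mathfrak{X}$, an open set $U_x\subset\mathfrak{M}$ containing $x$, and a homeomorphism $\varphi_x\colon\overline{U}_x\to[-1,1]^n\times\mathfrak{T}_x$ with $\varphi_x(x)=(0,w_x)$, $w_x\in \mathrm{int}(\mathfrak{T}_x)$, and $U_x=\varphi_x^{-1}((-1,1)^n\times \mathrm{int}(\mathfrak{T}_x))$. Let $\pi_x\colon\overline{U}_x\to\mathfrak{T}_x$ be $\varphi_x$ followed by projection to the second factor. For $w\in\mathfrak{T}_x$ the plaque is $\mathcal{P}_x(w)=\pi_x^{-1}(w)$, with $\mathrm{int}(\mathcal{P}_x(w))=\varphi_x^{-1}((-1,1)^n\times\{w\})$, and for $z\in\overline{U}_x$ one writes $\mathcal{P}_x(z)=\mathcal{P}_x(\pi_x(z))$. It is required that for $z\in U_x\cap U_y$ the set $\mathrm{int}(\mathcal{P}_x(z))\cap \mathrm{int}(\mathcal{P}_y(z))$ is open in both $\mathcal{P}_x(z)$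 and $\mathcal{P}_y(z)$. The sets $\varphi_x^{-1}(V\times\{w\})$, with $x\in\mathfrak{M}$, $w\in\mathfrak{T}_x$, $V\subset(-1,1)^n$ open, form a basis of the fine topology on $\mathfrak{M}$; the connected components in the fine topology are the leaves of the foliation $\mathcal{F}$. Smoothness: the foliated space is smooth if the charts can be chosen such that whenever $z\in U_x\cap U_y$ there is an open set $V_z$ with $z\in V_z\subset U_x\cap U_y$, with $\mathcal{P}_x(z)\cap V_z$ and $\mathcal{P}_y(z)\cap V_z$ connected open sets, such that $\varphi_y\circ\varphi_x^{-1}\colon\varphi_x(\mathcal{P}_x(z)\cap V_z)\to\varphi_y(\mathcal{P}_y(z)\cap V_z)$ is a smooth map (between subsets of $\mathbb{R}^n\times\{w\}\cong\mathbb{R}^n$ and $\mathbb{R}^n\times\{w'\}\cong\mathbb{R}^n$), depending continuously on $z$ in the $C^\infty$-topology on maps. A matchbox manifold is a continuum with the structure of a smooth foliated space such that every $\mathfrak{T}_x$ is totally disconnected. Solenoids: an $n$-dimensional solenoid is an inverse limit $\mathcal{S}=\varprojlim\{p_{\ell+1}\colon M_{\ell+1}\to M_\ell\}$, where for each $\ell\ge 0$, $M_\ell$ is a compact, connected, $n$-dimensional manifold without boundary, and the maps $p_{\ell+1}\colon M_{\ell+1}\to M_\ell$ are proper covering maps. It is a McCord solenoid if all of the defined compositions of the covering maps $p_\ell$ are normal coverings. *)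

theory Defs
  imports "HOL-Analysis.Analysis"
begin

section \<open>Continua and homogeneous spaces\<close>

definition homogeneous :: "'a topology \<Rightarrow> bool" where
  "homogeneous X \<longleftrightarrow>
     (\<forall>x\<in>topspace X. \<forall>y\<in>topspace X. \<exists>h. homeomorphic_map X X h \<and> h x = y)"

definition continuum :: "'a topology \<Rightarrow> bool" where
  "continuum X \<longleftrightarrow>
     compact_space X \<and> connected_space X \<and> topspace X \<noteq> {} \<and> metrizable_space X"

definition totally_disconnected_in :: "'a topology \<Rightarrow> 'a set \<Rightarrow> bool" where
  "totally_disconnected_in X S \<longleftrightarrow>
     (\<forall>C. connectedin X C \<and> C \<subseteq> S \<longrightarrow> (\<exists>a. C \<subseteq> {a}))"

section \<open>Foliated spaces\<close>

text \<open>The model of \<open>n\<close>-space is \<^const>\<open>Euclidean_space\<close>: a point is a function on the naturals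
  that vanishes at every index \<open>i \<ge> n\<close>. This includes the case \<open>n = 0\<close>.\<close>

definition closed_cube :: "nat \<Rightarrow> (nat \<Rightarrow> real) set" where
  "closed_cube n = {p \<in> topspace (Euclidean_space n). \<forall>i<n. -1 \<le> p i \<and> p i \<le> 1}"

definition open_cube :: "nat \<Rightarrow> (nat \<Rightarrow> real) set" where
  "open_cube n = {p \<in> topspace (Euclidean_space n). \<forall>i<n. -1 < p i \<and> p i < 1}"

text \<open>The chart data of a foliated space: the ambient space of the transversals, and for each
  point \<open>x\<close> the transversal \<open>T\<^sub>x\<close>, the open set \<open>U\<^sub>x\<close> and the chart \<open>\<phi>\<^sub>x\<close>, which matters only
  on the closure of \<open>U\<^sub>x\<close>.\<close>

record ('a, 'b) foliation_charts =
  transversal_space :: "'b topology"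
  transversal :: "'a \<Rightarrow> 'b set"
  chart_dom :: "'a \<Rightarrow> 'a set"
  chart :: "'a \<Rightarrow> 'a \<Rightarrow> (nat \<Rightarrow> real) \<times> 'b"

definition plaque :: "'a topology \<Rightarrow> ('a, 'b) foliation_charts \<Rightarrow> 'a \<Rightarrow> 'b \<Rightarrow> 'a set" where
  "plaque M F x w = {y \<in> M closure_of chart_dom F x. snd (chart F x y) = w}"

definition int_plaque ::
  "nat \<Rightarrow> 'a topology \<Rightarrow> ('a, 'b) foliation_charts \<Rightarrow> 'a \<Rightarrow> 'b \<Rightarrow> 'a set" where
  "int_plaque n M F x w =
     {y \<in> M closure_of chart_dom F x. chart F x y \<in> open_cube n \<times> {w}}"

definition foliated_space :: "nat \<Rightarrow> 'a topology \<Rightarrow> ('a, 'b) foliation_charts \<Rightarrow> bool" where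
  "foliated_space n M F \<longleftrightarrow>
     continuum M \<and>
     compact_space (transversal_space F) \<and>
     separable_space (transversal_space F) \<and>
     metrizable_space (transversal_space F) \<and>
     (\<forall>x\<in>topspace M.
        compactin (transversal_space F) (transversal F x) \<and>
        openin M (chart_dom F x) \<and> x \<in> chart_dom F x \<and>
        homeomorphic_map
          (subtopology M (M closure_of chart_dom F x))
          (prod_topology (subtopology (Euclidean_space n) (closed_cube n))
                         (subtopology (transversal_space F) (transversal F x)))
          (chart F x) \<and>
        fst (chart F x x) = (\<lambda>i. 0) \<and>
        snd (chart F x x) \<in> transversal_space F interior_of transversal F x \<and>
        chart_dom F x =
          {y \<in> M closure_of chart_dom F x.
             chart F x y \<in> open_cube n \<times> (transversal_space F interior_of transversal F x)}) \<and>
     (\<forall>x\<in>topspace M. \<forall>y\<in>topspace M. \<forall>z\<in>chart_dom F x \<inter> chart_dom F y.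
        let P = plaque M F x (snd (chart F x z)); Q = plaque M F y (snd (chart F y z));
            I = int_plaque n M F x (snd (chart F x z)) \<inter> int_plaque n M F y (snd (chart F y z))
        in openin (subtopology M P) I \<and> openin (subtopology M Q) I)"

definition fine_topology ::
  "nat \<Rightarrow> 'a topology \<Rightarrow> ('a, 'b) foliation_charts \<Rightarrow> 'a topology" where
  "fine_topology n M F = topology_generated_by
     {{y \<in> M closure_of chart_dom F x. chart F x y \<in> V \<times> {w}} | x w V.
        x \<in> topspace M \<and> w \<in> transversal F x \<and>
        openin (Euclidean_space n) V \<and> V \<subseteq> open_cube n}"

definition leaves :: "nat \<Rightarrow> 'a topology \<Rightarrow> ('a, 'b) foliation_charts \<Rightarrow> 'a set set" where
  "leaves n M F = connected_components_of (fine_topology n M F)"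

section \<open>Smoothness and matchbox manifolds\<close>

definition partial_deriv :: "nat \<Rightarrow> ((nat \<Rightarrow> real) \<Rightarrow> real) \<Rightarrow> (nat \<Rightarrow> real) \<Rightarrow> real" where
  "partial_deriv i f p = deriv (\<lambda>t. f (p(i := t))) (p i)"

definition iterated_partial ::
  "nat list \<Rightarrow> ((nat \<Rightarrow> real) \<Rightarrow> real) \<Rightarrow> (nat \<Rightarrow> real) \<Rightarrow> real" where
  "iterated_partial ds f = foldr partial_deriv ds f"

text \<open>Meant for \<open>D\<close> open in \<open>n\<close>-space. Only the values of \<open>f\<close> on \<open>D\<close> and its coordinates below
  \<open>n\<close> matter.\<close>

definition smooth_map_on ::
  "nat \<Rightarrow> (nat \<Rightarrow> real) set \<Rightarrow> ((nat \<Rightarrow> real) \<Rightarrow> (nat \<Rightarrow> real)) \<Rightarrow> bool" where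
  "smooth_map_on n D f \<longleftrightarrow>
     (\<forall>j<n. \<forall>ds. set ds \<subseteq> {..<n} \<longrightarrow>
        continuous_map (subtopology (Euclidean_space n) D) euclideanreal
          (iterated_partial ds (\<lambda>p. f p j)) \<and>
        (\<forall>i<n. \<forall>p\<in>D. (\<lambda>t. iterated_partial ds (\<lambda>q. f q j) (p(i := t))) differentiable at (p i)))"

text \<open>For \<open>V\<close> open inside \<open>U\<^sub>x\<close>, the image of the part in \<open>V\<close> of the plaque of \<open>z\<close> under the
  chart at \<open>x\<close>, with the constant transverse coordinate dropped.\<close>

definition plaque_image ::
  "'a topology \<Rightarrow> ('a, 'b) foliation_charts \<Rightarrow> 'a \<Rightarrow> 'a \<Rightarrow> 'a set \<Rightarrow> (nat \<Rightarrow> real) set" where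
  "plaque_image M F x z V = (\<lambda>y. fst (chart F x y)) ` (plaque M F x (snd (chart F x z)) \<inter> V)"

definition transition ::
  "'a topology \<Rightarrow> ('a, 'b) foliation_charts \<Rightarrow> 'a \<Rightarrow> 'a \<Rightarrow> 'a \<Rightarrow> (nat \<Rightarrow> real) \<Rightarrow> (nat \<Rightarrow> real)"
  where
  "transition M F x y z p =
     fst (chart F y (inv_into (M closure_of chart_dom F x) (chart F x) (p, snd (chart F x z))))"

text \<open>A family of maps \<open>f z\<close>, for \<open>z \<in> S\<close>, with open domains \<open>D z\<close> in \<open>n\<close>-space depends
  continuously on \<open>z\<close> in the \<open>C\<^sup>\<infinity>\<close>-topology: all iterated partial derivatives, of order 0
  included, converge uniformly on compact sets. As the domains vary, maps are compared where both
  are defined. In the application below \<open>D z'\<close> contains the point with coordinates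
  \<open>fst (\<phi>\<^sub>x(z'))\<close>, which tends to that of \<open>z\<close> as \<open>z'\<close> tends to \<open>z\<close>, so the comparison is never
  void near \<open>z\<close>.\<close>

definition smoothly_continuous_family ::
  "nat \<Rightarrow> 'a topology \<Rightarrow> 'a set \<Rightarrow> ('a \<Rightarrow> (nat \<Rightarrow> real) set) \<Rightarrow>
     ('a \<Rightarrow> (nat \<Rightarrow> real) \<Rightarrow> (nat \<Rightarrow> real)) \<Rightarrow> bool" where
  "smoothly_continuous_family n M S D f \<longleftrightarrow>
     (\<forall>z\<in>S. \<forall>K ds j. \<forall>\<epsilon>>0.
        compactin (Euclidean_space n) K \<and> K \<subseteq> D z \<and> set ds \<subseteq> {..<n} \<and> j < n \<longrightarrow>
        (\<exists>W. openin M W \<and> z \<in> W \<and>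
           (\<forall>z'\<in>W \<inter> S. \<forall>p\<in>K \<inter> D z'.
              \<bar>iterated_partial ds (\<lambda>q. f z' q j) p - iterated_partial ds (\<lambda>q. f z q j) p\<bar> < \<epsilon>)))"

text \<open>The inclusion of plaque pieces expresses that \<open>\<phi>\<^sub>y \<circ> \<phi>\<^sub>x\<^sup>-\<^sup>1\<close> maps the image of the first
  piece into the image of the second, so that forgetting the transverse coordinate in the target
  is harmless.\<close>

definition smooth_foliated_space ::
  "nat \<Rightarrow> 'a topology \<Rightarrow> ('a, 'b) foliation_charts \<Rightarrow> bool" where
  "smooth_foliated_space n M F \<longleftrightarrow>
     foliated_space n M F \<and>
     (\<forall>x\<in>topspace M. \<forall>y\<in>topspace M. \<exists>V.
        (\<forall>z\<in>chart_dom F x \<inter> chart_dom F y.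
           let P = plaque M F x (snd (chart F x z)); Q = plaque M F y (snd (chart F y z))
           in openin M (V z) \<and> z \<in> V z \<and> V z \<subseteq> chart_dom F x \<inter> chart_dom F y \<and>
              connectedin M (P \<inter> V z) \<and> openin (subtopology M P) (P \<inter> V z) \<and>
              connectedin M (Q \<inter> V z) \<and> openin (subtopology M Q) (Q \<inter> V z) \<and>
              P \<inter> V z \<subseteq> Q \<inter> V z \<and>
              smooth_map_on n (plaque_image M F x z (V z)) (transition M F x y z)) \<and>
        smoothly_continuous_family n M (chart_dom F x \<inter> chart_dom F y)
          (\<lambda>z. plaque_image M F x z (V z)) (transition M F x y))"

definition matchbox_manifold :: "nat \<Rightarrow> 'a topology \<Rightarrow> ('a, 'b) foliation_charts \<Rightarrow> bool" where
  "matchbox_manifold n M F \<longleftrightarrow>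
     smooth_foliated_space n M F \<and>
     (\<forall>x\<in>topspace M. totally_disconnected_in (transversal_space F) (transversal F x))"

section \<open>Solenoids\<close>

definition topological_manifold :: "nat \<Rightarrow> 'c topology \<Rightarrow> bool" where
  "topological_manifold n X \<longleftrightarrow>
     Hausdorff_space X \<and> second_countable X \<and>
     (\<forall>x\<in>topspace X. \<exists>U V. openin X U \<and> x \<in> U \<and> openin (Euclidean_space n) V \<and>
        subtopology X U homeomorphic_space subtopology (Euclidean_space n) V)"

text \<open>The map \<open>p (Suc l)\<close> goes from \<open>N (Suc l)\<close> to \<open>N l\<close>, and \<open>p 0\<close> is not used. ``Proper'' has
  its topological meaning. Coverings of degree one are allowed.\<close>

definition solenoid_system ::
  "nat \<Rightarrow> (nat \<Rightarrow> 'c::topological_space set) \<Rightarrow> (nat \<Rightarrow> 'c \<Rightarrow> 'c) \<Rightarrow> bool" where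
  "solenoid_system n N p \<longleftrightarrow>
     (\<forall>l. compact (N l) \<and> connected (N l) \<and> N l \<noteq> {} \<and> topological_manifold n (top_of_set (N l)) \<and>
          covering_space (N (Suc l)) (p (Suc l)) (N l) \<and>
          proper_map (top_of_set (N (Suc l))) (top_of_set (N l)) (p (Suc l)))"

definition inverse_limit :: "(nat \<Rightarrow> 'c set) \<Rightarrow> (nat \<Rightarrow> 'c \<Rightarrow> 'c) \<Rightarrow> (nat \<Rightarrow> 'c) set" where
  "inverse_limit N p = {x. \<forall>l. x l \<in> N l \<and> p (Suc l) (x (Suc l)) = x l}"

definition normal_covering ::
  "'c::topological_space set \<Rightarrow> ('c \<Rightarrow> 'd) \<Rightarrow> 'd::topological_space set \<Rightarrow> bool" where
  "normal_covering C p S \<longleftrightarrow>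
     covering_space C p S \<and>
     (\<forall>a\<in>C. \<forall>b\<in>C. p a = p b \<longrightarrow>
        (\<exists>h g. homeomorphism C C h g \<and> (\<forall>c\<in>C. p (h c) = p c) \<and> h a = b))"

text \<open>\<open>bonding_map p k d\<close> is the composition \<open>p (k + 1) \<circ> \<dots> \<circ> p (k + d)\<close> from \<open>N (k + d)\<close> to
  \<open>N k\<close>.\<close>

primrec bonding_map :: "(nat \<Rightarrow> 'c \<Rightarrow> 'c) \<Rightarrow> nat \<Rightarrow> nat \<Rightarrow> 'c \<Rightarrow> 'c" where
  "bonding_map p k 0 = id"
| "bonding_map p k (Suc d) = bonding_map p k d \<circ> p (Suc (k + d))"

definition McCord_system ::
  "nat \<Rightarrow> (nat \<Rightarrow> 'c::topological_space set) \<Rightarrow> (nat \<Rightarrow> 'c \<Rightarrow> 'c) \<Rightarrow> bool" where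
  "McCord_system n N p \<longleftrightarrow>
     solenoid_system n N p \<and>
     (\<forall>k d. d \<ge> 1 \<longrightarrow> normal_covering (N (k + d)) (bonding_map p k d) (N k))"

text \<open>A space is an \<open>n\<close>-dimensional McCord solenoid up to homeomorphism. The manifolds are taken
  inside the countable product of real lines, in which every compact metrizable space embeds,
  because HOL cannot quantify existentially over their types. The topology of the inverse limit is
  that of the product of the factors.\<close>

definition homeomorphic_to_McCord_solenoid :: "nat \<Rightarrow> 'a topology \<Rightarrow> bool" where
  "homeomorphic_to_McCord_solenoid n X \<longleftrightarrow>
     (\<exists>(N :: nat \<Rightarrow> (nat \<Rightarrow> real) set) p.
        McCord_system n N p \<and> X homeomorphic_space top_of_set (inverse_limit N p))"

end

theory Submission
  imports Defs
begin

text \<open>The proof avoids holonomy pseudogroups. By Effros' theorem a homogeneous compact space moves any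
  point to any nearby point by a homeomorphism close to the identity. Suppose that \<open>M\<close> carries,
  besides its plaques, a vertical structure: a continuous family of local transversals, such that
  every point can be transported vertically to any nearby plaque. Following a small homeomorphism
  by the projection along plaques gives a homeomorphism preserving every local transversal, and the
  homeomorphisms so obtained are determined by their value at one point, because leaves are dense.
  Products of small ones stay small since transversals are totally disconnected. They therefore
  form groups of arbitrarily small displacement that act freely, with local transversals as orbits
  near each point. Normal subgroups shrinking to the identity have compact manifolds as orbit
  spaces, and \<open>M\<close> is the inverse limit of this tower of normal coverings.

  The vertical structure is constructed chart by chart, as the local kernel of a map that differs
  from the leafwise coordinate by a small Lipschitz error along plaques. On the next chart the old
  map is interpolated with the coordinate projection of that chart; smoothness keeps the error
  small, because after refining the totally disconnected transversals into small clopen pieces the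
  old structure is close to a product on each of them.\<close>

section \<open>Homeomorphisms of a compact space and Effros' theorem\<close>

text \<open>The charts agree about plaques but not about verticals: the fibres of one chart are not
  those of another, so no vertical direction is given, and constructing one is the main obstacle.
  Once it exists, a small vertical homeomorphism is rigid: its values propagate along chains of
  small plaque steps, and such chains come close to every point. Density of leaves is therefore
  proved first, directly from Effros' theorem, and is not read off from the inverse limit. The
  fractions of \<open>R\<close> in the bounds have a common origin: the two relations are transitive
  only for points at mutual distance below \<open>R\<close>, so displacements are kept small enough
  for every triangle that occurs. In the construction of the verticals each new box multiplies the
  leafwise Lipschitz error by \<open>5 * (L + 1)\<^sup>2\<close>. There are finitely many boxes, so
  a small initial error ends at 1/2 or less, where the contraction principle yields vertical
  transport and the local forms are injective along plaques.\<close>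

definition Homeo :: "'m::metric_space set \<Rightarrow> ('m \<Rightarrow> 'm) set" where
  "Homeo S = {h. bij_betw h S S \<and> continuous_on S h \<and> (\<forall>x. x \<notin> S \<longrightarrow> h x = x)}"

definition displ :: "'m::metric_space set \<Rightarrow> real \<Rightarrow> ('m \<Rightarrow> 'm) \<Rightarrow> bool" where
  "displ S e h \<longleftrightarrow> (\<forall>z\<in>S. dist z (h z) < e)"

lemma Homeo_id: "id \<in> Homeo S"
  by (simp add: Homeo_def bij_betw_id continuous_on_id)

lemma Homeo_mem: "h \<in> Homeo S \<Longrightarrow> x \<in> S \<Longrightarrow> h x \<in> S"
  by (auto simp: Homeo_def bij_betw_def)

text \<open>The convention in \<open>Homeo\<close> that \<open>h\<close> is the identity off
  \<open>S\<close> pays off here: \<open>h\<close> is a bijection of the whole type, so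
  \<open>inv\<close> is the group inverse and equality of functions is equality on
  \<open>S\<close>.\<close>

lemma Homeo_bij:
  assumes "h \<in> Homeo S"
  shows "bij h"
proof (rule bijI)
  have b: "inj_on h S" "h ` S = S" "\<And>x. x \<notin> S \<Longrightarrow> h x = x"
    using assms by (auto simp: Homeo_def bij_betw_def)
  show "inj h"
  proof (rule injI)
    fix x y assume eq: "h x = h y"
    show "x = y"
    proof (cases "x \<in> S \<and> y \<in> S")
      case True
      then show ?thesis using b(1) eq by (auto dest: inj_onD)
    next
      case False
      then show ?thesis using b(2,3) eq by (metis imageI)
    qed
  qed
  show "surj h"
    unfolding surj_def using b(2,3) by (metis imageE)
qed

lemma Homeo_inv_apply [simp]: "h \<in> Homeo S \<Longrightarrow> inv h (h x) = x"
  by (simp add: Homeo_bij bij_is_inj)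

lemma Homeo_apply_inv [simp]: "h \<in> Homeo S \<Longrightarrow> h (inv h x) = x"
  by (simp add: Homeo_bij bij_is_surj surj_f_inv_f)

lemma Homeo_continuous: "h \<in> Homeo S \<Longrightarrow> continuous_on S h"
  by (simp add: Homeo_def)

lemma Homeo_comp:
  assumes "f \<in> Homeo S" "g \<in> Homeo S"
  shows "f \<circ> g \<in> Homeo S"
proof -
  have "bij_betw (f \<circ> g) S S"
    using assms bij_betw_trans[of g S S f S] by (simp add: Homeo_def)
  moreover have "continuous_on S (f \<circ> g)"
    using assms by (intro continuous_on_compose) (auto simp: Homeo_def bij_betw_def)
  ultimately show ?thesis using assms by (simp add: Homeo_def)
qed

lemma Homeo_off: "h \<in> Homeo S \<Longrightarrow> x \<notin> S \<Longrightarrow> h x = x"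
  by (simp add: Homeo_def)

lemma Homeo_image: "h \<in> Homeo S \<Longrightarrow> h ` S = S"
  by (simp add: Homeo_def bij_betw_def)

lemma Homeo_inv:
  assumes h: "h \<in> Homeo S" and S: "compact S"
  shows "inv h \<in> Homeo S"
proof -
  have 1: "inv h ` S = S"
    using h by (metis Homeo_image Homeo_bij bij_betw_def image_inv_f_f)
  have "continuous_on (h ` S) (inv h)"
    using continuous_on_inv[OF Homeo_continuous[OF h] S] h by simp
  then have 2: "continuous_on S (inv h)"
    using h by (simp add: Homeo_image)
  have 3: "inj_on (inv h) S"
    using h by (metis Homeo_bij bij_betw_def bij_imp_bij_inv inj_on_subset subset_UNIV)
  have "inv h x = x" if "x \<notin> S" for x
    using h that by (metis Homeo_off Homeo_inv_apply)
  then show ?thesis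
    using 1 2 3 by (simp add: Homeo_def bij_betw_def)
qed

lemma Homeo_eqI:
  assumes "f \<in> Homeo S" "g \<in> Homeo S" "\<And>x. x \<in> S \<Longrightarrow> f x = g x"
  shows "f = g"
  using assms by (metis Homeo_off ext)

lemma Homeo_inv_comp:
  assumes "f \<in> Homeo S" "g \<in> Homeo S"
  shows "inv (f \<circ> g) = inv g \<circ> inv f"
  using assms by (simp add: Homeo_bij o_inv_distrib)

lemma displ_inv:
  assumes h: "h \<in> Homeo S" "compact S" "displ S e h"
  shows "displ S e (inv h)"
  unfolding displ_def
proof
  fix z assume "z \<in> S"
  then have "inv h z \<in> S" using Homeo_inv[OF h(1,2)] Homeo_mem by blast
  then have "dist (inv h z) (h (inv h z)) < e" using h(3) by (simp add: displ_def)
  then show "dist z (inv h z) < e" using h(1) by (simp add: dist_commute)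
qed

lemma displ_comp:
  assumes "f \<in> Homeo S" "displ S a f" "displ S b g" "g \<in> Homeo S"
  shows "displ S (a + b) (f \<circ> g)"
  unfolding displ_def
proof
  fix z assume "z \<in> S"
  then have "dist z (g z) < b" "dist (g z) (f (g z)) < a"
    using assms Homeo_mem[OF assms(4)] by (auto simp: displ_def)
  then show "dist z ((f \<circ> g) z) < a + b"
    using dist_triangle[of z "f (g z)" "g z"] by (simp)
qed

lemma displ_mono: "displ S a h \<Longrightarrow> a \<le> b \<Longrightarrow> displ S b h"
  by (force simp: displ_def)

lemma displ_id: "e > 0 \<Longrightarrow> displ S e id"
  by (simp add: displ_def)

lemma Homeo_uniform:
  assumes "h \<in> Homeo S" "compact S" "e > 0"
  obtains d where "d > 0" "\<And>x y. x \<in> S \<Longrightarrow> y \<in> S \<Longrightarrow> dist x y < d \<Longrightarrow> dist (h x) (h y) < e"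
  using compact_uniformly_continuous[OF Homeo_continuous[OF assms(1)] assms(2)] assms(3)
  unfolding uniformly_continuous_on_def by (metis dist_commute)

text \<open>A homeomorphism is coded by a scale and by its rounded values on a finite net of that scale,
  so up to a uniform error there are only countably many of them.\<close>

lemma Homeo_countable_dense:
  fixes S :: "'m::metric_space set"
  assumes S: "compact S" and e: "e > 0"
  obtains K where "countable K" "K \<subseteq> Homeo S"
    "\<And>h. h \<in> Homeo S \<Longrightarrow> \<exists>k\<in>K. \<forall>z\<in>S. dist (k z) (h z) < e"
proof -
  have net: "\<exists>A. set A \<subseteq> S \<and> S \<subseteq> (\<Union>a\<in>set A. ball a r)" if "r > 0" for r
  proof -
    have "S \<subseteq> (\<Union>a\<in>S. ball a r)" using that by auto
    from compactE_image[OF S open_ball this]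
    obtain A where "finite A" "A \<subseteq> S" "S \<subseteq> (\<Union>a\<in>A. ball a r)" by metis
    then show ?thesis using finite_list by metis
  qed
  obtain A where A: "set (A m) \<subseteq> S" "S \<subseteq> (\<Union>a\<in>set (A m). ball a (1 / Suc m))" for m :: nat
  proof -
    have "\<forall>m. \<exists>A. set A \<subseteq> S \<and> S \<subseteq> (\<Union>a\<in>set A. ball a (1 / Suc m))"
      by (intro allI net) simp
    from choice[OF this] show ?thesis using that by blast
  qed
  \<comment> \<open>Two roundings and two moduli of continuity, each worth \<open>e / 4\<close>,
    will add up to \<open>e\<close>.\<close>
  have "e / 4 > 0" using e by simp
  then obtain B where B: "set B \<subseteq> S" "S \<subseteq> (\<Union>a\<in>set B. ball a (e/4))"
    using net by blast
  define sel where "sel x = (SOME b. b \<in> set B \<and> dist b x < e/4)" for x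
  have sel: "sel x \<in> set B \<and> dist (sel x) x < e/4" if "x \<in> S" for x
  proof -
    have "\<exists>b. b \<in> set B \<and> dist b x < e/4" using B(2) that by (fastforce simp: mem_ball)
    then show ?thesis unfolding sel_def by (rule someI_ex)
  qed
  define code where "code m h = (m, map (\<lambda>a. sel (h a)) (A m))" for m :: nat and h :: "'m \<Rightarrow> 'm"
  define C where "C = (UNIV :: nat set) \<times> lists (set B)"
  have C: "countable C"
    unfolding C_def by (intro countable_SIGMA countable_lists countable_finite countableI_type) simp
  define modul where "modul m h \<longleftrightarrow> (\<forall>x\<in>S. \<forall>y\<in>S. dist x y < 1 / Suc m \<longrightarrow> dist (h x) (h y) < e/4)"
    for m :: nat and h :: "'m \<Rightarrow> 'm"
  \<comment> \<open>One homeomorphism is chosen for each code that occurs. The code lists rounded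
    values on the net \<open>A m\<close>; these control \<open>h\<close> everywhere only together
    with the modulus at the same scale \<open>m\<close>.\<close>
  define pick where "pick c = (SOME h. h \<in> Homeo S \<and> modul (fst c) h \<and> code (fst c) h = c)" for c
  define K where "K = pick ` {c\<in>C. \<exists>h. h \<in> Homeo S \<and> modul (fst c) h \<and> code (fst c) h = c}"
  have pick: "pick c \<in> Homeo S \<and> modul (fst c) (pick c) \<and> code (fst c) (pick c) = c"
    if "\<exists>h. h \<in> Homeo S \<and> modul (fst c) h \<and> code (fst c) h = c" for c
    unfolding pick_def using someI_ex[OF that] .
  show thesis
  proof
    show "countable K" unfolding K_def using C by (intro countable_image) (auto intro: countable_subset)
    show "K \<subseteq> Homeo S" unfolding K_def using pick by auto
    fix h assume h: "h \<in> Homeo S"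
    obtain d where d: "d > 0" "\<And>x y. x \<in> S \<Longrightarrow> y \<in> S \<Longrightarrow> dist x y < d \<Longrightarrow> dist (h x) (h y) < e/4"
      using Homeo_uniform[OF h S, of "e/4"] e by auto
    obtain m where m: "1 / Suc m < d"
      using d(1) nat_approx_posE by metis
    have modul: "modul m h" using d m unfolding modul_def by force
    have "code m h \<in> C"
      unfolding C_def code_def using sel Homeo_mem[OF h] subsetD[OF A(1)[of m]] by auto
    moreover have ex: "\<exists>h'. h' \<in> Homeo S \<and> modul (fst (code m h)) h' \<and> code (fst (code m h)) h' = code m h"
      using h modul by (intro exI[of _ h]) (auto simp: code_def)
    ultimately have "pick (code m h) \<in> K" unfolding K_def by blast
    moreover have "dist (pick (code m h) z) (h z) < e" if z: "z \<in> S" for z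
    proof -
      define k where "k = pick (code m h)"
      have k: "k \<in> Homeo S" "modul m k" "code m k = code m h"
        using pick[OF ex] by (auto simp: code_def k_def)
      obtain a where a: "a \<in> set (A m)" "dist a z < 1 / Suc m"
        using A(2)[of m] z by (auto simp: mem_ball)
      have aS: "a \<in> S" using a A(1) by blast
      have "sel (k a) = sel (h a)"
        using k(3) a(1) by (auto simp: code_def)
      moreover have "dist (sel (k a)) (k a) < e/4" "dist (sel (h a)) (h a) < e/4"
        using sel Homeo_mem[OF k(1) aS] Homeo_mem[OF h aS] by auto
      ultimately have "dist (k a) (h a) < e/2"
        using dist_triangle3[of "k a" "h a" "sel (h a)"] by simp
      moreover have "dist (k a) (k z) < e/4" "dist (h a) (h z) < e/4"
        using k(2) modul a aS z unfolding modul_def by blast+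
      ultimately show "dist (k z) (h z) < e"
        using dist_triangle[of "k z" "h z" "k a"] dist_triangle[of "k a" "h z" "h a"]
        by (simp add: dist_commute)
    qed
    ultimately show "\<exists>k\<in>K. \<forall>z\<in>S. dist (k z) (h z) < e" by blast
  qed
qed

text \<open>A Lebesgue number for radii chosen point by point. The conclusion returns the centre and
  the radius at which \<open>Q\<close> was obtained, so \<open>Q\<close> need not be monotone in the
  radius.\<close>

lemma lebesgue_scale:
  fixes K :: "'m::metric_space set"
  assumes K: "compact K" and ex: "\<And>z. z \<in> K \<Longrightarrow> \<exists>r>0. Q z r"
  obtains s where "s > 0" "\<And>x. x \<in> K \<Longrightarrow> \<exists>z\<in>K. \<exists>r>0. Q z r \<and> ball x s \<subseteq> ball z r"
proof -
  obtain R where R: "\<And>z. z \<in> K \<Longrightarrow> R z > 0 \<and> Q z (R z)"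
    using ex by metis
  have "K \<subseteq> \<Union>((\<lambda>z. ball z (R z)) ` K)" using R by force
  then obtain s where s: "0 < s" "\<And>x. x \<in> K \<Longrightarrow> \<exists>G\<in>(\<lambda>z. ball z (R z)) ` K. ball x s \<subseteq> G"
    using Heine_Borel_lemma[OF K, of "(\<lambda>z. ball z (R z)) ` K"] by (metis (no_types, lifting) imageE open_ball)
  show thesis
  proof
    show "s > 0" by (rule s)
    fix x assume "x \<in> K"
    from s(2)[OF this] show "\<exists>z\<in>K. \<exists>r>0. Q z r \<and> ball x s \<subseteq> ball z r"
      using R by auto
  qed
qed

section \<open>Effros' theorem by category and back-and-forth\<close>

definition homog :: "'m::metric_space set \<Rightarrow> bool" where
  "homog S \<longleftrightarrow> (\<forall>x\<in>S. \<forall>y\<in>S. \<exists>h\<in>Homeo S. h x = y)"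

definition small_orbit :: "'m::metric_space set \<Rightarrow> real \<Rightarrow> 'm \<Rightarrow> 'm set" where
  "small_orbit S e x = {h x | h. h \<in> Homeo S \<and> displ S e h}"

lemma small_orbit_subset: "x \<in> S \<Longrightarrow> small_orbit S e x \<subseteq> S"
  by (auto simp: small_orbit_def Homeo_mem)

lemma Homeo_closure_image:
  assumes "k \<in> Homeo S" "A \<subseteq> S" "p \<in> S" "p \<in> closure A"
  shows "k p \<in> closure (k ` A)"
  unfolding closure_approachable
proof (intro allI impI)
  fix e :: real assume "e > 0"
  then obtain d where d: "d > 0" "\<And>x. x \<in> S \<Longrightarrow> dist x p < d \<Longrightarrow> dist (k x) (k p) < e"
    using Homeo_continuous[OF assms(1)] assms(3) unfolding continuous_on_iff by metis
  obtain a where "a \<in> A" "dist a p < d"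
    using assms(4) d(1) by (auto simp: closure_approachable)
  then show "\<exists>y\<in>k ` A. dist y (k p) < e" using d(2) assms(2) by blast
qed

lemma Homeo_at:
  assumes "k \<in> Homeo S" "p \<in> S" "e > 0"
  obtains d where "d > 0" "\<And>x. x \<in> S \<Longrightarrow> dist p x < d \<Longrightarrow> dist (k p) (k x) < e"
  using Homeo_continuous[OF assms(1)] assms(2,3) unfolding continuous_on_iff by (metis dist_commute)

text \<open>Baire category. If \<open>h x = y\<close> and a member \<open>k\<close> of the countable
  dense family is close to \<open>inv h\<close>, then \<open>k \<circ> h\<close> is small, so
  \<open>y\<close> lies in the translate of the small orbit by \<open>inv k\<close>. Countably many
  such translates cover \<open>S\<close>; the closure of one has interior, and applying
  \<open>k\<close> brings this back to the orbit itself.\<close>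

lemma small_orbit_somewhere_dense:
  fixes S :: "'m::metric_space set"
  assumes S: "compact S" and hom: "homog S" and x: "x \<in> S" and e: "e > 0"
  shows "\<exists>q\<in>S. \<exists>r>0. ball q r \<inter> S \<subseteq> closure (small_orbit S e x)"
proof -
  let ?T = "small_orbit S e x"
  obtain K where K: "countable K" "K \<subseteq> Homeo S"
    "\<And>h. h \<in> Homeo S \<Longrightarrow> \<exists>k\<in>K. \<forall>z\<in>S. dist (k z) (h z) < e"
    using Homeo_countable_dense[OF S e] by blast
  define G where "G = (\<lambda>k. S \<inter> closure (inv k ` ?T)) ` K"
  have TS: "?T \<subseteq> S" using small_orbit_subset[OF x] .
  have cover: "S \<subseteq> \<Union>G"
  proof
    fix y assume y: "y \<in> S"
    obtain h where h: "h \<in> Homeo S" "h x = y" using hom x y by (auto simp: homog_def)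
    obtain k where k: "k \<in> K" "\<forall>z\<in>S. dist (k z) (inv h z) < e"
      using K(3)[OF Homeo_inv[OF h(1) S]] by blast
    have kH: "k \<in> Homeo S" using k K by blast
    have "displ S e (k \<circ> h)"
      unfolding displ_def
    proof
      fix z assume z: "z \<in> S"
      have "dist (k (h z)) (inv h (h z)) < e"
        using k(2) Homeo_mem[OF h(1) z] by blast
      then show "dist z ((k \<circ> h) z) < e" using h(1) by (simp add: dist_commute)
    qed
    then have "k (h x) \<in> ?T"
      unfolding small_orbit_def using Homeo_comp[OF kH h(1)]
      by (intro CollectI exI[of _ "k \<circ> h"]) auto
    then have "inv k (k (h x)) \<in> inv k ` ?T" by (rule imageI)
    then have "y \<in> inv k ` ?T" unfolding Homeo_inv_apply[OF kH] h(2) .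
    then have "y \<in> S \<inter> closure (inv k ` ?T)" using y subsetD[OF closure_subset] by simp
    then show "y \<in> \<Union>G" unfolding G_def using k(1) by blast
  qed
  have "\<exists>T\<in>G. top_of_set S interior_of T \<noteq> {}"
  proof (rule ccontr)
    assume "\<not> ?thesis"
    then have emp: "\<And>T. T \<in> G \<Longrightarrow> top_of_set S interior_of T = {}" by blast
    have "compact_space (top_of_set S)" using S by (simp add: compact_space_subtopology)
    then have lc: "locally_compact_space (top_of_set S) \<and> regular_space (top_of_set S)"
      by (simp add: compact_imp_locally_compact_space metrizable_imp_regular_space
          metrizable_space_subtopology metrizable_space_euclidean)
    have "top_of_set S interior_of \<Union>G = {}"
      using lc emp K(1) by (intro Baire_category_alt) (auto simp: G_def closedin_closed)
    moreover have "\<Union>G = S" using cover by (auto simp: G_def)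
    moreover have "top_of_set S interior_of S = S"
      using interior_of_topspace[of "top_of_set S"] by simp
    ultimately show False using x by simp
  qed
  then obtain k p where k: "k \<in> K" and p: "p \<in> top_of_set S interior_of (S \<inter> closure (inv k ` ?T))"
    unfolding G_def by blast
  have kH: "k \<in> Homeo S" using k K by blast
  obtain U where U: "openin (top_of_set S) U" "U \<subseteq> S \<inter> closure (inv k ` ?T)" "p \<in> U"
    using p by (auto simp: interior_of_def)
  obtain r where r: "r > 0" "\<And>z. z \<in> S \<Longrightarrow> dist z p < r \<Longrightarrow> z \<in> U"
    using U(1,3) unfolding openin_euclidean_subtopology_iff by metis
  have pS: "p \<in> S" using U by blast
  let ?q = "k p"
  have qS: "?q \<in> S" using Homeo_mem[OF kH pS] .
  obtain d where d: "d > 0" "\<And>w. w \<in> S \<Longrightarrow> dist ?q w < d \<Longrightarrow> dist (inv k ?q) (inv k w) < r"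
    using Homeo_at[OF Homeo_inv[OF kH S] qS r(1)] by blast
  have "w \<in> closure ?T" if w: "w \<in> S" "dist ?q w < d" for w
  proof -
    have iw: "inv k w \<in> S" using Homeo_mem[OF Homeo_inv[OF kH S] w(1)] .
    have "dist (inv k w) p < r" using d(2)[OF w] kH by (simp add: dist_commute)
    then have "inv k w \<in> closure (inv k ` ?T)" using r(2) iw U(2) by blast
    moreover have "inv k ` ?T \<subseteq> S"
      using TS Homeo_mem[OF Homeo_inv[OF kH S]] by blast
    ultimately have "k (inv k w) \<in> closure (k ` inv k ` ?T)"
      using Homeo_closure_image[OF kH _ iw] by blast
    moreover have "k ` inv k ` ?T = ?T" using kH by (simp add: image_image)
    ultimately show ?thesis using kH by simp
  qed
  then show ?thesis using qS d(1) by (intro bexI[of _ ?q] exI[of _ d]) auto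
qed

text \<open>The open set found by category may lie away from \<open>x\<close>. A small
  \<open>u\<close> moves \<open>x\<close> into it and \<open>inv u\<close> pulls it back to a
  neighbourhood of \<open>x\<close>; two displacements of \<open>e / 2\<close> are spent.\<close>

lemma small_orbit_dense_near:
  fixes S :: "'m::metric_space set"
  assumes S: "compact S" and hom: "homog S" and x: "x \<in> S" and e: "e > 0"
  shows "\<exists>d>0. \<forall>y\<in>S. dist x y < d \<longrightarrow> y \<in> closure (small_orbit S e x)"
proof -
  let ?T = "small_orbit S (e/2) x"
  obtain q r where q: "q \<in> S" "r > 0" "ball q r \<inter> S \<subseteq> closure ?T"
    using small_orbit_somewhere_dense[OF S hom x, of "e/2"] e by auto
  have "q \<in> closure ?T" using q by auto
  then obtain t where "t \<in> ?T" "dist t q < r"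
    using q(2) unfolding closure_approachable by blast
  then obtain u where u: "u \<in> Homeo S" "displ S (e/2) u" "dist (u x) q < r"
    by (auto simp: small_orbit_def)
  obtain d where d: "d > 0" "\<And>y. y \<in> S \<Longrightarrow> dist x y < d \<Longrightarrow> dist (u x) (u y) < r - dist (u x) q"
    using Homeo_at[OF u(1) x, of "r - dist (u x) q"] u(3) by auto
  have "y \<in> closure (small_orbit S e x)" if y: "y \<in> S" "dist x y < d" for y
  proof -
    have "dist q (u y) < r" using d(2)[OF y] dist_triangle[of q "u y" "u x"] by (simp add: dist_commute)
    then have "u y \<in> closure ?T" using q(3) Homeo_mem[OF u(1) y(1)] by auto
    then have "inv u (u y) \<in> closure (inv u ` ?T)"
      using Homeo_closure_image[OF Homeo_inv[OF u(1) S]] small_orbit_subset[OF x] Homeo_mem[OF u(1) y(1)] by blast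
    moreover have "inv u ` ?T \<subseteq> small_orbit S e x"
    proof
      fix w assume "w \<in> inv u ` ?T"
      then obtain h where h: "h \<in> Homeo S" "displ S (e/2) h" "w = inv u (h x)"
        by (auto simp: small_orbit_def)
      have "displ S (e/2 + e/2) (inv u \<circ> h)"
        using displ_comp[OF Homeo_inv[OF u(1) S] displ_inv[OF u(1) S u(2)] h(2,1)] .
      then show "w \<in> small_orbit S e x"
        unfolding small_orbit_def using h(3) Homeo_comp[OF Homeo_inv[OF u(1) S] h(1)]
        by (intro CollectI exI[of _ "inv u \<circ> h"]) auto
    qed
    ultimately have "inv u (u y) \<in> closure (small_orbit S e x)" using closure_mono by blast
    then show ?thesis using u(1) by simp
  qed
  then show ?thesis using d(1) by blast
qed

text \<open>The interior in \<open>S\<close> of the closure of the small orbit, written with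
  distances.\<close>

definition dense_nbhd :: "'m::metric_space set \<Rightarrow> real \<Rightarrow> 'm \<Rightarrow> 'm set" where
  "dense_nbhd S e x = {y\<in>S. \<exists>d>0. \<forall>z\<in>S. dist y z < d \<longrightarrow> z \<in> closure (small_orbit S e x)}"

text \<open>One move of the back-and-forth. Membership of \<open>y\<close> allows \<open>u x\<close>
  to come as near to \<open>y\<close> as desired, in particular into the interior belonging to
  \<open>y\<close> at the next tolerance \<open>r'\<close>; the two points have then exchanged
  roles.\<close>

lemma dense_nbhd_step:
  fixes S :: "'m::metric_space set"
  assumes S: "compact S" and hom: "homog S" and x: "x \<in> S" and y: "y \<in> dense_nbhd S r x" and r': "r' > 0"
  shows "\<exists>u\<in>Homeo S. displ S r u \<and> u x \<in> dense_nbhd S r' y"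
proof -
  have yS: "y \<in> S" using y by (simp add: dense_nbhd_def)
  obtain d where d: "d > 0" "\<And>z. z \<in> S \<Longrightarrow> dist y z < d \<Longrightarrow> z \<in> closure (small_orbit S r' y)"
    using small_orbit_dense_near[OF S hom yS r'] by blast
  have "y \<in> closure (small_orbit S r x)" using y yS by (auto simp: dense_nbhd_def)
  then obtain u where u: "u \<in> Homeo S" "displ S r u" "dist (u x) y < d"
    using d(1) unfolding closure_approachable small_orbit_def by blast
  have "u x \<in> dense_nbhd S r' y"
    unfolding dense_nbhd_def
  proof (intro CollectI conjI exI[of _ "d - dist (u x) y"] ballI impI)
    show "u x \<in> S" using Homeo_mem[OF u(1) x] .
    show "0 < d - dist (u x) y" using u(3) by simp
    fix z assume "z \<in> S" "dist (u x) z < d - dist (u x) y"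
    then show "z \<in> closure (small_orbit S r' y)"
      using dist_triangle[of y z "u x"] by (intro d(2)) (auto simp: dist_commute)
  qed
  then show ?thesis using u by blast
qed

lemma geometric_Cauchy:
  fixes f :: "nat \<Rightarrow> 'm::metric_space"
  assumes "\<And>n. dist (f n) (f (Suc n)) \<le> e / 2^n"
  shows "dist (f n) (f (n + k)) \<le> 2 * e / 2^n - 2 * e / 2^(n+k)"
proof (induction k)
  case (Suc k)
  have "dist (f n) (f (n + Suc k)) \<le> dist (f n) (f (n+k)) + e / 2^(n+k)"
    using dist_triangle[of "f n" "f (n + Suc k)" "f (n+k)"] assms[of "n+k"] by simp
  moreover have "2 * e / 2^(n + Suc k) = e / 2^(n+k)" by simp
  ultimately show ?case using Suc by linarith
qed auto

lemma uniform_geometric_limit: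
  fixes S :: "'m::metric_space set"
  assumes S: "compact S" and fS: "\<And>n z. z \<in> S \<Longrightarrow> f n z \<in> S"
    and cont: "\<And>n. continuous_on S (f n)" and e: "e \<ge> 0"
    and step: "\<And>n z. z \<in> S \<Longrightarrow> dist (f n z) (f (Suc n) z) \<le> e / 2^n"
  obtains F where "continuous_on S F" "\<And>z. z \<in> S \<Longrightarrow> F z \<in> S" "\<And>z. z \<notin> S \<Longrightarrow> F z = z"
    "\<And>z n. z \<in> S \<Longrightarrow> dist (f n z) (F z) \<le> 2 * e / 2^n" "\<And>z. z \<in> S \<Longrightarrow> (\<lambda>n. f n z) \<longlonglongrightarrow> F z"
proof -
  have close: "dist (f n z) (f m z) \<le> 2 * e / 2^n" if "z \<in> S" "n \<le> m" for n m z
  proof -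
    have "dist (f n z) (f (n + (m - n)) z) \<le> 2 * e / 2^n - 2 * e / 2^(n + (m-n))"
      by (rule geometric_Cauchy) (rule step[OF that(1)])
    moreover have "0 \<le> 2 * e / 2^(n + (m-n))" using e by simp
    ultimately show ?thesis using that(2) by simp
  qed
  have small: "\<exists>N. \<forall>n\<ge>N. 2 * e / 2^n < d" if "d > 0" for d
  proof -
    have "(\<lambda>n. 2 * e * (1/2)^n) \<longlonglongrightarrow> 2 * e * 0"
      by (intro tendsto_intros LIMSEQ_realpow_zero) auto
    then have "(\<lambda>n. 2 * e / 2^n) \<longlonglongrightarrow> 0" by (simp add: power_one_over field_simps)
    from order_tendstoD(2)[OF this that] show ?thesis by (simp add: eventually_sequentially)
  qed
  have conv: "\<exists>l\<in>S. (\<lambda>n. f n z) \<longlonglongrightarrow> l" if z: "z \<in> S" for z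
  proof -
    have "Cauchy (\<lambda>n. f n z)"
    proof (rule metric_CauchyI)
      fix d :: real assume "d > 0"
      then obtain N where N: "\<And>n. n \<ge> N \<Longrightarrow> 2 * e / 2^n < d/2" using small[of "d/2"] by auto
      have "dist (f m z) (f n z) < d" if "m \<ge> N" "n \<ge> N" for m n
        using close[OF z that(1)] close[OF z that(2)] N[of N]
          dist_triangle3[of "f m z" "f n z" "f N z"] by simp
      then show "\<exists>M. \<forall>m\<ge>M. \<forall>n\<ge>M. dist (f m z) (f n z) < d" by blast
    qed
    then show ?thesis
      using compact_imp_complete[OF S, unfolded complete_def, rule_format, of "\<lambda>n. f n z"] fS[OF z] by auto
  qed
  define F where "F z = (if z \<in> S then (SOME l. l \<in> S \<and> (\<lambda>n. f n z) \<longlonglongrightarrow> l) else z)" for z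
  have F: "F z \<in> S \<and> (\<lambda>n. f n z) \<longlonglongrightarrow> F z" if "z \<in> S" for z
    unfolding F_def using someI_ex[of "\<lambda>l. l \<in> S \<and> (\<lambda>n. f n z) \<longlonglongrightarrow> l"] conv[OF that] that by auto
  have bound: "dist (f n z) (F z) \<le> 2 * e / 2^n" if z: "z \<in> S" for z n
  proof -
    have "(\<lambda>m. dist (f n z) (f m z)) \<longlonglongrightarrow> dist (f n z) (F z)"
      using F[OF z] by (intro tendsto_intros) auto
    then show ?thesis
      by (rule LIMSEQ_le_const2) (use close[OF z] in blast)
  qed
  have "uniform_limit S f F sequentially"
  proof (rule uniform_limitI)
    fix d :: real assume "d > 0"
    then obtain N where "\<And>n. n \<ge> N \<Longrightarrow> 2 * e / 2^n < d" using small by blast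
    then show "\<forall>\<^sub>F n in sequentially. \<forall>x\<in>S. dist (f n x) (F x) < d"
      unfolding eventually_sequentially using bound by (meson order_le_less_trans)
  qed
  then have "continuous_on S F"
    by (rule uniform_limit_theorem[rotated]) (use cont in auto)
  then show thesis using that[of F] F bound by (simp add: F_def)
qed

text \<open>A uniform limit of homeomorphisms can fail to be injective. The second estimate makes
  the inverses converge too, and their limit inverts \<open>F\<close>.\<close>

lemma Homeo_geometric_limit:
  fixes S :: "'m::metric_space set"
  assumes S: "compact S" and f: "\<And>n. f n \<in> Homeo S" and e: "e \<ge> 0"
    and s1: "\<And>n z. z \<in> S \<Longrightarrow> dist (f n z) (f (Suc n) z) \<le> e / 2^n"
    and s2: "\<And>n z. z \<in> S \<Longrightarrow> dist (inv (f n) z) (inv (f (Suc n)) z) \<le> e / 2^n"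
  obtains F where "F \<in> Homeo S" "\<And>z n. z \<in> S \<Longrightarrow> dist (f n z) (F z) \<le> 2 * e / 2^n"
    "\<And>z. z \<in> S \<Longrightarrow> (\<lambda>n. f n z) \<longlonglongrightarrow> F z"
proof -
  note i = Homeo_inv[OF f S]
  obtain F where F: "continuous_on S F" "\<And>z. z \<in> S \<Longrightarrow> F z \<in> S" "\<And>z. z \<notin> S \<Longrightarrow> F z = z"
    "\<And>z n. z \<in> S \<Longrightarrow> dist (f n z) (F z) \<le> 2 * e / 2^n" "\<And>z. z \<in> S \<Longrightarrow> (\<lambda>n. f n z) \<longlonglongrightarrow> F z"
    by (rule uniform_geometric_limit[OF S Homeo_mem[OF f] Homeo_continuous[OF f] e s1]) auto
  obtain G where G: "continuous_on S G" "\<And>z. z \<in> S \<Longrightarrow> G z \<in> S" "\<And>z. z \<notin> S \<Longrightarrow> G z = z"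
    "\<And>z n. z \<in> S \<Longrightarrow> dist (inv (f n) z) (G z) \<le> 2 * e / 2^n" "\<And>z. z \<in> S \<Longrightarrow> (\<lambda>n. inv (f n) z) \<longlonglongrightarrow> G z"
    by (rule uniform_geometric_limit[OF S Homeo_mem[OF i] Homeo_continuous[OF i] e s2]) auto
  have lim0: "(\<lambda>n. 2 * e / 2^n) \<longlonglongrightarrow> 0"
  proof -
    have "(\<lambda>n. 2 * e * (1/2)^n) \<longlonglongrightarrow> 2 * e * 0"
      by (intro tendsto_intros LIMSEQ_realpow_zero) auto
    then show ?thesis by (simp add: power_one_over field_simps)
  qed
  have GF: "G (F z) = z" if z: "z \<in> S" for z
  proof (rule LIMSEQ_unique)
    show "(\<lambda>n. G (f n z)) \<longlonglongrightarrow> G (F z)"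
      by (rule continuous_on_tendsto_compose[OF G(1) F(5)[OF z] F(2)[OF z]])
        (use Homeo_mem[OF f z] in auto)
    have "dist (G (f n z)) z \<le> 2 * e / 2^n" for n
      using G(4)[OF Homeo_mem[OF f z], of n n] Homeo_inv_apply[OF f, of n z] by (simp add: dist_commute)
    then show "(\<lambda>n. G (f n z)) \<longlonglongrightarrow> z"
      unfolding tendsto_dist_iff[of _ z] using tendsto_sandwich[OF _ _ tendsto_const lim0] by (simp add: always_eventually)
  qed
  have FG: "F (G z) = z" if z: "z \<in> S" for z
  proof (rule LIMSEQ_unique)
    show "(\<lambda>n. F (inv (f n) z)) \<longlonglongrightarrow> F (G z)"
      by (rule continuous_on_tendsto_compose[OF F(1) G(5)[OF z] G(2)[OF z]])
        (use Homeo_mem[OF i z] in auto)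
    have "dist (F (inv (f n) z)) z \<le> 2 * e / 2^n" for n
      using F(4)[OF Homeo_mem[OF i z], of n n] Homeo_apply_inv[OF f, of n z] by (simp add: dist_commute)
    then show "(\<lambda>n. F (inv (f n) z)) \<longlonglongrightarrow> z"
      unfolding tendsto_dist_iff[of _ z] using tendsto_sandwich[OF _ _ tendsto_const lim0] by (simp add: always_eventually)
  qed
  have "bij_betw F S S"
    by (rule bij_betw_byWitness[of S G]) (use GF FG F(2) G(2) in auto)
  then have "F \<in> Homeo S" using F by (simp add: Homeo_def)
  then show thesis using that F by blast
qed

text \<open>\<open>x\<close> and \<open>y\<close> are moved alternately by ever smaller
  homeomorphisms, accumulated in \<open>f n\<close> and \<open>g n\<close>, so that
  \<open>f n x\<close> and \<open>g n y\<close> approach each other. In the limit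
  \<open>F x = G y\<close>, and \<open>inv G \<circ> F\<close> is the required map. Each correction
  is chosen after the current map is known, which keeps the inverses under control.\<close>

lemma effros_pointwise:
  fixes S :: "'m::metric_space set"
  assumes S: "compact S" and hom: "homog S" and x: "x \<in> S" and e: "e > 0"
  shows "\<exists>d>0. \<forall>y\<in>S. dist x y < d \<longrightarrow> (\<exists>h\<in>Homeo S. displ S e h \<and> h x = y)"
proof -
  \<comment> \<open>The geometric series keeps each of \<open>F\<close> and \<open>G\<close> within
    \<open>3 * E\<close> of the identity, hence the composite within \<open>6 * E\<close>, below
    \<open>e\<close>.\<close>
  define E where "E = e / 8"
  have E: "E > 0" using e by (simp add: E_def)
  obtain d where d: "d > 0" "\<And>y. y \<in> S \<Longrightarrow> dist x y < d \<Longrightarrow> y \<in> closure (small_orbit S E x)"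
    using small_orbit_dense_near[OF S hom x E] by blast
  have "\<exists>h\<in>Homeo S. displ S e h \<and> h x = y" if y: "y \<in> S" "dist x y < d" for y
  proof -
    \<comment> \<open>Following \<open>f\<close> by a map of displacement below \<open>r\<close>
      changes both \<open>f\<close> and \<open>inv f\<close> by at most
      \<open>E / 2^n\<close>.\<close>
    define tol where "tol n f r \<longleftrightarrow> r > 0 \<and> r \<le> E / 2^n \<and>
        (\<forall>a\<in>S. \<forall>b\<in>S. dist a b < r \<longrightarrow> dist (inv f a) (inv f b) < E / 2^n)"
      for n :: nat and f :: "'m \<Rightarrow> 'm" and r :: real
    have tol_ex: "\<exists>r. tol n f r" if f: "f \<in> Homeo S" for n f
    proof -
      have pos: "E / 2^n > 0" using E by simp
      obtain r where r: "r > 0" "\<And>a b. a \<in> S \<Longrightarrow> b \<in> S \<Longrightarrow> dist a b < r \<Longrightarrow> dist (inv f a) (inv f b) < E / 2^n"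
        using Homeo_uniform[OF Homeo_inv[OF f S] S pos] by blast
      show ?thesis
        unfolding tol_def using r pos by (intro exI[of _ "min r (E / 2^n)"]) auto
    qed
    have tol_step: "dist (f z) ((u \<circ> f) z) \<le> E / 2^n \<and> dist (inv f z) (inv (u \<circ> f) z) \<le> E / 2^n"
      if "tol n f r" "f \<in> Homeo S" "u \<in> Homeo S" "displ S r u" "z \<in> S" for n f r u z
    proof
      have "dist (f z) (u (f z)) < r" using that Homeo_mem[OF that(2,5)] by (simp add: displ_def)
      then show "dist (f z) ((u \<circ> f) z) \<le> E / 2^n" using that(1) by (simp add: tol_def)
      have uz: "inv u z \<in> S" using Homeo_mem[OF Homeo_inv[OF that(3) S] that(5)] .
      have "dist z (inv u z) < r" using displ_inv[OF that(3) S that(4)] that(5) by (simp add: displ_def)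
      then have "dist (inv f z) (inv f (inv u z)) < E / 2^n" using that(1,5) uz by (simp add: tol_def)
      then show "dist (inv f z) (inv (u \<circ> f) z) \<le> E / 2^n"
        using Homeo_inv_comp[OF that(3,2)] by simp
    qed
    \<comment> \<open>The stored \<open>r\<close> is the tolerance for the next correction of
      \<open>f\<close>; the tolerance for \<open>g\<close> is chosen only when its turn
      comes.\<close>
    define P where "P n s \<longleftrightarrow> (case s of (f, g, r) \<Rightarrow> f \<in> Homeo S \<and> g \<in> Homeo S \<and> tol n f r \<and>
        g y \<in> dense_nbhd S r (f x))" for n and s :: "('m \<Rightarrow> 'm) \<times> ('m \<Rightarrow> 'm) \<times> real"
    define Q where "Q n s s' \<longleftrightarrow> (\<forall>z\<in>S.
        dist (fst s z) (fst s' z) \<le> E / 2^n \<and> dist (inv (fst s) z) (inv (fst s') z) \<le> E / 2^n \<and>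
        dist (fst (snd s) z) (fst (snd s') z) \<le> E / 2^n \<and>
        dist (inv (fst (snd s)) z) (inv (fst (snd s')) z) \<le> E / 2^n)"
      for n :: nat and s s' :: "('m \<Rightarrow> 'm) \<times> ('m \<Rightarrow> 'm) \<times> real"
    have base: "\<exists>s. P 0 s \<and> fst s = id \<and> fst (snd s) = id"
    proof -
      have "tol 0 id E" using E by (simp add: tol_def)
      moreover have "y \<in> dense_nbhd S E x"
        unfolding dense_nbhd_def
      proof (intro CollectI conjI exI[of _ "d - dist x y"] ballI impI)
        show "y \<in> S" "0 < d - dist x y" using y by auto
        fix z assume "z \<in> S" "dist y z < d - dist x y"
        then show "z \<in> closure (small_orbit S E x)"
          using dist_triangle[of x z y] by (intro d(2)) auto
      qed
      ultimately have "P 0 (id, id, E)" by (simp add: P_def Homeo_id)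
      then show ?thesis by force
    qed
    have step: "\<exists>s'. P (Suc n) s' \<and> Q n s s'" if "P n s" for n s
    proof -
      obtain f g r where s: "s = (f, g, r)" by (cases s)
      have f: "f \<in> Homeo S" and g: "g \<in> Homeo S" and r: "tol n f r" and gy: "g y \<in> dense_nbhd S r (f x)"
        using that by (auto simp: P_def s)
      obtain r1 where r1: "tol n g r1" using tol_ex[OF g] by blast
      obtain u where u: "u \<in> Homeo S" "displ S r u" "u (f x) \<in> dense_nbhd S r1 (g y)"
        using dense_nbhd_step[OF S hom Homeo_mem[OF f x] gy, of r1] r1 by (auto simp: tol_def)
      have uf: "u \<circ> f \<in> Homeo S" using Homeo_comp[OF u(1) f] .
      obtain r2 where r2: "tol (Suc n) (u \<circ> f) r2" using tol_ex[OF uf] by blast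
      obtain v where v: "v \<in> Homeo S" "displ S r1 v" "v (g y) \<in> dense_nbhd S r2 (u (f x))"
        using dense_nbhd_step[OF S hom Homeo_mem[OF g y(1)] u(3), of r2] r2 by (auto simp: tol_def)
      have "P (Suc n) (u \<circ> f, v \<circ> g, r2)"
        using uf Homeo_comp[OF v(1) g] r2 v(3) by (simp add: P_def)
      moreover have "Q n s (u \<circ> f, v \<circ> g, r2)"
        using tol_step[OF r f u(1,2)] tol_step[OF r1 g v(1,2)] unfolding Q_def s by simp
      ultimately show ?thesis by blast
    qed
    obtain s0 where s0: "P 0 s0" "fst s0 = id" "fst (snd s0) = id" using base by blast
    define s where "s = rec_nat s0 (\<lambda>n t. SOME t'. P (Suc n) t' \<and> Q n t t')"
    have s_Suc: "s (Suc n) = (SOME t'. P (Suc n) t' \<and> Q n (s n) t')" and s_0: "s 0 = s0" for n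
      by (simp_all add: s_def)
    have PQ: "P n (s n)" for n
    proof (induction n)
      case (Suc n)
      show ?case using someI_ex[OF step[OF Suc]] unfolding s_Suc by blast
    qed (use s0 s_0 in simp)
    have Qs: "Q n (s n) (s (Suc n))" for n
      using someI_ex[OF step[OF PQ[of n]]] unfolding s_Suc by blast
    define f where "f n = fst (s n)" for n
    define g where "g n = fst (snd (s n))" for n
    define r where "r n = snd (snd (s n))" for n
    have fH: "f n \<in> Homeo S" and gH: "g n \<in> Homeo S" and rt: "tol n (f n) (r n)"
      and gd: "g n y \<in> dense_nbhd S (r n) (f n x)" for n
      using PQ[of n] unfolding P_def f_def g_def r_def by (auto split: prod.splits)
    have f1: "\<And>n z. z \<in> S \<Longrightarrow> dist (f n z) (f (Suc n) z) \<le> E / 2^n"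
      and f2: "\<And>n z. z \<in> S \<Longrightarrow> dist (inv (f n) z) (inv (f (Suc n)) z) \<le> E / 2^n"
      and g1: "\<And>n z. z \<in> S \<Longrightarrow> dist (g n z) (g (Suc n) z) \<le> E / 2^n"
      and g2: "\<And>n z. z \<in> S \<Longrightarrow> dist (inv (g n) z) (inv (g (Suc n)) z) \<le> E / 2^n"
      using Qs unfolding Q_def f_def g_def by blast+
    obtain F where F: "F \<in> Homeo S" "\<And>z n. z \<in> S \<Longrightarrow> dist (f n z) (F z) \<le> 2 * E / 2^n"
      "\<And>z. z \<in> S \<Longrightarrow> (\<lambda>n. f n z) \<longlonglongrightarrow> F z"
      using Homeo_geometric_limit[OF S fH _ f1 f2] E by auto
    obtain G where G: "G \<in> Homeo S" "\<And>z n. z \<in> S \<Longrightarrow> dist (g n z) (G z) \<le> 2 * E / 2^n"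
      "\<And>z. z \<in> S \<Longrightarrow> (\<lambda>n. g n z) \<longlonglongrightarrow> G z"
      using Homeo_geometric_limit[OF S gH _ g1 g2] E by auto
    have FG: "F x = G y"
    proof -
      have b: "dist (f n x) (g n y) \<le> E / 2^n" for n
      proof -
        have fx: "f n x \<in> S" using Homeo_mem[OF fH x] .
        have "g n y \<in> closure (small_orbit S (r n) (f n x))"
          using gd[of n] by (auto simp: dense_nbhd_def)
        moreover have "small_orbit S (r n) (f n x) \<subseteq> cball (f n x) (r n)"
          using fx by (force simp: small_orbit_def displ_def)
        ultimately have "g n y \<in> cball (f n x) (r n)"
          using closure_minimal[OF _ closed_cball] by blast
        then show ?thesis using rt[of n] by (simp add: tol_def)
      qed
      have "(\<lambda>n. E * (1/2)^n) \<longlonglongrightarrow> E * 0"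
        by (intro tendsto_intros LIMSEQ_realpow_zero) auto
      then have l0: "(\<lambda>n. E / 2^n) \<longlonglongrightarrow> 0" by (simp add: power_one_over field_simps)
      have "(\<lambda>n. dist (f n x) (g n y)) \<longlonglongrightarrow> dist (F x) (G y)"
        by (intro tendsto_dist F(3) G(3) x y)
      from LIMSEQ_le[OF this l0] b have "dist (F x) (G y) \<le> 0" by blast
      then show ?thesis by simp
    qed
    have dF: "displ S (3 * E) F" and dG: "displ S (3 * E) G"
      unfolding displ_def using F(2)[of _ 0] G(2)[of _ 0] E s0 s_0 by (force simp: f_def g_def)+
    have "displ S (3 * E + 3 * E) (inv G \<circ> F)"
      using displ_comp[OF Homeo_inv[OF G(1) S] displ_inv[OF G(1) S dG] dF F(1)] .
    then have "displ S e (inv G \<circ> F)" by (rule displ_mono) (use e in \<open>simp add: E_def\<close>)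
    moreover have "(inv G \<circ> F) x = y" using FG G(1) by simp
    ultimately show ?thesis using Homeo_comp[OF Homeo_inv[OF G(1) S] F(1)] by blast
  qed
  then show ?thesis using d(1) by blast
qed

text \<open>On a Lebesgue ball around \<open>z\<close> both \<open>x\<close> and \<open>y\<close>
  are small images of \<open>z\<close>; passing through \<open>z\<close> doubles the displacement,
  hence \<open>e / 2\<close> in the pointwise statement.\<close>

theorem effros:
  fixes S :: "'m::metric_space set"
  assumes S: "compact S" and hom: "homog S" and e: "e > 0"
  obtains d where "d > 0" "\<And>x y. x \<in> S \<Longrightarrow> y \<in> S \<Longrightarrow> dist x y < d \<Longrightarrow> \<exists>h\<in>Homeo S. displ S e h \<and> h x = y"
proof -
  let ?Q = "\<lambda>x r. \<forall>y\<in>S. dist x y < r \<longrightarrow> (\<exists>h\<in>Homeo S. displ S (e/2) h \<and> h x = y)"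
  have "e / 2 > 0" using e by simp
  note pw = effros_pointwise[OF S hom _ this]
  obtain s where s: "s > 0" "\<And>x. x \<in> S \<Longrightarrow> \<exists>z\<in>S. \<exists>r>0. ?Q z r \<and> ball x s \<subseteq> ball z r"
    by (rule lebesgue_scale[OF S, of ?Q, OF pw]) (assumption, rule that)
  show thesis
  proof (rule that[OF s(1)])
    fix x y assume xy: "x \<in> S" "y \<in> S" "dist x y < s"
    obtain z r where z: "?Q z r" "ball x s \<subseteq> ball z r" using s(2)[OF xy(1)] by blast
    have "x \<in> ball x s" "y \<in> ball x s" using xy(3) s(1) by auto
    then have "x \<in> ball z r" "y \<in> ball z r" using z(2) by blast+
    then obtain f g where f: "f \<in> Homeo S" "displ S (e/2) f" "f z = x"
      and g: "g \<in> Homeo S" "displ S (e/2) g" "g z = y"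
      using z(1) xy by (metis mem_ball)
    have "displ S (e/2 + e/2) (g \<circ> inv f)"
      using displ_comp[OF g(1,2) displ_inv[OF f(1) S f(2)] Homeo_inv[OF f(1) S]] .
    moreover have "(g \<circ> inv f) x = y" using f g by (metis Homeo_inv_apply comp_apply)
    ultimately show "\<exists>h\<in>Homeo S. displ S e h \<and> h x = y"
      using Homeo_comp[OF g(1) Homeo_inv[OF f(1) S]] by (metis field_sum_of_halves)
  qed
qed

section \<open>Vertical structures\<close>

definition tot_disc :: "'m::topological_space set \<Rightarrow> bool" where
  "tot_disc K \<longleftrightarrow> (\<forall>C. connected C \<and> C \<subseteq> K \<longrightarrow> (\<exists>a. C \<subseteq> {a}))"

text \<open>In a compact Hausdorff space components are quasi-components, so \<open>{x}\<close> can
  be separated by a clopen set from what lies outside the ball. The gap \<open>g\<close> is a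
  Lebesgue number for \<open>Q\<close>: a chain in \<open>K\<close> with steps below
  \<open>g\<close> that starts in \<open>Q\<close> never leaves it.\<close>

lemma tot_disc_clopen:
  fixes K :: "'m::metric_space set"
  assumes K: "compact K" "tot_disc K" and x: "x \<in> K" and r: "r > 0"
  obtains Q g where "x \<in> Q" "Q \<subseteq> K" "Q \<subseteq> ball x r" "compact Q" "compact (K - Q)" "g > 0"
    "\<And>a b. a \<in> Q \<Longrightarrow> b \<in> K \<Longrightarrow> dist a b < g \<Longrightarrow> b \<in> Q"
proof -
  let ?X = "top_of_set K"
  have cs: "compact_space ?X" using K(1) by (simp add: compact_space_subtopology)
  have H: "Hausdorff_space ?X" by (simp add: Hausdorff_space_subtopology)
  have lc: "locally_compact_space ?X" using cs by (simp add: compact_imp_locally_compact_space)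
  define C where "C = connected_component_of_set ?X x"
  have CC: "C \<in> connected_components_of ?X"
    unfolding C_def connected_components_of_def using x by simp
  have conn: "connectedin ?X C" using CC by (rule connectedin_connected_components_of)
  then have "connected C" "C \<subseteq> K" by (auto simp: connectedin_subtopology connectedin_iff_connected)
  then obtain a where "C \<subseteq> {a}" using K(2) by (auto simp: tot_disc_def)
  moreover have "x \<in> C" unfolding C_def using x by (simp add: connected_component_of_refl)
  ultimately have Cx: "C = {x}" by auto
  have "compactin ?X C" using x by (simp add: Cx compactin_sing)
  then have qC: "C \<in> quasi_components_of ?X"
    using compact_quasi_eq_connected_components_of[OF lc H] CC by blast
  have "closedin ?X (K - ball x r)" by (metis Diff_eq closed_Compl closedin_closed_Int open_ball)
  then have "compactin ?X (K - ball x r)" by (rule closedin_compact_space[OF cs])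
  moreover have "disjnt (K - ball x r) C" using r by (auto simp: Cx disjnt_def)
  ultimately have "separated_between ?X (K - ball x r) C"
    using separated_between_compact_quasi_component[OF _ qC] by blast
  then obtain U Q where UQ: "openin ?X U" "openin ?X Q" "U \<union> Q = K" "disjnt U Q" "K - ball x r \<subseteq> U" "C \<subseteq> Q"
    unfolding separated_between_def by auto
  have Q: "Q = K - U" "U = K - Q" using UQ(3,4) by (auto simp: disjnt_def)
  have cQ: "compact Q"
    using closedin_compact[OF K(1), of Q] UQ(1) Q(1) by (simp add: closedin_diff)
  have cU: "compact (K - Q)"
    using closedin_compact[OF K(1), of "K - Q"] UQ(2) by (simp add: closedin_diff)
  have "\<exists>g>0. \<forall>a\<in>Q. \<forall>b\<in>K. dist a b < g \<longrightarrow> b \<in> Q"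
  proof -
    have pw: "\<exists>r>0. \<forall>b\<in>K. dist z b < r \<longrightarrow> b \<in> Q" if "z \<in> Q" for z
      using UQ(2) that unfolding openin_euclidean_subtopology_iff by (metis dist_commute)
    obtain s where s: "s > 0" "\<And>x. x \<in> Q \<Longrightarrow> \<exists>z\<in>Q. \<exists>r>0. (\<forall>b\<in>K. dist z b < r \<longrightarrow> b \<in> Q) \<and> ball x s \<subseteq> ball z r"
      by (rule lebesgue_scale[OF cQ, of "\<lambda>z r. \<forall>b\<in>K. dist z b < r \<longrightarrow> b \<in> Q", OF pw]) (assumption, rule that)
    show ?thesis
    proof (intro exI[of _ s] conjI ballI impI s(1))
      fix a b assume "a \<in> Q" "b \<in> K" "dist a b < s"
      then show "b \<in> Q" using s(2)[of a] by (auto simp: subset_iff)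
    qed
  qed
  then obtain g where g: "g > 0" "\<forall>a\<in>Q. \<forall>b\<in>K. dist a b < g \<longrightarrow> b \<in> Q" by blast
  show thesis
  proof (rule that[of Q g])
    show "x \<in> Q" using UQ(6) Cx by simp
    show "Q \<subseteq> K" "Q \<subseteq> ball x r" using UQ(3,4,5) by (auto simp: disjnt_def)
    show "dist a b < g \<Longrightarrow> b \<in> Q" if "a \<in> Q" "b \<in> K" for a b using g(2) that by blast
  qed (use cQ cU g(1) in simp_all)
qed

text \<open>The uniform radius also keeps the complement open, so \<open>Y\<close> is
  clopen.\<close>

lemma connected_uniformly_open:
  fixes S :: "'m::metric_space set"
  assumes S: "connected S" and Y: "Y \<subseteq> S" "Y \<noteq> {}"
    and d: "d > 0" "\<And>z z'. z \<in> Y \<Longrightarrow> z' \<in> S \<Longrightarrow> dist z z' < d \<Longrightarrow> z' \<in> Y"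
  shows "Y = S"
proof -
  have "openin (top_of_set S) Y"
    unfolding openin_euclidean_subtopology_iff using Y d
    by (intro conjI ballI exI[of _ d]) (auto simp: dist_commute)
  moreover have "openin (top_of_set S) (S - Y)"
    unfolding openin_euclidean_subtopology_iff using d by (intro conjI ballI exI[of _ d]) (auto simp: dist_commute)
  then have "closedin (top_of_set S) Y" using Y by (simp add: closedin_def Diff_Diff_Int)
  ultimately show ?thesis using S Y(2) by (metis connected_clopen)
qed

text \<open>Serves maps chosen point by point from a closed relation with a unique solution, such as
  the vertical projection in \<open>VH_exists\<close>, and maps descending to orbit spaces.\<close>

lemma continuous_on_closed_graph:
  fixes f :: "'a::metric_space \<Rightarrow> 'b::metric_space"
  assumes K: "compact K" and f: "\<And>x. x \<in> S \<Longrightarrow> f x \<in> K"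
    and cl: "\<And>x l z. (\<And>n::nat. x n \<in> S) \<Longrightarrow> z \<in> S \<Longrightarrow> x \<longlonglongrightarrow> z \<Longrightarrow> (\<lambda>n. f (x n)) \<longlonglongrightarrow> l \<Longrightarrow> l \<in> K \<Longrightarrow> l = f z"
  shows "continuous_on S f"
  unfolding continuous_on_sequentially
proof (intro allI ballI impI, elim conjE, rule ccontr)
  fix x z assume z: "z \<in> S" and x: "\<forall>n. x n \<in> S" "x \<longlonglongrightarrow> z" and "\<not> (f \<circ> x) \<longlonglongrightarrow> f z"
  then obtain e where e: "e > 0" "\<And>N. \<exists>n\<ge>N. dist (f (x n)) (f z) \<ge> e"
    unfolding lim_sequentially comp_def by (meson not_less)
  then obtain r :: "nat \<Rightarrow> nat" where r: "strict_mono r" "\<And>n. dist (f (x (r n))) (f z) \<ge> e"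
  proof -
    have "infinite {n. dist (f (x n)) (f z) \<ge> e}"
      unfolding infinite_nat_iff_unbounded_le using e(2) by simp
    from infinite_enumerate[OF this]
    obtain r :: "nat \<Rightarrow> nat" where r0: "strict_mono r" and r1: "\<forall>n. r n \<in> {n. dist (f (x n)) (f z) \<ge> e}"
      by blast
    show thesis by (rule that[OF r0]) (use r1 in simp)
  qed
  have "\<forall>n. f (x (r n)) \<in> K" using f x by blast
  then obtain l q where l: "l \<in> K" "strict_mono q" "((\<lambda>n. f (x (r n))) \<circ> q) \<longlonglongrightarrow> l"
    using K[unfolded compact_def, rule_format, of "\<lambda>n. f (x (r n))"] by blast
  have "(\<lambda>n. x (r (q n))) \<longlonglongrightarrow> z"
    using LIMSEQ_subseq_LIMSEQ[OF LIMSEQ_subseq_LIMSEQ[OF x(2) r(1)] l(2)] by (simp add: o_def)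
  then have "l = f z" using cl[of "\<lambda>n. x (r (q n))" z l] x z l by (auto simp: o_def)
  then have "(\<lambda>n. dist (f (x (r (q n)))) (f z)) \<longlonglongrightarrow> 0"
    using l(3) by (simp add: o_def tendsto_dist_iff[symmetric])
  then show False using r(2) e(1)
    by (metis (no_types, lifting) LIMSEQ_le_const linorder_not_less)
qed

text \<open>Think of \<open>P\<close> as lying on the same plaque and of \<open>V\<close> as lying on the same local transversal;
  both are meaningful only for points at distance less than \<open>R\<close>. The axiom \<open>transport\<close> says
  that every point has a vertical neighbour on each nearby plaque.\<close>

locale vertical_structure =
  fixes S :: "'m::metric_space set" and P V :: "'m \<Rightarrow> 'm \<Rightarrow> bool" and R :: real
  assumes compact_S: "compact S" and connected_S: "connected S" and homog_S: "homog S" and R_pos: "R > 0"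
    and P_refl: "x \<in> S \<Longrightarrow> P x x"
    and P_sym: "x \<in> S \<Longrightarrow> y \<in> S \<Longrightarrow> dist x y < R \<Longrightarrow> P x y \<Longrightarrow> P y x"
    and P_trans: "x \<in> S \<Longrightarrow> y \<in> S \<Longrightarrow> z \<in> S \<Longrightarrow> dist x y < R \<Longrightarrow> dist y z < R \<Longrightarrow> dist x z < R \<Longrightarrow> P x y \<Longrightarrow> P y z \<Longrightarrow> P x z"
    and V_refl: "x \<in> S \<Longrightarrow> V x x"
    and V_sym: "x \<in> S \<Longrightarrow> y \<in> S \<Longrightarrow> dist x y < R \<Longrightarrow> V x y \<Longrightarrow> V y x"
    and V_trans: "x \<in> S \<Longrightarrow> y \<in> S \<Longrightarrow> z \<in> S \<Longrightarrow> dist x y < R \<Longrightarrow> dist y z < R \<Longrightarrow> dist x z < R \<Longrightarrow> V x y \<Longrightarrow> V y z \<Longrightarrow> V x z"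
    and PV_eq: "x \<in> S \<Longrightarrow> y \<in> S \<Longrightarrow> dist x y < R \<Longrightarrow> P x y \<Longrightarrow> V x y \<Longrightarrow> x = y"
    and transport: "e > 0 \<Longrightarrow> \<exists>d>0. \<forall>z\<in>S. \<forall>y\<in>S. dist z y < d \<longrightarrow> (\<exists>u\<in>S. dist z u < e \<and> V z u \<and> P u y)"
    and P_closed: "(\<And>n::nat. f n \<in> S) \<Longrightarrow> (\<And>n. g n \<in> S) \<Longrightarrow> f \<longlonglongrightarrow> x \<Longrightarrow> g \<longlonglongrightarrow> y \<Longrightarrow> x \<in> S \<Longrightarrow> y \<in> S \<Longrightarrow>
        (\<And>n. P (f n) (g n)) \<Longrightarrow> dist x y < R \<Longrightarrow> P x y"
    and V_closed: "(\<And>n::nat. f n \<in> S) \<Longrightarrow> (\<And>n. g n \<in> S) \<Longrightarrow> f \<longlonglongrightarrow> x \<Longrightarrow> g \<longlonglongrightarrow> y \<Longrightarrow> x \<in> S \<Longrightarrow> y \<in> S \<Longrightarrow>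
        (\<And>n. V (f n) (g n)) \<Longrightarrow> dist x y < R \<Longrightarrow> V x y"
    and connected_P: "connected C \<Longrightarrow> C \<subseteq> S \<Longrightarrow> (\<And>a b. a \<in> C \<Longrightarrow> b \<in> C \<Longrightarrow> dist a b < R) \<Longrightarrow> x \<in> C \<Longrightarrow> y \<in> C \<Longrightarrow> P x y"
    and P_connected: "e > 0 \<Longrightarrow> \<exists>d>0. \<forall>x\<in>S. \<forall>y\<in>S. dist x y < d \<longrightarrow> P x y \<longrightarrow>
        (\<exists>C. connected C \<and> x \<in> C \<and> y \<in> C \<and> C \<subseteq> S \<and> C \<subseteq> ball x e)"
begin

text \<open>Leaves are handled through chains of small plaque steps; by \<open>step_refine\<close>
  all sufficiently small bounds \<open>d\<close> reach the same points.\<close>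

definition step :: "real \<Rightarrow> 'm \<Rightarrow> 'm \<Rightarrow> bool" where
  "step d x y \<longleftrightarrow> x \<in> S \<and> y \<in> S \<and> P x y \<and> dist x y < d"

text \<open>\<open>P\<close> is recovered from connectedness: nearby points of a plaque lie in a
  small connected set, its image is connected and still of diameter below \<open>R\<close>, and
  \<open>connected_P\<close> applies. Thus an arbitrary small homeomorphism respects
  plaques.\<close>

lemma homeo_P:
  obtains d where "d > 0" "d \<le> R / 8" "\<And>h x y. h \<in> Homeo S \<Longrightarrow> displ S (R/4) h \<Longrightarrow> x \<in> S \<Longrightarrow> y \<in> S \<Longrightarrow>
    dist x y < d \<Longrightarrow> P x y \<Longrightarrow> P (h x) (h y)"
proof -
  obtain d where d: "d > 0" "\<And>x y. x \<in> S \<Longrightarrow> y \<in> S \<Longrightarrow> dist x y < d \<Longrightarrow> P x y \<Longrightarrow>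
        (\<exists>C. connected C \<and> x \<in> C \<and> y \<in> C \<and> C \<subseteq> S \<and> C \<subseteq> ball x (R/16))"
    using P_connected[of "R/16"] R_pos by (metis divide_pos_pos zero_less_numeral)
  show thesis
  proof
    show "min d (R/8) > 0" "min d (R/8) \<le> R/8" using d R_pos by auto
    fix h x y assume h: "h \<in> Homeo S" "displ S (R/4) h" and xy: "x \<in> S" "y \<in> S" "dist x y < min d (R/8)" "P x y"
    obtain C where C: "connected C" "x \<in> C" "y \<in> C" "C \<subseteq> S" "C \<subseteq> ball x (R/16)"
      using d(2)[of x y] xy by auto
    have "connected (h ` C)"
      using C(1,4) Homeo_continuous[OF h(1)] connected_continuous_image continuous_on_subset by blast
    moreover have "h ` C \<subseteq> S" using C(4) Homeo_mem[OF h(1)] by blast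
    moreover have "dist a b < R" if hab: "a \<in> h ` C" "b \<in> h ` C" for a b
    proof -
      obtain a' b' where ab: "a' \<in> C" "b' \<in> C" "a = h a'" "b = h b'" using hab by blast
      then have "dist a' (h a') < R/4" "dist b' (h b') < R/4" "dist x a' < R/16" "dist x b' < R/16"
        using h(2) C(4,5) by (auto simp: displ_def)
      then show ?thesis
        using dist_triangle3[of "h a'" "h b'" a'] dist_triangle3[of a' b' x] dist_triangle[of a' "h b'" b'] ab(3,4) R_pos
        by (simp add: dist_commute)
    qed
    ultimately show "P (h x) (h y)" using connected_P[of "h ` C"] C(2,3) by blast
  qed
qed

lemma connected_step_chain:
  assumes C: "connected C" "C \<subseteq> S" "\<And>a b. a \<in> C \<Longrightarrow> b \<in> C \<Longrightarrow> dist a b < R" and xy: "x \<in> C" "y \<in> C" and d: "d > 0"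
  shows "(step d)\<^sup>*\<^sup>* x y"
proof -
  define Y where "Y = {c\<in>C. (step d)\<^sup>*\<^sup>* x c}"
  have "Y = C"
  proof (rule connected_uniformly_open[OF C(1) _ _ d])
    show "Y \<subseteq> C" "Y \<noteq> {}" using xy by (auto simp: Y_def)
    fix z z' assume z: "z \<in> Y" "z' \<in> C" "dist z z' < d"
    have "P z z'" using connected_P[OF C] z by (auto simp: Y_def)
    then have "step d z z'" using z C(2) by (auto simp: step_def Y_def)
    then show "z' \<in> Y" using z by (auto simp: Y_def)
  qed
  then show ?thesis using xy(2) by (auto simp: Y_def)
qed

text \<open>The ends of a step lie in a small connected set, and such a set is crossed by steps of
  any prescribed size.\<close>

lemma step_refine:
  obtains d0 where "d0 > 0" "d0 \<le> R / 8" "\<And>d x y. d > 0 \<Longrightarrow> (step d0)\<^sup>*\<^sup>* x y \<Longrightarrow> (step d)\<^sup>*\<^sup>* x y"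
proof -
  obtain d where d: "d > 0" "\<And>x y. x \<in> S \<Longrightarrow> y \<in> S \<Longrightarrow> dist x y < d \<Longrightarrow> P x y \<Longrightarrow>
        (\<exists>C. connected C \<and> x \<in> C \<and> y \<in> C \<and> C \<subseteq> S \<and> C \<subseteq> ball x (R/4))"
    using P_connected[of "R/4"] R_pos by (metis divide_pos_pos zero_less_numeral)
  have one: "(step r)\<^sup>*\<^sup>* x y" if rs: "r > 0" "step (min d (R/8)) x y" for r x y
  proof -
    obtain C where C: "connected C" "x \<in> C" "y \<in> C" "C \<subseteq> S" "C \<subseteq> ball x (R/4)"
      using d(2)[of x y] rs by (auto simp: step_def)
    have "dist a b < R" if "a \<in> C" "b \<in> C" for a b
    proof -
      have "dist x a < R/4" "dist x b < R/4" using that C(5) by auto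
      then show ?thesis using dist_triangle3[of a b x] R_pos by simp
    qed
    then show ?thesis using connected_step_chain[OF C(1,4) _ C(2,3) rs(1)] by blast
  qed
  show thesis
  proof
    show "min d (R/8) > 0" "min d (R/8) \<le> R / 8" using d R_pos by auto
    fix r x y assume r: "r > (0::real)" and "(step (min d (R/8)))\<^sup>*\<^sup>* x y"
    from this(2) show "(step r)\<^sup>*\<^sup>* x y"
      by (induction rule: rtranclp_induct) (use one[OF r] in \<open>auto intro: rtranclp_trans\<close>)
  qed
qed

lemma step_in_S: "(step d)\<^sup>*\<^sup>* x y \<Longrightarrow> x \<in> S \<Longrightarrow> y \<in> S"
  by (induction rule: rtranclp_induct) (auto simp: step_def)

lemma compact_vertical:
  assumes u0: "u0 \<in> S" and \<rho>: "\<rho> < R"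
  shows "compact {y\<in>S. V u0 y \<and> dist u0 y \<le> \<rho>}"
  unfolding compact_def
proof (intro allI impI)
  let ?K = "{y\<in>S. V u0 y \<and> dist u0 y \<le> \<rho>}"
  fix f :: "nat \<Rightarrow> 'm" assume f: "\<forall>n. f n \<in> ?K"
  then have "\<forall>n. f n \<in> S" by simp
  then obtain l r where l: "l \<in> S" "strict_mono r" "(f \<circ> r) \<longlonglongrightarrow> l"
    using compact_S unfolding compact_def by metis
  have "dist u0 l \<le> \<rho>"
  proof (rule LIMSEQ_le_const2)
    show "(\<lambda>n. dist u0 ((f \<circ> r) n)) \<longlonglongrightarrow> dist u0 l" by (intro tendsto_intros l)
    show "\<exists>N. \<forall>n\<ge>N. dist u0 ((f \<circ> r) n) \<le> \<rho>" using f by simp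
  qed
  moreover from this have "V u0 l"
    using V_closed[of "\<lambda>_. u0" "f \<circ> r" u0 l] u0 f l \<rho> by simp
  ultimately show "\<exists>l\<in>?K. \<exists>r. strict_mono r \<and> (f \<circ> r) \<longlonglongrightarrow> l" using l by auto
qed

text \<open>This is a consequence of the axioms: a connected subset would lie in one plaque by
  \<open>connected_P\<close>, and \<open>PV_eq\<close> leaves it only one point.\<close>

lemma tot_disc_vertical:
  assumes u0: "u0 \<in> S" and \<rho>: "\<rho> \<le> R/4"
  shows "tot_disc {y\<in>S. V u0 y \<and> dist u0 y \<le> \<rho>}"
  unfolding tot_disc_def
proof (intro allI impI, elim conjE)
  let ?K = "{y\<in>S. V u0 y \<and> dist u0 y \<le> \<rho>}"
  have close: "dist a b < R" if "a \<in> ?K" "b \<in> ?K" for a b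
    using that dist_triangle3[of a b u0] \<rho> R_pos by simp
  fix C assume C: "connected C" "C \<subseteq> ?K"
  have "a = b" if "a \<in> C" "b \<in> C" for a b
  proof -
    have ab: "a \<in> ?K" "b \<in> ?K" using that C by auto
    then have abS: "a \<in> S" "b \<in> S" "V u0 a" "V u0 b" "dist u0 a < R" "dist u0 b < R"
      using \<rho> R_pos by auto
    have "P a b"
      by (rule connected_P[OF C(1)]) (use C(2) close that in auto)
    moreover have "V a u0" using V_sym u0 abS by blast
    then have "V a b" using V_trans[of a u0 b] abS u0 close[OF ab] by (simp add: dist_commute)
    ultimately show ?thesis using PV_eq abS close[OF ab] by blast
  qed
  then show "\<exists>a. C \<subseteq> {a}" by (metis singleton_iff subsetI)
qed

text \<open>The saturation of a clopen piece of a vertical set is clopen, since small homeomorphisms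
  move points of the space arbitrarily and respect plaques.\<close>

theorem leaf_dense:
  assumes d: "d > 0" and x0: "x0 \<in> S" and u0: "u0 \<in> S" and e: "e > 0"
  shows "\<exists>y. (step d)\<^sup>*\<^sup>* x0 y \<and> dist y u0 < e"
proof -
  obtain d0 where d0: "d0 > 0" "d0 \<le> R / 8" "\<And>d x y. d > 0 \<Longrightarrow> (step d0)\<^sup>*\<^sup>* x y \<Longrightarrow> (step d)\<^sup>*\<^sup>* x y"
    using step_refine by blast
  obtain d1 where d1: "d1 > 0" "d1 \<le> R / 8" "\<And>h x y. h \<in> Homeo S \<Longrightarrow> displ S (R/4) h \<Longrightarrow> x \<in> S \<Longrightarrow> y \<in> S \<Longrightarrow>
    dist x y < d1 \<Longrightarrow> P x y \<Longrightarrow> P (h x) (h y)"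
    using homeo_P by blast
  have leaf_h: "(step d0)\<^sup>*\<^sup>* (h x) (h y)" if h: "h \<in> Homeo S" "displ S (d0/4) h" and xy: "(step d0)\<^sup>*\<^sup>* x y" for h x y
  proof -
    have h': "displ S (R/4) h" using h(2) by (rule displ_mono) (use d0 R_pos in simp)
    \<comment> \<open>The chain is refined first, because \<open>h\<close> may lengthen every step
      by up to \<open>d0 / 2\<close>.\<close>
    have "(step (min d1 (d0/4)))\<^sup>*\<^sup>* x y" using d0(3)[OF _ xy] d1(1) d0(1) by simp
    then show ?thesis
    proof (induction rule: rtranclp_induct)
      case (step y z)
      have yz: "y \<in> S" "z \<in> S" "P y z" "dist y z < d1" "dist y z < d0/4" using step(2) by (auto simp: step_def)
      have "P (h y) (h z)" using d1(3)[OF h(1) h'] yz by blast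
      moreover have "dist y (h y) < d0/4" "dist z (h z) < d0/4" using h(2) yz by (auto simp: displ_def)
      then have "dist (h y) (h z) < d0"
        using dist_triangle3[of "h y" "h z" y] dist_triangle[of y "h z" z] yz(5) d0(1) by linarith
      ultimately have "step d0 (h y) (h z)" using Homeo_mem[OF h(1)] yz by (simp add: step_def)
      then show ?case using step by simp
    qed simp
  qed
  define \<rho> where "\<rho> = min (R/4) (e/2)"
  have \<rho>: "\<rho> > 0" "\<rho> \<le> R/4" "\<rho> < e" using R_pos e by (auto simp: \<rho>_def)
  define K where "K = {y\<in>S. V u0 y \<and> dist u0 y \<le> \<rho>}"
  have cK: "compact K" unfolding K_def by (rule compact_vertical[OF u0]) (use \<rho> R_pos in simp)
  have tK: "tot_disc K" unfolding K_def by (rule tot_disc_vertical[OF u0]) (use \<rho> R_pos in simp)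
  have u0K: "u0 \<in> K" using u0 V_refl \<rho> by (simp add: K_def)
  obtain Q g where Q: "u0 \<in> Q" "Q \<subseteq> K" "Q \<subseteq> ball u0 (\<rho>/2)" "g > 0"
      "\<And>a b. a \<in> Q \<Longrightarrow> b \<in> K \<Longrightarrow> dist a b < g \<Longrightarrow> b \<in> Q"
    using tot_disc_clopen[OF cK tK u0K, of "\<rho>/2"] \<rho>(1) by (metis half_gt_zero)
  define Y where "Y = {z\<in>S. \<exists>w\<in>Q. (step d0)\<^sup>*\<^sup>* z w}"
  \<comment> \<open>The bound \<open>g\<close> keeps the transported point in \<open>Q\<close>,
    \<open>\<rho>/2\<close> keeps it in \<open>K\<close>, and \<open>d0/2\<close> makes the
    correction from \<open>h w\<close> to it a single step.\<close>
  define e2 where "e2 = min (min g (\<rho>/2)) (d0/2)"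
  have e2: "e2 > 0" "e2 \<le> g" "e2 \<le> \<rho>/2" "e2 \<le> d0/2" using Q(4) \<rho> d0(1) by (auto simp: e2_def)
  obtain d2 where d2: "d2 > 0" "\<And>z y. z \<in> S \<Longrightarrow> y \<in> S \<Longrightarrow> dist z y < d2 \<Longrightarrow> \<exists>u\<in>S. dist z u < e2 \<and> V z u \<and> P u y"
    using transport[OF e2(1)] by blast
  have "min d2 (d0/4) > 0" using d2(1) d0(1) by simp
  then obtain d3 where d3: "d3 > 0" "\<And>x y. x \<in> S \<Longrightarrow> y \<in> S \<Longrightarrow> dist x y < d3 \<Longrightarrow>
      \<exists>h\<in>Homeo S. displ S (min d2 (d0/4)) h \<and> h x = y"
    using effros[OF compact_S homog_S] by metis
  \<comment> \<open>If a chain leads from \<open>z\<close> to \<open>w\<close> in \<open>Q\<close>,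
    a small \<open>h\<close> with \<open>h z = z'\<close> carries it to a chain from
    \<open>z'\<close> to \<open>h w\<close>. Transport then replaces \<open>h w\<close> by a point
    vertical over \<open>w\<close>, which is again in \<open>Q\<close>.\<close>
  have "Y = S"
  proof (rule connected_uniformly_open[OF connected_S _ _ d3(1)])
    show "Y \<subseteq> S" by (auto simp: Y_def)
    show "Y \<noteq> {}" using u0 Q(1) by (auto simp: Y_def)
    fix z z' assume z: "z \<in> Y" "z' \<in> S" "dist z z' < d3"
    then obtain w where w: "w \<in> Q" "(step d0)\<^sup>*\<^sup>* z w" and zS: "z \<in> S" by (auto simp: Y_def)
    obtain h where h: "h \<in> Homeo S" "displ S (min d2 (d0/4)) h" "h z = z'" using d3(2)[OF zS z(2,3)] by blast
    have wK: "w \<in> K" "w \<in> S" using w(1) Q(2) by (auto simp: K_def)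
    have 1: "(step d0)\<^sup>*\<^sup>* z' (h w)"
      using leaf_h[OF h(1) displ_mono[OF h(2)] w(2)] h(3) by simp
    have hw: "h w \<in> S" "dist w (h w) < d2" "dist w (h w) < d0/4"
      using Homeo_mem[OF h(1) wK(2)] h(2) wK(2) by (auto simp: displ_def)
    obtain u where u: "u \<in> S" "dist w u < e2" "V w u" "P u (h w)" using d2(2)[OF wK(2) hw(1,2)] by blast
    have wu: "dist u0 w < \<rho>/2" "V u0 w" using w(1) Q(2,3) by (auto simp: K_def)
    have uu: "dist u0 u < \<rho>" using wu(1) u(2) e2(3) dist_triangle[of u0 u w] by simp
    have "V u0 u" using V_trans[of u0 w u] u0 wK(2) u wu uu e2(3) \<rho>(2) R_pos by simp
    then have "u \<in> K" using u(1) uu by (simp add: K_def)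
    then have "u \<in> Q" using Q(5)[OF w(1)] u(2) e2(2) by simp
    moreover have duh: "dist u (h w) < d0" using u(2) hw(3) e2(4) dist_triangle3[of u "h w" w] d0(1) by simp
    have "P (h w) u" using P_sym[OF u(1) hw(1) _ u(4)] duh d0(2) R_pos by simp
    then have "step d0 (h w) u" using u(1) hw(1) duh by (simp add: step_def dist_commute)
    then have "(step d0)\<^sup>*\<^sup>* z' u" using 1 by simp
    ultimately show "z' \<in> Y" using z(2) by (auto simp: Y_def)
  qed
  then obtain w where w: "w \<in> Q" "(step d0)\<^sup>*\<^sup>* x0 w" using x0 by (auto simp: Y_def)
  have "dist w u0 < e" using w(1) Q(3) \<rho> by (force simp: dist_commute)
  then show ?thesis using d0(3)[OF d w(2)] by blast
qed

end

section \<open>Vertical homeomorphisms\<close>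

text \<open>The generated monoid, with new factors added on the left, so that the images of a base
  point form a chain with one generator per step. By \<open>mgen_inv\<close> it is a group when the
  generators are closed under inversion.\<close>

inductive_set mgen :: "('m \<Rightarrow> 'm) set \<Rightarrow> ('m \<Rightarrow> 'm) set" for A where
  mgen_id: "id \<in> mgen A"
| mgen_step: "f \<in> A \<Longrightarrow> D \<in> mgen A \<Longrightarrow> f \<circ> D \<in> mgen A"

lemma mgen_base: "f \<in> A \<Longrightarrow> f \<in> mgen A"
  using mgen_step[OF _ mgen_id, of f A] by simp

lemma mgen_comp: "D \<in> mgen A \<Longrightarrow> E \<in> mgen A \<Longrightarrow> D \<circ> E \<in> mgen A"
  by (induction rule: mgen.induct) (auto simp: o_assoc[symmetric] intro: mgen.intros)

lemma mgen_mono: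
  assumes "A \<subseteq> B"
  shows "mgen A \<subseteq> mgen B"
proof
  fix x assume "x \<in> mgen A"
  then show "x \<in> mgen B" by induction (use assms in \<open>blast intro: mgen.intros\<close>)+
qed

lemma mgen_Homeo:
  assumes "A \<subseteq> Homeo S" "D \<in> mgen A"
  shows "D \<in> Homeo S"
  using assms(2) by induction (use assms(1) in \<open>blast intro: Homeo_id Homeo_comp\<close>)+

lemma mgen_inv:
  assumes A: "A \<subseteq> Homeo S" "\<And>f. f \<in> A \<Longrightarrow> inv f \<in> A" and D: "D \<in> mgen A"
  shows "inv D \<in> mgen A"
  using D
proof induction
  case mgen_id
  then show ?case unfolding inv_id by (rule mgen.mgen_id)
next
  case (mgen_step f D)
  have "inv (f \<circ> D) = inv D \<circ> inv f"
    using Homeo_inv_comp[of f S D] A(1) mgen_step mgen_Homeo[OF A(1)] by blast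
  then show ?case using mgen_comp[OF mgen_step(3) mgen_base[OF A(2)[OF mgen_step(1)]]] by metis
qed

section \<open>Small vertical homeomorphisms: uniqueness, existence, stability\<close>

context vertical_structure begin

definition VH :: "real \<Rightarrow> ('m \<Rightarrow> 'm) set" where
  "VH e = {D \<in> Homeo S. displ S e D \<and> (\<forall>z\<in>S. V z (D z))}"

lemma VH_Homeo: "D \<in> VH e \<Longrightarrow> D \<in> Homeo S"
  by (simp add: VH_def)

lemma VH_dist: "D \<in> VH e \<Longrightarrow> z \<in> S \<Longrightarrow> dist z (D z) < e"
  by (simp add: VH_def displ_def)

lemma VH_V: "D \<in> VH e \<Longrightarrow> z \<in> S \<Longrightarrow> V z (D z)"
  by (simp add: VH_def)

lemma VH_mem: "D \<in> VH e \<Longrightarrow> z \<in> S \<Longrightarrow> D z \<in> S"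
  using VH_Homeo Homeo_mem by blast

lemma VH_mono: "a \<le> b \<Longrightarrow> VH a \<subseteq> VH b"
  using displ_mono by (auto simp: VH_def)

lemma VH_id: "e > 0 \<Longrightarrow> id \<in> VH e"
  by (simp add: VH_def Homeo_id displ_id V_refl)

lemma VH_comp:
  assumes D: "D \<in> VH a" and E: "E \<in> VH b" and ab: "a + b \<le> R"
  shows "D \<circ> E \<in> VH (a + b)"
proof -
  have disp: "displ S (a + b) (D \<circ> E)"
    using displ_comp[of D S a b E] D E by (simp add: VH_def)
  have "V z (D (E z))" if z: "z \<in> S" for z
  proof -
    have Ez: "E z \<in> S" using VH_mem[OF E z] .
    have d: "dist z (E z) < b" "dist (E z) (D (E z)) < a"
      using VH_dist[OF E z] VH_dist[OF D Ez] by auto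
    have nn: "0 \<le> dist z (E z)" "0 \<le> dist (E z) (D (E z))" by auto
    have "dist z (D (E z)) < a + b" using disp z by (simp add: displ_def)
    then show ?thesis
      using V_trans[OF z Ez VH_mem[OF D Ez] _ _ _ VH_V[OF E z] VH_V[OF D Ez]] d nn ab by linarith
  qed
  then show ?thesis
    using disp Homeo_comp[OF VH_Homeo[OF D] VH_Homeo[OF E]] by (simp add: VH_def)
qed

lemma VH_inv:
  assumes D: "D \<in> VH a" and a: "a \<le> R"
  shows "inv D \<in> VH a"
proof -
  note H = Homeo_inv[OF VH_Homeo[OF D] compact_S]
  have disp: "displ S a (inv D)" using displ_inv[of D S a] D compact_S by (simp add: VH_def)
  have "V z (inv D z)" if z: "z \<in> S" for z
  proof -
    have iz: "inv D z \<in> S" using Homeo_mem[OF H z] .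
    have "V (inv D z) (D (inv D z))" using VH_V[OF D iz] .
    then have "V (inv D z) z" using VH_Homeo[OF D] by simp
    moreover have "dist z (inv D z) < R" using disp z a by (force simp: displ_def)
    ultimately show ?thesis using V_sym[OF iz z] by (simp add: dist_commute)
  qed
  then show ?thesis using H disp by (simp add: VH_def)
qed

text \<open>Agreement propagates along chains: if \<open>D y = E y\<close> and \<open>z\<close> is
  one step away from \<open>y\<close>, then \<open>D z\<close> and \<open>E z\<close> lie both on
  one plaque and on one vertical set, hence coincide. Chains from \<open>x\<close> are dense by
  \<open>leaf_dense\<close>, and continuity gives the rest.\<close>

lemma VH_unique:
  assumes D: "D \<in> VH (R/8)" and E: "E \<in> VH (R/8)" and x: "x \<in> S" "D x = E x"
  shows "D = E"
proof -
  obtain d1 where d1: "d1 > 0" "d1 \<le> R / 8" "\<And>h x y. h \<in> Homeo S \<Longrightarrow> displ S (R/4) h \<Longrightarrow> x \<in> S \<Longrightarrow> y \<in> S \<Longrightarrow>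
    dist x y < d1 \<Longrightarrow> P x y \<Longrightarrow> P (h x) (h y)"
    using homeo_P by blast
  have R8: "R/8 > 0" using R_pos by simp
  obtain d2 where d2: "d2 > 0" "\<And>x y. x \<in> S \<Longrightarrow> y \<in> S \<Longrightarrow> dist x y < d2 \<Longrightarrow> dist (D x) (D y) < R/8"
    using Homeo_uniform[OF VH_Homeo[OF D] compact_S R8] by blast
  obtain d3 where d3: "d3 > 0" "\<And>x y. x \<in> S \<Longrightarrow> y \<in> S \<Longrightarrow> dist x y < d3 \<Longrightarrow> dist (E x) (E y) < R/8"
    using Homeo_uniform[OF VH_Homeo[OF E] compact_S R8] by blast
  define d where "d = min d1 (min d2 d3)"
  have d: "d > 0" "d \<le> d1" "d \<le> d2" "d \<le> d3" using d1 d2 d3 by (auto simp: d_def)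
  have dD: "displ S (R/4) D" and dE: "displ S (R/4) E"
    using D E R_pos by (auto simp: VH_def intro: displ_mono)
  have eq: "D y = E y" if "(step d)\<^sup>*\<^sup>* x y" for y
    using that
  proof (induction rule: rtranclp_induct)
    case (step y z)
    have yz: "y \<in> S" "z \<in> S" "P y z" "dist y z < d" using step(2) by (auto simp: step_def)
    have S4: "D y \<in> S" "D z \<in> S" "E z \<in> S" using VH_mem D E yz by auto
    have P1: "P (D y) (D z)" using d1(3)[OF VH_Homeo[OF D] dD] yz d by simp
    have P2: "P (D y) (E z)" using d1(3)[OF VH_Homeo[OF E] dE] yz d step(3) by simp
    have n1: "dist (D y) (D z) < R/8" using d2(2)[OF yz(1,2)] yz d by simp
    have n2: "dist (D y) (E z) < R/8" using d3(2)[OF yz(1,2)] yz d step(3) by simp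
    have n3: "dist (D z) (E z) < R/4" using dist_triangle3[of "D z" "E z" "D y"] n1 n2 by simp
    have "P (D z) (D y)" using P_sym[OF S4(1,2) _ P1] n1 R_pos by simp
    then have P3: "P (D z) (E z)" using P_trans[OF S4(2,1,3)] n1 n2 n3 P2 R_pos by (simp add: dist_commute)
    note v = VH_dist[OF D yz(2)] VH_dist[OF E yz(2)]
    have "V (D z) z" using V_sym[OF yz(2) S4(2) _ VH_V[OF D yz(2)]] v R_pos by simp
    then have "V (D z) (E z)"
      using V_trans[OF S4(2) yz(2) S4(3) _ _ _ _ VH_V[OF E yz(2)]] v n3 R_pos by (simp add: dist_commute)
    then show ?case using PV_eq[OF S4(2,3) _ P3] n3 R_pos by simp
  qed (use x in simp)
  show ?thesis
  proof (rule Homeo_eqI[OF VH_Homeo[OF D] VH_Homeo[OF E]])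
    fix u assume u: "u \<in> S"
    have "dist (D u) (E u) \<le> e" if e: "e > 0" for e
    proof -
      have e2: "e/2 > 0" using e by simp
      obtain b1 where b1: "b1 > 0" "\<And>y. y \<in> S \<Longrightarrow> dist u y < b1 \<Longrightarrow> dist (D u) (D y) < e/2"
        using Homeo_at[OF VH_Homeo[OF D] u e2] by blast
      obtain b2 where b2: "b2 > 0" "\<And>y. y \<in> S \<Longrightarrow> dist u y < b2 \<Longrightarrow> dist (E u) (E y) < e/2"
        using Homeo_at[OF VH_Homeo[OF E] u e2] by blast
      have "min b1 b2 > 0" using b1 b2 by simp
      then obtain y where y: "(step d)\<^sup>*\<^sup>* x y" "dist y u < min b1 b2"
        using leaf_dense[OF d(1) x(1) u] by blast
      have yS: "y \<in> S" using step_in_S[OF y(1) x(1)] .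
      have "dist (D u) (D y) < e/2" "dist (E u) (E y) < e/2"
        using b1(2)[OF yS] b2(2)[OF yS] y(2) by (auto simp: dist_commute)
      then show ?thesis using dist_triangle2[of "D u" "E u" "D y"] eq[OF y(1)] by simp
    qed
    then have "dist (D u) (E u) \<le> 0" by (meson field_le_epsilon add_0 order_refl zero_less_dist_iff dense_ge)
    then show "D u = E u" by simp
  qed
qed

text \<open>A small homeomorphism is made vertical by following it with the projection along plaques.\<close>

lemma VH_exists:
  assumes e: "e > 0"
  obtains d where "d > 0" "\<And>x y. x \<in> S \<Longrightarrow> y \<in> S \<Longrightarrow> dist x y < d \<Longrightarrow> V x y \<Longrightarrow> \<exists>D\<in>VH e. D x = y"
proof -
  obtain d0 where d0: "d0 > 0" "d0 \<le> R / 8" "\<And>h x y. h \<in> Homeo S \<Longrightarrow> displ S (R/4) h \<Longrightarrow> x \<in> S \<Longrightarrow> y \<in> S \<Longrightarrow>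
    dist x y < d0 \<Longrightarrow> P x y \<Longrightarrow> P (h x) (h y)"
    using homeo_P by blast
  define e' where "e' = min e (min (R/16) (d0/2))"
  have e': "e' > 0" "e' \<le> e" "e' \<le> R/16" "e' \<le> d0/2" using e R_pos d0 by (auto simp: e'_def)
  obtain d1 where d1: "d1 > 0" "\<And>z y. z \<in> S \<Longrightarrow> y \<in> S \<Longrightarrow> dist z y < d1 \<Longrightarrow> \<exists>u\<in>S. dist z u < e' \<and> V z u \<and> P u y"
    using transport[OF e'(1)] by blast
  define d2 where "d2 = min d1 (min (R/16) (d0/2))"
  have d2: "d2 > 0" "d2 \<le> d1" "d2 \<le> R/16" "d2 \<le> d0/2" using d1 R_pos d0 by (auto simp: d2_def)
  \<comment> \<open>The non-strict distance bound makes this a closed condition, as the closed graph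
    argument requires.\<close>
  define good where "good h z u \<longleftrightarrow> u \<in> S \<and> dist z u \<le> R/16 \<and> V z u \<and> P u (h z)" for h :: "'m \<Rightarrow> 'm" and z u
  have uniq: "u = u'" if h: "h \<in> Homeo S" "displ S d2 h" and z: "z \<in> S" and g: "good h z u" "good h z u'" for h z u u'
  proof -
    note hz = Homeo_mem[OF h(1) z]
    have dz: "dist z (h z) < R/16" using h(2) z d2(3) by (force simp: displ_def)
    have u: "u \<in> S" "dist z u \<le> R/16" "V z u" "P u (h z)" "u' \<in> S" "dist z u' \<le> R/16" "V z u'" "P u' (h z)"
      using g by (auto simp: good_def)
    have uu: "dist u u' < R" using dist_triangle3[of u u' z] u R_pos by simp
    have uh: "dist u (h z) < R" "dist u' (h z) < R"
      using dist_triangle3[of u "h z" z] dist_triangle3[of u' "h z" z] u dz R_pos by auto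
    have "V u z" using V_sym[OF z u(1) _ u(3)] u(2) R_pos by simp
    then have Vuu: "V u u'" using V_trans[OF u(1) z u(5) _ _ _ _ u(7)] u(2,6) uu R_pos by (simp add: dist_commute)
    have "P (h z) u'" using P_sym[OF u(5) hz uh(2) u(8)] .
    then have "P u u'" using P_trans[OF u(1) hz u(5) uh(1) _ uu u(4)] uh(2) by (simp add: dist_commute)
    then show ?thesis using PV_eq[OF u(1,5) uu _ Vuu] by blast
  qed
  define vp where "vp h z = (if z \<in> S then (SOME u. good h z u \<and> dist z u < e') else z)" for h z
  have vp: "good h z (vp h z) \<and> dist z (vp h z) < e'" if h: "h \<in> Homeo S" "displ S d2 h" and z: "z \<in> S" for h z
  proof -
    have "dist z (h z) < d1" using h(2) z d2(2) by (force simp: displ_def)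
    then obtain u where "u \<in> S" "dist z u < e'" "V z u" "P u (h z)"
      using d1(2)[OF z Homeo_mem[OF h(1) z]] by blast
    then have "\<exists>u. good h z u \<and> dist z u < e'" using e'(3) by (force simp: good_def)
    from someI_ex[OF this] show ?thesis using z by (simp add: vp_def)
  qed
  \<comment> \<open>With \<open>u = vp h z\<close>, the point \<open>inv h u\<close> is on the
    plaque of \<open>z\<close>, and \<open>z\<close> is vertical over \<open>u\<close>. So
    \<open>z\<close> solves the projection problem of \<open>inv h\<close> at \<open>u\<close>, and
    projecting \<open>inv h\<close> undoes projecting \<open>h\<close>.\<close>
  have inv_vp: "vp (inv h) (vp h z) = z" if h: "h \<in> Homeo S" "displ S d2 h" and z: "z \<in> S" for h z
  proof -
    note hi = Homeo_inv[OF h(1) compact_S] displ_inv[OF h(1) compact_S h(2)]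
    define u where "u = vp h z"
    have u: "u \<in> S" "dist z u < e'" "V z u" "P u (h z)" using vp[OF h z] by (auto simp: good_def u_def)
    have "dist z (h z) < d2" using h(2) z by (simp add: displ_def)
    then have duh: "dist u (h z) < d0" using dist_triangle3[of u "h z" z] u(2) d2(4) e'(4) by simp
    have "displ S (R/4) (inv h)" using hi(2) by (rule displ_mono) (use d2 R_pos in simp)
    then have "P (inv h u) (inv h (h z))" using d0(3)[OF hi(1) _ u(1) Homeo_mem[OF h(1) z] duh u(4)] by blast
    then have p: "P (inv h u) z" using h(1) by simp
    have hu: "inv h u \<in> S" using Homeo_mem[OF hi(1) u(1)] .
    have "dist u (inv h u) < d2" using hi(2) u(1) by (simp add: displ_def)
    then have "dist (inv h u) z < R" using dist_triangle3[of "inv h u" z u] u(2) d2(3) e'(3) R_pos by (simp add: dist_commute)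
    then have "P z (inv h u)" using P_sym[OF hu z _ p] by simp
    moreover have "V u z" using V_sym[OF z u(1) _ u(3)] u(2) e'(3) R_pos by simp
    ultimately have "good (inv h) u z" using z u(2) e'(3) by (simp add: good_def dist_commute)
    then show ?thesis using uniq[OF hi u(1)] vp[OF hi u(1)] by (simp add: u_def)
  qed
  have vpVH: "vp h \<in> VH e" if h: "h \<in> Homeo S" "displ S d2 h" for h
  proof -
    note hi = Homeo_inv[OF h(1) compact_S] displ_inv[OF h(1) compact_S h(2)]
    have ii: "inv (inv h) = h" using Homeo_bij[OF h(1)] by (rule inv_inv_eq)
    have g: "vp h z \<in> S \<and> dist z (vp h z) < e' \<and> V z (vp h z)" "vp (inv h) z \<in> S" if "z \<in> S" for z
      using vp[OF h that] vp[OF hi that] by (auto simp: good_def)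
    have "bij_betw (vp h) S S"
      by (rule bij_betw_byWitness[of S "vp (inv h)"])
        (use inv_vp[OF h] inv_vp[OF hi] ii g in auto)
    moreover have "continuous_on S (vp h)"
    proof (rule continuous_on_closed_graph[OF compact_S])
      show "vp h x \<in> S" if "x \<in> S" for x using g that by blast
      fix x :: "nat \<Rightarrow> 'm" and l z assume x: "\<And>n. x n \<in> S" "z \<in> S" "x \<longlonglongrightarrow> z" "(\<lambda>n. vp h (x n)) \<longlonglongrightarrow> l" "l \<in> S"
      have "dist z l \<le> R/16"
      proof (rule LIMSEQ_le_const2)
        show "(\<lambda>n. dist (x n) (vp h (x n))) \<longlonglongrightarrow> dist z l" by (intro tendsto_dist x)
        show "\<exists>N. \<forall>n\<ge>N. dist (x n) (vp h (x n)) \<le> R/16"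
          using vp[OF h x(1)] by (auto simp: good_def)
      qed
      moreover have "V z l"
        by (rule V_closed[OF x(1) _ x(3,4,2,5)])
          (use vp[OF h x(1)] calculation R_pos in \<open>auto simp: good_def\<close>)
      moreover have "P l (h z)"
      proof (rule P_closed[OF _ _ x(4) _ x(5)])
        show "(\<lambda>n. h (x n)) \<longlonglongrightarrow> h z"
          using continuous_on_tendsto_compose[OF Homeo_continuous[OF h(1)] x(3,2)] x(1) by simp
        show "h z \<in> S" "h (x n) \<in> S" "vp h (x n) \<in> S" "P (vp h (x n)) (h (x n))" for n
          using Homeo_mem[OF h(1)] x vp[OF h x(1), of n] by (auto simp: good_def)
        have "dist z (h z) < R/16" using h(2) x(2) d2(3) by (force simp: displ_def)
        then show "dist l (h z) < R" using dist_triangle3[of l "h z" z] calculation R_pos by simp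
      qed
      ultimately have "good h z l" using x(5) by (simp add: good_def)
      then show "l = vp h z" using uniq[OF h x(2)] vp[OF h x(2)] by blast
    qed
    ultimately have "vp h \<in> Homeo S" by (simp add: Homeo_def vp_def)
    moreover have "displ S e (vp h)" using g e'(2) by (force simp: displ_def)
    ultimately show ?thesis using g by (simp add: VH_def)
  qed
  obtain d3 where d3: "d3 > 0" "\<And>x y. x \<in> S \<Longrightarrow> y \<in> S \<Longrightarrow> dist x y < d3 \<Longrightarrow> \<exists>h\<in>Homeo S. displ S d2 h \<and> h x = y"
    using effros[OF compact_S homog_S d2(1)] by metis
  show thesis
  proof
    show "min d3 (R/16) > 0" using d3 R_pos by simp
    fix x y assume xy: "x \<in> S" "y \<in> S" "dist x y < min d3 (R/16)" "V x y"
    obtain h where h: "h \<in> Homeo S" "displ S d2 h" "h x = y" using d3(2)[OF xy(1,2)] xy(3) by auto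
    \<comment> \<open>\<open>y\<close> is equal to \<open>h x\<close> and already vertical over
      \<open>x\<close>, so the projection leaves it in place.\<close>
    have "good h x y" using xy h(3) P_refl by (simp add: good_def)
    then have "vp h x = y" using uniq[OF h(1,2) xy(1)] vp[OF h(1,2) xy(1)] by blast
    then show "\<exists>D\<in>VH e. D x = y" using vpVH[OF h(1,2)] by blast
  qed
qed

text \<open>\<open>D x\<close> and \<open>E x\<close> are vertically near, so a small vertical
  \<open>F\<close> carries one to the other; then \<open>F \<circ> D\<close> and \<open>E\<close>
  agree at \<open>x\<close> and are equal by uniqueness. One value thus controls the whole map. The
  bound \<open>R/32\<close> keeps \<open>F \<circ> D\<close> within the range of
  \<open>VH_unique\<close>.\<close>

lemma VH_close:
  assumes e: "e > 0"
  obtains \<tau> where "\<tau> > 0" "\<And>D E x z. D \<in> VH (R/32) \<Longrightarrow> E \<in> VH (R/32) \<Longrightarrow> x \<in> S \<Longrightarrow> dist (D x) (E x) < \<tau> \<Longrightarrow>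
    z \<in> S \<Longrightarrow> dist (D z) (E z) < e"
proof -
  have "min e (R/32) > 0" using e R_pos by simp
  then obtain d where d: "d > 0" "\<And>x y. x \<in> S \<Longrightarrow> y \<in> S \<Longrightarrow> dist x y < d \<Longrightarrow> V x y \<Longrightarrow> \<exists>D\<in>VH (min e (R/32)). D x = y"
    using VH_exists by metis
  show thesis
  proof (rule that[OF d(1)])
    fix D E x z assume D: "D \<in> VH (R/32)" and E: "E \<in> VH (R/32)" and x: "x \<in> S" and c: "dist (D x) (E x) < d" and z: "z \<in> S"
    note m = VH_mem[OF D x] VH_mem[OF E x]
    note n = VH_dist[OF D x] VH_dist[OF E x]
    have n3: "dist (D x) (E x) < R" using dist_triangle3[of "D x" "E x" x] n R_pos by simp
    have "V (D x) x" using V_sym[OF x m(1) _ VH_V[OF D x]] n R_pos by simp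
    then have "V (D x) (E x)" using V_trans[OF m(1) x m(2) _ _ n3 _ VH_V[OF E x]] n R_pos by (simp add: dist_commute)
    then obtain F where F: "F \<in> VH (min e (R/32))" "F (D x) = E x" using d(2)[OF m c] by blast
    have "F \<in> VH (R/32)" using F(1) VH_mono[OF min.cobounded2] by blast
    then have "F \<circ> D \<in> VH (R/32 + R/32)" by (intro VH_comp D) (use R_pos in simp_all)
    then have "F \<circ> D \<in> VH (R/8)" using VH_mono[of "R/32 + R/32" "R/8"] R_pos by auto
    moreover have "E \<in> VH (R/8)" using E VH_mono[of "R/32" "R/8"] R_pos by auto
    ultimately have "F \<circ> D = E" using VH_unique[of "F \<circ> D" E x] x F(2) by simp
    then have "E z = F (D z)" by auto
    then show "dist (D z) (E z) < e" using VH_dist[OF F(1) VH_mem[OF D z]] by simp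
  qed
qed

text \<open>Products of very small vertical homeomorphisms stay small: the orbit of a base point is a
  chain with small steps in a totally disconnected set, so it cannot leave a small clopen piece.\<close>

lemma mgen_VH_small:
  assumes e: "e > 0" and ne: "S \<noteq> {}"
  obtains d where "d > 0" "d \<le> R / 64" "mgen (VH d) \<subseteq> VH e"
proof -
  obtain x0 where x0: "x0 \<in> S" using ne by blast
  define e' where "e' = min e (R/64)"
  have e': "e' > 0" "e' \<le> e" "e' \<le> R/64" using e R_pos by (auto simp: e'_def)
  obtain \<tau> where \<tau>: "\<tau> > 0" "\<And>D E x z. D \<in> VH (R/32) \<Longrightarrow> E \<in> VH (R/32) \<Longrightarrow> x \<in> S \<Longrightarrow> dist (D x) (E x) < \<tau> \<Longrightarrow>
    z \<in> S \<Longrightarrow> dist (D z) (E z) < e'"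
    using VH_close[OF e'(1)] by blast
  define K where "K = {y\<in>S. V x0 y \<and> dist x0 y \<le> R/64}"
  have R64: "R/64 < R" "R/64 > 0" using R_pos by auto
  have cK: "compact K" unfolding K_def by (rule compact_vertical[OF x0 R64(1)])
  have tK: "tot_disc K" unfolding K_def by (rule tot_disc_vertical[OF x0]) (use R_pos in simp)
  have x0K: "x0 \<in> K" using x0 V_refl R_pos by (simp add: K_def)
  have "min \<tau> (R/128) > 0" using \<tau> R_pos by simp
  then obtain Q g where Q: "x0 \<in> Q" "Q \<subseteq> K" "Q \<subseteq> ball x0 (min \<tau> (R/128))" "g > 0"
      "\<And>a b. a \<in> Q \<Longrightarrow> b \<in> K \<Longrightarrow> dist a b < g \<Longrightarrow> b \<in> Q"
    using tot_disc_clopen[OF cK tK x0K] by metis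
  define d where "d = min g (R/128)"
  have d: "d > 0" "d \<le> g" "d \<le> R/128" using Q(4) R_pos by (auto simp: d_def)
  \<comment> \<open>Only the image of \<open>x0\<close> is followed; that it stays in the small
    piece \<open>Q\<close> gives uniform smallness through \<open>VH_close\<close>.\<close>
  have "D \<in> VH e' \<and> D x0 \<in> Q" if "D \<in> mgen (VH d)" for D
    using that
  proof induction
    case mgen_id
    show ?case using VH_id[OF e'(1)] Q(1) by (metis id_apply)
  next
    case (mgen_step f D)
    then have f: "f \<in> VH d" and D: "D \<in> VH e'" "D x0 \<in> Q" by auto
    have "f \<circ> D \<in> VH (d + e')" using VH_comp[OF f D(1)] d e' R_pos by simp
    then have fD: "f \<circ> D \<in> VH (R/32)" using VH_mono[of "d + e'" "R/32"] d e' R_pos by auto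
    have m: "D x0 \<in> S" "f (D x0) \<in> S" using VH_mem[OF D(1) x0] VH_mem[OF f] by auto
    have n: "dist (D x0) (f (D x0)) < d" using VH_dist[OF f m(1)] .
    have n2: "dist x0 (D x0) < R/128" "dist x0 (D x0) < \<tau>" using D(2) Q(3) by auto
    have "dist x0 (f (D x0)) \<le> R/64" using dist_triangle[of x0 "f (D x0)" "D x0"] n n2 d by simp
    moreover have "V x0 (f (D x0))" using VH_V[OF fD x0] by simp
    ultimately have "f (D x0) \<in> K" using m by (simp add: K_def)
    then have inQ: "f (D x0) \<in> Q" using Q(5)[OF D(2)] n d by simp
    then have "dist (id x0) ((f \<circ> D) x0) < \<tau>" using Q(3) by auto
    moreover have "id \<in> VH (R/32)" using VH_id R_pos by simp
    ultimately have "dist z ((f \<circ> D) z) < e'" if "z \<in> S" for z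
      using \<tau>(2)[OF _ fD x0 _ that, of id] by simp
    then have "f \<circ> D \<in> VH e'" using fD by (simp add: VH_def displ_def)
    then show ?case using inQ by (metis comp_apply)
  qed
  then have "mgen (VH d) \<subseteq> VH e" using VH_mono[OF e'(2)] by blast
  then show thesis using that[of d] d R_pos by simp
qed

text \<open>Up to \<open>e / 3\<close> an element is determined by its value at \<open>x0\<close>,
  and finitely many balls of radius \<open>\<tau> / 2\<close> cover the possible values; so finitely
  many moduli of continuity serve all of \<open>G\<close>.\<close>

lemma VH_set_equicontinuous:
  assumes G: "G \<subseteq> VH (R/32)" and e: "e > 0" and ne: "S \<noteq> {}"
  obtains d where "d > 0" "\<And>g x y. g \<in> G \<Longrightarrow> x \<in> S \<Longrightarrow> y \<in> S \<Longrightarrow> dist x y < d \<Longrightarrow> dist (g x) (g y) < e"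
proof -
  obtain x0 where x0: "x0 \<in> S" using ne by blast
  have e3: "e/3 > 0" using e by simp
  obtain \<tau> where \<tau>: "\<tau> > 0" "\<And>D E x z. D \<in> VH (R/32) \<Longrightarrow> E \<in> VH (R/32) \<Longrightarrow> x \<in> S \<Longrightarrow> dist (D x) (E x) < \<tau> \<Longrightarrow>
    z \<in> S \<Longrightarrow> dist (D z) (E z) < e/3"
    using VH_close[OF e3] by blast
  have "S \<subseteq> (\<Union>a\<in>S. ball a (\<tau>/2))" using \<tau>(1) by auto
  from compactE_image[OF compact_S open_ball this]
  obtain A where A: "finite A" "S \<subseteq> (\<Union>a\<in>A. ball a (\<tau>/2))" by metis
  define pick where "pick a = (SOME g. g \<in> G \<and> dist a (g x0) < \<tau>/2)" for a
  define A' where "A' = {a\<in>A. \<exists>g\<in>G. dist a (g x0) < \<tau>/2}"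
  have pick: "pick a \<in> G \<and> dist a (pick a x0) < \<tau>/2" if "a \<in> A'" for a
  proof -
    have "\<exists>g. g \<in> G \<and> dist a (g x0) < \<tau>/2" using that unfolding A'_def by blast
    then show ?thesis unfolding pick_def by (rule someI_ex)
  qed
  have "\<exists>r>0. \<forall>x\<in>S. \<forall>y\<in>S. dist x y < r \<longrightarrow> dist (pick a x) (pick a y) < e/3" if a: "a \<in> A'" for a
    using Homeo_uniform[OF VH_Homeo compact_S e3] pick[OF a] G by (metis subsetD)
  then obtain r where r: "\<And>a. a \<in> A' \<Longrightarrow> r a > 0 \<and> (\<forall>x\<in>S. \<forall>y\<in>S. dist x y < r a \<longrightarrow> dist (pick a x) (pick a y) < e/3)"
    by metis
  define d where "d = Min (insert 1 (r ` A'))"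
  have fin: "finite (insert 1 (r ` A'))" using A(1) by (simp add: A'_def)
  have d0: "d > 0" unfolding d_def using fin r by (subst Min_gr_iff) auto
  show thesis
  proof (rule that[OF d0])
    fix g x y assume g: "g \<in> G" and xy: "x \<in> S" "y \<in> S" "dist x y < d"
    have "g x0 \<in> S" using g G VH_mem x0 by blast
    then obtain a where a: "a \<in> A" "dist a (g x0) < \<tau>/2" using A(2) by auto
    then have a': "a \<in> A'" using g by (auto simp: A'_def)
    have "d \<le> r a" unfolding d_def using fin a' by (intro Min_le) auto
    then have 1: "dist (pick a x) (pick a y) < e/3" using r[OF a'] xy by auto
    have "dist (g x0) (pick a x0) < \<tau>" using pick[OF a'] a(2) dist_triangle3[of "g x0" "pick a x0" a] by simp
    then have "dist (g x) (pick a x) < e/3" "dist (g y) (pick a y) < e/3"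
      using \<tau>(2)[of g "pick a" x0] g pick[OF a'] G x0 xy by blast+
    then show "dist (g x) (g y) < e"
      using 1 dist_triangle[of "g x" "g y" "pick a x"] dist_triangle[of "pick a x" "g y" "pick a y"]
      by (simp add: dist_commute)
  qed
qed

end

section \<open>The tower of orbit spaces\<close>

lemma homeomorphism_imp_homeomorphic_space:
  assumes "homeomorphism S T f g"
  shows "top_of_set S homeomorphic_space top_of_set T"
  unfolding homeomorphic_space_def
proof (intro exI)
  show "homeomorphic_maps (top_of_set S) (top_of_set T) f g"
    using assms by (auto simp: homeomorphic_maps_def homeomorphism_def)
qed

lemma dense_sequence:
  fixes S :: "'m::metric_space set"
  assumes S: "compact S" "S \<noteq> {}"
  obtains a :: "nat \<Rightarrow> 'm" where "\<And>j. a j \<in> S" "\<And>x e. x \<in> S \<Longrightarrow> e > 0 \<Longrightarrow> \<exists>j. dist (a j) x < e"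
proof -
  have "\<exists>A. finite A \<and> A \<subseteq> S \<and> S \<subseteq> (\<Union>a\<in>A. ball a (1 / Suc m))" for m :: nat
  proof -
    have "S \<subseteq> (\<Union>a\<in>S. ball a (1 / Suc m))" by auto
    from compactE_image[OF S(1) open_ball this] show ?thesis by metis
  qed
  then obtain A where A: "\<And>m::nat. finite (A m) \<and> A m \<subseteq> S \<and> S \<subseteq> (\<Union>a\<in>A m. ball a (1 / Suc m))"
    by metis
  define B where "B = (\<Union>m. A m)"
  have B: "countable B" "B \<subseteq> S" "B \<noteq> {}"
  proof -
    show "countable B" unfolding B_def using A by (intro countable_UN) (auto intro: countable_finite)
    show "B \<subseteq> S" unfolding B_def using A by blast
    show "B \<noteq> {}" unfolding B_def using A[of 0] S(2) by auto
  qed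
  show thesis
  proof (rule that[of "from_nat_into B"])
    show "from_nat_into B j \<in> S" for j using from_nat_into[OF B(3)] B(2) by blast
    fix x and e :: real assume x: "x \<in> S" "e > 0"
    obtain m where m: "1 / Suc m < e" using x(2) nat_approx_posE by metis
    obtain b where b: "b \<in> A m" "dist b x < 1 / Suc m" using A[of m] x(1) by fastforce
    have "b \<in> B" using b(1) by (auto simp: B_def)
    then obtain j where "from_nat_into B j = b" using from_nat_into_surj[OF B(1)] by blast
    then show "\<exists>j. dist (from_nat_into B j) x < e" using b(2) m by (metis order_less_trans)
  qed
qed

text \<open>The last clause of \<open>P_manifold\<close> says that \<open>B\<close> is open within
  its plaque, that is in the leaf topology; in general \<open>B\<close> is not open in
  \<open>S\<close>.\<close>

locale vertical_manifold = vertical_structure S P V R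
  for S :: "'m::metric_space set" and P V :: "'m \<Rightarrow> 'm \<Rightarrow> bool" and R :: real +
  fixes n :: nat
  assumes S_ne: "S \<noteq> {}"
    and P_manifold: "z \<in> S \<Longrightarrow> e > 0 \<Longrightarrow> \<exists>B U. z \<in> B \<and> B \<subseteq> S \<inter> ball z e \<and> openin (Euclidean_space n) U \<and>
        top_of_set B homeomorphic_space subtopology (Euclidean_space n) U \<and> (\<forall>p\<in>B. \<forall>q\<in>B. P p q) \<and>
        (\<forall>p\<in>B. \<exists>d>0. \<forall>y\<in>S. dist p y < d \<and> P p y \<longrightarrow> y \<in> B)"
begin

text \<open>\<open>G l\<close> is generated by the conjugates, under the group of all small vertical homeomorphisms, of
  those whose displacement is below a scale depending on \<open>l\<close>. This makes it a normal subgroup,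
  hence the coverings normal.\<close>

lemma levels:
  obtains G :: "nat \<Rightarrow> ('m \<Rightarrow> 'm) set" where
    "\<And>l. G l \<subseteq> VH (R/64)" "\<And>l. G l \<subseteq> VH (1 / Suc l)"
    "\<And>l. id \<in> G l" "\<And>l D E. D \<in> G l \<Longrightarrow> E \<in> G l \<Longrightarrow> D \<circ> E \<in> G l" "\<And>l D. D \<in> G l \<Longrightarrow> inv D \<in> G l"
    "\<And>l. G (Suc l) \<subseteq> G l"
    "\<And>k l D E. E \<in> G k \<Longrightarrow> D \<in> G l \<Longrightarrow> E \<circ> D \<circ> inv E \<in> G l"
    "\<And>l. \<exists>d>0. \<forall>x\<in>S. \<forall>y\<in>S. dist x y < d \<and> V x y \<longrightarrow> (\<exists>D\<in>G l. D x = y)"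
proof -
  have R64: "R/64 > 0" using R_pos by simp
  obtain d0 where d0: "d0 > 0" "d0 \<le> R/64" "mgen (VH d0) \<subseteq> VH (R/64)"
    using mgen_VH_small[OF R64 S_ne] by metis
  define H where "H = mgen (VH d0)"
  have HV: "H \<subseteq> VH (R/64)" using d0 by (simp add: H_def)
  have HV': "H \<subseteq> VH (R/32)" using HV VH_mono[of "R/64" "R/32"] R_pos by auto
  have HH: "E \<in> Homeo S" if "E \<in> H" for E using HV that VH_Homeo by blast
  have Hinv: "inv E \<in> H" if "E \<in> H" for E
    unfolding H_def
    by (rule mgen_inv[of _ S]) (use that VH_Homeo VH_inv d0(2) R_pos in \<open>auto simp: H_def\<close>)
  define conj where "conj d = {E \<circ> D \<circ> inv E | E D. E \<in> H \<and> D \<in> VH d}" for d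
  have ex: "\<exists>d>0. d \<le> d0 \<and> mgen (conj d) \<subseteq> VH (min (R/64) (1 / Suc l))" for l :: nat
  proof -
    have "min (R/64) (1 / Suc l) > 0" using R_pos by simp
    then obtain \<theta> where \<theta>: "\<theta> > 0" "\<theta> \<le> R/64" "mgen (VH \<theta>) \<subseteq> VH (min (R/64) (1 / Suc l))"
      using mgen_VH_small[OF _ S_ne] by metis
    obtain d where d: "d > 0" "\<And>g x y. g \<in> H \<Longrightarrow> x \<in> S \<Longrightarrow> y \<in> S \<Longrightarrow> dist x y < d \<Longrightarrow> dist (g x) (g y) < \<theta>"
      using VH_set_equicontinuous[OF HV' \<theta>(1) S_ne] by blast
    \<comment> \<open>For \<open>z = E w\<close>, the conjugate moves \<open>z\<close> to
      \<open>E (D w)\<close>, which equicontinuity of \<open>H\<close> keeps within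
      \<open>\<theta>\<close>. The move is vertical because the points \<open>E w\<close>,
      \<open>w\<close>, \<open>D w\<close>, \<open>E (D w)\<close> are successively vertical over
      each other.\<close>
    have "conj (min d d0) \<subseteq> VH \<theta>"
    proof
      fix F assume "F \<in> conj (min d d0)"
      then obtain E D where F: "F = E \<circ> D \<circ> inv E" and E: "E \<in> H" and D: "D \<in> VH (min d d0)" by (auto simp: conj_def)
      have iE: "inv E \<in> Homeo S" using Homeo_inv[OF HH[OF E] compact_S] .
      have FH: "F \<in> Homeo S" unfolding F using Homeo_comp HH[OF E] VH_Homeo[OF D] iE by blast
      have "dist z (F z) < \<theta> \<and> V z (F z)" if z: "z \<in> S" for z
      proof -
        define w where "w = inv E z"
        have w: "w \<in> S" "E w = z" using Homeo_mem[OF iE z] HH[OF E] by (auto simp: w_def)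
        have Fz: "F z = E (D w)" by (simp add: F w_def)
        have Dw: "D w \<in> S" "dist w (D w) < min d d0" "V w (D w)"
          using VH_mem[OF D w(1)] VH_dist[OF D w(1)] VH_V[OF D w(1)] by auto
        have EV: "E \<in> VH (R/64)" using E HV by blast
        have EDw: "E (D w) \<in> S" "dist (D w) (E (D w)) < R/64" "V (D w) (E (D w))"
          using VH_mem[OF EV Dw(1)] VH_dist[OF EV Dw(1)] VH_V[OF EV Dw(1)] by auto
        have Ew: "dist w (E w) < R/64" "V w (E w)" using VH_dist[OF EV w(1)] VH_V[OF EV w(1)] by auto
        have 1: "dist (E w) (E (D w)) < \<theta>" using d(2)[OF E w(1) Dw(1)] Dw(2) by simp
        have dd: "dist w (D w) < R/64" using Dw(2) d0(2) by simp
        have "V (E w) w" using V_sym[OF w(1) _ _ Ew(2)] Ew(1) z w R_pos by simp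
        moreover have dED: "dist (E w) (D w) < R" using dist_triangle3[of "E w" "D w" w] Ew(1) dd R_pos by simp
        ultimately have "V (E w) (D w)"
          using V_trans[OF _ w(1) Dw(1) _ _ dED _ Dw(3)] Ew(1) dd z w(2) R_pos by (simp add: dist_commute)
        then have "V (E w) (E (D w))"
          using V_trans[OF _ Dw(1) EDw(1) dED _ _ _ EDw(3)] EDw(2) 1 \<theta>(2) z w(2) R_pos by simp
        then show ?thesis using 1 Fz w(2) by simp
      qed
      then show "F \<in> VH \<theta>" using FH by (simp add: VH_def displ_def)
    qed
    then have "mgen (conj (min d d0)) \<subseteq> mgen (VH \<theta>)" by (rule mgen_mono)
    then show ?thesis using \<theta>(3) d(1) d0(1) by (intro exI[of _ "min d d0"]) auto
  qed
  then obtain r where r: "\<And>l::nat. r l > 0 \<and> r l \<le> d0 \<and> mgen (conj (r l)) \<subseteq> VH (min (R/64) (1 / Suc l))"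
    by metis
  \<comment> \<open>The minimum over the lower levels makes the groups decrease with
    \<open>l\<close>.\<close>
  define \<delta> where "\<delta> l = Min (r ` {..l})" for l :: nat
  have \<delta>: "\<delta> l > 0" "\<delta> l \<le> r l" "\<delta> (Suc l) \<le> \<delta> l" for l
  proof -
    show "\<delta> l > 0" unfolding \<delta>_def using r by (subst Min_gr_iff) auto
    show "\<delta> l \<le> r l" unfolding \<delta>_def by (rule Min_le) auto
    show "\<delta> (Suc l) \<le> \<delta> l" unfolding \<delta>_def by (rule Min_antimono) auto
  qed
  define G where "G l = mgen (conj (\<delta> l))" for l
  have conj_mono: "conj a \<subseteq> conj b" if "a \<le> b" for a b
    using VH_mono[OF that] unfolding conj_def by blast
  have idH: "id \<in> H" unfolding H_def by (rule mgen_id)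
  have VHG: "VH (\<delta> l) \<subseteq> G l" for l
  proof
    fix D assume D: "D \<in> VH (\<delta> l)"
    have "id \<circ> D \<circ> inv id \<in> conj (\<delta> l)" unfolding conj_def using D idH by blast
    then have "D \<in> conj (\<delta> l)" by (simp only: inv_id comp_id id_comp)
    then show "D \<in> G l" unfolding G_def by (rule mgen_base)
  qed
  have conjH: "conj a \<subseteq> Homeo S" for a
    unfolding conj_def using Homeo_comp HH VH_Homeo Homeo_inv[OF HH compact_S] by blast
  have Gsub: "G l \<subseteq> VH (min (R/64) (1 / Suc l))" for l
    using mgen_mono[OF conj_mono[OF \<delta>(2)[of l]]] r[of l] unfolding G_def by blast
  have \<delta>R: "\<delta> l \<le> R" for l using \<delta>(2)[of l] r[of l] d0(2) R_pos by simp
  have Ginv: "inv D \<in> G l" if "D \<in> G l" for l D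
    unfolding G_def
  proof (rule mgen_inv[OF conjH])
    show "D \<in> mgen (conj (\<delta> l))" using that by (simp add: G_def)
    fix f assume "f \<in> conj (\<delta> l)"
    then obtain E D where f: "f = E \<circ> D \<circ> inv E" and E: "E \<in> H" and D: "D \<in> VH (\<delta> l)" by (auto simp: conj_def)
    have iE: "inv E \<in> Homeo S" using Homeo_inv[OF HH[OF E] compact_S] .
    have "inv f = inv (inv E) \<circ> inv (E \<circ> D)"
      unfolding f using Homeo_inv_comp[OF Homeo_comp[OF HH[OF E] VH_Homeo[OF D]] iE] .
    also have "\<dots> = E \<circ> (inv D \<circ> inv E)"
      using Homeo_inv_comp[OF HH[OF E] VH_Homeo[OF D]] Homeo_bij[OF HH[OF E]] by (simp add: inv_inv_eq)
    finally have "inv f = E \<circ> inv D \<circ> inv E" by (simp add: o_assoc)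
    then show "inv f \<in> conj (\<delta> l)" unfolding conj_def using E VH_inv[OF D \<delta>R] by blast
  qed
  have Gconj: "E \<circ> D \<circ> inv E \<in> G l" if E: "E \<in> H" and D: "D \<in> G l" for E D l
    using D unfolding G_def
  proof induction
    case mgen_id
    have "E \<circ> id \<circ> inv E = id" using HH[OF E] by (intro ext) simp
    then show ?case using mgen.mgen_id by metis
  next
    case (mgen_step f D)
    obtain E' D' where f: "f = E' \<circ> D' \<circ> inv E'" and E': "E' \<in> H" and D': "D' \<in> VH (\<delta> l)"
      using mgen_step(1) by (auto simp: conj_def)
    have EE: "E \<circ> E' \<in> H" using E E' mgen_comp unfolding H_def by blast
    have "E \<circ> f \<circ> inv E = (E \<circ> E') \<circ> D' \<circ> inv (E \<circ> E')"
      unfolding f Homeo_inv_comp[OF HH[OF E] HH[OF E']] by (simp add: o_assoc)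
    then have "E \<circ> f \<circ> inv E \<in> conj (\<delta> l)" unfolding conj_def using EE D' by blast
    moreover have "E \<circ> (f \<circ> D) \<circ> inv E = (E \<circ> f \<circ> inv E) \<circ> (E \<circ> D \<circ> inv E)"
      using HH[OF E] by (intro ext) simp
    ultimately show ?case using mgen.mgen_step[OF _ mgen_step(3)] by metis
  qed
  have "conj (\<delta> l) \<subseteq> H" for l
  proof
    fix f assume "f \<in> conj (\<delta> l)"
    then obtain E D where f: "f = E \<circ> D \<circ> inv E" and E: "E \<in> H" and D: "D \<in> VH (\<delta> l)" by (auto simp: conj_def)
    have "\<delta> l \<le> d0" using \<delta>(2)[of l] r[of l] by simp
    then have "D \<in> VH d0" using VH_mono D by blast
    then have "D \<in> H" unfolding H_def by (rule mgen_base)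
    then show "f \<in> H" unfolding f using E Hinv[OF E] mgen_comp unfolding H_def by blast
  qed
  then have sub: "f \<in> H" if "f \<in> conj (\<delta> l)" for f l using that by blast
  have GH: "G l \<subseteq> H" for l
  proof
    fix D assume "D \<in> G l"
    then show "D \<in> H"
      unfolding G_def
    proof induction
      case mgen_id
      show ?case by (rule idH)
    next
      case (mgen_step f D)
      then show ?case using sub[OF mgen_step(1)] mgen_comp unfolding H_def by blast
    qed
  qed
  show thesis
  proof (rule that[of G])
    show "G l \<subseteq> VH (R/64)" for l using Gsub[of l] VH_mono[OF min.cobounded1] by blast
    show "G l \<subseteq> VH (1 / Suc l)" for l using Gsub[of l] VH_mono[OF min.cobounded2] by blast
    show "id \<in> G l" for l unfolding G_def by (rule mgen_id)
    show "D \<circ> E \<in> G l" if "D \<in> G l" "E \<in> G l" for l D E using that mgen_comp unfolding G_def by blast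
    show "inv D \<in> G l" if "D \<in> G l" for l D using Ginv[OF that] .
    show "G (Suc l) \<subseteq> G l" for l unfolding G_def by (intro mgen_mono conj_mono \<delta>)
    show "E \<circ> D \<circ> inv E \<in> G l" if "E \<in> G k" "D \<in> G l" for k l D E using Gconj GH that by blast
    show "\<exists>d>0. \<forall>x\<in>S. \<forall>y\<in>S. dist x y < d \<and> V x y \<longrightarrow> (\<exists>D\<in>G l. D x = y)" for l
    proof -
      obtain d where "d > 0" "\<And>x y. x \<in> S \<Longrightarrow> y \<in> S \<Longrightarrow> dist x y < d \<Longrightarrow> V x y \<Longrightarrow> \<exists>D\<in>VH (\<delta> l). D x = y"
        using VH_exists[OF \<delta>(1)[of l]] by blast
      then show ?thesis using VHG[of l] by blast
    qed
  qed
qed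

end

locale vertical_levels = vertical_manifold S P V R n
  for S :: "'m::metric_space set" and P V :: "'m \<Rightarrow> 'm \<Rightarrow> bool" and R :: real and n :: nat +
  fixes G :: "nat \<Rightarrow> ('m \<Rightarrow> 'm) set" and a :: "nat \<Rightarrow> 'm"
  assumes G_VH: "G l \<subseteq> VH (R/64)" and G_small: "G l \<subseteq> VH (1 / Suc l)"
    and G_id: "id \<in> G l" and G_comp: "D \<in> G l \<Longrightarrow> E \<in> G l \<Longrightarrow> D \<circ> E \<in> G l" and G_inv: "D \<in> G l \<Longrightarrow> inv D \<in> G l"
    and G_Suc: "G (Suc l) \<subseteq> G l"
    and G_normal: "E \<in> G k \<Longrightarrow> D \<in> G l \<Longrightarrow> E \<circ> D \<circ> inv E \<in> G l"
    and G_trans: "\<exists>d>0. \<forall>x\<in>S. \<forall>y\<in>S. dist x y < d \<and> V x y \<longrightarrow> (\<exists>D\<in>G l. D x = y)"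
    and a_dense: "x \<in> S \<Longrightarrow> e > 0 \<Longrightarrow> \<exists>j. dist (a j) x < e"
begin

section \<open>Orbits and their quotient maps\<close>

definition orb :: "nat \<Rightarrow> 'm \<Rightarrow> 'm set" where
  "orb l z = (\<lambda>g. g z) ` G l"

text \<open>The orbit space of \<open>G l\<close>, realised in the product of lines by distances to orbits.\<close>

definition quot :: "nat \<Rightarrow> 'm \<Rightarrow> nat \<Rightarrow> real" where
  "quot l z j = infdist (a j) (orb l z)"

definition level :: "nat \<Rightarrow> (nat \<Rightarrow> real) set" where
  "level l = quot l ` S"

lemma G_Homeo: "g \<in> G l \<Longrightarrow> g \<in> Homeo S"
  using G_VH VH_Homeo by blast

lemma G_mem: "g \<in> G l \<Longrightarrow> z \<in> S \<Longrightarrow> g z \<in> S"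
  using G_Homeo Homeo_mem by blast

lemma G_mono: "k \<le> l \<Longrightarrow> G l \<subseteq> G k"
  by (induction l rule: dec_induct) (use G_Suc in auto)

lemma G_free:
  assumes "g \<in> G k" "h \<in> G l" "x \<in> S" "g x = h x"
  shows "g = h"
proof -
  have "g \<in> VH (R/8)" "h \<in> VH (R/8)" using assms G_VH VH_mono[of "R/64" "R/8"] R_pos by auto
  then show ?thesis using VH_unique assms by blast
qed

lemma orb_refl: "z \<in> orb l z"
  unfolding orb_def using G_id[of l] by (metis id_apply image_eqI)

lemma orb_subset: "z \<in> S \<Longrightarrow> orb l z \<subseteq> S"
  by (auto simp: orb_def G_mem)

lemma orb_eq:
  assumes "y \<in> orb l x"
  shows "orb l y = orb l x"
proof -
  obtain g where g: "g \<in> G l" "y = g x" using assms by (auto simp: orb_def)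
  show ?thesis
  proof
    show "orb l y \<subseteq> orb l x"
    proof
      fix w assume "w \<in> orb l y"
      then obtain h where h: "h \<in> G l" "w = (h \<circ> g) x" using g by (auto simp: orb_def)
      show "w \<in> orb l x" unfolding orb_def by (rule image_eqI[where x = "h \<circ> g"]) (use h g G_comp in blast)+
    qed
    show "orb l x \<subseteq> orb l y"
    proof
      fix w assume "w \<in> orb l x"
      then obtain h where h: "h \<in> G l" "w = h x" by (auto simp: orb_def)
      then have "w = (h \<circ> inv g) y" using G_Homeo[OF g(1)] g(2) by simp
      then show "w \<in> orb l y" unfolding orb_def
        by (rule image_eqI[where x = "h \<circ> inv g"]) (use h g G_comp G_inv in blast)
    qed
  qed
qed

lemma orb_dist: "y \<in> orb l x \<Longrightarrow> x \<in> S \<Longrightarrow> dist x y < R/64"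
  unfolding orb_def using VH_dist[OF subsetD[OF G_VH]] by blast

lemma orb_V: "y \<in> orb l x \<Longrightarrow> x \<in> S \<Longrightarrow> V x y"
  unfolding orb_def using VH_V[OF subsetD[OF G_VH]] by blast

text \<open>A limit \<open>y\<close> of orbit points is vertical over \<open>x\<close>, hence over
  an orbit point very close to it, and \<open>G_trans\<close> moves that point to
  \<open>y\<close>.\<close>

lemma closed_orb:
  assumes x: "x \<in> S"
  shows "closed (orb l x)"
proof -
  have "y \<in> orb l x" if y: "y \<in> closure (orb l x)" for y
  proof -
    have yS: "y \<in> S"
      using y closure_minimal[OF orb_subset[OF x, of l] compact_imp_closed[OF compact_S]] by blast
    obtain s where s: "\<And>n. s n \<in> orb l x" "s \<longlonglongrightarrow> y" using y unfolding closure_sequential by blast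
    have sS: "s n \<in> S" for n using s orb_subset[OF x] by blast
    have "dist x y \<le> R/64"
    proof (rule LIMSEQ_le_const2)
      show "(\<lambda>n. dist x (s n)) \<longlonglongrightarrow> dist x y" by (intro tendsto_intros s)
      show "\<exists>N. \<forall>n\<ge>N. dist x (s n) \<le> R/64" using orb_dist[OF s(1) x] by (auto intro: less_imp_le)
    qed
    then have xy: "dist x y < R" using R_pos by simp
    have Vxy: "V x y"
      by (rule V_closed[OF _ sS tendsto_const s(2) x yS]) (use x orb_V[OF s(1) x] xy in auto)
    obtain d where d: "d > 0" "\<forall>x\<in>S. \<forall>y\<in>S. dist x y < d \<and> V x y \<longrightarrow> (\<exists>D\<in>G l. D x = y)"
      using G_trans by blast
    have "min d (R/2) > 0" using d R_pos by simp
    then obtain n where n: "dist (s n) y < min d (R/2)"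
      using metric_LIMSEQ_D[OF s(2), of "min d (R/2)"] by blast
    have "V (s n) x" using V_sym[OF x sS _ orb_V[OF s(1) x]] orb_dist[OF s(1)[of n] x] R_pos by simp
    then have "V (s n) y"
      using V_trans[OF sS x yS _ xy _ _ Vxy] orb_dist[OF s(1)[of n] x] n R_pos by (simp add: dist_commute)
    then obtain D where "D \<in> G l" "D (s n) = y" using d(2) sS yS n by (metis min_less_iff_conj)
    then have "y \<in> orb l (s n)" by (auto simp: orb_def)
    then show ?thesis using orb_eq[OF s(1)] by blast
  qed
  then have "closure (orb l x) \<subseteq> orb l x" by blast
  then show ?thesis by (simp add: closure_subset_eq)
qed

text \<open>Distances from a dense sequence detect whether \<open>y\<close> lies on a closed
  orbit.\<close>

lemma quot_eq_iff:
  assumes x: "x \<in> S" and y: "y \<in> S"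
  shows "quot l x = quot l y \<longleftrightarrow> y \<in> orb l x"
proof
  assume "y \<in> orb l x"
  then show "quot l x = quot l y" using orb_eq by (simp add: quot_def fun_eq_iff)
next
  assume eq: "quot l x = quot l y"
  show "y \<in> orb l x"
  proof (rule ccontr)
    assume "y \<notin> orb l x"
    moreover have "orb l x \<noteq> {}" using orb_refl by blast
    ultimately have "infdist y (orb l x) \<noteq> 0" using in_closed_iff_infdist_zero[OF closed_orb[OF x]] by blast
    then have pos: "infdist y (orb l x) > 0" using infdist_nonneg[of y "orb l x"] by simp
    obtain j where j: "dist (a j) y < infdist y (orb l x) / 2" using a_dense[OF y, of "infdist y (orb l x) / 2"] pos by auto
    have "infdist (a j) (orb l y) \<le> dist (a j) y" using infdist_le[OF orb_refl] .
    moreover have "infdist (a j) (orb l x) = infdist (a j) (orb l y)"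
      using fun_cong[OF eq, of j] by (simp add: quot_def)
    moreover have "infdist y (orb l x) \<le> infdist (a j) (orb l x) + dist y (a j)" by (rule infdist_triangle)
    ultimately show False using j by (simp add: dist_commute)
  qed
qed

lemma quot_G: "g \<in> G l \<Longrightarrow> z \<in> S \<Longrightarrow> quot l (g z) = quot l z"
  using quot_eq_iff[of z "g z" l] G_mem by (auto simp: orb_def)

text \<open>By equicontinuity of \<open>G l\<close>, nearby points have uniformly close orbits, and
  the infima of distances inherit the bound.\<close>

lemma continuous_quot: "continuous_on S (quot l)"
proof (rule continuous_on_coordinatewise_then_product)
  fix j
  have G32: "G l \<subseteq> VH (R/32)" using G_VH[of l] VH_mono[of "R/64" "R/32"] R_pos by auto
  show "continuous_on S (\<lambda>x. quot l x j)"
    unfolding continuous_on_iff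
  proof (intro ballI allI impI)
    fix x and e :: real assume x: "x \<in> S" and e: "e > 0"
    obtain d where d: "d > 0" "\<And>g x y. g \<in> G l \<Longrightarrow> x \<in> S \<Longrightarrow> y \<in> S \<Longrightarrow> dist x y < d \<Longrightarrow> dist (g x) (g y) < e/2"
      using VH_set_equicontinuous[OF G32 _ S_ne, of "e/2"] e by auto
    have half: "quot l y j \<le> quot l z j + e/2" if "y \<in> S" "z \<in> S" "dist y z < d" for y z
    proof -
      have "quot l y j - e/2 \<le> dist (a j) w" if w: "w \<in> orb l z" for w
      proof -
        obtain g where g: "g \<in> G l" "w = g z" using w by (auto simp: orb_def)
        have "dist (g y) (g z) < e/2" using d(2)[OF g(1)] \<open>y \<in> S\<close> \<open>z \<in> S\<close> \<open>dist y z < d\<close> by blast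
        moreover have "quot l y j \<le> dist (a j) (g y)"
          unfolding quot_def by (rule infdist_le) (use g in \<open>simp add: orb_def\<close>)
        ultimately show ?thesis using dist_triangle[of "a j" "g y" "g z"] g(2) by (simp add: dist_commute)
      qed
      then have "quot l y j - e/2 \<le> infdist (a j) (orb l z)"
        unfolding infdist_def using orb_refl[of z l] by (auto intro!: cINF_greatest)
      then show ?thesis by (simp add: quot_def)
    qed
    have "dist (quot l y j) (quot l x j) < e" if "y \<in> S" "dist y x < d" for y
      using half[OF that(1) x that(2)] half[OF x that(1)] that(2) e by (simp add: dist_commute dist_real_def abs_less_iff)
    then show "\<exists>d>0. \<forall>x'\<in>S. dist x' x < d \<longrightarrow> dist (quot l x' j) (quot l x j) < e" using d(1) by blast
  qed
qed

lemma compact_level: "compact (level l)"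
  unfolding level_def by (rule compact_continuous_image[OF continuous_quot compact_S])

text \<open>The complement of the image is the image of the compact set of points whose orbits avoid
  \<open>W\<close>.\<close>

lemma quot_open:
  assumes W: "openin (top_of_set S) W"
  shows "openin (top_of_set (level l)) (quot l ` W)"
proof -
  have WS: "W \<subseteq> S" using W openin_imp_subset by blast
  define A where "A = {z\<in>S. orb l z \<inter> W = {}}"
  have "openin (top_of_set S) (S - A)"
    unfolding openin_euclidean_subtopology_iff
  proof (intro conjI ballI)
    fix z assume "z \<in> S - A"
    then obtain g where g: "g \<in> G l" "g z \<in> W" and z: "z \<in> S" by (auto simp: A_def orb_def)
    obtain r where r: "r > 0" "\<And>y. y \<in> S \<Longrightarrow> dist y (g z) < r \<Longrightarrow> y \<in> W"
      using W g(2) unfolding openin_euclidean_subtopology_iff by metis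
    obtain d where d: "d > 0" "\<And>x. x \<in> S \<Longrightarrow> dist z x < d \<Longrightarrow> dist (g z) (g x) < r"
      using Homeo_at[OF G_Homeo[OF g(1)] z r(1)] by blast
    have "y \<in> S - A" if y: "y \<in> S" "dist y z < d" for y
    proof -
      have "g y \<in> W" using r(2)[OF G_mem[OF g(1) y(1)]] d(2)[OF y(1)] y(2) by (simp add: dist_commute)
      then show ?thesis using y(1) g(1) by (auto simp: A_def orb_def)
    qed
    then show "\<exists>e>0. \<forall>x'\<in>S. dist x' z < e \<longrightarrow> x' \<in> S - A" using d(1) by blast
  qed auto
  then have "closedin (top_of_set S) A" by (simp add: closedin_def A_def Diff_Diff_Int Int_absorb1 Collect_restrict)
  then have "compact A" using closedin_compact[OF compact_S] by blast
  moreover have "continuous_on A (quot l)"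
    using continuous_quot by (rule continuous_on_subset) (auto simp: A_def)
  ultimately have "compact (quot l ` A)" by (rule compact_continuous_image[rotated])
  then have "openin (top_of_set (level l)) (level l - quot l ` A)"
    by (metis Diff_eq closed_def compact_imp_closed openin_open_Int)
  moreover have "level l - quot l ` A = quot l ` W"
  proof
    show "level l - quot l ` A \<subseteq> quot l ` W"
    proof
      fix v assume v: "v \<in> level l - quot l ` A"
      then obtain z where z: "z \<in> S" "v = quot l z" by (auto simp: level_def)
      then have "z \<notin> A" using v by blast
      then obtain w where "w \<in> orb l z" "w \<in> W" using z by (auto simp: A_def)
      then show "v \<in> quot l ` W" using quot_eq_iff[OF z(1), of w l] WS z(2) by auto
    qed
    show "quot l ` W \<subseteq> level l - quot l ` A"
    proof
      fix v assume "v \<in> quot l ` W"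
      then obtain w where w: "w \<in> W" "v = quot l w" by blast
      have "quot l w \<noteq> quot l z" if "z \<in> A" for z
        using quot_eq_iff[of z w l] that w(1) WS unfolding A_def by (metis (mono_tags, lifting) disjoint_iff mem_Collect_eq subsetD)
      then show "v \<in> level l - quot l ` A" using w WS by (auto simp: level_def)
    qed
  qed
  ultimately show ?thesis by simp
qed

text \<open>\<open>quot l\<close> maps a compact space onto \<open>level l\<close>, so a convergent
  sequence below lifts, after passing to a subsequence, to a convergent sequence above.\<close>

lemma descend_continuous:
  fixes \<phi> :: "'m \<Rightarrow> 'b::metric_space"
  assumes \<phi>: "continuous_on S \<phi>" and F: "\<And>z. z \<in> S \<Longrightarrow> F (quot l z) = \<phi> z"
  shows "continuous_on (level l) F"
proof (rule continuous_on_closed_graph[OF compact_continuous_image[OF \<phi> compact_S]])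
  show "F x \<in> \<phi> ` S" if "x \<in> level l" for x using that F by (auto simp: level_def)
  fix x :: "nat \<Rightarrow> nat \<Rightarrow> real" and w v
  assume x: "\<And>n. x n \<in> level l" "v \<in> level l" "x \<longlonglongrightarrow> v" "(\<lambda>n. F (x n)) \<longlonglongrightarrow> w"
  have "\<forall>n. \<exists>z\<in>S. x n = quot l z" using x(1) by (auto simp: level_def)
  then obtain z where z: "\<And>n. z n \<in> S" "\<And>n. x n = quot l (z n)" by metis
  obtain y r where y: "y \<in> S" "strict_mono (r :: nat \<Rightarrow> nat)" "(z \<circ> r) \<longlonglongrightarrow> y"
    using compact_S[unfolded compact_def, rule_format, of z] z(1) by blast
  have "(\<lambda>n. quot l ((z \<circ> r) n)) \<longlonglongrightarrow> quot l y"
    by (rule continuous_on_tendsto_compose[OF continuous_quot y(3,1)]) (simp add: z)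
  then have "(x \<circ> r) \<longlonglongrightarrow> quot l y" by (simp add: o_def z(2))
  then have v: "v = quot l y" using LIMSEQ_subseq_LIMSEQ[OF x(3) y(2)] LIMSEQ_unique by blast
  have "(\<lambda>n. \<phi> ((z \<circ> r) n)) \<longlonglongrightarrow> \<phi> y"
    by (rule continuous_on_tendsto_compose[OF \<phi> y(3,1)]) (simp add: z)
  then have "((\<lambda>n. F (x n)) \<circ> r) \<longlonglongrightarrow> \<phi> y" by (simp add: o_def z F)
  then have "w = \<phi> y" using LIMSEQ_subseq_LIMSEQ[OF x(4) y(2)] LIMSEQ_unique by blast
  then show "w = F v" using v F[OF y(1)] by simp
qed

text \<open>Openness in the leaf topology. The image of such a set is open in every orbit space
  (\<open>quot_plaque_open\<close>), which is why the levels are manifolds of the dimension of the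
  leaves.\<close>

definition plaque_open :: "'m set \<Rightarrow> bool" where
  "plaque_open B \<longleftrightarrow> B \<subseteq> S \<and> (\<forall>p\<in>B. \<exists>d>0. \<forall>y\<in>S. dist p y < d \<and> P p y \<longrightarrow> y \<in> B)"

text \<open>A point near \<open>p\<close> is carried by transport to the plaque of \<open>p\<close>,
  where it lands inside \<open>B\<close>. The vertical move is realised by an element of
  \<open>G l\<close>, so the image in the level does not change.\<close>

lemma quot_plaque_open:
  assumes B: "plaque_open B"
  shows "openin (top_of_set (level l)) (quot l ` B)"
proof (subst openin_subopen, intro ballI)
  fix v assume "v \<in> quot l ` B"
  then obtain p where p: "p \<in> B" "v = quot l p" by blast
  have pS: "p \<in> S" using p B by (auto simp: plaque_open_def)
  obtain d where d: "d > 0" "\<And>y. y \<in> S \<Longrightarrow> dist p y < d \<Longrightarrow> P p y \<Longrightarrow> y \<in> B"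
    using B p(1) unfolding plaque_open_def by meson
  obtain \<kappa> where \<kappa>: "\<kappa> > 0" "\<forall>x\<in>S. \<forall>y\<in>S. dist x y < \<kappa> \<and> V x y \<longrightarrow> (\<exists>D\<in>G l. D x = y)"
    using G_trans by blast
  define e where "e = min \<kappa> (min (d/2) (R/2))"
  have e: "e > 0" "e \<le> \<kappa>" "e \<le> d/2" "e \<le> R/2" using \<kappa> d R_pos by (auto simp: e_def)
  obtain d' where d': "d' > 0" "\<And>z y. z \<in> S \<Longrightarrow> y \<in> S \<Longrightarrow> dist z y < d' \<Longrightarrow> \<exists>u\<in>S. dist z u < e \<and> V z u \<and> P u y"
    using transport[OF e(1)] by blast
  define r where "r = min d' (min (d/2) (R/2))"
  have r: "r > 0" "r \<le> d'" "r \<le> d/2" "r \<le> R/2" using d' d R_pos by (auto simp: r_def)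
  have "quot l y \<in> quot l ` B" if y: "y \<in> S" "dist p y < r" for y
  proof -
    obtain u where u: "u \<in> S" "dist y u < e" "V y u" "P u p" using d'(2)[OF y(1) pS] y(2) r(2) by (auto simp: dist_commute)
    have pu: "dist p u < d" "dist p u < R" using dist_triangle[of p u y] y(2) u(2) e r by auto
    have "u \<in> B" using d(2)[OF u(1) pu(1)] P_sym[OF u(1) pS _ u(4)] pu(2) by (simp add: dist_commute)
    moreover obtain D where "D \<in> G l" "D y = u" using \<kappa>(2) y(1) u e(2) by (meson order_less_le_trans)
    then have "quot l y = quot l u" using quot_G y(1) by metis
    ultimately show ?thesis by blast
  qed
  then have "quot l ` (S \<inter> ball p r) \<subseteq> quot l ` B" by auto
  moreover have "openin (top_of_set (level l)) (quot l ` (S \<inter> ball p r))"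
    by (rule quot_open) (simp add: openin_open_Int)
  moreover have "v \<in> quot l ` (S \<inter> ball p r)" using p pS r by auto
  ultimately show "\<exists>T. openin (top_of_set (level l)) T \<and> v \<in> T \<and> T \<subseteq> quot l ` B" by blast
qed

lemma plaque_open_image:
  assumes B: "plaque_open B" and g: "g \<in> G l"
  shows "plaque_open (g ` B)"
  unfolding plaque_open_def
proof (intro conjI ballI)
  show "g ` B \<subseteq> S" using B G_mem[OF g] by (auto simp: plaque_open_def)
  fix q assume "q \<in> g ` B"
  then obtain p where p: "p \<in> B" "q = g p" by blast
  have pS: "p \<in> S" using p B by (auto simp: plaque_open_def)
  have qS: "q \<in> S" using G_mem[OF g pS] p by simp
  obtain d where d: "d > 0" "\<And>y. y \<in> S \<Longrightarrow> dist p y < d \<Longrightarrow> P p y \<Longrightarrow> y \<in> B"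
    using B p(1) unfolding plaque_open_def by meson
  note ig = G_inv[OF g]
  obtain d1 where d1: "d1 > 0" "d1 \<le> R / 8" "\<And>h x y. h \<in> Homeo S \<Longrightarrow> displ S (R/4) h \<Longrightarrow> x \<in> S \<Longrightarrow> y \<in> S \<Longrightarrow>
    dist x y < d1 \<Longrightarrow> P x y \<Longrightarrow> P (h x) (h y)"
    using homeo_P by blast
  have dg: "displ S (R/4) (inv g)"
    by (rule displ_mono[of _ "R/64"]) (use ig G_VH R_pos in \<open>auto simp: VH_def\<close>)
  obtain d2 where d2: "d2 > 0" "\<And>x. x \<in> S \<Longrightarrow> dist q x < d2 \<Longrightarrow> dist (inv g q) (inv g x) < d"
    using Homeo_at[OF G_Homeo[OF ig] qS d(1)] by blast
  have iq: "inv g q = p" using G_Homeo[OF g] p by simp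
  have "y \<in> g ` B" if y: "y \<in> S" "dist q y < min d1 d2" "P q y" for y
  proof -
    have "P (inv g q) (inv g y)" using d1(3)[OF G_Homeo[OF ig] dg qS y(1) _ y(3)] y(2) by simp
    then have "inv g y \<in> B" using d(2)[OF G_mem[OF ig y(1)]] d2(2)[OF y(1)] y(2) iq by simp
    then have "g (inv g y) \<in> g ` B" by blast
    then show ?thesis using G_Homeo[OF g] by simp
  qed
  then show "\<exists>d>0. \<forall>y\<in>S. dist q y < d \<and> P q y \<longrightarrow> y \<in> g ` B"
    using d1(1) d2(1) by (intro exI[of _ "min d1 d2"]) auto
qed

lemma plaque_open_subset:
  assumes B: "plaque_open B" and U: "openin (top_of_set B) U"
  shows "plaque_open U"
  unfolding plaque_open_def
proof (intro conjI ballI)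
  have UB: "U \<subseteq> B" using U openin_imp_subset by blast
  then show "U \<subseteq> S" using B by (auto simp: plaque_open_def)
  fix p assume p: "p \<in> U"
  obtain d where d: "d > 0" "\<And>y. y \<in> S \<Longrightarrow> dist p y < d \<Longrightarrow> P p y \<Longrightarrow> y \<in> B"
    using B p UB unfolding plaque_open_def by (meson subsetD)
  obtain r where r: "r > 0" "\<And>y. y \<in> B \<Longrightarrow> dist y p < r \<Longrightarrow> y \<in> U"
    using U p unfolding openin_euclidean_subtopology_iff by metis
  show "\<exists>d>0. \<forall>y\<in>S. dist p y < d \<and> P p y \<longrightarrow> y \<in> U"
    using d r by (intro exI[of _ "min d r"]) (auto simp: dist_commute)
qed

text \<open>Orbits are vertical and \<open>B\<close> lies in one plaque, so \<open>PV_eq\<close>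
  prevents an orbit of any level from meeting \<open>B\<close> twice.\<close>

lemma plaque_chart:
  assumes z: "z \<in> S"
  obtains B U where "z \<in> B" "plaque_open B" "openin (Euclidean_space n) U"
    "top_of_set B homeomorphic_space subtopology (Euclidean_space n) U"
    "\<And>l p p' g. p \<in> B \<Longrightarrow> p' \<in> B \<Longrightarrow> g \<in> G l \<Longrightarrow> g p = p' \<Longrightarrow> p = p'"
proof -
  have "R/4 > 0" using R_pos by simp
  from P_manifold[OF z this] obtain B U where B: "z \<in> B" "B \<subseteq> S \<inter> ball z (R/4)" "openin (Euclidean_space n) U"
        "top_of_set B homeomorphic_space subtopology (Euclidean_space n) U" "\<forall>p\<in>B. \<forall>q\<in>B. P p q"
        "\<forall>p\<in>B. \<exists>d>0. \<forall>y\<in>S. dist p y < d \<and> P p y \<longrightarrow> y \<in> B" by blast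
  show thesis
  proof (rule that[OF B(1) _ B(3,4)])
    show "plaque_open B" using B by (simp add: plaque_open_def)
    fix l p p' g assume p: "p \<in> B" "p' \<in> B" "g \<in> G l" "g p = p'"
    have pS: "p \<in> S" "p' \<in> S" using p B by auto
    have "p' \<in> orb l p" using p by (auto simp: orb_def)
    then have "V p p'" "dist p p' < R" using orb_V orb_dist[OF _ pS(1)] pS R_pos by fastforce+
    then show "p = p'" using PV_eq[OF pS] B(5) p by blast
  qed
qed

lemma quot_level: "z \<in> S \<Longrightarrow> quot l z \<in> level l"
  by (simp add: level_def)

lemma quot_eqD:
  assumes "x \<in> S" "y \<in> S" "quot l x = quot l y"
  obtains g where "g \<in> G l" "y = g x"
  using quot_eq_iff[OF assms(1,2)] assms(3) by (auto simp: orb_def)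

lemma quot_mono:
  assumes "x \<in> S" "y \<in> S" "quot l x = quot l y" "k \<le> l"
  shows "quot k x = quot k y"
proof -
  obtain g where "g \<in> G l" "y = g x" using quot_eqD[OF assms(1-3)] .
  then show ?thesis using G_mono[OF assms(4)] quot_G assms(1) by force
qed

section \<open>The levels as manifolds and normal coverings\<close>

lemma quot_homeomorphism:
  assumes B: "plaque_open B" and inj: "inj_on (quot l) B"
  obtains g where "homeomorphism B (quot l ` B) (quot l) g"
proof (rule homeomorphism_injective_open_map[OF _ refl inj])
  have BS: "B \<subseteq> S" using B by (simp add: plaque_open_def)
  show "continuous_on B (quot l)" using continuous_quot BS by (rule continuous_on_subset)
  fix U assume U: "openin (top_of_set B) U"
  have "openin (top_of_set (level l)) (quot l ` U)"
    using quot_plaque_open[OF plaque_open_subset[OF B U]] .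
  moreover have "quot l ` U \<subseteq> quot l ` B" using U openin_imp_subset by blast
  moreover have "quot l ` B \<subseteq> level l" using BS by (auto simp: level_def)
  ultimately show "openin (top_of_set (quot l ` B)) (quot l ` U)"
    by (meson openin_subset_trans)
qed

lemma inj_on_quot:
  assumes B: "B \<subseteq> S" and inj: "\<And>p p' g. p \<in> B \<Longrightarrow> p' \<in> B \<Longrightarrow> g \<in> G l \<Longrightarrow> g p = p' \<Longrightarrow> p = p'"
  shows "inj_on (quot l) B"
proof (rule inj_onI)
  fix p p' assume p: "p \<in> B" "p' \<in> B" "quot l p = quot l p'"
  obtain g where "g \<in> G l" "p' = g p" using quot_eqD[of p p' l] p B by blast
  then show "p = p'" using inj p by blast
qed

lemma level_manifold: "topological_manifold n (top_of_set (level l))"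
  unfolding topological_manifold_def
proof (intro conjI ballI)
  show "Hausdorff_space (top_of_set (level l))" by (simp add: Hausdorff_space_subtopology)
  show "second_countable (top_of_set (level l))"
  proof (rule second_countable_subtopology)
    obtain B :: "(nat \<Rightarrow> real) set set" where "countable B" "topological_basis B"
      using ex_countable_basis by blast
    then show "second_countable (euclidean :: (nat \<Rightarrow> real) topology)"
      unfolding second_countable_def by (metis open_openin topological_basis_def topological_basisE)
  qed
  fix v assume "v \<in> topspace (top_of_set (level l))"
  then obtain z where z: "z \<in> S" "v = quot l z" by (auto simp: level_def)
  obtain B U where B: "z \<in> B" "plaque_open B" "openin (Euclidean_space n) U"
    "top_of_set B homeomorphic_space subtopology (Euclidean_space n) U"
    "\<And>l p p' g. p \<in> B \<Longrightarrow> p' \<in> B \<Longrightarrow> g \<in> G l \<Longrightarrow> g p = p' \<Longrightarrow> p = p'"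
    using plaque_chart[OF z(1)] by metis
  have BS: "B \<subseteq> S" using B(2) by (simp add: plaque_open_def)
  have inj: "inj_on (quot l) B" using inj_on_quot[OF BS] B(5) by blast
  obtain g where "homeomorphism B (quot l ` B) (quot l) g" using quot_homeomorphism[OF B(2) inj] .
  then have "top_of_set (quot l ` B) homeomorphic_space top_of_set B"
    using homeomorphism_imp_homeomorphic_space homeomorphic_space_sym by blast
  then have "top_of_set (quot l ` B) homeomorphic_space subtopology (Euclidean_space n) U"
    using B(4) homeomorphic_space_trans by blast
  moreover have "quot l ` B \<subseteq> level l" using BS by (auto simp: level_def)
  then have "subtopology (top_of_set (level l)) (quot l ` B) = top_of_set (quot l ` B)"
    by (simp add: subtopology_subtopology Int_absorb1)
  ultimately show "\<exists>U V. openin (top_of_set (level l)) U \<and> v \<in> U \<and> openin (Euclidean_space n) V \<and>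
      subtopology (top_of_set (level l)) U homeomorphic_space subtopology (Euclidean_space n) V"
    using quot_plaque_open[OF B(2), of l] B(1,3) z(2) by (intro exI[of _ "quot l ` B"] exI[of _ U]) auto
qed

lemma connected_level: "connected (level l)"
  unfolding level_def by (rule connected_continuous_image[OF continuous_quot connected_S])

text \<open>Over the image \<open>T\<close> of a plaque chart \<open>B\<close>, the sheets are the
  images of the translates of \<open>B\<close> by elements of \<open>G k\<close>. If two sheets
  meet, freeness gives \<open>g' = h \<circ> g\<close> with \<open>h\<close> in \<open>G l\<close>,
  so the two translates have the same image.\<close>

lemma level_covering:
  assumes kl: "k \<le> l" and f: "\<And>z. z \<in> S \<Longrightarrow> f (quot l z) = quot k z"
  shows "covering_space (level l) f (level k)"
  unfolding covering_space_def
proof (intro conjI ballI)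
  show cf: "continuous_on (level l) f" by (rule descend_continuous[OF continuous_quot f])
  show "f ` level l = level k" using f by (auto simp: level_def image_image)
  fix v assume "v \<in> level k"
  then obtain z where z: "z \<in> S" "v = quot k z" by (auto simp: level_def)
  obtain B U where B: "z \<in> B" "plaque_open B"
    "\<And>l p p' g. p \<in> B \<Longrightarrow> p' \<in> B \<Longrightarrow> g \<in> G l \<Longrightarrow> g p = p' \<Longrightarrow> p = p'"
    using plaque_chart[OF z(1)] by metis
  have BS: "B \<subseteq> S" using B(2) by (simp add: plaque_open_def)
  have injk: "inj_on (quot k) B" using inj_on_quot[OF BS] B(3) by blast
  define T where "T = quot k ` B"
  define sheet where "sheet g = quot l ` g ` B" for g
  have sheet_open: "openin (top_of_set (level l)) (sheet g)" if "g \<in> G k" for g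
    unfolding sheet_def by (rule quot_plaque_open[OF plaque_open_image[OF B(2) that]])
  have f_sheet: "f (quot l (g p)) = quot k p" if "g \<in> G k" "p \<in> B" for g p
    using f G_mem[OF that(1)] quot_G[OF that(1)] that BS by auto
  have union: "\<Union>(sheet ` G k) = level l \<inter> f -` T"
  proof
    show "\<Union>(sheet ` G k) \<subseteq> level l \<inter> f -` T"
      using f_sheet G_mem BS by (auto simp: sheet_def level_def T_def)
    show "level l \<inter> f -` T \<subseteq> \<Union>(sheet ` G k)"
    proof
      fix w assume w: "w \<in> level l \<inter> f -` T"
      then obtain y p where y: "y \<in> S" "w = quot l y" and p: "p \<in> B" "f w = quot k p" by (auto simp: level_def T_def)
      then have "quot k p = quot k y" using f[OF y(1)] by simp
      then obtain g where "g \<in> G k" "y = g p" using quot_eqD[of p y k] p(1) BS y(1) by blast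
      then show "w \<in> \<Union>(sheet ` G k)" using p(1) y(2) by (auto simp: sheet_def)
    qed
  qed
  have disj: "sheet g = sheet g'" if g: "g \<in> G k" "g' \<in> G k" and ne: "sheet g \<inter> sheet g' \<noteq> {}" for g g'
  proof -
    obtain p p' where p: "p \<in> B" "p' \<in> B" "quot l (g p) = quot l (g' p')" using ne by (auto simp: sheet_def)
    have "quot k p = quot k p'" using f_sheet[OF g(1) p(1)] f_sheet[OF g(2) p(2)] p(3) by simp
    then have pp: "p = p'" using injk p by (auto dest: inj_onD)
    have pS: "p \<in> S" using p BS by blast
    obtain h where h: "h \<in> G l" "g' p = h (g p)"
      using quot_eqD[OF G_mem[OF g(1) pS] G_mem[OF g(2) pS], of l] p(3) pp by auto
    have "h \<circ> g \<in> G k" using G_comp G_mono[OF kl] h(1) g(1) by blast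
    then have g': "g' = h \<circ> g" using G_free[OF g(2) _ pS, of "h \<circ> g" k] h(2) by simp
    have "quot l (g' x) = quot l (g x)" if "x \<in> B" for x
      using quot_G[OF h(1) G_mem[OF g(1)]] that BS g' by auto
    then show ?thesis unfolding sheet_def image_image by (intro image_cong) auto
  qed
  have homeo: "\<exists>q. homeomorphism (sheet g) T f q" if g: "g \<in> G k" for g
  proof -
    have sl: "sheet g \<subseteq> level l" using sheet_open[OF g] openin_imp_subset by blast
    have im: "f ` sheet g = T"
      unfolding sheet_def T_def image_image using f_sheet[OF g] by (intro image_cong) auto
    have inj: "inj_on f (sheet g)"
    proof (rule inj_onI)
      fix a b assume "a \<in> sheet g" "b \<in> sheet g" "f a = f b"
      then obtain p p' where "p \<in> B" "p' \<in> B" "a = quot l (g p)" "b = quot l (g p')" "quot k p = quot k p'"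
        using f_sheet[OF g] by (auto simp: sheet_def)
      then show "a = b" using injk by (auto dest: inj_onD)
    qed
    show ?thesis
    proof (rule homeomorphism_injective_open_map[OF continuous_on_subset[OF cf sl] im inj])
      fix W assume W: "openin (top_of_set (sheet g)) W"
      define A where "A = {p\<in>B. quot l (g p) \<in> W}"
      have gB: "continuous_on B (\<lambda>p. quot l (g p))"
        by (rule continuous_on_compose2[OF continuous_quot continuous_on_subset[OF Homeo_continuous[OF G_Homeo[OF g]] BS]])
          (use G_mem[OF g] BS in auto)
      have "openin (top_of_set B) (B \<inter> (\<lambda>p. quot l (g p)) -` W)"
        by (rule continuous_openin_preimage[OF gB _ W]) (auto simp: sheet_def)
      moreover have "B \<inter> (\<lambda>p. quot l (g p)) -` W = A" by (auto simp: A_def)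
      ultimately have "plaque_open A" using plaque_open_subset[OF B(2)] by simp
      then have "openin (top_of_set (level k)) (quot k ` A)" by (rule quot_plaque_open)
      moreover have WA: "W = (\<lambda>p. quot l (g p)) ` A"
        using openin_imp_subset[OF W] by (auto simp: A_def sheet_def)
      have "f ` W = quot k ` A"
        unfolding WA image_image by (rule image_cong[OF refl]) (use f_sheet[OF g] in \<open>auto simp: A_def\<close>)
      moreover have "quot k ` A \<subseteq> T" by (auto simp: T_def A_def)
      moreover have "T \<subseteq> level k" using BS by (auto simp: T_def level_def)
      ultimately show "openin (top_of_set T) (f ` W)" by (metis openin_subset_trans)
    qed auto
  qed
  show "\<exists>T. v \<in> T \<and> openin (top_of_set (level k)) T \<and>
      (\<exists>v. \<Union>v = level l \<inter> f -` T \<and> (\<forall>u\<in>v. openin (top_of_set (level l)) u) \<and>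
        pairwise disjnt v \<and> (\<forall>u\<in>v. \<exists>q. homeomorphism u T f q))"
  proof (intro exI[of _ T] exI[of _ "sheet ` G k"] conjI)
    show "v \<in> T" using z(2) B(1) by (simp add: T_def)
    show "openin (top_of_set (level k)) T" unfolding T_def by (rule quot_plaque_open[OF B(2)])
    show "pairwise disjnt (sheet ` G k)" unfolding pairwise_def disjnt_def using disj by blast
  qed (use union sheet_open homeo in auto)
qed

text \<open>Elements of \<open>G k\<close> normalise \<open>G l\<close>, so they descend to
  \<open>level l\<close>, where they act as deck transformations over \<open>level k\<close>. Two
  points in one fibre come from points of one orbit of \<open>G k\<close>, whence
  transitivity.\<close>

lemma level_normal_covering:
  assumes kl: "k \<le> l" and f: "\<And>z. z \<in> S \<Longrightarrow> f (quot l z) = quot k z"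
  shows "normal_covering (level l) f (level k)"
  unfolding normal_covering_def
proof (intro conjI ballI impI)
  show "covering_space (level l) f (level k)" by (rule level_covering[OF kl f])
  fix v w assume vw: "v \<in> level l" "w \<in> level l" "f v = f w"
  then obtain x y where x: "x \<in> S" "v = quot l x" and y: "y \<in> S" "w = quot l y" by (auto simp: level_def)
  have "quot k x = quot k y" using vw(3) f x y by simp
  then obtain g where g: "g \<in> G k" "y = g x" using quot_eqD x y by metis
  define deck where "deck e u = quot l (e (inv_into S (quot l) u))" for e u
  have inv_S: "inv_into S (quot l) u \<in> S" "quot l (inv_into S (quot l) u) = u" if "u \<in> level l" for u
    using that unfolding level_def by (auto intro: inv_into_into f_inv_into_f)
  have deck: "deck e (quot l z) = quot l (e z)" if e: "e \<in> G k" and z: "z \<in> S" for e z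
  proof -
    define z' where "z' = inv_into S (quot l) (quot l z)"
    have z': "z' \<in> S" "quot l z' = quot l z" unfolding z'_def using inv_S[OF quot_level[OF z]] by auto
    obtain h where h: "h \<in> G l" "z = h z'" using quot_eqD[OF z'(1) z z'(2)] .
    have "e z = (e \<circ> h \<circ> inv e) (e z')" using h(2) G_Homeo[OF e] by simp
    then have "quot l (e z) = quot l (e z')"
      using quot_G[OF G_normal[OF e h(1)] G_mem[OF e z'(1)]] by simp
    then show ?thesis by (simp add: deck_def z'_def)
  qed
  have cont: "continuous_on (level l) (deck e)" if e: "e \<in> G k" for e
  proof (rule descend_continuous[of "\<lambda>z. quot l (e z)"])
    show "continuous_on S (\<lambda>z. quot l (e z))"
      by (rule continuous_on_compose2[OF continuous_quot Homeo_continuous[OF G_Homeo[OF e]]])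
        (use G_mem[OF e] in auto)
  qed (use deck[OF e] in auto)
  have ig: "inv g \<in> G k" using G_inv[OF g(1)] .
  have inv1: "deck (inv g) (deck g u) = u" "deck g (deck (inv g) u) = u" "deck g u \<in> level l" "deck (inv g) u \<in> level l"
    if u: "u \<in> level l" for u
  proof -
    obtain z where z: "z \<in> S" "u = quot l z" using u by (auto simp: level_def)
    show "deck (inv g) (deck g u) = u" "deck g (deck (inv g) u) = u" "deck g u \<in> level l" "deck (inv g) u \<in> level l"
      using z deck[OF g(1)] deck[OF ig] G_mem[OF g(1)] G_mem[OF ig] G_Homeo[OF g(1)] by (auto simp: level_def)
  qed
  have "homeomorphism (level l) (level l) (deck g) (deck (inv g))"
    by (rule homeomorphismI[OF cont[OF g(1)] cont[OF ig]]) (use inv1 in auto)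
  moreover have "f (deck g c) = f c" if c: "c \<in> level l" for c
  proof -
    obtain z where z: "z \<in> S" "c = quot l z" using c by (auto simp: level_def)
    then show ?thesis using deck[OF g(1)] f G_mem[OF g(1)] quot_G[OF g(1)] by simp
  qed
  moreover have "deck g v = w" using deck[OF g(1)] x y g(2) by simp
  ultimately show "\<exists>h q. homeomorphism (level l) (level l) h q \<and> (\<forall>c\<in>level l. f (h c) = f c) \<and> h v = w" by blast
qed

text \<open>Indexed by its source, in accordance with the convention of
  \<open>solenoid_system\<close>. The choice of a representative is harmless because each orbit lies
  in an orbit of the level below.\<close>

definition bond :: "nat \<Rightarrow> (nat \<Rightarrow> real) \<Rightarrow> (nat \<Rightarrow> real)" where
  "bond l v = quot (l - 1) (inv_into S (quot l) v)"

lemma bond_quot: "z \<in> S \<Longrightarrow> bond (Suc l) (quot (Suc l) z) = quot l z"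
proof -
  assume z: "z \<in> S"
  define z' where "z' = inv_into S (quot (Suc l)) (quot (Suc l) z)"
  have "z' \<in> S" "quot (Suc l) z' = quot (Suc l) z"
    unfolding z'_def using z by (auto intro: inv_into_into f_inv_into_f)
  then have "quot l z' = quot l z" using quot_mono[OF _ z, of z' "Suc l" l] by simp
  then show ?thesis by (simp add: bond_def z'_def)
qed

lemma bonding_map_quot: "z \<in> S \<Longrightarrow> bonding_map bond k d (quot (k + d) z) = quot k z"
  by (induction d) (use bond_quot in auto)

lemma McCord_level: "McCord_system n level bond"
  unfolding McCord_system_def solenoid_system_def
proof (intro conjI allI impI)
  fix l
  show "compact (level l)" by (rule compact_level)
  show "connected (level l)" by (rule connected_level)
  show "level l \<noteq> {}" using S_ne by (simp add: level_def)
  show "topological_manifold n (top_of_set (level l))" by (rule level_manifold)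
  show cov: "covering_space (level (Suc l)) (bond (Suc l)) (level l)"
    by (rule level_covering) (use bond_quot in auto)
  show "proper_map (top_of_set (level (Suc l))) (top_of_set (level l)) (bond (Suc l))"
  proof (rule continuous_imp_proper_map)
    show "compact_space (top_of_set (level (Suc l)))" using compact_level by (simp add: compact_space_subtopology)
    show "kc_space (top_of_set (level l))" by (simp add: Hausdorff_imp_kc_space Hausdorff_space_subtopology)
    show "continuous_map (top_of_set (level (Suc l))) (top_of_set (level l)) (bond (Suc l))"
      using cov by (auto simp: covering_space_def)
  qed
next
  fix k d :: nat
  show "normal_covering (level (k + d)) (bonding_map bond k d) (level k)"
    by (rule level_normal_covering) (use bonding_map_quot in auto)
qed

text \<open>Points with equal images at all levels differ by elements of displacement below
  \<open>1 / Suc l\<close> for every \<open>l\<close>, hence not at all. For surjectivity,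
  representatives of a coherent sequence cluster at a point, and its image at level \<open>k\<close>
  is the limit of an eventually constant sequence.\<close>

lemma inverse_limit_homeomorphic: "top_of_set S homeomorphic_space top_of_set (inverse_limit level bond)"
proof -
  define \<Phi> where "\<Phi> z l = quot l z" for z l
  have cont: "continuous_on S \<Phi>"
    by (rule continuous_on_coordinatewise_then_product) (simp add: \<Phi>_def continuous_quot)
  have inj: "inj_on \<Phi> S"
  proof (rule inj_onI)
    fix x y assume x: "x \<in> S" and y: "y \<in> S" and eq: "\<Phi> x = \<Phi> y"
    have "dist x y \<le> 1 / Suc l" for l
    proof -
      have "quot l x = quot l y" using fun_cong[OF eq, of l] by (simp add: \<Phi>_def)
      then obtain g where g: "g \<in> G l" "y = g x" using quot_eqD x y by metis
      have "g \<in> VH (1 / Suc l)" using G_small g(1) by blast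
      from VH_dist[OF this x] show ?thesis using g(2) by simp
    qed
    then have "dist x y \<le> 0"
      using LIMSEQ_le_const[OF LIMSEQ_inverse_real_of_nat, of "dist x y"] by (simp add: inverse_eq_divide)
    then show "x = y" by simp
  qed
  have surj: "\<Phi> ` S = inverse_limit level bond"
  proof
    show "\<Phi> ` S \<subseteq> inverse_limit level bond"
      using bond_quot quot_level by (auto simp: inverse_limit_def \<Phi>_def)
    show "inverse_limit level bond \<subseteq> \<Phi> ` S"
    proof
      fix v assume v: "v \<in> inverse_limit level bond"
      then have "\<forall>l. \<exists>z\<in>S. v l = quot l z" by (auto simp: inverse_limit_def level_def)
      then obtain z where z: "\<And>l. z l \<in> S" "\<And>l. v l = quot l (z l)" by metis
      have down: "bonding_map bond k d (v (k + d)) = v k" for k d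
        by (induction d) (use v in \<open>auto simp: inverse_limit_def\<close>)
      have zk: "quot k (z l) = v k" if "k \<le> l" for k l
        using down[of k "l - k"] bonding_map_quot[OF z(1)[of l], of k "l - k"] z(2)[of l] that by simp
      obtain y r where y: "y \<in> S" "strict_mono (r :: nat \<Rightarrow> nat)" "(z \<circ> r) \<longlonglongrightarrow> y"
        using compact_S[unfolded compact_def, rule_format, of z] z(1) by blast
      have "quot k y = v k" for k
      proof (rule LIMSEQ_unique)
        show "(\<lambda>n. quot k ((z \<circ> r) n)) \<longlonglongrightarrow> quot k y"
          by (rule continuous_on_tendsto_compose[OF continuous_quot y(3,1)]) (simp add: z)
        have "quot k ((z \<circ> r) m) = v k" if "m \<ge> k" for m
          using zk[of k "r m"] that strict_mono_imp_increasing[OF y(2), of m] by simp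
        then have "\<forall>\<^sub>F m in sequentially. quot k ((z \<circ> r) m) = v k" unfolding eventually_sequentially by blast
        then show "(\<lambda>n. quot k ((z \<circ> r) n)) \<longlonglongrightarrow> v k" by (rule tendsto_eventually)
      qed
      then have "v = \<Phi> y" by (auto simp: \<Phi>_def)
      then show "v \<in> \<Phi> ` S" using y(1) by blast
    qed
  qed
  from homeomorphism_compact[OF compact_S cont surj inj]
  show ?thesis using homeomorphism_imp_homeomorphic_space by blast
qed

end

context vertical_manifold begin

theorem homeomorphic_to_McCord: "homeomorphic_to_McCord_solenoid n (top_of_set S)"
proof -
  obtain G where G:
    "\<And>l. G l \<subseteq> VH (R/64)" "\<And>l. G l \<subseteq> VH (1 / Suc l)"
    "\<And>l. id \<in> G l" "\<And>l D E. D \<in> G l \<Longrightarrow> E \<in> G l \<Longrightarrow> D \<circ> E \<in> G l" "\<And>l D. D \<in> G l \<Longrightarrow> inv D \<in> G l"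
    "\<And>l. G (Suc l) \<subseteq> G l"
    "\<And>k l D E. E \<in> G k \<Longrightarrow> D \<in> G l \<Longrightarrow> E \<circ> D \<circ> inv E \<in> G l"
    "\<And>l. \<exists>d>0. \<forall>x\<in>S. \<forall>y\<in>S. dist x y < d \<and> V x y \<longrightarrow> (\<exists>D\<in>G l. D x = y)"
    by (rule levels) (rule that; assumption)
  obtain a :: "nat \<Rightarrow> 'm" where a0: "\<And>j. a j \<in> S" and a: "\<And>x e. x \<in> S \<Longrightarrow> e > 0 \<Longrightarrow> \<exists>j. dist (a j) x < e"
    by (rule dense_sequence[OF compact_S S_ne]) (rule that; assumption)
  interpret vertical_levels S P V R n G a
    by unfold_locales (use G a in auto)
  show ?thesis
    unfolding homeomorphic_to_McCord_solenoid_def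
    using McCord_level inverse_limit_homeomorphic by blast
qed

end

section \<open>Laminations with strictly differentiable charts\<close>

lemma openin_ball_iff:
  fixes S :: "'m::metric_space set"
  shows "openin (top_of_set S) N \<longleftrightarrow> N \<subseteq> S \<and> (\<forall>z\<in>N. \<exists>r>0. S \<inter> ball z r \<subseteq> N)"
proof -
  have "(\<forall>x'\<in>S. dist x' z < e \<longrightarrow> x' \<in> N) \<longleftrightarrow> S \<inter> ball z e \<subseteq> N" for z e
    by (auto simp: subset_iff dist_commute)
  then show ?thesis unfolding openin_euclidean_subtopology_iff by simp
qed

lemma uniform_cont:
  assumes "compact K" "continuous_on K f" "e > 0"
  obtains d where "d > 0" "\<And>x y. x \<in> K \<Longrightarrow> y \<in> K \<Longrightarrow> dist x y < d \<Longrightarrow> dist (f x) (f y) < (e::real)"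
  using compact_uniformly_continuous[OF assms(2,1)] assms(3)
  unfolding uniformly_continuous_on_def by (metis dist_commute)

text \<open>Finitely many closed boxes: \<open>c i\<close> is the leafwise coordinate, with values in the unit ball of
  the model space \<open>X\<close>, and \<open>t i\<close> retracts the box \<open>Bc i\<close> onto the slice \<open>c i = 0\<close>. Coordinate
  changes are strictly differentiable along plaques, uniformly in the transverse direction.\<close>

locale lamination =
  fixes S :: "'m::metric_space set" and X :: "'e::banach set" and n :: nat and I :: "'i set"
    and Bc :: "'i \<Rightarrow> 'm set" and c :: "'i \<Rightarrow> 'm \<Rightarrow> 'e" and t :: "'i \<Rightarrow> 'm \<Rightarrow> 'm" and L :: real
  assumes compact_S: "compact S" and connected_S: "connected S" and S_ne: "S \<noteq> {}" and homog_S: "homog S"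
    and subspace_X: "subspace X" and closed_X: "closed X"
    and X_chart: "x \<in> X \<Longrightarrow> r > 0 \<Longrightarrow> \<exists>U. openin (Euclidean_space n) U \<and>
        top_of_set (X \<inter> ball x r) homeomorphic_space subtopology (Euclidean_space n) U"
    and finite_I: "finite I"
    and compact_Bc: "i \<in> I \<Longrightarrow> compact (Bc i)" and Bc_S: "i \<in> I \<Longrightarrow> Bc i \<subseteq> S"
    and c_cont: "i \<in> I \<Longrightarrow> continuous_on (Bc i) (c i)" and t_cont: "i \<in> I \<Longrightarrow> continuous_on (Bc i) (t i)"
    and c_X: "i \<in> I \<Longrightarrow> z \<in> Bc i \<Longrightarrow> c i z \<in> X" and c_norm: "i \<in> I \<Longrightarrow> z \<in> Bc i \<Longrightarrow> norm (c i z) \<le> 1"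
    and t_Bc: "i \<in> I \<Longrightarrow> z \<in> Bc i \<Longrightarrow> t i z \<in> Bc i" and t_t: "i \<in> I \<Longrightarrow> z \<in> Bc i \<Longrightarrow> t i (t i z) = t i z"
    and ct_inj: "i \<in> I \<Longrightarrow> z \<in> Bc i \<Longrightarrow> z' \<in> Bc i \<Longrightarrow> c i z = c i z' \<Longrightarrow> t i z = t i z' \<Longrightarrow> z = z'"
    and ct_surj: "i \<in> I \<Longrightarrow> z \<in> Bc i \<Longrightarrow> x \<in> X \<Longrightarrow> norm x \<le> 1 \<Longrightarrow> \<exists>z'\<in>Bc i. c i z' = x \<and> t i z' = t i z"
    and open_box: "i \<in> I \<Longrightarrow> openin (top_of_set S) {z\<in>Bc i. norm (c i z) < 1}"
    and conn_t: "i \<in> I \<Longrightarrow> connected C \<Longrightarrow> C \<subseteq> Bc i \<Longrightarrow> z \<in> C \<Longrightarrow> z' \<in> C \<Longrightarrow> t i z = t i z'"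
    and cover: "z \<in> S \<Longrightarrow> \<exists>i\<in>I. z \<in> Bc i \<and> norm (c i z) < 1/2"
    and L_pos: "L \<ge> 0"
    and strict_diff: "i \<in> I \<Longrightarrow> j \<in> I \<Longrightarrow> z0 \<in> Bc i \<Longrightarrow> z0 \<in> Bc j \<Longrightarrow>
        \<exists>A. linear A \<and> A ` X \<subseteq> X \<and> (\<forall>x\<in>X. norm (A x) \<le> L * norm x) \<and>
          (\<forall>e>0. \<exists>d>0. \<forall>z\<in>Bc i \<inter> Bc j. \<forall>z'\<in>Bc i \<inter> Bc j. dist z0 z < d \<longrightarrow> dist z0 z' < d \<longrightarrow> t i z = t i z' \<longrightarrow>
            norm ((c j z - c j z') - A (c i z - c i z')) \<le> e * norm (c i z - c i z'))"
begin

section \<open>Geometry of the boxes\<close>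

definition box :: "'i \<Rightarrow> 'm set" where "box i = {z\<in>Bc i. norm (c i z) < 1}"

lemma box_Bc: "box i \<subseteq> Bc i" by (auto simp: box_def)

lemma box_S: "i \<in> I \<Longrightarrow> box i \<subseteq> S" using Bc_S by (auto simp: box_def)

lemma open_box': "i \<in> I \<Longrightarrow> openin (top_of_set S) (box i)" using open_box by (simp add: box_def)

definition pt :: "'i \<Rightarrow> 'e \<Rightarrow> 'm \<Rightarrow> 'm" where
  "pt i x w = (SOME z. z \<in> Bc i \<and> c i z = x \<and> t i z = w)"

lemma pt:
  assumes "i \<in> I" "z \<in> Bc i" "x \<in> X" "norm x \<le> 1"
  shows "pt i x (t i z) \<in> Bc i" "c i (pt i x (t i z)) = x" "t i (pt i x (t i z)) = t i z"
proof -
  have "\<exists>u. u \<in> Bc i \<and> c i u = x \<and> t i u = t i z" using ct_surj[OF assms] by blast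
  from someI_ex[OF this]
  show "pt i x (t i z) \<in> Bc i" "c i (pt i x (t i z)) = x" "t i (pt i x (t i z)) = t i z"
    by (auto simp: pt_def)
qed

lemma pt_eq: "i \<in> I \<Longrightarrow> z \<in> Bc i \<Longrightarrow> pt i (c i z) (t i z) = z"
  using pt[of i z "c i z"] c_X c_norm ct_inj by metis

lemma X_diff: "x \<in> X \<Longrightarrow> y \<in> X \<Longrightarrow> x - y \<in> X" using subspace_X by (rule subspace_diff)

lemma X_add: "x \<in> X \<Longrightarrow> y \<in> X \<Longrightarrow> x + y \<in> X" using subspace_X by (rule subspace_add)

lemma X_scale: "x \<in> X \<Longrightarrow> r *\<^sub>R x \<in> X" using subspace_X by (rule subspace_scale)

text \<open>The pair \<open>(c i, t i)\<close> is a continuous injection of a compact set, so its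
  inverse is uniformly continuous.\<close>

lemma ct_close:
  assumes i: "i \<in> I" and e: "e > 0"
  obtains d where "d > 0" "\<And>z z'. z \<in> Bc i \<Longrightarrow> z' \<in> Bc i \<Longrightarrow> norm (c i z - c i z') < d \<Longrightarrow> dist (t i z) (t i z') < d \<Longrightarrow> dist z z' < e"
proof -
  let ?F = "\<lambda>z. (c i z, t i z)"
  have cF: "continuous_on (Bc i) ?F" using c_cont[OF i] t_cont[OF i] by (rule continuous_on_Pair)
  have inj: "inj_on ?F (Bc i)" using ct_inj[OF i] by (auto intro!: inj_onI)
  obtain g where g: "homeomorphism (Bc i) (?F ` Bc i) ?F g"
    using homeomorphism_compact[OF compact_Bc[OF i] cF refl inj] by blast
  have cK: "compact (?F ` Bc i)" using compact_continuous_image[OF cF compact_Bc[OF i]] .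
  have cg: "continuous_on (?F ` Bc i) g" using g by (simp add: homeomorphism_def)
  obtain d where d: "d > 0" "\<And>x y. x \<in> ?F ` Bc i \<Longrightarrow> y \<in> ?F ` Bc i \<Longrightarrow> dist x y < d \<Longrightarrow> dist (g x) (g y) < e"
    using uniform_cont[OF cK cg e] by blast
  show thesis
  proof (rule that[of "d/2"])
    fix z z' assume z: "z \<in> Bc i" "z' \<in> Bc i" "norm (c i z - c i z') < d/2" "dist (t i z) (t i z') < d/2"
    have "dist (?F z) (?F z') \<le> dist (c i z) (c i z') + dist (t i z) (t i z')"
      unfolding dist_Pair_Pair by (rule sqrt_sum_squares_le_sum) auto
    then have "dist (?F z) (?F z') < d" using z by (simp add: dist_norm)
    then have "dist (g (?F z)) (g (?F z')) < e" using d(2) z(1,2) by blast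
    then show "dist z z' < e" using g z by (simp add: homeomorphism_def)
  qed (use d in simp)
qed

lemma box_ball:
  assumes "i \<in> I" "z \<in> box i"
  obtains r where "r > 0" "S \<inter> ball z r \<subseteq> box i"
  using open_box'[OF assms(1)] assms(2) unfolding openin_ball_iff by blast

lemma plaque_continuous:
  assumes i: "i \<in> I" and z: "z \<in> Bc i"
  shows "continuous_on (X \<inter> cball 0 1) (\<lambda>x. pt i x (t i z))"
  unfolding continuous_on_iff
proof (intro ballI allI impI)
  fix x and e :: real assume x: "x \<in> X \<inter> cball 0 1" and e: "e > 0"
  obtain d where d: "d > 0" "\<And>z z'. z \<in> Bc i \<Longrightarrow> z' \<in> Bc i \<Longrightarrow> norm (c i z - c i z') < d \<Longrightarrow> dist (t i z) (t i z') < d \<Longrightarrow> dist z z' < e"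
    using ct_close[OF i e] by blast
  have "dist (pt i y (t i z)) (pt i x (t i z)) < e" if "y \<in> X \<inter> cball 0 1" "dist y x < d" for y
    by (rule d(2)) (use that x pt[OF i z] d(1) in \<open>auto simp: dist_norm\<close>)
  then show "\<exists>d>0. \<forall>x'\<in>X \<inter> cball 0 1. dist x' x < d \<longrightarrow> dist (pt i x' (t i z)) (pt i x (t i z)) < e"
    using d(1) by blast
qed

text \<open>The set \<open>C\<close> is the lift of the straight segment between the two
  coordinates; convexity of the coordinate ball keeps it in the box.\<close>

lemma plaque_segment:
  assumes i: "i \<in> I" and e: "e > 0"
  obtains d where "d > 0" "\<And>z z'. z \<in> Bc i \<Longrightarrow> z' \<in> Bc i \<Longrightarrow> t i z = t i z' \<Longrightarrow> norm (c i z - c i z') < d \<Longrightarrow>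
    \<exists>C. connected C \<and> z \<in> C \<and> z' \<in> C \<and> C \<subseteq> Bc i \<and> C \<subseteq> ball z e"
proof -
  obtain d where d: "d > 0" "\<And>z z'. z \<in> Bc i \<Longrightarrow> z' \<in> Bc i \<Longrightarrow> norm (c i z - c i z') < d \<Longrightarrow> dist (t i z) (t i z') < d \<Longrightarrow> dist z z' < e"
    using ct_close[OF i e] by blast
  show thesis
  proof (rule that[OF d(1)])
    fix z z' assume z: "z \<in> Bc i" "z' \<in> Bc i" "t i z = t i z'" "norm (c i z - c i z') < d"
    define J where "J = closed_segment (c i z) (c i z')"
    have "convex (X \<inter> cball 0 1)"
      by (intro convex_Int subspace_imp_convex subspace_X convex_cball)
    then have J: "J \<subseteq> X \<inter> cball 0 1"
      unfolding J_def using z c_X[OF i] c_norm[OF i] by (intro closed_segment_subset) auto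
    define C where "C = (\<lambda>x. pt i x (t i z)) ` J"
    have "connected C"
      unfolding C_def
      by (rule connected_continuous_image[OF continuous_on_subset[OF plaque_continuous[OF i z(1)] J]])
        (simp add: J_def)
    moreover have "z \<in> C" unfolding C_def by (rule image_eqI[of _ _ "c i z"]) (use pt_eq[OF i z(1)] in \<open>auto simp: J_def\<close>)
    moreover have "z' \<in> C" unfolding C_def by (rule image_eqI[of _ _ "c i z'"]) (use pt_eq[OF i z(2)] z(3) in \<open>auto simp: J_def\<close>)
    moreover have "C \<subseteq> Bc i"
    proof
      fix u assume "u \<in> C"
      then obtain x where x: "x \<in> J" "u = pt i x (t i z)" by (auto simp: C_def)
      then have "x \<in> X \<inter> cball 0 1" using J by blast
      then show "u \<in> Bc i" using x(2) pt(1)[OF i z(1), of x] by simp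
    qed
    moreover have "C \<subseteq> ball z e"
    proof
      fix u assume "u \<in> C"
      then obtain x where x: "x \<in> J" "u = pt i x (t i z)" by (auto simp: C_def)
      have "x \<in> X \<inter> cball 0 1" using x(1) J by blast
      then have xX: "x \<in> X" "norm x \<le> 1" by auto
      have "norm (c i z - x) \<le> norm (c i z - c i z')"
        using segment_bound1[of x "c i z" "c i z'"] x(1) by (simp add: J_def norm_minus_commute)
      then have "dist z u < e" using d(2)[OF z(1), of u] pt[OF i z(1) xX] x(2) z(4) d(1) by simp
      then show "u \<in> ball z e" by simp
    qed
    ultimately show "\<exists>C. connected C \<and> z \<in> C \<and> z' \<in> C \<and> C \<subseteq> Bc i \<and> C \<subseteq> ball z e" by blast
  qed
qed

text \<open>A short segment in a plaque of box \<open>i\<close> stays inside box \<open>j\<close>,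
  and \<open>t j\<close> is constant on connected sets by \<open>conn_t\<close>.\<close>

lemma plaque_compat:
  assumes i: "i \<in> I" and j: "j \<in> I" and z0: "z0 \<in> box i" "z0 \<in> box j"
  obtains r where "r > 0" "S \<inter> ball z0 r \<subseteq> box i \<inter> box j"
    "\<And>z z'. z \<in> S \<inter> ball z0 r \<Longrightarrow> z' \<in> S \<inter> ball z0 r \<Longrightarrow> t i z = t i z' \<Longrightarrow> t j z = t j z'"
proof -
  obtain r1 where r1: "r1 > 0" "S \<inter> ball z0 r1 \<subseteq> box i" using box_ball[OF i z0(1)] .
  obtain r2 where r2: "r2 > 0" "S \<inter> ball z0 r2 \<subseteq> box j" using box_ball[OF j z0(2)] .
  define e where "e = min r1 r2 / 2"
  have e: "e > 0" "2 * e \<le> r1" "2 * e \<le> r2" using r1 r2 by (auto simp: e_def)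
  obtain d where d: "d > 0" "\<And>z z'. z \<in> Bc i \<Longrightarrow> z' \<in> Bc i \<Longrightarrow> t i z = t i z' \<Longrightarrow> norm (c i z - c i z') < d \<Longrightarrow>
    \<exists>C. connected C \<and> z \<in> C \<and> z' \<in> C \<and> C \<subseteq> Bc i \<and> C \<subseteq> ball z e"
    by (rule plaque_segment[OF i e(1)]) (rule that; assumption)
  obtain \<delta> where \<delta>: "\<delta> > 0" "\<And>x y. x \<in> Bc i \<Longrightarrow> y \<in> Bc i \<Longrightarrow> dist x y < \<delta> \<Longrightarrow> dist (c i x) (c i y) < d"
    using uniform_cont[OF compact_Bc[OF i] c_cont[OF i] d(1)] by blast
  define r where "r = min e (\<delta>/2)"
  have r: "r > 0" "r \<le> e" "r \<le> \<delta>/2" using e \<delta> by (auto simp: r_def)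
  show thesis
  proof (rule that[OF r(1)])
    have "ball z0 r \<subseteq> ball z0 r1" "ball z0 r \<subseteq> ball z0 r2" using e r by auto
    then show "S \<inter> ball z0 r \<subseteq> box i \<inter> box j" using r1(2) r2(2) by blast
    fix z z' assume z: "z \<in> S \<inter> ball z0 r" "z' \<in> S \<inter> ball z0 r" "t i z = t i z'"
    have "dist z0 z < r1" "dist z0 z' < r1" using z(1,2) e(1,2) r(2) by auto
    then have "z \<in> S \<inter> ball z0 r1" "z' \<in> S \<inter> ball z0 r1" using z(1,2) by auto
    then have zi: "z \<in> Bc i" "z' \<in> Bc i" using r1(2) box_Bc by blast+
    have "dist z z' < \<delta>" using dist_triangle3[of z z' z0] z r(3) by simp
    then have "norm (c i z - c i z') < d" using \<delta>(2)[OF zi] by (simp add: dist_norm)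
    then obtain C where C: "connected C" "z \<in> C" "z' \<in> C" "C \<subseteq> Bc i" "C \<subseteq> ball z e" using d(2)[OF zi z(3)] by blast
    have "C \<subseteq> S \<inter> ball z0 r2"
    proof
      fix u assume u: "u \<in> C"
      have "dist z u < e" "dist z0 z < r" using C(5) u z(1) by auto
      then have "dist z0 u < r2" using dist_triangle[of z0 u z] r(2) e(3) by simp
      then show "u \<in> S \<inter> ball z0 r2" using u C(4) Bc_S[OF i] by auto
    qed
    then have "C \<subseteq> Bc j" using r2(2) box_Bc by blast
    then show "t j z = t j z'" using conn_t[OF j C(1) _ C(2,3)] by blast
  qed
qed

text \<open>The last clause controls the variation of \<open>a - c i\<close> along plaques, not its
  size; transversally \<open>a\<close> is merely continuous.\<close>

definition lform :: "('m \<Rightarrow> 'm \<Rightarrow> bool) \<Rightarrow> real \<Rightarrow> 'i \<Rightarrow> 'm set \<Rightarrow> ('m \<Rightarrow> 'e) \<Rightarrow> bool" where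
  "lform V e i N a \<longleftrightarrow> i \<in> I \<and> openin (top_of_set S) N \<and> N \<subseteq> box i \<and> continuous_on N a \<and> a ` N \<subseteq> X \<and>
     (\<forall>z\<in>N. \<forall>y\<in>N. V z y \<longleftrightarrow> a z = a y) \<and>
     (\<forall>z\<in>N. \<forall>z'\<in>N. t i z = t i z' \<longrightarrow> norm ((a z - a z') - (c i z - c i z')) \<le> e * norm (c i z - c i z'))"

text \<open>A vertical structure on an open set: a relation that is locally the kernel of a map close to
  the coordinate projection along plaques. The bound \<open>e\<close> limits how much vertical transport
  deviates from a translation.\<close>

definition vert :: "('m \<Rightarrow> 'm \<Rightarrow> bool) \<Rightarrow> real \<Rightarrow> 'm set \<Rightarrow> bool" where
  "vert V e U \<longleftrightarrow> (\<forall>z0\<in>U. \<exists>i N a. z0 \<in> N \<and> N \<subseteq> U \<and> lform V e i N a)"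

lemma lform_subset:
  "lform V e i N a \<Longrightarrow> openin (top_of_set S) N' \<Longrightarrow> N' \<subseteq> N \<Longrightarrow> lform V e i N' a"
  unfolding lform_def by (meson continuous_on_subset image_mono order_trans subsetD)

lemma lform_mono:
  assumes "lform V e i N a" "e \<le> e'"
  shows "lform V e' i N a"
proof -
  have "e * norm (x::'e) \<le> e' * norm x" for x using assms(2) by (simp add: mult_right_mono)
  then show ?thesis using assms(1) unfolding lform_def by (meson order_trans)
qed

lemma openin_ball_Int: "openin (top_of_set S) N \<Longrightarrow> openin (top_of_set S) (N \<inter> ball z r)"
  by (metis (no_types, lifting) open_ball openin_Int openin_open_Int inf.absorb2 inf.orderE inf_assoc inf_commute openin_imp_subset)

text \<open>If \<open>A\<close> killed a nonzero \<open>x\<close>, a displacement by a multiple of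
  \<open>x\<close> would be visible in chart \<open>i\<close> and almost invisible in chart
  \<open>j\<close>. The reverse coordinate change has Lipschitz constant \<open>L + 1\<close> near
  \<open>z0\<close> and excludes this.\<close>

lemma deriv_inj:
  assumes i: "i \<in> I" and j: "j \<in> I" and z0: "z0 \<in> box i" "z0 \<in> box j"
    and A: "linear A" "\<forall>e>0. \<exists>d>0. \<forall>z\<in>Bc i \<inter> Bc j. \<forall>z'\<in>Bc i \<inter> Bc j. dist z0 z < d \<longrightarrow> dist z0 z' < d \<longrightarrow> t i z = t i z' \<longrightarrow>
            norm ((c j z - c j z') - A (c i z - c i z')) \<le> e * norm (c i z - c i z')"
    and x: "x \<in> X" "A x = 0"
  shows "x = 0"
proof (rule ccontr)
  assume x0: "x \<noteq> 0"
  obtain B where B: "\<forall>x\<in>X. norm (B x) \<le> L * norm x" "\<forall>e>0. \<exists>d>0. \<forall>z\<in>Bc j \<inter> Bc i. \<forall>z'\<in>Bc j \<inter> Bc i. dist z0 z < d \<longrightarrow> dist z0 z' < d \<longrightarrow> t j z = t j z' \<longrightarrow>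
            norm ((c i z - c i z') - B (c j z - c j z')) \<le> e * norm (c j z - c j z')"
    using strict_diff[OF j i] z0 box_Bc by blast
  \<comment> \<open>Chosen so that \<open>(L + 1) * e = 1/2\<close>, which the reverse Lipschitz
    bound contradicts.\<close>
  define e where "e = 1 / (2 * (L + 1))"
  have e: "e > 0" using L_pos by (simp add: e_def)
  obtain d1 where d1: "d1 > 0" "\<forall>z\<in>Bc i \<inter> Bc j. \<forall>z'\<in>Bc i \<inter> Bc j. dist z0 z < d1 \<longrightarrow> dist z0 z' < d1 \<longrightarrow> t i z = t i z' \<longrightarrow>
            norm ((c j z - c j z') - A (c i z - c i z')) \<le> e * norm (c i z - c i z')"
    using A(2) e by blast
  obtain d2 where d2: "d2 > 0" "\<forall>z\<in>Bc j \<inter> Bc i. \<forall>z'\<in>Bc j \<inter> Bc i. dist z0 z < d2 \<longrightarrow> dist z0 z' < d2 \<longrightarrow> t j z = t j z' \<longrightarrow>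
            norm ((c i z - c i z') - B (c j z - c j z')) \<le> 1 * norm (c j z - c j z')"
    using B(2) zero_less_one by blast
  obtain r where r: "r > 0" "S \<inter> ball z0 r \<subseteq> box i \<inter> box j"
    "\<And>z z'. z \<in> S \<inter> ball z0 r \<Longrightarrow> z' \<in> S \<inter> ball z0 r \<Longrightarrow> t i z = t i z' \<Longrightarrow> t j z = t j z'"
    by (rule plaque_compat[OF i j z0]) (rule that; assumption)
  define \<rho> where "\<rho> = min r (min d1 d2)"
  have \<rho>: "\<rho> > 0" "\<rho> \<le> r" "\<rho> \<le> d1" "\<rho> \<le> d2" using r d1 d2 by (auto simp: \<rho>_def)
  obtain \<delta> where \<delta>: "\<delta> > 0" "\<And>z z'. z \<in> Bc i \<Longrightarrow> z' \<in> Bc i \<Longrightarrow> norm (c i z - c i z') < \<delta> \<Longrightarrow> dist (t i z) (t i z') < \<delta> \<Longrightarrow> dist z z' < \<rho>"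
    using ct_close[OF i \<rho>(1)] by blast
  have zi: "z0 \<in> Bc i" "norm (c i z0) < 1" using z0 by (auto simp: box_def)
  \<comment> \<open>The multiple of \<open>x\<close> is kept small enough for the displaced point to
    stay in the box and within \<open>\<rho>\<close> of \<open>z0\<close>.\<close>
  define s where "s = min (\<delta>/2) (1 - norm (c i z0)) / norm x"
  have "s * norm x = min (\<delta>/2) (1 - norm (c i z0))" using x0 by (simp add: s_def)
  then have s: "s * norm x \<le> \<delta>/2" "s * norm x \<le> 1 - norm (c i z0)" by linarith+
  have s0: "s > 0" using \<delta>(1) zi(2) x0 by (simp add: s_def)
  define y where "y = pt i (c i z0 + s *\<^sub>R x) (t i z0)"
  have yX: "c i z0 + s *\<^sub>R x \<in> X" using X_add[OF c_X[OF i zi(1)] X_scale[OF x(1)]] .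
  have yn: "norm (c i z0 + s *\<^sub>R x) \<le> 1" using norm_triangle_ineq[of "c i z0" "s *\<^sub>R x"] s s0 by simp
  have y: "y \<in> Bc i" "c i y = c i z0 + s *\<^sub>R x" "t i y = t i z0" using pt[OF i zi(1) yX yn] by (auto simp: y_def)
  have "dist z0 y < \<rho>" using \<delta>(2)[OF zi(1) y(1)] y s s0 \<delta>(1) by simp
  then have yb: "y \<in> S \<inter> ball z0 \<rho>" using y(1) Bc_S[OF i] by auto
  then have "y \<in> S \<inter> ball z0 r" using \<rho>(2) by simp
  then have yj: "y \<in> Bc j" using r(2) box_Bc by blast
  have z0b: "z0 \<in> S \<inter> ball z0 \<rho>" using zi(1) Bc_S[OF i] \<rho>(1) by auto
  have tj: "t j y = t j z0" using r(3)[of y z0] yb z0b y(3) \<rho>(2) by auto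
  have zj: "z0 \<in> Bc j" using z0 box_Bc by blast
  have "norm ((c j y - c j z0) - A (c i y - c i z0)) \<le> e * norm (c i y - c i z0)"
    using d1(2) y(1,3) yj zi(1) zj yb z0b \<rho>(3) by auto
  moreover have "A (c i y - c i z0) = 0" using y(2) x(2) linear_scale[OF A(1)] by simp
  ultimately have 1: "norm (c j y - c j z0) \<le> e * (s * norm x)" using y(2) s0 by simp
  have "norm ((c i y - c i z0) - B (c j y - c j z0)) \<le> 1 * norm (c j y - c j z0)"
    using d2(2) y(1) tj yj zi(1) zj yb z0b \<rho>(4) by auto
  moreover have "norm (B (c j y - c j z0)) \<le> L * norm (c j y - c j z0)"
    using B(1) X_diff[OF c_X[OF j yj] c_X[OF j zj]] by blast
  moreover have "norm (c i y - c i z0) \<le> norm ((c i y - c i z0) - B (c j y - c j z0)) + norm (B (c j y - c j z0))"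
    by (metis add.commute norm_triangle_sub)
  ultimately have "norm (c i y - c i z0) \<le> (L + 1) * norm (c j y - c j z0)" by (simp add: algebra_simps)
  also have "\<dots> \<le> (L + 1) * (e * (s * norm x))" using 1 L_pos by (intro mult_left_mono) auto
  also have "\<dots> = s * norm x / 2" using L_pos by (simp add: e_def field_simps)
  finally have "s * norm x \<le> s * norm x / 2" using y(2) s0 by simp
  then show False using s0 x0 by simp
qed

end

text \<open>A finite cover by small clopen sets is turned into a partition by letting
  \<open>\<kappa> w\<close> depend only on the set of members containing \<open>w\<close>; the
  smallest of their gaps is a gap for the partition.\<close>

lemma tot_disc_partition:
  fixes W :: "'m::metric_space set"
  assumes W: "compact W" "tot_disc W" and d: "d > 0"
  obtains \<kappa> g where "g > 0" "\<And>w. w \<in> W \<Longrightarrow> \<kappa> w \<in> W \<and> dist w (\<kappa> w) < d"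
    "\<And>w w'. w \<in> W \<Longrightarrow> w' \<in> W \<Longrightarrow> dist w w' < g \<Longrightarrow> \<kappa> w = \<kappa> w'"
proof -
  have "\<exists>Q g. w \<in> Q \<and> Q \<subseteq> W \<and> Q \<subseteq> ball w d \<and> compact (W - Q) \<and> g > 0 \<and>
      (\<forall>a\<in>Q. \<forall>b\<in>W. dist a b < g \<longrightarrow> b \<in> Q)" if "w \<in> W" for w
    by (rule tot_disc_clopen[OF W that d]) blast
  then obtain Q G where QG: "\<And>w. w \<in> W \<Longrightarrow> w \<in> Q w \<and> Q w \<subseteq> W \<and> Q w \<subseteq> ball w d \<and> compact (W - Q w) \<and> G w > 0 \<and>
      (\<forall>a\<in>Q w. \<forall>b\<in>W. dist a b < G w \<longrightarrow> b \<in> Q w)" by metis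
  have op: "open (- (W - Q w))" if "w \<in> W" for w using QG[OF that] compact_imp_closed by blast
  have "W \<subseteq> (\<Union>w\<in>W. - (W - Q w))" using QG by blast
  from compactE_image[OF W(1) op this]
  obtain A where A: "A \<subseteq> W" "finite A" "W \<subseteq> (\<Union>w\<in>A. - (W - Q w))" by metis
  define \<kappa> where "\<kappa> w = (SOME a. a \<in> {a\<in>A. w \<in> Q a})" for w
  define g where "g = Min (insert 1 (G ` A))"
  have \<kappa>: "\<kappa> w \<in> A \<and> w \<in> Q (\<kappa> w)" if "w \<in> W" for w
  proof -
    have "\<exists>a. a \<in> {a\<in>A. w \<in> Q a}" using A(3) that by blast
    from someI_ex[OF this] show ?thesis by (simp add: \<kappa>_def)
  qed
  have g: "g > 0" "\<And>a. a \<in> A \<Longrightarrow> g \<le> G a"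
  proof -
    show "g > 0" unfolding g_def using A(1,2) QG by (subst Min_gr_iff) auto
    show "g \<le> G a" if "a \<in> A" for a unfolding g_def using A(2) that by (intro Min_le) auto
  qed
  show thesis
  proof (rule that[OF g(1)])
    show "\<kappa> w \<in> W \<and> dist w (\<kappa> w) < d" if "w \<in> W" for w
      using \<kappa>[OF that] A(1) QG[of "\<kappa> w"] by (auto simp: dist_commute subset_iff)
    fix w w' assume w: "w \<in> W" "w' \<in> W" "dist w w' < g"
    have "w \<in> Q a \<longleftrightarrow> w' \<in> Q a" if a: "a \<in> A" for a
    proof -
      have "dist w w' < G a" "dist w' w < G a" using g(2)[OF a] w(3) by (auto simp: dist_commute)
      then show ?thesis using QG[of a] a A(1) w(1,2) by blast
    qed
    then have "{a\<in>A. w \<in> Q a} = {a\<in>A. w' \<in> Q a}" by blast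
    then show "\<kappa> w = \<kappa> w'" by (simp only: \<kappa>_def)
  qed
qed

context lamination begin

text \<open>The derivative contributes \<open>L\<close>; the error of the linear approximation, here
  allowed to be as large as the increment itself, contributes one.\<close>

lemma lipschitz_change:
  assumes i: "i \<in> I" and j: "j \<in> I" and z0: "z0 \<in> box i" "z0 \<in> box j"
  obtains r where "r > 0" "S \<inter> ball z0 r \<subseteq> box i \<inter> box j"
    "\<And>z z'. z \<in> S \<inter> ball z0 r \<Longrightarrow> z' \<in> S \<inter> ball z0 r \<Longrightarrow> t j z = t j z' \<Longrightarrow>
      t i z = t i z' \<and> norm (c i z - c i z') \<le> (L + 1) * norm (c j z - c j z')"
proof -
  obtain B where B: "\<forall>x\<in>X. norm (B x) \<le> L * norm x" "\<forall>e>0. \<exists>d>0. \<forall>z\<in>Bc j \<inter> Bc i. \<forall>z'\<in>Bc j \<inter> Bc i. dist z0 z < d \<longrightarrow> dist z0 z' < d \<longrightarrow> t j z = t j z' \<longrightarrow>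
            norm ((c i z - c i z') - B (c j z - c j z')) \<le> e * norm (c j z - c j z')"
    using strict_diff[OF j i] z0 box_Bc by blast
  obtain d2 where d2: "d2 > 0" "\<forall>z\<in>Bc j \<inter> Bc i. \<forall>z'\<in>Bc j \<inter> Bc i. dist z0 z < d2 \<longrightarrow> dist z0 z' < d2 \<longrightarrow> t j z = t j z' \<longrightarrow>
            norm ((c i z - c i z') - B (c j z - c j z')) \<le> 1 * norm (c j z - c j z')"
    using B(2) zero_less_one by blast
  obtain r where r: "r > 0" "S \<inter> ball z0 r \<subseteq> box j \<inter> box i"
    "\<And>z z'. z \<in> S \<inter> ball z0 r \<Longrightarrow> z' \<in> S \<inter> ball z0 r \<Longrightarrow> t j z = t j z' \<Longrightarrow> t i z = t i z'"
    by (rule plaque_compat[OF j i z0(2,1)]) (rule that; assumption)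
  have sub: "S \<inter> ball z0 (min r d2) \<subseteq> S \<inter> ball z0 r" by auto
  show thesis
  proof (rule that[of "min r d2"])
    show "min r d2 > 0" using r d2 by simp
    show "S \<inter> ball z0 (min r d2) \<subseteq> box i \<inter> box j" using sub r(2) by blast
    fix z z' assume z: "z \<in> S \<inter> ball z0 (min r d2)" "z' \<in> S \<inter> ball z0 (min r d2)" "t j z = t j z'"
    have zz: "z \<in> Bc i" "z \<in> Bc j" "z' \<in> Bc i" "z' \<in> Bc j" using z sub r(2) box_Bc by blast+
    have "norm ((c i z - c i z') - B (c j z - c j z')) \<le> 1 * norm (c j z - c j z')"
      using d2(2) zz z by auto
    moreover have "norm (B (c j z - c j z')) \<le> L * norm (c j z - c j z')"
      using B(1) X_diff[OF c_X[OF j zz(2)] c_X[OF j zz(4)]] by blast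
    moreover have "norm (c i z - c i z') \<le> norm ((c i z - c i z') - B (c j z - c j z')) + norm (B (c j z - c j z'))"
      by (metis add.commute norm_triangle_sub)
    ultimately have "norm (c i z - c i z') \<le> (L + 1) * norm (c j z - c j z')" by (simp add: algebra_simps)
    then show "t i z = t i z' \<and> norm (c i z - c i z') \<le> (L + 1) * norm (c j z - c j z')"
      using r(3)[of z z'] z sub by blast
  qed
qed

text \<open>The new form is \<open>A \<circ> a\<close>, with \<open>A\<close> the derivative of the
  coordinate change at \<open>z0\<close>. Injectivity of \<open>A\<close> preserves the kernel. The
  old error becomes \<open>L * e\<close>, linearisation adds \<open>e\<close>, and expressing the
  increments in chart \<open>j\<close> costs another factor \<open>L + 1\<close>.\<close>

lemma chart_change:
  assumes f: "lform V e i N a" and z0: "z0 \<in> N" and e: "e > 0" and j: "j \<in> I" "z0 \<in> box j"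
  obtains N' a' where "z0 \<in> N'" "N' \<subseteq> N" "lform V ((L + 1)\<^sup>2 * e) j N' a'"
proof -
  have i: "i \<in> I" and N: "openin (top_of_set S) N" "N \<subseteq> box i" and a: "continuous_on N a" "a ` N \<subseteq> X"
    and ker: "\<And>z y. z \<in> N \<Longrightarrow> y \<in> N \<Longrightarrow> V z y \<longleftrightarrow> a z = a y"
    and lip: "\<And>z z'. z \<in> N \<Longrightarrow> z' \<in> N \<Longrightarrow> t i z = t i z' \<Longrightarrow> norm ((a z - a z') - (c i z - c i z')) \<le> e * norm (c i z - c i z')"
    using f by (auto simp: lform_def)
  have z0i: "z0 \<in> box i" using N z0 by blast
  obtain A where A: "linear A" "A ` X \<subseteq> X" "\<forall>x\<in>X. norm (A x) \<le> L * norm x"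
     "\<forall>e>0. \<exists>d>0. \<forall>z\<in>Bc i \<inter> Bc j. \<forall>z'\<in>Bc i \<inter> Bc j. dist z0 z < d \<longrightarrow> dist z0 z' < d \<longrightarrow> t i z = t i z' \<longrightarrow>
            norm ((c j z - c j z') - A (c i z - c i z')) \<le> e * norm (c i z - c i z')"
    using strict_diff[OF i j(1)] z0i j(2) box_Bc by blast
  obtain d where d: "d > 0" "\<forall>z\<in>Bc i \<inter> Bc j. \<forall>z'\<in>Bc i \<inter> Bc j. dist z0 z < d \<longrightarrow> dist z0 z' < d \<longrightarrow> t i z = t i z' \<longrightarrow>
            norm ((c j z - c j z') - A (c i z - c i z')) \<le> e * norm (c i z - c i z')"
    using A(4) e by blast
  obtain r where r: "r > 0" "S \<inter> ball z0 r \<subseteq> box i \<inter> box j"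
    "\<And>z z'. z \<in> S \<inter> ball z0 r \<Longrightarrow> z' \<in> S \<inter> ball z0 r \<Longrightarrow> t j z = t j z' \<Longrightarrow>
      t i z = t i z' \<and> norm (c i z - c i z') \<le> (L + 1) * norm (c j z - c j z')"
    by (rule lipschitz_change[OF i j(1) z0i j(2)]) (rule that; assumption)
  define N' where "N' = N \<inter> ball z0 (min r d)"
  have N': "N' \<subseteq> N" "N' \<subseteq> S \<inter> ball z0 r" "N' \<subseteq> S \<inter> ball z0 d"
    using openin_imp_subset[OF N(1)] by (auto simp: N'_def)
  have N'b: "N' \<subseteq> Bc i \<inter> Bc j" using N'(2) r(2) box_Bc by blast
  have "L-lipschitz_on X A"
  proof (rule lipschitz_onI)
    fix x y assume "x \<in> X" "y \<in> X"
    then show "dist (A x) (A y) \<le> L * dist x y"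
      using A(3) X_diff[of x y] linear_diff[OF A(1), of x y] by (auto simp: dist_norm)
  qed (rule L_pos)
  then have cA: "continuous_on X A" by (rule lipschitz_on_continuous_on)
  show thesis
  proof (rule that[of N' "\<lambda>z. A (a z)"])
    show "z0 \<in> N'" using z0 r d by (simp add: N'_def)
    show "N' \<subseteq> N" by (rule N')
    show "lform V ((L + 1)\<^sup>2 * e) j N' (\<lambda>z. A (a z))"
      unfolding lform_def
    proof (intro conjI ballI impI)
      show "j \<in> I" by (rule j)
      show "openin (top_of_set S) N'" unfolding N'_def by (rule openin_ball_Int[OF N(1)])
      show "N' \<subseteq> box j" using N'(2) r(2) by blast
      show "continuous_on N' (\<lambda>z. A (a z))"
        by (rule continuous_on_compose2[OF cA continuous_on_subset[OF a(1) N'(1)]]) (use a(2) N'(1) in blast)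
      show "(\<lambda>z. A (a z)) ` N' \<subseteq> X" using a(2) A(2) N'(1) by blast
    next
      fix z y assume zy: "z \<in> N'" "y \<in> N'"
      then have X2: "a z \<in> X" "a y \<in> X" "V z y \<longleftrightarrow> a z = a y" using a(2) N'(1) ker by blast+
      show "V z y \<longleftrightarrow> A (a z) = A (a y)"
      proof
        assume "A (a z) = A (a y)"
        then have "A (a z - a y) = 0" using linear_diff[OF A(1), of "a z" "a y"] by simp
        then have "a z - a y = 0" using deriv_inj[OF i j(1) z0i j(2) A(1,4)] X_diff X2 by blast
        then show "V z y" using X2 by simp
      qed (use X2 in simp)
    next
      fix z z' assume z: "z \<in> N'" "z' \<in> N'" "t j z = t j z'"
      have tt: "t i z = t i z'" and lc: "norm (c i z - c i z') \<le> (L + 1) * norm (c j z - c j z')"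
        using r(3)[of z z'] z N'(2) by blast+
      have zb: "z \<in> Bc i" "z \<in> Bc j" "z' \<in> Bc i" "z' \<in> Bc j" "z \<in> N" "z' \<in> N" using z N'b N'(1) by auto
      define \<Delta> where "\<Delta> = c i z - c i z'"
      define \<Delta>a where "\<Delta>a = a z - a z'"
      have XX: "\<Delta> \<in> X" "\<Delta>a \<in> X" unfolding \<Delta>_def \<Delta>a_def using X_diff c_X[OF i] zb a(2) by blast+
      have 1: "norm (A (\<Delta>a - \<Delta>)) \<le> L * (e * norm \<Delta>)"
      proof -
        have "norm (A (\<Delta>a - \<Delta>)) \<le> L * norm (\<Delta>a - \<Delta>)" using A(3) X_diff XX by blast
        also have "\<dots> \<le> L * (e * norm \<Delta>)"
          using lip[OF zb(5,6) tt] L_pos unfolding \<Delta>_def \<Delta>a_def by (intro mult_left_mono) auto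
        finally show ?thesis .
      qed
      have "z \<in> ball z0 d" "z' \<in> ball z0 d" using z N'(3) by blast+
      then have 2: "norm ((c j z - c j z') - A \<Delta>) \<le> e * norm \<Delta>"
        using d(2) zb tt unfolding \<Delta>_def by auto
      have eq: "(A (a z) - A (a z')) - (c j z - c j z') = A (\<Delta>a - \<Delta>) - ((c j z - c j z') - A \<Delta>)"
        using linear_diff[OF A(1)] by (simp add: \<Delta>a_def)
      have "norm ((A (a z) - A (a z')) - (c j z - c j z')) \<le> L * (e * norm \<Delta>) + e * norm \<Delta>"
        using norm_triangle_ineq4[of "A (\<Delta>a - \<Delta>)" "(c j z - c j z') - A \<Delta>"] 1 2 unfolding eq by linarith
      also have "\<dots> = ((L + 1) * e) * norm \<Delta>" by (simp add: algebra_simps)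
      also have "\<dots> \<le> ((L + 1) * e) * ((L + 1) * norm (c j z - c j z'))"
        using lc L_pos e unfolding \<Delta>_def by (intro mult_left_mono) auto
      also have "\<dots> = (L + 1)\<^sup>2 * e * norm (c j z - c j z')" by (simp add: power2_eq_square)
      finally show "norm ((A (a z) - A (a z')) - (c j z - c j z')) \<le> (L + 1)\<^sup>2 * e * norm (c j z - c j z')" .
    qed
  qed
qed

text \<open>Along a plaque \<open>a\<close> is the coordinate perturbed by a map with Lipschitz
  constant at most 1/2.\<close>

lemma lform_inj:
  assumes f: "lform V e i N a" and e: "e \<le> 1/2" and z: "z \<in> N" "z' \<in> N" "t i z = t i z'" "a z = a z'"
  shows "z = z'"
proof -
  have "norm ((a z - a z') - (c i z - c i z')) \<le> e * norm (c i z - c i z')"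
    using f z unfolding lform_def by blast
  then have "norm (c i z - c i z') \<le> e * norm (c i z - c i z')" using z(4) by (simp add: norm_minus_commute)
  also have "\<dots> \<le> 1/2 * norm (c i z - c i z')" using e by (intro mult_right_mono) auto
  finally have "c i z = c i z'" by simp
  moreover have "i \<in> I" "z \<in> Bc i" "z' \<in> Bc i" using f z box_Bc unfolding lform_def by blast+
  ultimately show ?thesis using ct_inj z(3) by blast
qed

text \<open>Vertical transport to a nearby plaque exists by the contraction principle.\<close>

lemma transport_local:
  assumes f: "lform V e i N a" and e: "e \<le> 1/2" and z0: "z0 \<in> N" and \<rho>: "\<rho> > 0"
  obtains d where "d > 0" "S \<inter> ball z0 d \<subseteq> N"
    "\<And>z y. z \<in> S \<inter> ball z0 d \<Longrightarrow> y \<in> S \<inter> ball z0 d \<Longrightarrow> \<exists>u\<in>N. dist z0 u < \<rho> \<and> t i u = t i y \<and> a u = a z"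
proof -
  have i: "i \<in> I" and N: "openin (top_of_set S) N" "N \<subseteq> box i" and a: "continuous_on N a" "a ` N \<subseteq> X"
    and lip0: "\<And>z z'. z \<in> N \<Longrightarrow> z' \<in> N \<Longrightarrow> t i z = t i z' \<Longrightarrow> norm ((a z - a z') - (c i z - c i z')) \<le> e * norm (c i z - c i z')"
    using f by (auto simp: lform_def)
  have lip: "norm ((a z - a z') - (c i z - c i z')) \<le> 1/2 * norm (c i z - c i z')"
    if "z \<in> N" "z' \<in> N" "t i z = t i z'" for z z'
    using lip0[OF that] mult_right_mono[OF e, of "norm (c i z - c i z')"] by simp
  have NS: "N \<subseteq> S" using openin_imp_subset[OF N(1)] .
  have NBc: "N \<subseteq> Bc i" using N box_Bc by blast
  have z0b: "z0 \<in> Bc i" "norm (c i z0) < 1" using N z0 by (auto simp: box_def)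
  obtain r0 where r0: "r0 > 0" "S \<inter> ball z0 r0 \<subseteq> N" using N(1) z0 unfolding openin_ball_iff by blast
  define \<rho>' where "\<rho>' = min \<rho> r0"
  have \<rho>': "\<rho>' > 0" "\<rho>' \<le> \<rho>" "\<rho>' \<le> r0" using \<rho> r0 by (auto simp: \<rho>'_def)
  obtain \<delta> where \<delta>: "\<delta> > 0" "\<And>z z'. z \<in> Bc i \<Longrightarrow> z' \<in> Bc i \<Longrightarrow> norm (c i z - c i z') < \<delta> \<Longrightarrow> dist (t i z) (t i z') < \<delta> \<Longrightarrow> dist z z' < \<rho>'"
    using ct_close[OF i \<rho>'(1)] by blast
  define \<delta>' where "\<delta>' = min (\<delta>/2) (1 - norm (c i z0))"
  have \<delta>': "\<delta>' > 0" "\<delta>' < \<delta>" "\<delta>' \<le> 1 - norm (c i z0)" using \<delta>(1) z0b by (auto simp: \<delta>'_def)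
  \<comment> \<open>Two errors below \<open>\<delta>'/4\<close> and a contracted term of at most
    \<open>\<delta>'/2\<close> will keep the ball of radius \<open>\<delta>'\<close> invariant under
    the contraction.\<close>
  have d4: "\<delta>'/4 > 0" using \<delta>' by simp
  obtain \<eta> where \<eta>: "\<eta> > 0" "\<And>u. u \<in> N \<Longrightarrow> dist u z0 < \<eta> \<Longrightarrow> dist (a u) (a z0) < \<delta>'/4"
    using a(1) z0 d4 unfolding continuous_on_iff by blast
  obtain \<delta>2 where \<delta>2: "\<delta>2 > 0" "\<And>z z'. z \<in> Bc i \<Longrightarrow> z' \<in> Bc i \<Longrightarrow> norm (c i z - c i z') < \<delta>2 \<Longrightarrow> dist (t i z) (t i z') < \<delta>2 \<Longrightarrow> dist z z' < \<eta>"
    using ct_close[OF i \<eta>(1)] by blast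
  have "min \<delta> \<delta>2 > 0" using \<delta> \<delta>2 by simp
  then obtain \<tau> where \<tau>: "\<tau> > 0" "\<And>y. y \<in> Bc i \<Longrightarrow> dist y z0 < \<tau> \<Longrightarrow> dist (t i y) (t i z0) < min \<delta> \<delta>2"
    using t_cont[OF i] z0b(1) unfolding continuous_on_iff by blast
  define d where "d = min r0 (min \<eta> \<tau>)"
  have d: "d > 0" "d \<le> r0" "d \<le> \<eta>" "d \<le> \<tau>" using r0 \<eta> \<tau> by (auto simp: d_def)
  have dN: "S \<inter> ball z0 d \<subseteq> N" using r0(2) d(2) by (meson Int_mono order_refl order_trans subset_ball)
  show thesis
  proof (rule that[OF d(1) dN])
    fix z y assume zy: "z \<in> S \<inter> ball z0 d" "y \<in> S \<inter> ball z0 d"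
    then have zN: "z \<in> N" "y \<in> N" using dN by blast+
    have yB: "y \<in> Bc i" using zN NBc by blast
    have ty: "dist (t i y) (t i z0) < \<delta>" "dist (t i y) (t i z0) < \<delta>2" using \<tau>(2)[OF yB] zy(2) d(4) by (auto simp: dist_commute)
    have az: "norm (a z - a z0) < \<delta>'/4" using \<eta>(2)[OF zN(1)] zy(1) d(3) by (simp add: dist_commute dist_norm norm_minus_commute)
    define \<psi> where "\<psi> x = pt i x (t i y)" for x
    define D where "D = X \<inter> cball (c i z0) \<delta>'"
    have \<psi>: "\<psi> x \<in> Bc i" "c i (\<psi> x) = x" "t i (\<psi> x) = t i y" "\<psi> x \<in> N" "dist z0 (\<psi> x) < \<rho>" if x: "x \<in> D" for x
    proof -
      have xX: "x \<in> X" "norm (c i z0 - x) \<le> \<delta>'" using x by (auto simp: D_def dist_norm)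
      have "norm x \<le> 1" using xX(2) \<delta>'(3) norm_triangle_sub[of x "c i z0"] by (simp add: norm_minus_commute)
      from pt[OF i yB xX(1) this] show p: "\<psi> x \<in> Bc i" "c i (\<psi> x) = x" "t i (\<psi> x) = t i y" by (auto simp: \<psi>_def)
      have "dist z0 (\<psi> x) < \<rho>'" using \<delta>(2)[OF z0b(1) p(1)] p xX(2) \<delta>'(2) ty(1) by (simp add: dist_commute)
      then show "dist z0 (\<psi> x) < \<rho>" "\<psi> x \<in> N" using \<rho>' r0(2) p(1) Bc_S[OF i] by auto
    qed
    have cD: "c i z0 \<in> D" using c_X[OF i z0b(1)] \<delta>' by (simp add: D_def)
    define u0 where "u0 = \<psi> (c i z0)"
    have "dist u0 z0 < \<eta>" using \<delta>2(2)[of u0 z0] \<psi>[OF cD] z0b(1) \<delta>2(1) ty(2) by (simp add: u0_def)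
    then have au0: "norm (a u0 - a z0) < \<delta>'/4" using \<eta>(2)[of u0] \<psi>[OF cD] by (simp add: u0_def dist_norm)
    \<comment> \<open>A fixed point solves \<open>a (\<psi> x) = a z\<close>. The term subtracted is
      the deviation of \<open>a\<close> from the coordinate, which is 1/2-Lipschitz along the
      plaque.\<close>
    define f where "f x = a z - (a (\<psi> x) - x)" for x
    have dif: "norm ((a (\<psi> x) - a (\<psi> x')) - (x - x')) \<le> 1/2 * norm (x - x')" if "x \<in> D" "x' \<in> D" for x x'
      using lip[of "\<psi> x" "\<psi> x'"] \<psi>[OF that(1)] \<psi>[OF that(2)] by simp
    have "\<exists>!x\<in>D. f x = x"
    proof (rule Banach_fix)
      show "complete D" unfolding D_def
        unfolding complete_eq_closed by (intro closed_Int closed_X closed_cball)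
      show "D \<noteq> {}" using cD by blast
      show "(0::real) \<le> 1/2" "(1/2::real) < 1" by auto
      show "f ` D \<subseteq> D"
      proof
        fix v assume "v \<in> f ` D"
        then obtain x where x: "x \<in> D" "v = f x" by blast
        have xX: "x \<in> X" "norm (x - c i z0) \<le> \<delta>'" using x(1) by (auto simp: D_def dist_norm norm_minus_commute)
        have aX: "a z \<in> X" "a (\<psi> x) \<in> X" using a(2) zN(1) \<psi>(4)[OF x(1)] by blast+
        have vX: "v \<in> X" unfolding x(2) f_def using X_diff aX xX by blast
        have eqv: "v - c i z0 = (a z - a z0) - (a u0 - a z0) - ((a (\<psi> x) - a u0) - (x - c i z0))"
          by (simp add: x(2) f_def)
        have "norm (v - c i z0) \<le> norm (a z - a z0) + norm (a u0 - a z0) + norm ((a (\<psi> x) - a u0) - (x - c i z0))"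
          using norm_triangle_ineq4[of "(a z - a z0) - (a u0 - a z0)" "(a (\<psi> x) - a u0) - (x - c i z0)"]
            norm_triangle_ineq4[of "a z - a z0" "a u0 - a z0"] unfolding eqv by linarith
        also have "\<dots> \<le> \<delta>'" using az au0 dif[OF x(1) cD] xX(2) by (simp add: u0_def)
        finally show "v \<in> D" using vX by (simp add: D_def dist_norm norm_minus_commute)
      qed
      show "dist (f x) (f x') \<le> 1/2 * dist x x'" if "x \<in> D" "x' \<in> D" for x x'
      proof -
        have "f x - f x' = - ((a (\<psi> x) - a (\<psi> x')) - (x - x'))" by (simp add: f_def)
        then show ?thesis using dif[OF that] unfolding dist_norm by (metis norm_minus_cancel)
      qed
    qed
    then obtain x where x: "x \<in> D" "f x = x" by blast
    then have "a (\<psi> x) = a z" by (simp add: f_def)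
    then show "\<exists>u\<in>N. dist z0 u < \<rho> \<and> t i u = t i y \<and> a u = a z" using \<psi>[OF x(1)] by blast
  qed
qed

section \<open>Cutoff functions that are Lipschitz along plaques\<close>

definition lipf :: "real \<Rightarrow> ('m \<Rightarrow> real) \<Rightarrow> bool" where
  "lipf \<Lambda> f \<longleftrightarrow> (\<forall>j\<in>I. \<forall>z1\<in>box j. \<exists>r>0. \<forall>z\<in>S \<inter> ball z1 r. \<forall>z'\<in>S \<inter> ball z1 r. t j z = t j z' \<longrightarrow>
      \<bar>f z - f z'\<bar> \<le> \<Lambda> * norm (c j z - c j z'))"

lemma lipf_sum:
  assumes "finite A" "\<And>a. a \<in> A \<Longrightarrow> lipf (\<Lambda> a) (f a)"
  shows "lipf (\<Sum>a\<in>A. \<Lambda> a) (\<lambda>z. \<Sum>a\<in>A. f a z)"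
  using assms
proof (induction A)
  case empty
  then show ?case unfolding lipf_def by (auto intro!: exI[of _ 1])
next
  case (insert b A)
  have b: "lipf (\<Lambda> b) (f b)" and A: "lipf (\<Sum>a\<in>A. \<Lambda> a) (\<lambda>z. \<Sum>a\<in>A. f a z)" using insert by auto
  show ?case
    unfolding lipf_def
  proof (intro ballI)
    fix j z1 assume j: "j \<in> I" "z1 \<in> box j"
    obtain r1 where r1: "r1 > 0" "\<And>z z'. z \<in> S \<inter> ball z1 r1 \<Longrightarrow> z' \<in> S \<inter> ball z1 r1 \<Longrightarrow> t j z = t j z' \<Longrightarrow>
      \<bar>f b z - f b z'\<bar> \<le> \<Lambda> b * norm (c j z - c j z')" using b j unfolding lipf_def by meson
    obtain r2 where r2: "r2 > 0" "\<And>z z'. z \<in> S \<inter> ball z1 r2 \<Longrightarrow> z' \<in> S \<inter> ball z1 r2 \<Longrightarrow> t j z = t j z' \<Longrightarrow>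
      \<bar>(\<Sum>a\<in>A. f a z) - (\<Sum>a\<in>A. f a z')\<bar> \<le> (\<Sum>a\<in>A. \<Lambda> a) * norm (c j z - c j z')" using A j unfolding lipf_def by meson
    have "\<bar>(\<Sum>a\<in>insert b A. f a z) - (\<Sum>a\<in>insert b A. f a z')\<bar> \<le> (\<Sum>a\<in>insert b A. \<Lambda> a) * norm (c j z - c j z')"
      if z: "z \<in> S \<inter> ball z1 (min r1 r2)" "z' \<in> S \<inter> ball z1 (min r1 r2)" "t j z = t j z'" for z z'
    proof -
      have "\<bar>f b z - f b z'\<bar> \<le> \<Lambda> b * norm (c j z - c j z')" using r1(2)[of z z'] z by auto
      moreover have "\<bar>(\<Sum>a\<in>A. f a z) - (\<Sum>a\<in>A. f a z')\<bar> \<le> (\<Sum>a\<in>A. \<Lambda> a) * norm (c j z - c j z')" using r2(2)[of z z'] z by auto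
      ultimately show ?thesis using insert(1,2) by (simp add: algebra_simps abs_le_iff)
    qed
    then show "\<exists>r>0. \<forall>z\<in>S \<inter> ball z1 r. \<forall>z'\<in>S \<inter> ball z1 r. t j z = t j z' \<longrightarrow>
        \<bar>(\<Sum>a\<in>insert b A. f a z) - (\<Sum>a\<in>insert b A. f a z')\<bar> \<le> (\<Sum>a\<in>insert b A. \<Lambda> a) * norm (c j z - c j z')"
      using r1(1) r2(1) by (intro exI[of _ "min r1 r2"]) auto
  qed
qed

text \<open>The transverse term in \<open>g\<close> is constant along plaques, so only the leafwise
  term, of slope \<open>1 / r\<close>, counts; other charts see it with the factor
  \<open>L + 1\<close>. The constant 2 leaves a margin above one at \<open>z0\<close> for the later
  truncation.\<close>

lemma bump:
  assumes i: "i \<in> I" and z0: "z0 \<in> box i" and \<rho>: "\<rho> > 0"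
  obtains f \<Lambda> where "\<Lambda> \<ge> 0" "lipf \<Lambda> f" "continuous_on S f" "\<And>z. f z \<ge> 0" "f z0 > 1"
    "\<And>z. z \<in> S \<Longrightarrow> f z \<noteq> 0 \<Longrightarrow> dist z0 z < \<rho>"
proof -
  have z0b: "z0 \<in> Bc i" "norm (c i z0) < 1" using z0 by (auto simp: box_def)
  obtain \<delta> where \<delta>: "\<delta> > 0" "\<And>z z'. z \<in> Bc i \<Longrightarrow> z' \<in> Bc i \<Longrightarrow> norm (c i z - c i z') < \<delta> \<Longrightarrow> dist (t i z) (t i z') < \<delta> \<Longrightarrow> dist z z' < \<rho>"
    using ct_close[OF i \<rho>] by blast
  define r where "r = min \<delta> (1 - norm (c i z0)) / 3"
  have "r > 0" "r \<le> \<delta> / 3" "r \<le> (1 - norm (c i z0)) / 3" using \<delta>(1) z0b by (auto simp: r_def)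
  then have r: "r > 0" "2 * r < \<delta>" "2 * r < 1 - norm (c i z0)" using z0b(2) \<delta>(1) by (simp_all add: field_simps)
  define g where "g z = max 0 (2 - norm (c i z - c i z0) / r - dist (t i z) (t i z0) / r)" for z
  define f where "f z = (if z \<in> Bc i then g z else 0)" for z
  define F where "F = {z\<in>Bc i. norm (c i z - c i z0) \<le> 2 * r \<and> dist (t i z) (t i z0) \<le> 2 * r}"
  have f_supp: "z \<in> F" if "f z \<noteq> 0" for z
  proof -
    have zB: "z \<in> Bc i" and "g z \<noteq> 0" using that by (auto simp: f_def split: if_splits)
    then have p: "norm (c i z - c i z0) / r + dist (t i z) (t i z0) / r < 2" by (auto simp: g_def max_def split: if_splits)
    have "0 \<le> norm (c i z - c i z0) / r" "0 \<le> dist (t i z) (t i z0) / r" using r(1) by auto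
    then have "norm (c i z - c i z0) / r \<le> 2" "dist (t i z) (t i z0) / r \<le> 2" using p by linarith+
    then show ?thesis using zB r(1) by (simp add: F_def field_simps)
  qed
  have F_box: "F \<subseteq> box i"
  proof
    fix z assume "z \<in> F"
    then show "z \<in> box i" using r(3) norm_triangle_sub[of "c i z" "c i z0"] by (auto simp: F_def box_def)
  qed
  have cg: "continuous_on (Bc i) (\<lambda>z. norm (c i z - c i z0))" "continuous_on (Bc i) (\<lambda>z. dist (t i z) (t i z0))"
    by (intro continuous_intros c_cont[OF i] t_cont[OF i])+
  have cF: "closedin (top_of_set (Bc i)) (Bc i \<inter> (\<lambda>z. norm (c i z - c i z0)) -` {..2*r})"
    "closedin (top_of_set (Bc i)) (Bc i \<inter> (\<lambda>z. dist (t i z) (t i z0)) -` {..2*r})"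
    by (intro continuous_closedin_preimage cg closed_atMost)+
  have "F = (Bc i \<inter> (\<lambda>z. norm (c i z - c i z0)) -` {..2*r}) \<inter> (Bc i \<inter> (\<lambda>z. dist (t i z) (t i z0)) -` {..2*r})"
    by (auto simp: F_def)
  then have "compact F" using closedin_Int[OF cF] closedin_compact[OF compact_Bc[OF i]] by simp
  then have Fc: "closed F" by (rule compact_imp_closed)
  have off: "\<exists>\<epsilon>>0. \<forall>z\<in>ball z1 \<epsilon>. f z = 0" if "z1 \<notin> box i" for z1
  proof -
    have "z1 \<in> - F" using that F_box by blast
    then obtain \<epsilon> where "\<epsilon> > 0" "ball z1 \<epsilon> \<subseteq> - F" using Fc open_Compl open_contains_ball by metis
    then show ?thesis using f_supp by blast
  qed
  have lf: "lipf ((L + 1) / r) f"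
    unfolding lipf_def
  proof (intro ballI)
    fix j z1 assume j: "j \<in> I" and z1: "z1 \<in> box j"
    show "\<exists>s>0. \<forall>z\<in>S \<inter> ball z1 s. \<forall>z'\<in>S \<inter> ball z1 s. t j z = t j z' \<longrightarrow> \<bar>f z - f z'\<bar> \<le> (L + 1) / r * norm (c j z - c j z')"
    proof (cases "z1 \<in> box i")
      case True
      obtain s where s: "s > 0" "S \<inter> ball z1 s \<subseteq> box i \<inter> box j"
        "\<And>z z'. z \<in> S \<inter> ball z1 s \<Longrightarrow> z' \<in> S \<inter> ball z1 s \<Longrightarrow> t j z = t j z' \<Longrightarrow>
          t i z = t i z' \<and> norm (c i z - c i z') \<le> (L + 1) * norm (c j z - c j z')"
        by (rule lipschitz_change[OF i j True z1]) (rule that; assumption)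
      have "\<bar>f z - f z'\<bar> \<le> (L + 1) / r * norm (c j z - c j z')"
        if z: "z \<in> S \<inter> ball z1 s" "z' \<in> S \<inter> ball z1 s" "t j z = t j z'" for z z'
      proof -
        have zB: "z \<in> Bc i" "z' \<in> Bc i" using z s(2) box_Bc by blast+
        have tl: "t i z = t i z'" "norm (c i z - c i z') \<le> (L + 1) * norm (c j z - c j z')" using s(3)[OF z] by auto
        have "\<bar>f z - f z'\<bar> \<le> \<bar>norm (c i z - c i z0) / r - norm (c i z' - c i z0) / r\<bar>"
          using zB tl(1) by (auto simp: f_def g_def max_def)
        also have "\<dots> = \<bar>norm (c i z - c i z0) - norm (c i z' - c i z0)\<bar> / r"
          using r(1) by (simp flip: diff_divide_distrib)
        also have "\<dots> \<le> norm (c i z - c i z') / r"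
          using norm_triangle_ineq3[of "c i z - c i z0" "c i z' - c i z0"] r(1) by (intro divide_right_mono) auto
        also have "\<dots> \<le> ((L + 1) * norm (c j z - c j z')) / r" using tl(2) r(1) by (intro divide_right_mono) auto
        finally show ?thesis by simp
      qed
      then show ?thesis using s(1) by blast
    next
      case False
      then obtain \<epsilon> where "\<epsilon> > 0" "\<forall>z\<in>ball z1 \<epsilon>. f z = 0" using off by blast
      then show ?thesis using L_pos r(1) by (intro exI[of _ \<epsilon>]) auto
    qed
  qed
  have cont: "continuous_on S f"
    unfolding continuous_on_iff
  proof (intro ballI allI impI)
    fix z1 and \<epsilon> :: real assume z1: "z1 \<in> S" and \<epsilon>: "\<epsilon> > 0"
    show "\<exists>d>0. \<forall>z\<in>S. dist z z1 < d \<longrightarrow> dist (f z) (f z1) < \<epsilon>"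
    proof (cases "z1 \<in> box i")
      case True
      obtain s where s: "s > 0" "S \<inter> ball z1 s \<subseteq> box i" using box_ball[OF i True] .
      have "continuous_on (Bc i) g" unfolding g_def using r(1) by (intro continuous_intros cg) auto
      then obtain d where d: "d > 0" "\<And>z. z \<in> Bc i \<Longrightarrow> dist z z1 < d \<Longrightarrow> dist (g z) (g z1) < \<epsilon>"
        using True box_Bc \<epsilon> unfolding continuous_on_iff by (meson subsetD)
      have "dist (f z) (f z1) < \<epsilon>" if "z \<in> S" "dist z z1 < min s d" for z
      proof -
        have "z \<in> box i" using s(2) that by (auto simp: dist_commute)
        then have "z \<in> Bc i" "z1 \<in> Bc i" using True box_Bc by blast+
        then show ?thesis using d(2)[of z] that by (simp add: f_def)
      qed
      then show ?thesis using s(1) d(1) by (intro exI[of _ "min s d"]) auto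
    next
      case False
      then obtain d where d: "d > 0" "\<forall>z\<in>ball z1 d. f z = 0" using off by blast
      then have "f z1 = 0" by simp
      then show ?thesis using d \<epsilon> by (intro exI[of _ d]) (auto simp: dist_commute)
    qed
  qed
  show thesis
  proof (rule that[OF _ lf cont])
    show "0 \<le> (L + 1) / r" using L_pos r by simp
    show "f z \<ge> 0" for z by (simp add: f_def g_def)
    show "f z0 > 1" using z0b by (simp add: f_def g_def)
    show "dist z0 z < \<rho>" if "z \<in> S" "f z \<noteq> 0" for z
      using f_supp[OF that(2)] \<delta>(2)[OF z0b(1), of z] r by (auto simp: F_def norm_minus_commute dist_commute)
  qed
qed

text \<open>A finite sum of bumps truncated at one. Since the bumps exceed one near their centres,
  the result is one on a whole neighbourhood \<open>U'\<close> of \<open>A\<close>, so that a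
  structure can be left untouched there.\<close>

lemma cutoff:
  assumes A: "compact A" and U: "openin (top_of_set S) U" and AU: "A \<subseteq> U"
  obtains \<mu> \<Lambda> Z U' where "\<Lambda> \<ge> 0" "lipf \<Lambda> \<mu>" "continuous_on S \<mu>" "\<And>z. 0 \<le> \<mu> z \<and> \<mu> z \<le> 1"
    "compact Z" "Z \<subseteq> U" "\<And>z. z \<in> S \<Longrightarrow> \<mu> z \<noteq> 0 \<Longrightarrow> z \<in> Z"
    "openin (top_of_set S) U'" "A \<subseteq> U'" "\<And>z. z \<in> U' \<Longrightarrow> \<mu> z = 1"
proof -
  have US: "U \<subseteq> S" using openin_imp_subset[OF U] .
  define good where "good z q \<longleftrightarrow> (case q of (f, \<Lambda>, \<rho>, r) \<Rightarrow> \<rho> > 0 \<and> S \<inter> cball z \<rho> \<subseteq> U \<and> \<Lambda> \<ge> 0 \<and> lipf \<Lambda> f \<and> continuous_on S f \<and> (\<forall>y. f y \<ge> 0) \<and>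
      (\<forall>y\<in>S. f y \<noteq> 0 \<longrightarrow> y \<in> cball z \<rho>) \<and> r > 0 \<and> (\<forall>y\<in>S \<inter> ball z r. f y > 1))"
    for z and q :: "('m \<Rightarrow> real) \<times> real \<times> real \<times> real"
  have ex: "\<exists>q. good z q" if z: "z \<in> A" for z
  proof -
    have zS: "z \<in> S" "z \<in> U" using z AU US by auto
    obtain q where q: "q > 0" "S \<inter> ball z q \<subseteq> U" using U zS(2) unfolding openin_ball_iff by blast
    obtain i where i: "i \<in> I" "z \<in> Bc i" "norm (c i z) < 1/2" using cover[OF zS(1)] by blast
    have zb: "z \<in> box i" using i by (simp add: box_def)
    have q2: "q/2 > 0" using q by simp
    obtain f \<Lambda> where f: "\<Lambda> \<ge> 0" "lipf \<Lambda> f" "continuous_on S f" "\<And>z. f z \<ge> 0" "f z > 1"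
      "\<And>y. y \<in> S \<Longrightarrow> f y \<noteq> 0 \<Longrightarrow> dist z y < q/2"
      by (rule bump[OF i(1) zb q2]) (rule that; assumption)
    have "f z - 1 > 0" using f(5) by simp
    then obtain r where r: "r > 0" "\<And>y. y \<in> S \<Longrightarrow> dist y z < r \<Longrightarrow> dist (f y) (f z) < f z - 1"
      using f(3) zS(1) unfolding continuous_on_iff by blast
    have "f y > 1" if "y \<in> S \<inter> ball z r" for y
      using r(2)[of y] that by (auto simp: dist_real_def dist_commute)
    moreover have "cball z (q/2) \<subseteq> ball z q" using q(1) by auto
    then have "S \<inter> cball z (q/2) \<subseteq> U" using q(2) by blast
    ultimately have "good z (f, \<Lambda>, q/2, r)"
      unfolding good_def using f(1-4) r(1) q2 less_imp_le[OF f(6)] by auto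
    then show ?thesis by blast
  qed
  then obtain q where q: "\<And>z. z \<in> A \<Longrightarrow> good z (q z)" by metis
  define f where "f z = fst (q z)" for z
  define \<Lambda> where "\<Lambda> z = fst (snd (q z))" for z
  define \<rho> where "\<rho> z = fst (snd (snd (q z)))" for z
  define r where "r z = snd (snd (snd (q z)))" for z
  have fr: "\<rho> z > 0 \<and> S \<inter> cball z (\<rho> z) \<subseteq> U \<and> \<Lambda> z \<ge> 0 \<and> lipf (\<Lambda> z) (f z) \<and> continuous_on S (f z) \<and> (\<forall>y. f z y \<ge> 0) \<and>
      (\<forall>y\<in>S. f z y \<noteq> 0 \<longrightarrow> y \<in> cball z (\<rho> z)) \<and> r z > 0 \<and> (\<forall>y\<in>S \<inter> ball z (r z). f z y > 1)" if "z \<in> A" for z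
    using q[OF that] unfolding good_def f_def \<Lambda>_def \<rho>_def r_def by (auto split: prod.splits)
  have "z \<in> ball z (r z)" if "z \<in> A" for z using fr[OF that] by simp
  then have "A \<subseteq> (\<Union>z\<in>A. ball z (r z))" by blast
  from compactE_image[OF A open_ball this]
  obtain D where D: "D \<subseteq> A" "finite D" "A \<subseteq> (\<Union>z\<in>D. ball z (r z))" by metis
  define F where "F y = (\<Sum>z\<in>D. f z y)" for y
  define \<mu> where "\<mu> y = min 1 (F y)" for y
  have F0: "F y \<ge> 0" for y unfolding F_def using fr D(1) by (intro sum_nonneg) blast
  have lF: "lipf (\<Sum>z\<in>D. \<Lambda> z) F" unfolding F_def by (rule lipf_sum[OF D(2)]) (use fr D(1) in blast)
  have cF: "continuous_on S F" unfolding F_def by (intro continuous_on_sum) (use fr D(1) in blast)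
  have ll: "lipf (\<Sum>z\<in>D. \<Lambda> z) \<mu>"
    unfolding lipf_def
  proof (intro ballI)
    fix j z1 assume j: "j \<in> I" "z1 \<in> box j"
    obtain s where s: "s > 0" "\<And>z z'. z \<in> S \<inter> ball z1 s \<Longrightarrow> z' \<in> S \<inter> ball z1 s \<Longrightarrow> t j z = t j z' \<Longrightarrow>
      \<bar>F z - F z'\<bar> \<le> (\<Sum>z\<in>D. \<Lambda> z) * norm (c j z - c j z')" using lF j unfolding lipf_def by meson
    have "\<bar>\<mu> z - \<mu> z'\<bar> \<le> \<bar>F z - F z'\<bar>" for z z' by (auto simp: \<mu>_def min_def)
    then show "\<exists>s>0. \<forall>z\<in>S \<inter> ball z1 s. \<forall>z'\<in>S \<inter> ball z1 s. t j z = t j z' \<longrightarrow> \<bar>\<mu> z - \<mu> z'\<bar> \<le> (\<Sum>z\<in>D. \<Lambda> z) * norm (c j z - c j z')"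
      using s by (intro exI[of _ s]) (meson order_trans)
  qed
  define Z where "Z = (\<Union>z\<in>D. S \<inter> cball z (\<rho> z))"
  define U' where "U' = (\<Union>z\<in>D. S \<inter> ball z (r z))"
  show thesis
  proof (rule that[OF _ ll])
    show "0 \<le> (\<Sum>z\<in>D. \<Lambda> z)" using fr D(1) by (intro sum_nonneg) blast
    show "continuous_on S \<mu>" unfolding \<mu>_def by (intro continuous_intros cF)
    show "0 \<le> \<mu> z \<and> \<mu> z \<le> 1" for z using F0[of z] by (simp add: \<mu>_def)
    show "compact Z" unfolding Z_def using D(2) compact_S by (intro compact_UN compact_Int_closed closed_cball) auto
    show "Z \<subseteq> U" unfolding Z_def using fr D(1) by blast
    show "z \<in> Z" if z: "z \<in> S" "\<mu> z \<noteq> 0" for z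
    proof -
      have "F z \<noteq> 0" using z(2) by (auto simp: \<mu>_def)
      then obtain d where d: "d \<in> D" "f d z \<noteq> 0" unfolding F_def by (meson sum.not_neutral_contains_not_neutral)
      then have "d \<in> A" using D(1) by blast
      from fr[OF this] have "z \<in> cball d (\<rho> d)" using z(1) d(2) by blast
      then show ?thesis unfolding Z_def using z(1) d(1) by blast
    qed
    show "openin (top_of_set S) U'" unfolding U'_def by (intro openin_Union) (auto simp: openin_open_Int)
    show "A \<subseteq> U'" using D(3) AU US by (auto simp: U'_def)
    show "\<mu> z = 1" if zU: "z \<in> U'" for z
    proof -
      obtain d where d: "d \<in> D" "z \<in> S \<inter> ball d (r d)" using zU by (auto simp: U'_def)
      have "1 < f d z" using fr[of d] d D(1) by blast
      also have "f d z \<le> F z" unfolding F_def using fr D by (intro member_le_sum d) auto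
      finally show ?thesis by (simp add: \<mu>_def)
    qed
  qed
qed

section \<open>Extension of the vertical structure over all boxes\<close>

lemma compact_transversal: "i \<in> I \<Longrightarrow> compact (t i ` Bc i)"
  using compact_continuous_image[OF t_cont compact_Bc] .

lemma tot_disc_transversal:
  assumes i: "i \<in> I"
  shows "tot_disc (t i ` Bc i)"
  unfolding tot_disc_def
proof (intro allI impI, elim conjE)
  fix C assume C: "connected C" "C \<subseteq> t i ` Bc i"
  have CB: "C \<subseteq> Bc i" using C(2) t_Bc[OF i] by blast
  have "a = b" if ab: "a \<in> C" "b \<in> C" for a b
  proof -
    have fix_t: "t i w = w" if "w \<in> t i ` Bc i" for w
      using that by (rule imageE) (simp only: t_t[OF i])
    show ?thesis
      using fix_t[OF subsetD[OF C(2) ab(1)]] fix_t[OF subsetD[OF C(2) ab(2)]] conn_t[OF i C(1) CB ab] by metis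
  qed
  then show "\<exists>a. C \<subseteq> {a}" by (metis singleton_iff subsetI)
qed

text \<open>The radii 1/2 of the cores, 3/4 of \<open>Bj\<close> in \<open>vert_extend\<close> and 1
  of the boxes leave room between a core and the edge of its box.\<close>

definition core :: "'i \<Rightarrow> 'm set" where "core i = {z\<in>Bc i. norm (c i z) \<le> 1/2}"

lemma compact_sub_box:
  assumes i: "i \<in> I"
  shows "compact {z\<in>Bc i. norm (c i z) \<le> r}"
proof -
  have "continuous_on (Bc i) (\<lambda>z. norm (c i z))" by (intro continuous_intros c_cont[OF i])
  from continuous_closedin_preimage[OF this closed_atMost[of r]]
  have "closedin (top_of_set (Bc i)) (Bc i \<inter> (\<lambda>z. norm (c i z)) -` {..r})" .
  moreover have "Bc i \<inter> (\<lambda>z. norm (c i z)) -` {..r} = {z\<in>Bc i. norm (c i z) \<le> r}" by auto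
  ultimately show ?thesis using closedin_compact[OF compact_Bc[OF i]] by simp
qed

lemma compact_core: "i \<in> I \<Longrightarrow> compact (core i)"
  unfolding core_def by (rule compact_sub_box)

lemma open_sub_box:
  assumes i: "i \<in> I" and r: "r \<le> 1"
  shows "openin (top_of_set S) {z\<in>Bc i. norm (c i z) < r}"
  unfolding openin_ball_iff
proof (intro conjI ballI)
  show "{z\<in>Bc i. norm (c i z) < r} \<subseteq> S" using Bc_S[OF i] by blast
  fix z assume z: "z \<in> {z\<in>Bc i. norm (c i z) < r}"
  then have zb: "z \<in> box i" using r by (auto simp: box_def)
  obtain q where q: "q > 0" "S \<inter> ball z q \<subseteq> box i" using box_ball[OF i zb] .
  have "r - norm (c i z) > 0" "z \<in> Bc i" using z by auto
  then obtain d where d: "d > 0" "\<And>y. y \<in> Bc i \<Longrightarrow> dist y z < d \<Longrightarrow> dist (c i y) (c i z) < r - norm (c i z)"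
    using c_cont[OF i] unfolding continuous_on_iff by blast
  have "S \<inter> ball z (min q d) \<subseteq> {z\<in>Bc i. norm (c i z) < r}"
  proof
    fix y assume y: "y \<in> S \<inter> ball z (min q d)"
    then have "y \<in> S \<inter> ball z q" by simp
    then have yB: "y \<in> Bc i" using q(2) box_Bc by blast
    have "norm (c i y - c i z) < r - norm (c i z)" using d(2)[OF yB] y by (simp add: dist_commute dist_norm)
    then have "norm (c i y) < r" using norm_triangle_sub[of "c i y" "c i z"] by simp
    then show "y \<in> {z\<in>Bc i. norm (c i z) < r}" using yB by simp
  qed
  then show "\<exists>q>0. S \<inter> ball z q \<subseteq> {z\<in>Bc i. norm (c i z) < r}" using q d by (intro exI[of _ "min q d"]) auto
qed

text \<open>Extension of a vertical structure over one more box: on the box, the old structure, read as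
  projection to a central plaque, is interpolated with the product structure of the box. The
  transverse pieces are taken so small that the interpolation stays close to the identity.\<close>

lemma vert_extend:
  assumes V: "vert V e U" and U: "openin (top_of_set S) U" and AU: "A \<subseteq> U" and A: "compact A"
    and j: "j \<in> I" and e: "e > 0" "(L + 1)\<^sup>2 * e \<le> 1/4"
  obtains V' U' where "vert V' (5 * ((L + 1)\<^sup>2 * e)) U'" "openin (top_of_set S) U'" "A \<union> core j \<subseteq> U'"
proof -
  define e1 where "e1 = (L + 1)\<^sup>2 * e"
  have "(1::real) \<le> (L + 1)\<^sup>2" using L_pos by (simp add: power2_eq_square algebra_simps)
  then have ee1: "e \<le> e1" using e(1) mult_right_mono[of 1 "(L + 1)\<^sup>2" e] by (simp add: e1_def)
  have e1: "e1 > 0" "e1 \<le> 1/4" using ee1 e(1) e(2)[folded e1_def] by linarith+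
  \<comment> \<open>The old relation will be kept on \<open>OA\<close>, where the cutoff is one; at
    points of \<open>S\<close> outside the compact set \<open>Z\<close> in \<open>U\<close> the
    cutoff vanishes.\<close>
  obtain \<mu> \<Lambda> Z OA where cut: "\<Lambda> \<ge> 0" "lipf \<Lambda> \<mu>" "continuous_on S \<mu>" "\<And>z. 0 \<le> \<mu> z \<and> \<mu> z \<le> 1"
    "compact Z" "Z \<subseteq> U" "\<And>z. z \<in> S \<Longrightarrow> \<mu> z \<noteq> 0 \<Longrightarrow> z \<in> Z"
    "openin (top_of_set S) OA" "A \<subseteq> OA" "\<And>z. z \<in> OA \<Longrightarrow> \<mu> z = 1"
    by (rule cutoff[OF A U AU]) (rule that; assumption)
  have OAS: "OA \<subseteq> S" using openin_imp_subset[OF cut(8)] .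
  have OAZ: "OA \<subseteq> Z" using cut(7,10) OAS by (metis one_neq_zero subsetD subsetI)
  have US: "U \<subseteq> S" using openin_imp_subset[OF U] .
  have ZS: "Z \<subseteq> S" using cut(6) US by blast
  define Bj where "Bj = {z\<in>Bc j. norm (c j z) < 3/4}"
  define Zc where "Zc = Z \<inter> {z\<in>Bc j. norm (c j z) \<le> 3/4}"
  have oBj: "openin (top_of_set S) Bj" unfolding Bj_def by (rule open_sub_box[OF j]) simp
  have BjB: "Bj \<subseteq> box j" "Bj \<subseteq> Bc j" by (auto simp: Bj_def box_def)
  have BjS: "Bj \<subseteq> S" using BjB Bc_S[OF j] by blast
  have cZc: "compact Zc" unfolding Zc_def
    by (intro compact_Int_closed cut(5) compact_imp_closed compact_sub_box[OF j])
  have Zc: "Zc \<subseteq> U" "Zc \<subseteq> box j" "Zc \<subseteq> Bc j" "Zc \<subseteq> S" using cut(6) ZS by (auto simp: Zc_def box_def)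
  have ZBj: "z \<in> Zc" if "z \<in> Z" "z \<in> Bj" for z using that by (auto simp: Zc_def Bj_def)
  have loc: "\<exists>N a. lform V e1 j N a \<and> z \<in> N" if z: "z \<in> Zc" for z
  proof -
    obtain i N a where f: "z \<in> N" "lform V e i N a" using V z Zc(1) unfolding vert_def by blast
    have zj: "z \<in> box j" using z Zc by blast
    show ?thesis
      by (rule chart_change[OF f(2,1) e(1) j zj]) (auto simp: e1_def)
  qed
  define Q1 where "Q1 z r \<longleftrightarrow> (\<exists>N a. lform V e1 j N a \<and> S \<inter> ball z r \<subseteq> N)" for z r
  have Q1: "\<exists>r>0. Q1 z r" if z: "z \<in> Zc" for z
  proof -
    obtain N a where f: "lform V e1 j N a" "z \<in> N" using loc[OF z] by blast
    then have "openin (top_of_set S) N" by (simp add: lform_def)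
    then obtain r where "r > 0" "S \<inter> ball z r \<subseteq> N" using f(2) unfolding openin_ball_iff by blast
    then show ?thesis using f(1) unfolding Q1_def by blast
  qed
  obtain s0 where s0: "s0 > 0" "\<And>z. z \<in> Zc \<Longrightarrow> \<exists>y\<in>Zc. \<exists>r>0. Q1 y r \<and> ball z s0 \<subseteq> ball y r"
    by (rule lebesgue_scale[OF cZc Q1]) (assumption, rule that)
  have N0: "\<exists>N a. lform V e1 j N a \<and> S \<inter> ball z s0 \<subseteq> N" if z: "z \<in> Zc" for z
    using s0(2)[OF z] unfolding Q1_def by blast
  \<comment> \<open>The displacement \<open>H\<close> below will be at most \<open>\<eta>\<close>,
    so that the slope \<open>\<Lambda>\<close> of the cutoff contributes at most \<open>e1\<close>
    to the error.\<close>
  define \<eta> where "\<eta> = e1 / (\<Lambda> + 1)"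
  have \<eta>: "\<eta> > 0" "\<Lambda> * \<eta> \<le> e1" using e1 cut(1) by (auto simp: \<eta>_def field_simps)
  obtain s' where s': "s' > 0" "\<And>x y. x \<in> Bc j \<Longrightarrow> y \<in> Bc j \<Longrightarrow> dist x y < s' \<Longrightarrow> dist (c j x) (c j y) < \<eta>"
    using uniform_cont[OF compact_Bc[OF j] c_cont[OF j] \<eta>(1)] by blast
  define s where "s = min s' (s0 / 4)"
  have s: "s > 0" "s \<le> s'" "s \<le> s0 / 4" using s' s0 by (auto simp: s_def)
  \<comment> \<open>Transport exists locally; a Lebesgue scale makes it uniform over
    \<open>Zc\<close>. The target \<open>y\<close> only serves to name a plaque of the box.\<close>
  define Q2 where "Q2 z r \<longleftrightarrow> (\<forall>x\<in>S \<inter> ball z r. \<forall>y\<in>S \<inter> ball z r. \<exists>u\<in>Bc j. dist x u < s \<and> V x u \<and> t j u = t j y)" for z r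
  have Q2: "\<exists>r>0. Q2 z r" if z: "z \<in> Zc" for z
  proof -
    obtain N a where f: "lform V e1 j N a" "z \<in> N" using loc[OF z] by blast
    have "e1 \<le> 1/2" "s/2 > 0" using e1 s by auto
    then obtain d where d: "d > 0" "S \<inter> ball z d \<subseteq> N"
      "\<And>x y. x \<in> S \<inter> ball z d \<Longrightarrow> y \<in> S \<inter> ball z d \<Longrightarrow> \<exists>u\<in>N. dist z u < s/2 \<and> t j u = t j y \<and> a u = a x"
      using transport_local[OF f(1) _ f(2), of "s/2"] by metis
    have "\<exists>u\<in>Bc j. dist x u < s \<and> V x u \<and> t j u = t j y"
      if x: "x \<in> S \<inter> ball z (min d (s/2))" and y: "y \<in> S \<inter> ball z (min d (s/2))" for x y
    proof -
      have xd: "x \<in> S \<inter> ball z d" "y \<in> S \<inter> ball z d" using x y by auto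
      obtain u where u: "u \<in> N" "dist z u < s/2" "t j u = t j y" "a u = a x" using d(3)[OF xd] by blast
      have "x \<in> N" using d(2) xd by blast
      then have "V x u" "u \<in> Bc j" using f(1) u(1,4) box_Bc unfolding lform_def by force+
      moreover have "dist x u < s" using dist_triangle3[of x u z] u(2) x by simp
      ultimately show ?thesis using u(3) by blast
    qed
    then show ?thesis unfolding Q2_def using d(1) s(1) by (intro exI[of _ "min d (s/2)"]) auto
  qed
  obtain \<delta> where \<delta>: "\<delta> > 0" "\<And>z. z \<in> Zc \<Longrightarrow> \<exists>y\<in>Zc. \<exists>r>0. Q2 y r \<and> ball z \<delta> \<subseteq> ball y r"
    by (rule lebesgue_scale[OF cZc Q2]) (assumption, rule that)
  have T0: "\<exists>u\<in>Bc j. dist z u < s \<and> V z u \<and> t j u = t j y" if z: "z \<in> Zc" and y: "y \<in> S" "dist z y < \<delta>" for z y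
  proof -
    obtain x r where x: "Q2 x r" "ball z \<delta> \<subseteq> ball x r" using \<delta>(2)[OF z] by blast
    have "z \<in> ball z \<delta>" "y \<in> ball z \<delta>" using \<delta>(1) y(2) by auto
    then have "z \<in> S \<inter> ball x r" "y \<in> S \<inter> ball x r" using x(2) y(1) z Zc(4) by blast+
    then show ?thesis using x(1) unfolding Q2_def by blast
  qed
  obtain \<delta>2 where \<delta>2: "\<delta>2 > 0" "\<And>z z'. z \<in> Bc j \<Longrightarrow> z' \<in> Bc j \<Longrightarrow> norm (c j z - c j z') < \<delta>2 \<Longrightarrow> dist (t j z) (t j z') < \<delta>2 \<Longrightarrow> dist z z' < \<delta>"
    using ct_close[OF j \<delta>(1)] by blast
  \<comment> \<open>All points over one clopen piece are transported to one central plaque, the one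
    over the chosen point of the piece. The bound \<open>\<delta>2\<close> makes the pieces so small
    that this transport is available.\<close>
  obtain \<kappa> g where \<kappa>: "g > 0" "\<And>w. w \<in> t j ` Bc j \<Longrightarrow> \<kappa> w \<in> t j ` Bc j \<and> dist w (\<kappa> w) < \<delta>2"
    "\<And>w w'. w \<in> t j ` Bc j \<Longrightarrow> w' \<in> t j ` Bc j \<Longrightarrow> dist w w' < g \<Longrightarrow> \<kappa> w = \<kappa> w'"
    using tot_disc_partition[OF compact_transversal[OF j] tot_disc_transversal[OF j] \<delta>2(1)] by metis
  define tgood where "tgood z u \<longleftrightarrow> u \<in> Bc j \<and> dist z u < s \<and> V z u \<and> t j u = \<kappa> (t j z)" for z u
  define tr where "tr z = (SOME u. tgood z u)" for z
  have tr: "tgood z (tr z)" if z: "z \<in> Zc" for z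
  proof -
    have zB: "z \<in> Bc j" using z Zc by blast
    obtain w where w: "w \<in> Bc j" "\<kappa> (t j z) = t j w" using \<kappa>(2)[of "t j z"] zB by blast
    define y where "y = pt j (c j z) (t j w)"
    have y: "y \<in> Bc j" "c j y = c j z" "t j y = t j w"
      using pt[OF j w(1) c_X[OF j zB] c_norm[OF j zB]] by (auto simp: y_def)
    have "dist z y < \<delta>" using \<delta>2(2)[OF zB y(1)] y(2,3) \<delta>2(1) \<kappa>(2)[of "t j z"] zB w(2) by simp
    then obtain u where "u \<in> Bc j" "dist z u < s" "V z u" "t j u = t j y" using T0[OF z] y(1) Bc_S[OF j] by blast
    then have "tgood z u" using w(2) y(3) by (simp add: tgood_def)
    then show ?thesis unfolding tr_def by (rule someI)
  qed
  \<comment> \<open>With weight one, \<open>c j z + H z\<close> is the coordinate of the transported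
    point, which represents the old structure; with weight zero only the product coordinate
    \<open>c j\<close> remains.\<close>
  define H where "H z = (if z \<in> Zc then c j (tr z) - c j z else 0)" for z
  define E where "E z = \<mu> z *\<^sub>R H z" for z
  define a' where "a' z = c j z + E z" for z
  have HX: "H z \<in> X" for z
  proof (cases "z \<in> Zc")
    case True
    then have "tr z \<in> Bc j" "z \<in> Bc j" using tr[OF True] Zc by (auto simp: tgood_def)
    then show ?thesis using True X_diff c_X[OF j] by (simp add: H_def)
  next
    case False
    then show ?thesis using subspace_0[OF subspace_X] by (simp add: H_def)
  qed
  have H\<eta>: "norm (H z) \<le> \<eta>" for z
  proof (cases "z \<in> Zc")
    case True
    then have "tr z \<in> Bc j" "z \<in> Bc j" "dist z (tr z) < s'" using tr[OF True] Zc s(2) by (auto simp: tgood_def)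
    then have "dist (c j z) (c j (tr z)) < \<eta>" using s'(2) by blast
    then show ?thesis using True by (simp add: H_def dist_norm norm_minus_commute)
  qed (use \<eta>(1) in \<open>simp add: H_def\<close>)
  \<comment> \<open>With \<open>s \<le> s0 / 4\<close>, two points closer than \<open>s0 / 2\<close>
    and their transports lie in the domain of one form.\<close>
  have near: "\<exists>N a. lform V e1 j N a \<and> z \<in> N \<and> z' \<in> N \<and> tr z \<in> N \<and> (z' \<in> Zc \<longrightarrow> tr z' \<in> N)"
    if z: "z \<in> Zc" "z' \<in> S" "dist z z' < s0 / 2" for z z'
  proof -
    obtain N a where f: "lform V e1 j N a" "S \<inter> ball z s0 \<subseteq> N" using N0[OF z(1)] by blast
    have "tr z \<in> S" "dist z (tr z) < s" using tr[OF z(1)] Bc_S[OF j] by (auto simp: tgood_def)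
    moreover have "tr z' \<in> S \<and> dist z' (tr z') < s" if "z' \<in> Zc" using tr[OF that] Bc_S[OF j] by (auto simp: tgood_def)
    moreover have "dist z (tr z') \<le> dist z z' + dist z' (tr z')" by (rule dist_triangle)
    ultimately have "z \<in> S \<inter> ball z s0" "z' \<in> S \<inter> ball z s0" "tr z \<in> S \<inter> ball z s0" "z' \<in> Zc \<longrightarrow> tr z' \<in> S \<inter> ball z s0"
      using z s(3) s0(1) Zc(4) by auto
    then show ?thesis using f by blast
  qed
  \<comment> \<open>As \<open>e1 \<le> 1/4\<close>, transport enlarges increments along a plaque at
    most by the factor 3; the errors on the two plaques then add up to
    \<open>e1 + 3 * e1\<close>.\<close>
  have Hlip: "norm (H z - H z') \<le> 4 * e1 * norm (c j z - c j z')"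
    if z: "z \<in> Zc" "z' \<in> Zc" "dist z z' < s0 / 2" "t j z = t j z'" for z z'
  proof -
    obtain N a where f: "lform V e1 j N a" "z \<in> N" "z' \<in> N" "tr z \<in> N" "tr z' \<in> N"
      using near[OF z(1) subsetD[OF Zc(4) z(2)] z(3)] z(2) by blast
    define D1 where "D1 = c j z - c j z'"
    define D2 where "D2 = c j (tr z) - c j (tr z')"
    define Da where "Da = a z - a z'"
    have tg: "V z (tr z)" "V z' (tr z')" "t j (tr z) = t j (tr z')" using tr[OF z(1)] tr[OF z(2)] z(4) by (auto simp: tgood_def)
    have ker: "a z = a (tr z)" "a z' = a (tr z')" using f tg(1,2) unfolding lform_def by blast+
    have 1: "norm (Da - D1) \<le> e1 * norm D1" unfolding Da_def D1_def using f(1,2,3) z(4) unfolding lform_def by blast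
    have "norm ((a (tr z) - a (tr z')) - (c j (tr z) - c j (tr z'))) \<le> e1 * norm (c j (tr z) - c j (tr z'))"
      using f(1,4,5) tg(3) unfolding lform_def by blast
    then have 2: "norm (Da - D2) \<le> e1 * norm D2" by (simp add: Da_def D2_def ker)
    have "norm (D2 - D1) \<le> norm (Da - D1) + norm (Da - D2)"
      using norm_triangle_ineq4[of "Da - D1" "Da - D2"] by simp
    then have 3: "norm (D2 - D1) \<le> e1 * norm D1 + e1 * norm D2" using 1 2 by linarith
    have q: "e1 * norm D2 \<le> 1/4 * norm D2" "e1 * norm D1 \<le> 1/4 * norm D1" using e1(2) by (intro mult_right_mono; simp)+
    have "norm D2 \<le> norm D1 + norm (D2 - D1)" by (rule norm_triangle_sub)
    then have "norm D2 \<le> 3 * norm D1" using 3 q norm_ge_zero[of D1] by linarith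
    then have "e1 * norm D2 \<le> e1 * (3 * norm D1)" using e1(1) by (intro mult_left_mono) auto
    then have "norm (D2 - D1) \<le> 4 * e1 * norm D1" using 3 by simp
    moreover have "H z - H z' = D2 - D1" using z(1,2) by (simp add: H_def D1_def D2_def)
    ultimately show ?thesis by (simp add: D1_def)
  qed
  have Elip0: "norm (E z - E z') \<le> \<bar>\<mu> z - \<mu> z'\<bar> * \<eta> + 4 * e1 * norm (c j z - c j z')"
    if z: "z \<in> Bj" "z' \<in> Bj" "dist z z' < s0 / 2" "t j z = t j z'" for z z'
  proof -
    have zero: "E x = 0 \<and> \<mu> x = 0" if "x \<in> Bj" "x \<notin> Zc" for x
    proof -
      have "\<mu> x = 0" using that cut(7)[of x] ZBj[of x] BjS by blast
      then show ?thesis by (simp add: E_def)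
    qed
    have single: "norm (E x) = \<bar>\<mu> x\<bar> * norm (H x)" for x by (simp add: E_def)
    have bd: "\<bar>\<mu> x\<bar> * norm (H x) \<le> \<bar>\<mu> x\<bar> * \<eta>" for x using H\<eta>[of x] by (intro mult_left_mono) auto
    have nn: "0 \<le> 4 * e1 * norm (c j z - c j z')" using e1(1) by simp
    show ?thesis
    proof (cases "z \<in> Zc \<and> z' \<in> Zc")
      case True
      have "E z - E z' = (\<mu> z - \<mu> z') *\<^sub>R H z + \<mu> z' *\<^sub>R (H z - H z')" by (simp add: E_def algebra_simps)
      then have "norm (E z - E z') \<le> \<bar>\<mu> z - \<mu> z'\<bar> * norm (H z) + \<bar>\<mu> z'\<bar> * norm (H z - H z')"
        using norm_triangle_ineq[of "(\<mu> z - \<mu> z') *\<^sub>R H z" "\<mu> z' *\<^sub>R (H z - H z')"] by simp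
      also have "\<dots> \<le> \<bar>\<mu> z - \<mu> z'\<bar> * \<eta> + 1 * norm (H z - H z')"
        using H\<eta>[of z] cut(4)[of z'] by (intro add_mono mult_left_mono mult_right_mono) auto
      finally show ?thesis using Hlip[of z z'] True z by simp
    next
      case False
      then consider "z \<notin> Zc" | "z' \<notin> Zc" by blast
      then show ?thesis
      proof cases
        case 1
        then show ?thesis using zero[OF z(1)] single[of z'] bd[of z'] nn by simp
      next
        case 2
        then show ?thesis using zero[OF z(2)] single[of z] bd[of z] nn by simp
      qed
    qed
  qed
  \<comment> \<open>Where the cutoff vanishes, boundedness of \<open>H\<close> is enough. Elsewhere
    nearby points of \<open>Bj\<close> lie in \<open>Zc\<close> and are transported to a common
    plaque, on which \<open>a\<close> controls the coordinate; so the transported coordinate is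
    continuous there.\<close>
  have contE: "continuous_on Bj E"
    unfolding continuous_on_iff
  proof (intro ballI allI impI)
    fix z1 and \<epsilon> :: real assume z1: "z1 \<in> Bj" and \<epsilon>: "\<epsilon> > 0"
    have z1S: "z1 \<in> S" using z1 BjS by blast
    have "\<epsilon> / (2 * \<eta>) > 0" using \<epsilon> \<eta> by simp
    then obtain d1 where d1: "d1 > 0" "\<And>z. z \<in> S \<Longrightarrow> dist z z1 < d1 \<Longrightarrow> dist (\<mu> z) (\<mu> z1) < \<epsilon> / (2 * \<eta>)"
      using cut(3) z1S unfolding continuous_on_iff by blast
    have first: "norm ((\<mu> z - \<mu> z1) *\<^sub>R H z) < \<epsilon> / 2" if "z \<in> S" "dist z z1 < d1" for z
    proof -
      have "norm ((\<mu> z - \<mu> z1) *\<^sub>R H z) \<le> \<bar>\<mu> z - \<mu> z1\<bar> * \<eta>" using H\<eta>[of z] by (simp add: mult_left_mono)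
      also have "\<dots> < \<epsilon> / (2 * \<eta>) * \<eta>" using d1(2)[OF that] \<eta>(1) by (intro mult_strict_right_mono) (auto simp: dist_real_def)
      finally show ?thesis using \<eta>(1) by simp
    qed
    have split: "E z - E z1 = (\<mu> z - \<mu> z1) *\<^sub>R H z + \<mu> z1 *\<^sub>R (H z - H z1)" for z by (simp add: E_def algebra_simps)
    show "\<exists>d>0. \<forall>z\<in>Bj. dist z z1 < d \<longrightarrow> dist (E z) (E z1) < \<epsilon>"
    proof (cases "\<mu> z1 = 0")
      case True
      have "dist (E z) (E z1) < \<epsilon>" if "z \<in> Bj" "dist z z1 < d1" for z
      proof -
        have "z \<in> S" using that BjS by blast
        then show ?thesis using first[of z] that(2) split[of z] True \<epsilon> by (simp add: dist_norm)
      qed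
      then show ?thesis using d1(1) by blast
    next
      case False
      then have z1Z: "z1 \<in> Zc" using cut(7)[OF z1S] ZBj z1 by blast
      have z1B: "z1 \<in> Bc j" using z1 BjB by blast
      obtain N a where f: "lform V e1 j N a" "S \<inter> ball z1 s0 \<subseteq> N" using N0[OF z1Z] by blast
      have z1N: "z1 \<in> N" using f(2) z1S s0(1) by auto
      have "\<bar>\<mu> z1\<bar> > 0" using False by simp
      then obtain d2 where d2: "d2 > 0" "\<And>z. z \<in> S \<Longrightarrow> dist z z1 < d2 \<Longrightarrow> dist (\<mu> z) (\<mu> z1) < \<bar>\<mu> z1\<bar>"
        using cut(3) z1S unfolding continuous_on_iff by blast
      have e8: "\<epsilon>/8 > 0" using \<epsilon> by simp
      have ca: "continuous_on N a" using f(1) by (simp add: lform_def)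
      obtain d3 where d3: "d3 > 0" "\<And>z. z \<in> N \<Longrightarrow> dist z z1 < d3 \<Longrightarrow> dist (a z) (a z1) < \<epsilon>/8"
        using ca z1N e8 unfolding continuous_on_iff by blast
      obtain d4 where d4: "d4 > 0" "\<And>z. z \<in> Bc j \<Longrightarrow> dist z z1 < d4 \<Longrightarrow> dist (c j z) (c j z1) < \<epsilon>/8"
        using c_cont[OF j] z1B e8 unfolding continuous_on_iff by blast
      obtain d5 where d5: "d5 > 0" "\<And>z. z \<in> Bc j \<Longrightarrow> dist z z1 < d5 \<Longrightarrow> dist (t j z) (t j z1) < g"
        using t_cont[OF j] z1B \<kappa>(1) unfolding continuous_on_iff by blast
      define d where "d = min (min d1 d2) (min (min d3 d4) (min d5 (s0/2)))"
      have d: "d > 0" "d \<le> d1" "d \<le> d2" "d \<le> d3" "d \<le> d4" "d \<le> d5" "d \<le> s0/2"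
        using d1 d2 d3 d4 d5 s0 by (auto simp: d_def)
      have "dist (E z) (E z1) < \<epsilon>" if z: "z \<in> Bj" "dist z z1 < d" for z
      proof -
        have zS: "z \<in> S" "z \<in> Bc j" using z BjS BjB by blast+
        have "\<mu> z \<noteq> 0" using d2(2)[OF zS(1)] z(2) d(3) by (auto simp: dist_real_def)
        then have zZ: "z \<in> Zc" using cut(7)[OF zS(1)] ZBj z(1) by blast
        have trS: "tr z \<in> S" "tr z1 \<in> S" "dist z (tr z) < s" "dist z1 (tr z1) < s" "V z (tr z)" "V z1 (tr z1)"
            "t j (tr z) = \<kappa> (t j z)" "t j (tr z1) = \<kappa> (t j z1)"
          using tr[OF zZ] tr[OF z1Z] Bc_S[OF j] by (auto simp: tgood_def)
        have "dist z1 (tr z) < s0" using dist_triangle[of z1 "tr z" z] trS(3) z(2) d(7) s(3) s0(1) by (simp add: dist_commute)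
        moreover have "dist z1 (tr z1) < s0" "dist z1 z < s0" using trS(4) s(3) z(2) d(7) s0(1) by (auto simp: dist_commute)
        ultimately have inN: "z \<in> N" "tr z \<in> N" "tr z1 \<in> N" using f(2) zS trS by auto
        have ker: "a z = a (tr z)" "a z1 = a (tr z1)" using f(1) inN z1N trS(5,6) unfolding lform_def by blast+
        have tt: "t j (tr z) = t j (tr z1)"
          using trS(7,8) \<kappa>(3)[of "t j z" "t j z1"] d5(2)[OF zS(2)] z(2) d(6) zS(2) z1B by simp
        define D2 where "D2 = c j (tr z) - c j (tr z1)"
        have "norm ((a (tr z) - a (tr z1)) - D2) \<le> e1 * norm D2"
          unfolding D2_def using f(1) inN tt unfolding lform_def by blast
        then have "norm ((a z - a z1) - D2) \<le> 1/4 * norm D2"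
          using mult_right_mono[OF e1(2), of "norm D2"] ker by simp
        moreover have "norm D2 \<le> norm (a z - a z1) + norm (D2 - (a z - a z1))" by (rule norm_triangle_sub)
        ultimately have "norm D2 \<le> 2 * norm (a z - a z1)" using norm_minus_commute[of D2 "a z - a z1"] norm_ge_zero[of D2] by linarith
        then have n1: "norm D2 < \<epsilon>/4" using d3(2)[OF inN(1)] z(2) d(4) by (simp add: dist_norm)
        have n2: "norm (c j z - c j z1) < \<epsilon>/8" using d4(2)[OF zS(2)] z(2) d(5) by (simp add: dist_norm)
        have "H z - H z1 = D2 - (c j z - c j z1)" using zZ z1Z by (simp add: H_def D2_def)
        then have "norm (H z - H z1) \<le> norm D2 + norm (c j z - c j z1)" by (metis norm_triangle_ineq4)
        then have "norm (H z - H z1) < \<epsilon>/2" using n1 n2 \<epsilon> by linarith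
        moreover have "norm (\<mu> z1 *\<^sub>R (H z - H z1)) \<le> 1 * norm (H z - H z1)"
          unfolding norm_scaleR using cut(4)[of z1] by (intro mult_right_mono) auto
        ultimately have "norm (\<mu> z1 *\<^sub>R (H z - H z1)) < \<epsilon>/2" by simp
        moreover have "norm ((\<mu> z - \<mu> z1) *\<^sub>R H z) < \<epsilon>/2" using first[OF zS(1)] z(2) d(2) by simp
        ultimately show ?thesis unfolding dist_norm split
          using norm_triangle_ineq[of "(\<mu> z - \<mu> z1) *\<^sub>R H z" "\<mu> z1 *\<^sub>R (H z - H z1)"] by linarith
      qed
      then show ?thesis using d(1) by blast
    qed
  qed
  obtain s1' where s1': "s1' > 0" "\<And>x y. x \<in> Bc j \<Longrightarrow> y \<in> Bc j \<Longrightarrow> dist x y < s1' \<Longrightarrow> dist (t j x) (t j y) < g"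
    using uniform_cont[OF compact_Bc[OF j] t_cont[OF j] \<kappa>(1)] by blast
  define s1 where "s1 = min s1' (s0/2)"
  have s1: "s1 > 0" "s1 \<le> s1'" "s1 \<le> s0/2" using s1' s0 by (auto simp: s1_def)
  have same: "\<kappa> (t j z) = \<kappa> (t j y)" if "z \<in> Bj" "y \<in> Bj" "dist z y < s1" for z y
  proof -
    have "z \<in> Bc j" "y \<in> Bc j" using that BjB by auto
    then show ?thesis using \<kappa>(3)[of "t j z" "t j y"] s1'(2)[of z y] that(3) s1(2) by simp
  qed
  \<comment> \<open>On a fixed central plaque both the coordinate and \<open>a\<close> are
    injective, so the old and the new relation say the same thing: the transported points
    coincide.\<close>
  have agree: "V z y \<longleftrightarrow> a' z = a' y" if z: "z \<in> OA" "y \<in> OA" "z \<in> Bj" "y \<in> Bj" "dist z y < s1" for z y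
  proof -
    have zy: "z \<in> Zc" "y \<in> Zc" "y \<in> S" using z OAZ ZBj OAS by auto
    obtain N a where f: "lform V e1 j N a" "z \<in> N" "y \<in> N" "tr z \<in> N" "tr y \<in> N"
      using near[OF zy(1,3)] z(5) s1(3) zy(2) by auto
    have tg: "V z (tr z)" "V y (tr y)" "t j (tr z) = \<kappa> (t j z)" "t j (tr y) = \<kappa> (t j y)" "tr z \<in> Bc j" "tr y \<in> Bc j"
      using tr[OF zy(1)] tr[OF zy(2)] by (auto simp: tgood_def)
    have tt: "t j (tr z) = t j (tr y)" using tg same[OF z(3,4,5)] by simp
    have ker: "V z y \<longleftrightarrow> a z = a y" "a z = a (tr z)" "a y = a (tr y)" using f tg(1,2) unfolding lform_def by blast+
    have "a' z = c j (tr z)" "a' y = c j (tr y)"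
      using zy cut(10)[OF z(1)] cut(10)[OF z(2)] by (simp_all add: a'_def E_def H_def)
    then have "a' z = a' y \<longleftrightarrow> tr z = tr y" using ct_inj[OF j tg(5,6) _ tt] by auto
    moreover have "a (tr z) = a (tr y) \<longleftrightarrow> tr z = tr y"
      using lform_inj[OF f(1) _ f(4,5) tt] e1(2) by auto
    ultimately show ?thesis using ker by simp
  qed
  \<comment> \<open>Values of \<open>a'\<close> are compared only within one clopen piece, because
    over different pieces they refer to different central plaques.\<close>
  define V' where "V' z y \<longleftrightarrow> (z \<in> OA \<and> y \<in> OA \<and> V z y) \<or> (z \<in> Bj \<and> y \<in> Bj \<and> \<kappa> (t j z) = \<kappa> (t j y) \<and> a' z = a' y)" for z y
  \<comment> \<open>The factor 5 consists of \<open>e1\<close> from the slope of the cutoff and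
    \<open>4 * e1\<close> from \<open>Hlip\<close>.\<close>
  have "vert V' (5 * e1) (OA \<union> Bj)"
    unfolding vert_def
  proof
    fix z0 assume z0: "z0 \<in> OA \<union> Bj"
    show "\<exists>i N a. z0 \<in> N \<and> N \<subseteq> OA \<union> Bj \<and> lform V' (5 * e1) i N a"
    proof (cases "z0 \<in> Bj")
      case True
      obtain r where r: "r > 0" "\<And>z z'. z \<in> S \<inter> ball z0 r \<Longrightarrow> z' \<in> S \<inter> ball z0 r \<Longrightarrow> t j z = t j z' \<Longrightarrow>
        \<bar>\<mu> z - \<mu> z'\<bar> \<le> \<Lambda> * norm (c j z - c j z')"
        using cut(2) j True BjB(1) unfolding lipf_def by (meson subsetD)
      define N where "N = Bj \<inter> ball z0 (min r (s1/2))"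
      have N: "N \<subseteq> Bj" "N \<subseteq> S \<inter> ball z0 r" using BjS by (auto simp: N_def)
      have dN: "dist z y < s1" if "z \<in> N" "y \<in> N" for z y
        using that dist_triangle3[of z y z0] by (auto simp: N_def)
      have "lform V' (5 * e1) j N a'"
        unfolding lform_def
      proof (intro conjI ballI impI)
        show "j \<in> I" by (rule j)
        show "openin (top_of_set S) N" unfolding N_def by (rule openin_ball_Int[OF oBj])
        show "N \<subseteq> box j" using N BjB by blast
        show "continuous_on N a'"
          unfolding a'_def
          by (intro continuous_on_add continuous_on_subset[OF c_cont[OF j]] continuous_on_subset[OF contE])
            (use N BjB in blast)+
        show "a' ` N \<subseteq> X"
        proof
          fix v assume "v \<in> a' ` N"
          then obtain z where "z \<in> N" "v = a' z" by blast
          then show "v \<in> X" using X_add[OF c_X[OF j] X_scale[OF HX]] N BjB by (auto simp: a'_def E_def)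
        qed
        fix z y assume zy: "z \<in> N" "y \<in> N"
        have zyB: "z \<in> Bj" "y \<in> Bj" using zy N by auto
        show "V' z y \<longleftrightarrow> a' z = a' y"
          using agree[OF _ _ zyB dN[OF zy]] same[OF zyB dN[OF zy]] zyB by (auto simp: V'_def)
        assume tt: "t j z = t j y"
        have ds: "dist z y < s0/2" using dN[OF zy] s1(3) by simp
        have "\<bar>\<mu> z - \<mu> y\<bar> \<le> \<Lambda> * norm (c j z - c j y)"
          using r(2)[OF subsetD[OF N(2) zy(1)] subsetD[OF N(2) zy(2)] tt] .
        then have "\<bar>\<mu> z - \<mu> y\<bar> * \<eta> \<le> (\<Lambda> * norm (c j z - c j y)) * \<eta>"
          using \<eta>(1) by (intro mult_right_mono) auto
        also have "\<dots> = (\<Lambda> * \<eta>) * norm (c j z - c j y)" by simp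
        also have "\<dots> \<le> e1 * norm (c j z - c j y)" using \<eta>(2) by (intro mult_right_mono) auto
        finally have "norm (E z - E y) \<le> 5 * e1 * norm (c j z - c j y)"
          using Elip0[OF zyB ds tt] by simp
        moreover have "(a' z - a' y) - (c j z - c j y) = E z - E y" by (simp add: a'_def)
        ultimately show "norm ((a' z - a' y) - (c j z - c j y)) \<le> 5 * e1 * norm (c j z - c j y)" by metis
      qed
      moreover have "z0 \<in> N" using True r s1 by (simp add: N_def)
      ultimately show ?thesis using N(1) by blast
    next
      case False
      then have z0A: "z0 \<in> OA" using z0 by blast
      then have "z0 \<in> U" using OAZ cut(6) by blast
      then obtain i N a where f: "z0 \<in> N" "lform V e i N a" using V unfolding vert_def by blast
      define N' where "N' = (N \<inter> OA) \<inter> ball z0 (s1/2)"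
      have oN: "openin (top_of_set S) N" using f(2) by (simp add: lform_def)
      have oN': "openin (top_of_set S) N'" unfolding N'_def by (intro openin_ball_Int openin_Int oN cut(8))
      have N': "N' \<subseteq> N" "N' \<subseteq> OA" by (auto simp: N'_def)
      have f': "lform V (5 * e1) i N' a"
        by (rule lform_mono[OF lform_subset[OF f(2) oN' N'(1)]]) (use ee1 e1 in simp)
      have "V' z y \<longleftrightarrow> V z y" if zy: "z \<in> N'" "y \<in> N'" for z y
      proof -
        have "dist z y < s1" using zy dist_triangle3[of z y z0] by (auto simp: N'_def)
        moreover have "z \<in> OA" "y \<in> OA" using zy N' by auto
        ultimately show ?thesis using agree[of z y] by (auto simp: V'_def)
      qed
      then have "lform V' (5 * e1) i N' a" using f' unfolding lform_def by simp
      moreover have "z0 \<in> N'" using f(1) z0A s1 by (simp add: N'_def)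
      ultimately show ?thesis using N'(2) by blast
    qed
  qed
  moreover have "openin (top_of_set S) (OA \<union> Bj)" using cut(8) oBj by (rule openin_Un)
  moreover have "core j \<subseteq> Bj" by (auto simp: core_def Bj_def)
  then have "A \<union> core j \<subseteq> OA \<union> Bj" using cut(9) by blast
  ultimately show thesis using that unfolding e1_def by blast
qed

lemma vert_exists:
  assumes J: "J \<subseteq> I" and e: "e > 0"
  shows "\<exists>V U. vert V e U \<and> openin (top_of_set S) U \<and> (\<Union>j\<in>J. core j) \<subseteq> U"
proof -
  have "finite J" using J finite_I finite_subset by blast
  then show ?thesis using J e
  proof (induction J arbitrary: e)
    case empty
    have "vert V e {}" for V by (simp add: vert_def)
    then show ?case by (intro exI[of _ "\<lambda>_ _. True"] exI[of _ "{}"]) simp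
  next
    case (insert j J)
    define K where "K = (L + 1)\<^sup>2"
    have K: "K > 0" using L_pos by (simp add: K_def)
    \<comment> \<open>Anticipates the growth by \<open>5 * K\<close> in the next extension and
      respects the threshold 1/4 of \<open>vert_extend\<close>.\<close>
    define e' where "e' = min (e / (5 * K)) (1 / (4 * K))"
    have e': "e' > 0" "5 * (K * e') \<le> e" "K * e' \<le> 1/4"
    proof -
      show "e' > 0" using insert.prems K by (simp add: e'_def)
      have "e' \<le> e / (5 * K)" "e' \<le> 1 / (4 * K)" by (auto simp: e'_def)
      then show "5 * (K * e') \<le> e" "K * e' \<le> 1/4" using K by (auto simp: field_simps)
    qed
    obtain V U where V: "vert V e' U" "openin (top_of_set S) U" "(\<Union>j\<in>J. core j) \<subseteq> U"
      using insert.IH[of e'] insert.prems e'(1) by auto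
    have cA: "compact (\<Union>j\<in>J. core j)"
      using insert.hyps insert.prems by (intro compact_UN compact_core) auto
    have jI: "j \<in> I" using insert.prems by simp
    obtain V' U' where V': "vert V' (5 * (K * e')) U'" "openin (top_of_set S) U'" "(\<Union>j\<in>J. core j) \<union> core j \<subseteq> U'"
      using vert_extend[OF V cA jI e'(1)] e'(3) unfolding K_def by metis
    have "vert V' e U'" using V'(1) lform_mono[OF _ e'(2)] unfolding vert_def by meson
    then show ?case using V' by (intro exI[of _ V'] exI[of _ U']) auto
  qed
qed

theorem vert_total:
  assumes e: "e > 0"
  obtains V where "vert V e S"
proof -
  obtain V U where V: "vert V e U" "openin (top_of_set S) U" "(\<Union>j\<in>I. core j) \<subseteq> U"
    using vert_exists[OF order_refl e] by blast
  have "S \<subseteq> (\<Union>j\<in>I. core j)" using cover by (force simp: core_def)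
  then have "U = S" using V(2,3) openin_imp_subset by blast
  then show thesis using that V(1) by blast
qed

section \<open>From local forms to a vertical structure on the whole space\<close>

lemma plaque_segment_uniform:
  assumes e: "e > 0"
  obtains d where "d > 0" "\<And>i z z'. i \<in> I \<Longrightarrow> z \<in> Bc i \<Longrightarrow> z' \<in> Bc i \<Longrightarrow> t i z = t i z' \<Longrightarrow> dist z z' < d \<Longrightarrow>
    \<exists>C. connected C \<and> z \<in> C \<and> z' \<in> C \<and> C \<subseteq> Bc i \<and> C \<subseteq> ball z e"
proof -
  have "\<exists>d>0. \<forall>z\<in>Bc i. \<forall>z'\<in>Bc i. t i z = t i z' \<longrightarrow> dist z z' < d \<longrightarrow>
    (\<exists>C. connected C \<and> z \<in> C \<and> z' \<in> C \<and> C \<subseteq> Bc i \<and> C \<subseteq> ball z e)" if i: "i \<in> I" for i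
  proof -
    obtain r where r: "r > 0" "\<And>z z'. z \<in> Bc i \<Longrightarrow> z' \<in> Bc i \<Longrightarrow> t i z = t i z' \<Longrightarrow> norm (c i z - c i z') < r \<Longrightarrow>
      \<exists>C. connected C \<and> z \<in> C \<and> z' \<in> C \<and> C \<subseteq> Bc i \<and> C \<subseteq> ball z e"
      by (rule plaque_segment[OF i e]) (rule that; assumption)
    obtain d where d: "d > 0" "\<And>x y. x \<in> Bc i \<Longrightarrow> y \<in> Bc i \<Longrightarrow> dist x y < d \<Longrightarrow> dist (c i x) (c i y) < r"
      using uniform_cont[OF compact_Bc[OF i] c_cont[OF i] r(1)] by blast
    show ?thesis using d r(2) unfolding dist_norm by (intro exI[of _ d]) auto
  qed
  then obtain D where D: "\<And>i. i \<in> I \<Longrightarrow> D i > 0 \<and> (\<forall>z\<in>Bc i. \<forall>z'\<in>Bc i. t i z = t i z' \<longrightarrow> dist z z' < D i \<longrightarrow>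
    (\<exists>C. connected C \<and> z \<in> C \<and> z' \<in> C \<and> C \<subseteq> Bc i \<and> C \<subseteq> ball z e))" by metis
  define d where "d = Min (insert 1 (D ` I))"
  have d: "d > 0" "\<And>i. i \<in> I \<Longrightarrow> d \<le> D i"
  proof -
    show "d > 0" unfolding d_def using finite_I D by (subst Min_gr_iff) auto
    show "d \<le> D i" if "i \<in> I" for i unfolding d_def using finite_I that by (intro Min_le) auto
  qed
  show thesis
  proof (rule that[OF d(1)])
    fix i z z' assume i: "i \<in> I" and z: "z \<in> Bc i" "z' \<in> Bc i" "t i z = t i z'" "dist z z' < d"
    have "dist z z' < D i" using z(4) d(2)[OF i] by simp
    then show "\<exists>C. connected C \<and> z \<in> C \<and> z' \<in> C \<and> C \<subseteq> Bc i \<and> C \<subseteq> ball z e" using D[OF i] z(1-3) by blast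
  qed
qed

definition same_plaque :: "'m \<Rightarrow> 'm \<Rightarrow> bool" where
  "same_plaque x y \<longleftrightarrow> (\<exists>i\<in>I. x \<in> box i \<and> y \<in> box i \<and> t i x = t i y)"

text \<open>One scale \<open>s\<close> admits a form around every point, and below \<open>R\<close>
  both relations are read off in that form. The axioms of \<open>vertical_manifold\<close> thereby
  become statements about the maps \<open>t i\<close> and \<open>a\<close>.\<close>

theorem solenoid_and_dense_chains:
  shows "homeomorphic_to_McCord_solenoid n (top_of_set S)"
    and "x0 \<in> S \<Longrightarrow> u0 \<in> S \<Longrightarrow> e > 0 \<Longrightarrow> \<exists>y. same_plaque\<^sup>*\<^sup>* x0 y \<and> dist y u0 < e"
proof -
  obtain V where V: "vert V (1/2) S" using vert_total[of "1/2"] by auto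
  define Q where "Q z r \<longleftrightarrow> (\<exists>i N a. lform V (1/2) i N a \<and> S \<inter> ball z r \<subseteq> N)" for z r
  have Q: "\<exists>r>0. Q z r" if z: "z \<in> S" for z
  proof -
    obtain i N a where f: "z \<in> N" "lform V (1/2) i N a" using V z unfolding vert_def by blast
    then have "openin (top_of_set S) N" by (simp add: lform_def)
    then obtain r where "r > 0" "S \<inter> ball z r \<subseteq> N" using f(1) unfolding openin_ball_iff by blast
    then show ?thesis using f(2) unfolding Q_def by blast
  qed
  obtain s where s: "s > 0" "\<And>z. z \<in> S \<Longrightarrow> \<exists>y\<in>S. \<exists>r>0. Q y r \<and> ball z s \<subseteq> ball y r"
    by (rule lebesgue_scale[OF compact_S Q]) (assumption, rule that)
  have chart: "\<exists>i N a. lform V (1/2) i N a \<and> S \<inter> ball z s \<subseteq> N" if "z \<in> S" for z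
    using s(2)[OF that] unfolding Q_def by blast
  have s8: "s/8 > 0" using s by simp
  obtain \<delta> where \<delta>: "\<delta> > 0" "\<And>i z z'. i \<in> I \<Longrightarrow> z \<in> Bc i \<Longrightarrow> z' \<in> Bc i \<Longrightarrow> t i z = t i z' \<Longrightarrow> dist z z' < \<delta> \<Longrightarrow>
    \<exists>C. connected C \<and> z \<in> C \<and> z' \<in> C \<and> C \<subseteq> Bc i \<and> C \<subseteq> ball z (s/8)"
    by (rule plaque_segment_uniform[OF s8]) (rule that; assumption)
  \<comment> \<open>Defined by small connected sets without reference to charts, so that it is one
    relation on all of \<open>S\<close>; \<open>iff\<close> identifies it with equality of
    \<open>t i\<close> at scale \<open>R\<close>.\<close>
  define P where "P x y \<longleftrightarrow> (\<exists>C. connected C \<and> x \<in> C \<and> y \<in> C \<and> C \<subseteq> S \<and> (\<forall>u\<in>C. \<forall>v\<in>C. dist u v < s/2))" for x y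
  define R where "R = min \<delta> (s/4)"
  have R: "R > 0" "R \<le> \<delta>" "R \<le> s/4" using \<delta> s by (auto simp: R_def)
  have inN: "y \<in> N" if "S \<inter> ball z s \<subseteq> N" "y \<in> S" "dist z y < s" for y z N using that by auto
  have iff: "x \<in> N \<and> y \<in> N \<and> (P x y \<longleftrightarrow> t i x = t i y) \<and> (V x y \<longleftrightarrow> a x = a y)"
    if f: "lform V (1/2) i N a" "S \<inter> ball z s \<subseteq> N" and z: "z \<in> S" "x \<in> S" "y \<in> S" "dist z x \<le> s/4" "dist x y < R" for i N a z x y
  proof -
    have i: "i \<in> I" and NB: "N \<subseteq> Bc i" using f(1) box_Bc unfolding lform_def by blast+
    have xN: "x \<in> N" using inN[OF f(2) z(2)] z(4) s(1) by simp
    have "dist z y < s" using dist_triangle[of z y x] z(4,5) R(3) s(1) by linarith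
    then have yN: "y \<in> N" using inN[OF f(2) z(3)] by simp
    have "P x y \<longleftrightarrow> t i x = t i y"
    proof
      assume "P x y"
      then obtain C where C: "connected C" "x \<in> C" "y \<in> C" "C \<subseteq> S" "\<forall>u\<in>C. \<forall>v\<in>C. dist u v < s/2" by (auto simp: P_def)
      have "C \<subseteq> N"
      proof
        fix u assume u: "u \<in> C"
        then have "dist x u < s/2" using C by blast
        then have "dist z u < s" using dist_triangle[of z u x] z(4) s(1) by linarith
        then show "u \<in> N" using inN[OF f(2)] u C(4) by blast
      qed
      then show "t i x = t i y" using conn_t[OF i C(1) _ C(2,3)] NB by blast
    next
      assume "t i x = t i y"
      moreover have "x \<in> Bc i" "y \<in> Bc i" "dist x y < \<delta>" using xN yN NB z(5) R(2) by auto
      ultimately obtain C where C: "connected C" "x \<in> C" "y \<in> C" "C \<subseteq> Bc i" "C \<subseteq> ball x (s/8)" using \<delta>(2)[OF i] by blast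
      have "dist u v < s/2" if "u \<in> C" "v \<in> C" for u v
      proof -
        have "dist x u < s/8" "dist x v < s/8" using C(5) that by auto
        then show ?thesis using dist_triangle3[of u v x] s(1) by linarith
      qed
      then show "P x y" using C Bc_S[OF i] unfolding P_def by (intro exI[of _ C]) auto
    qed
    moreover have "V x y \<longleftrightarrow> a x = a y" using f(1) xN yN unfolding lform_def by blast
    ultimately show ?thesis using xN yN by blast
  qed
  have Rs: "dist x y \<le> s/4" if "dist x y < R" for x y :: 'm using that R(3) by linarith
  have P_refl: "P x x" if "x \<in> S" for x
    unfolding P_def using that s(1) by (intro exI[of _ "{x}"]) auto
  have vm: "vertical_manifold S P V R n"
  proof
    show "compact S" "connected S" "homog S" "0 < R" "S \<noteq> {}" using compact_S connected_S homog_S R(1) S_ne by auto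
    show "P x x" if "x \<in> S" for x using P_refl[OF that] .
    show "P y x" if "P x y" for x y using that unfolding P_def by blast
    show "V x x" if x: "x \<in> S" for x
    proof -
      obtain i N a where f: "lform V (1/2) i N a" "S \<inter> ball x s \<subseteq> N" using chart[OF x] by blast
      show ?thesis using iff[OF f x x x] s(1) R(1) by simp
    qed
    show "V y x" if x: "x \<in> S" "y \<in> S" "dist x y < R" "V x y" for x y
    proof -
      obtain i N a where f: "lform V (1/2) i N a" "S \<inter> ball x s \<subseteq> N" using chart[OF x(1)] by blast
      show ?thesis using iff[OF f x(1) x(1,2) _ x(3)] iff[OF f x(1) x(2,1) Rs[OF x(3)]] x(3,4) s(1) by (simp add: dist_commute)
    qed
    fix x y z assume xyz: "x \<in> S" "y \<in> S" "z \<in> S" "dist x y < R" "dist y z < R" "dist x z < R"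
    obtain i N a where f: "lform V (1/2) i N a" "S \<inter> ball x s \<subseteq> N" using chart[OF xyz(1)] by blast
    have s0: "dist x x \<le> s/4" using s(1) by simp
    note q = iff[OF f xyz(1) xyz(1,2) s0 xyz(4)] iff[OF f xyz(1) xyz(2,3) Rs[OF xyz(4)] xyz(5)] iff[OF f xyz(1) xyz(1,3) s0 xyz(6)]
    show "P x z" if "P x y" "P y z" using q that by simp
    show "V x z" if "V x y" "V y z" using q that by simp
  next
    fix x y assume xy: "x \<in> S" "y \<in> S" "dist x y < R" "P x y" "V x y"
    obtain i N a where f: "lform V (1/2) i N a" "S \<inter> ball x s \<subseteq> N" using chart[OF xy(1)] by blast
    have "dist x x \<le> s/4" using s(1) by simp
    then have "x \<in> N \<and> y \<in> N \<and> t i x = t i y \<and> a x = a y" using iff[OF f xy(1) xy(1,2) _ xy(3)] xy(4,5) by blast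
    then show "x = y" using lform_inj[OF f(1)] by simp
  next
    fix e :: real assume e: "e > 0"
    define \<rho> where "\<rho> = min (e/2) (R/2)"
    have \<rho>: "\<rho> > 0" "2 * \<rho> \<le> e" "2 * \<rho> \<le> R" using e R(1) by (auto simp: \<rho>_def)
    define T where "T w r \<longleftrightarrow> (\<forall>z\<in>S \<inter> ball w r. \<forall>y\<in>S \<inter> ball w r. \<exists>u\<in>S. dist z u < e \<and> V z u \<and> P u y)" for w r
    have T: "\<exists>r>0. T w r" if w: "w \<in> S" for w
    proof -
      obtain i N a where f: "lform V (1/2) i N a" "S \<inter> ball w s \<subseteq> N" using chart[OF w] by blast
      have wN: "w \<in> N" using inN[OF f(2) w] s(1) by simp
      obtain d where d: "d > 0" "S \<inter> ball w d \<subseteq> N"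
        "\<And>z y. z \<in> S \<inter> ball w d \<Longrightarrow> y \<in> S \<inter> ball w d \<Longrightarrow> \<exists>u\<in>N. dist w u < \<rho> \<and> t i u = t i y \<and> a u = a z"
        by (rule transport_local[OF f(1) order_refl wN \<rho>(1)]) (rule that; assumption)
      have "\<exists>u\<in>S. dist z u < e \<and> V z u \<and> P u y" if z: "z \<in> S \<inter> ball w (min d \<rho>)" and y: "y \<in> S \<inter> ball w (min d \<rho>)" for z y
      proof -
        have zd: "z \<in> S \<inter> ball w d" "y \<in> S \<inter> ball w d" using z y by auto
        obtain u where u: "u \<in> N" "dist w u < \<rho>" "t i u = t i y" "a u = a z" using d(3)[OF zd] by blast
        have uS: "u \<in> S" using u(1) f(1) openin_imp_subset unfolding lform_def by blast
        have zN: "z \<in> N" using d(2) zd by blast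
        have V1: "V z u" using f(1) zN u(1,4) unfolding lform_def by simp
        have "dist z u < e" using dist_triangle3[of z u w] z u(2) \<rho>(2) by simp
        moreover have duy: "dist u y < R" using dist_triangle3[of u y w] y u(2) \<rho>(3) by simp
        have "dist w u \<le> s/4" using u(2) \<rho>(1,3) R(3) by linarith
        then have "P u y" using iff[OF f w uS _ _ duy] y u(3) by simp
        ultimately show ?thesis using uS V1 by blast
      qed
      then show ?thesis unfolding T_def using d(1) \<rho>(1) by (intro exI[of _ "min d \<rho>"]) auto
    qed
    obtain d where d: "d > 0" "\<And>z. z \<in> S \<Longrightarrow> \<exists>y\<in>S. \<exists>r>0. T y r \<and> ball z d \<subseteq> ball y r"
      by (rule lebesgue_scale[OF compact_S T]) (assumption, rule that)
    have "\<exists>u\<in>S. dist z u < e \<and> V z u \<and> P u y" if zy: "z \<in> S" "y \<in> S" "dist z y < d" for z y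
    proof -
      obtain x r where x: "T x r" "ball z d \<subseteq> ball x r" using d(2)[OF zy(1)] by blast
      have "z \<in> ball z d" "y \<in> ball z d" using d(1) zy(3) by auto
      then have "z \<in> S \<inter> ball x r" "y \<in> S \<inter> ball x r" using x(2) zy by blast+
      then show ?thesis using x(1) unfolding T_def by blast
    qed
    then show "\<exists>d>0. \<forall>z\<in>S. \<forall>y\<in>S. dist z y < d \<longrightarrow> (\<exists>u\<in>S. dist z u < e \<and> V z u \<and> P u y)" using d(1) by blast
  next
    fix f g :: "nat \<Rightarrow> 'm" and x y
    assume fg: "\<And>n. f n \<in> S" "\<And>n. g n \<in> S" "f \<longlonglongrightarrow> x" "g \<longlonglongrightarrow> y" "x \<in> S" "y \<in> S" and xy: "dist x y < R"
    obtain i N a where h: "lform V (1/2) i N a" "S \<inter> ball x s \<subseteq> N" using chart[OF fg(5)] by blast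
    have i: "i \<in> I" and NB: "N \<subseteq> Bc i" using h(1) box_Bc unfolding lform_def by blast+
    have s0: "dist x x \<le> s/4" using s(1) by simp
    note q = iff[OF h fg(5) fg(5,6) s0 xy]
    have "\<forall>\<^sub>F n in sequentially. dist x (f n) < s/4"
      using tendstoD[OF fg(3), of "s/4"] s(1) by (simp add: dist_commute)
    moreover have "(\<lambda>n. dist (f n) (g n)) \<longlonglongrightarrow> dist x y" by (intro tendsto_dist fg)
    then have "\<forall>\<^sub>F n in sequentially. dist (f n) (g n) < R" using xy by (rule order_tendstoD)
    ultimately have ev: "\<forall>\<^sub>F n in sequentially. f n \<in> N \<and> g n \<in> N \<and> (P (f n) (g n) \<longleftrightarrow> t i (f n) = t i (g n)) \<and> (V (f n) (g n) \<longleftrightarrow> a (f n) = a (g n))"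
      by eventually_elim (rule iff[OF h fg(5) fg(1,2)]; simp)
    have eN: "\<forall>\<^sub>F n in sequentially. f n \<in> N" "\<forall>\<^sub>F n in sequentially. g n \<in> N" using ev by (auto elim: eventually_mono)
    have xyB: "x \<in> N" "y \<in> N" using q by auto
    have ct: "continuous_on N (t i)" "continuous_on N a" using continuous_on_subset[OF t_cont[OF i] NB] h(1) by (auto simp: lform_def)
    note lim = continuous_on_tendsto_compose[OF ct(1) fg(3) xyB(1) eN(1)] continuous_on_tendsto_compose[OF ct(1) fg(4) xyB(2) eN(2)]
      continuous_on_tendsto_compose[OF ct(2) fg(3) xyB(1) eN(1)] continuous_on_tendsto_compose[OF ct(2) fg(4) xyB(2) eN(2)]
    show "P x y" if "\<And>n. P (f n) (g n)"
    proof -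
      have "\<forall>\<^sub>F n in sequentially. t i (f n) = t i (g n)" using ev by eventually_elim (use that in blast)
      from Lim_transform_eventually[OF lim(1) this] have "(\<lambda>n. t i (g n)) \<longlonglongrightarrow> t i x" .
      then have "t i x = t i y" using lim(2) LIMSEQ_unique by blast
      then show ?thesis using q by blast
    qed
    show "V x y" if "\<And>n. V (f n) (g n)"
    proof -
      have "\<forall>\<^sub>F n in sequentially. a (f n) = a (g n)" using ev by eventually_elim (use that in blast)
      from Lim_transform_eventually[OF lim(3) this] have "(\<lambda>n. a (g n)) \<longlonglongrightarrow> a x" .
      then have "a x = a y" using lim(4) LIMSEQ_unique by blast
      then show ?thesis using q by blast
    qed
  next
    fix C x y assume C: "connected C" "C \<subseteq> S" "\<And>a b. a \<in> C \<Longrightarrow> b \<in> C \<Longrightarrow> dist a b < R" "x \<in> C" "y \<in> C"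
    have "dist u v < s/2" if "u \<in> C" "v \<in> C" for u v using C(3)[OF that] R(3) s(1) by linarith
    then show "P x y" unfolding P_def using C by blast
  next
    fix e :: real assume e: "e > 0"
    obtain d where d: "d > 0" "\<And>i z z'. i \<in> I \<Longrightarrow> z \<in> Bc i \<Longrightarrow> z' \<in> Bc i \<Longrightarrow> t i z = t i z' \<Longrightarrow> dist z z' < d \<Longrightarrow>
      \<exists>C. connected C \<and> z \<in> C \<and> z' \<in> C \<and> C \<subseteq> Bc i \<and> C \<subseteq> ball z e"
      by (rule plaque_segment_uniform[OF e]) (rule that; assumption)
    have "\<exists>C. connected C \<and> x \<in> C \<and> y \<in> C \<and> C \<subseteq> S \<and> C \<subseteq> ball x e"
      if x: "x \<in> S" "y \<in> S" "dist x y < min d R" "P x y" for x y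
    proof -
      obtain i N a where f: "lform V (1/2) i N a" "S \<inter> ball x s \<subseteq> N" using chart[OF x(1)] by blast
      have i: "i \<in> I" and NB: "N \<subseteq> Bc i" using f(1) box_Bc unfolding lform_def by blast+
      have "dist x x \<le> s/4" "dist x y < R" using s(1) x(3) by auto
      then have "x \<in> Bc i" "y \<in> Bc i" "t i x = t i y" using iff[OF f x(1) x(1,2)] x(4) NB by blast+
      then obtain C where "connected C" "x \<in> C" "y \<in> C" "C \<subseteq> Bc i" "C \<subseteq> ball x e" using d(2)[OF i] x(3) by (metis min_less_iff_conj)
      then show ?thesis using Bc_S[OF i] by blast
    qed
    then show "\<exists>d>0. \<forall>x\<in>S. \<forall>y\<in>S. dist x y < d \<longrightarrow> P x y \<longrightarrow>
        (\<exists>C. connected C \<and> x \<in> C \<and> y \<in> C \<and> C \<subseteq> S \<and> C \<subseteq> ball x e)"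
      using d(1) R(1) by (intro exI[of _ "min d R"]) auto
  next
    fix z and e :: real assume z: "z \<in> S" and e: "e > 0"
    obtain i N a where f: "lform V (1/2) i N a" "S \<inter> ball z s \<subseteq> N" using chart[OF z] by blast
    have i: "i \<in> I" and NB: "N \<subseteq> Bc i" "N \<subseteq> box i" using f(1) box_Bc unfolding lform_def by blast+
    have "z \<in> N" using inN[OF f(2) z] s(1) by simp
    then have zB: "z \<in> Bc i" "norm (c i z) < 1" using NB by (auto simp: box_def)
    define e' where "e' = min e (R/2)"
    have e': "e' > 0" "e' \<le> e" "e' \<le> R/2" using e R(1) by (auto simp: e'_def)
    obtain r0 where r0: "r0 > 0" "\<And>z z'. z \<in> Bc i \<Longrightarrow> z' \<in> Bc i \<Longrightarrow> norm (c i z - c i z') < r0 \<Longrightarrow> dist (t i z) (t i z') < r0 \<Longrightarrow> dist z z' < e'"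
      using ct_close[OF i e'(1)] by blast
    define r where "r = min r0 (1 - norm (c i z))"
    have r: "r > 0" "r \<le> r0" "r \<le> 1 - norm (c i z)" using r0 zB(2) by (auto simp: r_def)
    \<comment> \<open>An open coordinate ball in the plaque of \<open>z\<close>, as asked for by
      \<open>P_manifold\<close>.\<close>
    define B where "B = {u\<in>Bc i. t i u = t i z \<and> norm (c i z - c i u) < r}"
    have Bz: "dist z u < e'" if "u \<in> B" for u
      using r0(2)[OF zB(1), of u] that r r0(1) by (auto simp: B_def)
    have BS: "B \<subseteq> S" using Bc_S[OF i] by (auto simp: B_def)
    define D where "D = X \<inter> ball (c i z) r"
    have D1: "D \<subseteq> X \<inter> cball 0 1"
    proof
      fix x assume "x \<in> D"
      then have "x \<in> X" "norm (c i z - x) < r" by (auto simp: D_def dist_norm)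
      then show "x \<in> X \<inter> cball 0 1" using norm_triangle_sub[of x "c i z"] r(3) by (simp add: norm_minus_commute)
    qed
    have "homeomorphism D B (\<lambda>x. pt i x (t i z)) (c i)"
    proof (rule homeomorphismI)
      show "continuous_on D (\<lambda>x. pt i x (t i z))" by (rule continuous_on_subset[OF plaque_continuous[OF i zB(1)] D1])
      show "continuous_on B (c i)" by (rule continuous_on_subset[OF c_cont[OF i]]) (auto simp: B_def)
      have p: "pt i x (t i z) \<in> Bc i" "c i (pt i x (t i z)) = x" "t i (pt i x (t i z)) = t i z" if "x \<in> D" for x
      proof -
        have "x \<in> X \<inter> cball 0 1" using D1 that by blast
        then have "x \<in> X" "norm x \<le> 1" by auto
        from pt[OF i zB(1) this]
        show "pt i x (t i z) \<in> Bc i" "c i (pt i x (t i z)) = x" "t i (pt i x (t i z)) = t i z" by auto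
      qed
      show "(\<lambda>x. pt i x (t i z)) ` D \<subseteq> B" using p by (auto simp: B_def) (auto simp: D_def dist_norm)
      show "c i ` B \<subseteq> D" using c_X[OF i] by (auto simp: B_def D_def dist_norm)
      show "c i (pt i x (t i z)) = x" if "x \<in> D" for x using p[OF that] by simp
      show "pt i (c i u) (t i z) = u" if "u \<in> B" for u using pt_eq[OF i, of u] that by (auto simp: B_def)
    qed
    then have "top_of_set B homeomorphic_space top_of_set D"
      using homeomorphism_imp_homeomorphic_space homeomorphic_space_sym by blast
    moreover obtain U where U: "openin (Euclidean_space n) U" "top_of_set D homeomorphic_space subtopology (Euclidean_space n) U"
      using X_chart[OF c_X[OF i zB(1)] r(1)] unfolding D_def by blast
    ultimately have hom: "top_of_set B homeomorphic_space subtopology (Euclidean_space n) U" using homeomorphic_space_trans by blast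
    have zp: "dist z p \<le> s/4" if "p \<in> B" for p using Bz[OF that] e'(3) R(1,3) by linarith
    have PB: "P p q" if pq: "p \<in> B" "q \<in> B" for p q
    proof -
      have "dist p q < R" using dist_triangle3[of p q z] Bz[OF pq(1)] Bz[OF pq(2)] e'(3) by linarith
      then show ?thesis using iff[OF f z _ _ zp[OF pq(1)]] pq BS by (force simp: B_def)
    qed
    have open_B: "\<exists>d>0. \<forall>y\<in>S. dist p y < d \<and> P p y \<longrightarrow> y \<in> B" if p: "p \<in> B" for p
    proof -
      have pB: "p \<in> Bc i" "t i p = t i z" "norm (c i z - c i p) < r" using p by (auto simp: B_def)
      have "r - norm (c i z - c i p) > 0" using pB by simp
      then obtain d where d: "d > 0" "\<And>y. y \<in> Bc i \<Longrightarrow> dist y p < d \<Longrightarrow> dist (c i y) (c i p) < r - norm (c i z - c i p)"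
        using c_cont[OF i] pB(1) unfolding continuous_on_iff by blast
      have "y \<in> B" if y: "y \<in> S" "dist p y < min d R" "P p y" for y
      proof -
        have "dist p y < R" using y(2) by simp
        then have yt: "y \<in> Bc i" "t i y = t i p" using iff[OF f z subsetD[OF BS p] y(1) zp[OF p]] y(3) NB by auto
        have "dist y p < d" using y(2) by (simp add: dist_commute)
        from d(2)[OF yt(1) this] have "norm (c i p - c i y) < r - norm (c i z - c i p)"
          unfolding dist_norm norm_minus_commute[of "c i y"] .
        then have "norm (c i z - c i y) < r" using norm_triangle_ineq[of "c i z - c i p" "c i p - c i y"] by simp
        then show ?thesis using yt pB(2) by (simp add: B_def)
      qed
      then show ?thesis using d(1) R(1) by (intro exI[of _ "min d R"]) auto
    qed
    have "z \<in> B" using zB(1) r(1) by (simp add: B_def)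
    moreover have "B \<subseteq> S \<inter> ball z e"
    proof
      fix u assume "u \<in> B"
      then show "u \<in> S \<inter> ball z e" using Bz[of u] e'(2) BS by auto
    qed
    ultimately show "\<exists>B U. z \<in> B \<and> B \<subseteq> S \<inter> ball z e \<and> openin (Euclidean_space n) U \<and>
        top_of_set B homeomorphic_space subtopology (Euclidean_space n) U \<and> (\<forall>p\<in>B. \<forall>q\<in>B. P p q) \<and>
        (\<forall>p\<in>B. \<exists>d>0. \<forall>y\<in>S. dist p y < d \<and> P p y \<longrightarrow> y \<in> B)"
      using U(1) hom PB open_B by (intro exI[of _ B] exI[of _ U] conjI ballI) simp_all
  qed
  interpret vm: vertical_manifold S P V R n by (rule vm)
  show "homeomorphic_to_McCord_solenoid n (top_of_set S)" by (rule vm.homeomorphic_to_McCord)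
  show "\<exists>y. same_plaque\<^sup>*\<^sup>* x0 y \<and> dist y u0 < e" if xu: "x0 \<in> S" "u0 \<in> S" "e > 0"
  proof -
    obtain y where y: "(vm.step R)\<^sup>*\<^sup>* x0 y" "dist y u0 < e" using vm.leaf_dense[OF R(1) xu] by blast
    have "same_plaque x z" if "vm.step R x z" for x z
    proof -
      have xz: "x \<in> S" "z \<in> S" "P x z" "dist x z < R" using that by (auto simp: vm.step_def)
      obtain i N a where f: "lform V (1/2) i N a" "S \<inter> ball x s \<subseteq> N" using chart[OF xz(1)] by blast
      have "dist x x \<le> s/4" using s(1) by simp
      then have "x \<in> N \<and> z \<in> N \<and> t i x = t i z" using iff[OF f xz(1) xz(1,2) _ xz(4)] xz(3) by blast
      then show ?thesis using f(1) unfolding same_plaque_def lform_def by blast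
    qed
    then have "same_plaque\<^sup>*\<^sup>* x0 y" using y(1) by (metis mono_rtranclp)
    then show ?thesis using y(2) by blast
  qed
qed

end

section \<open>The model space\<close>

text \<open>The library states completeness only for domains that are metric spaces, which the type of
  natural numbers is not.\<close>

instance bcontfun :: (topological_space, complete_space) complete_space
proof
  fix f :: "nat \<Rightarrow> ('a, 'b) bcontfun"
  assume f: "Cauchy f"
  have "uniformly_Cauchy_on UNIV (\<lambda>n. apply_bcontfun (f n))"
  proof (rule uniformly_Cauchy_onI)
    fix e :: real assume "e > 0"
    then show "\<exists>M. \<forall>x\<in>UNIV. \<forall>m\<ge>M. \<forall>n\<ge>M. dist (f m x) (f n x) < e"
      using f unfolding Cauchy_def by (meson dist_fun_lt_imp_dist_val_lt)
  qed
  then obtain g where "uniform_limit UNIV (\<lambda>n. apply_bcontfun (f n)) g sequentially"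
    using Cauchy_uniformly_convergent unfolding uniformly_convergent_on_def by blast
  then show "convergent f" using uniform_limit_bcontfunE[OF _ sequentially_bot] convergentI by metis
qed

instance bcontfun :: (topological_space, banach) banach ..

text \<open>The dimension is a variable, so the leafwise coordinates live in one fixed Banach type,
  the bounded functions on the naturals, with \<open>model n\<close> as the subspace of dimension
  \<open>n\<close>. In the supremum norm cubes are balls.\<close>

definition toE :: "nat \<Rightarrow> (nat \<Rightarrow> real) \<Rightarrow> (nat \<Rightarrow>\<^sub>C real)" where
  "toE n p = Bcontfun (\<lambda>i. if i < n then p i else 0)"

definition model :: "nat \<Rightarrow> (nat \<Rightarrow>\<^sub>C real) set" where
  "model n = {x. \<forall>i\<ge>n. apply_bcontfun x i = 0}"

lemma finite_support_bcontfun: "(\<lambda>i. if i < (n::nat) then p i else (0::real)) \<in> bcontfun"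
proof -
  have "range (\<lambda>i. if i < n then p i else (0::real)) \<subseteq> insert 0 (p ` {..<n})" by auto
  then have "finite (range (\<lambda>i. if i < n then p i else (0::real)))" by (rule finite_subset) simp
  then show ?thesis unfolding bcontfun_def by (simp add: finite_imp_bounded)
qed

lemma apply_toE [simp]: "apply_bcontfun (toE n p) i = (if i < n then p i else 0)"
  unfolding toE_def using Bcontfun_inverse[OF finite_support_bcontfun[of n p]] by simp

lemma toE_model: "toE n p \<in> model n"
  by (simp add: model_def)

lemma toE_apply: "x \<in> model n \<Longrightarrow> toE n (apply_bcontfun x) = x"
  by (intro bcontfun_eqI) (simp add: model_def)

lemma coord_le_norm: "\<bar>apply_bcontfun (x :: nat \<Rightarrow>\<^sub>C real) i\<bar> \<le> norm x"
  using norm_bounded[of x i] by simp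

lemma norm_toE_le:
  assumes "r \<ge> 0" "\<And>i. i < n \<Longrightarrow> \<bar>p i\<bar> \<le> r"
  shows "norm (toE n p) \<le> r"
  by (rule norm_bound) (use assms in auto)

lemma coord_toE: "i < n \<Longrightarrow> \<bar>p i\<bar> \<le> norm (toE n p)"
  using coord_le_norm[of "toE n p" i] by simp

lemma toE_diff: "toE n p - toE n q = toE n (\<lambda>i. p i - q i)"
  by (intro bcontfun_eqI) simp

lemma subspace_model: "subspace (model n)"
  by (auto simp: subspace_def model_def)

lemma continuous_coord: "continuous_on A (\<lambda>x. apply_bcontfun (x :: nat \<Rightarrow>\<^sub>C real) i)"
proof (rule continuous_on_subset[OF _ subset_UNIV])
  have "1-lipschitz_on UNIV (\<lambda>x. apply_bcontfun (x :: nat \<Rightarrow>\<^sub>C real) i)"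
    by (rule lipschitz_onI) (use dist_bounded in auto)
  then show "continuous_on UNIV (\<lambda>x. apply_bcontfun (x :: nat \<Rightarrow>\<^sub>C real) i)" by (rule lipschitz_on_continuous_on)
qed

lemma closed_model: "closed (model n)"
proof -
  have "model n = (\<Inter>i\<in>{n..}. {x. apply_bcontfun x i = 0})" by (auto simp: model_def)
  moreover have "closed {x. apply_bcontfun (x :: nat \<Rightarrow>\<^sub>C real) i = 0}" for i
    using continuous_coord[of UNIV i] by (intro closed_Collect_eq continuous_on_const) auto
  ultimately show ?thesis by auto
qed

lemma continuous_toE: "continuous_on A (toE n)"
proof -
  have eq: "toE n p = (\<Sum>i<n. p i *\<^sub>R toE n (\<lambda>k. if k = i then 1 else 0))" for p
  proof (rule bcontfun_eqI)
    fix k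
    have ap: "apply_bcontfun (\<Sum>i\<in>F. f i) k = (\<Sum>i\<in>F. apply_bcontfun (f i) k)" if "finite F" for F and f :: "nat \<Rightarrow> nat \<Rightarrow>\<^sub>C real"
      using that by (induction F) auto
    show "apply_bcontfun (toE n p) k = apply_bcontfun (\<Sum>i<n. p i *\<^sub>R toE n (\<lambda>k. if k = i then 1 else 0)) k"
      by (simp add: ap sum.delta if_distrib[of "(*) _"] cong: if_cong)
  qed
  have "continuous_on A (\<lambda>p. \<Sum>i<n. p i *\<^sub>R toE n (\<lambda>k. if k = i then 1 else 0))"
    by (intro continuous_on_sum continuous_on_scaleR continuous_on_const
        continuous_on_subset[OF continuous_on_product_coordinates] subset_UNIV)
  then show ?thesis by (rule continuous_on_eq) (rule eq[symmetric])
qed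

lemma Euclidean_space_eq: "Euclidean_space n = top_of_set {p. \<forall>i\<ge>n. p i = (0::real)}"
  by (simp add: Euclidean_space_def euclidean_product_topology)

lemma model_chart:
  assumes "x \<in> model n" "r > 0"
  shows "\<exists>U. openin (Euclidean_space n) U \<and>
    top_of_set (model n \<inter> ball x r) homeomorphic_space subtopology (Euclidean_space n) U"
proof -
  define Y where "Y = {p. \<forall>i\<ge>n. p i = (0::real)}"
  define U where "U = Y \<inter> toE n -` ball x r"
  have Y: "Euclidean_space n = top_of_set Y" by (simp add: Y_def Euclidean_space_eq)
  have "openin (top_of_set Y) U" unfolding U_def by (rule continuous_openin_preimage_gen[OF continuous_toE open_ball])
  moreover have "homeomorphism (model n \<inter> ball x r) U apply_bcontfun (toE n)"
  proof (rule homeomorphismI)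
    show "continuous_on (model n \<inter> ball x r) apply_bcontfun"
      by (rule continuous_on_coordinatewise_then_product) (rule continuous_coord)
    show "continuous_on U (toE n)" by (rule continuous_toE)
    show "apply_bcontfun ` (model n \<inter> ball x r) \<subseteq> U"
      using toE_apply by (auto simp: U_def Y_def model_def)
    show "toE n ` U \<subseteq> model n \<inter> ball x r" using toE_model by (auto simp: U_def)
    show "toE n (apply_bcontfun y) = y" if "y \<in> model n \<inter> ball x r" for y using toE_apply that by blast
    show "apply_bcontfun (toE n p) = p" if "p \<in> U" for p using that by (auto simp: U_def Y_def fun_eq_iff)
  qed
  then have "top_of_set (model n \<inter> ball x r) homeomorphic_space top_of_set U"
    by (rule homeomorphism_imp_homeomorphic_space)
  moreover have "subtopology (Euclidean_space n) U = top_of_set U"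
    unfolding Y subtopology_subtopology by (simp add: U_def Int_absorb1)
  ultimately show ?thesis unfolding Y by auto
qed

section \<open>Mean value estimates\<close>

lemma mvt_bound:
  fixes g :: "real \<Rightarrow> real"
  assumes d: "\<And>s. min a b \<le> s \<Longrightarrow> s \<le> max a b \<Longrightarrow> (g has_real_derivative D s) (at s) \<and> \<bar>D s - A\<bar> \<le> e"
  shows "\<bar>g b - g a - A * (b - a)\<bar> \<le> e * \<bar>b - a\<bar>"
proof -
  have main: "\<bar>g v - g u - A * (v - u)\<bar> \<le> e * \<bar>v - u\<bar>"
    if uv: "u < v" and d: "\<And>s. u \<le> s \<Longrightarrow> s \<le> v \<Longrightarrow> (g has_real_derivative D s) (at s) \<and> \<bar>D s - A\<bar> \<le> e" for u v
  proof -
    obtain z where z: "u < z" "z < v" "g v - g u = (v - u) * D z"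
      using MVT2[OF uv, of g D] d by blast
    have "\<bar>g v - g u - A * (v - u)\<bar> = \<bar>D z - A\<bar> * \<bar>v - u\<bar>"
      unfolding z(3) abs_mult[symmetric] by (simp add: algebra_simps)
    also have "\<dots> \<le> e * \<bar>v - u\<bar>" using d[of z] z by (intro mult_right_mono) auto
    finally show ?thesis .
  qed
  consider "a < b" | "b < a" | "a = b" by linarith
  then show ?thesis
  proof cases
    case 1
    then show ?thesis using main[OF 1] d by auto
  next
    case 2
    then have "\<bar>g a - g b - A * (a - b)\<bar> \<le> e * \<bar>a - b\<bar>" using main[OF 2] d by auto
    moreover have "g a - g b - A * (a - b) = - (g b - g a - A * (b - a))" by (simp add: algebra_simps)
    ultimately show ?thesis by (simp add: abs_minus_commute)
  qed simp
qed

text \<open>The mean value theorem, one coordinate at a time: the coordinates of \<open>p\<close> are replaced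
  successively by those of \<open>q\<close>.\<close>

lemma coordinatewise_mvt:
  fixes f :: "(nat \<Rightarrow> real) \<Rightarrow> real"
  assumes pq: "\<And>i. i \<ge> n \<Longrightarrow> p i = q i"
    and d: "\<And>i x. i < n \<Longrightarrow> (\<And>k. min (p k) (q k) \<le> x k \<and> x k \<le> max (p k) (q k)) \<Longrightarrow>
      ((\<lambda>s. f (x(i := s))) has_real_derivative D i x) (at (x i)) \<and> \<bar>D i x - A i\<bar> \<le> e"
  shows "\<bar>f q - f p - (\<Sum>i<n. A i * (q i - p i))\<bar> \<le> e * (\<Sum>i<n. \<bar>q i - p i\<bar>)"
proof -
  define w where "w m i = (if i < m then q i else p i)" for m i
  have step: "\<bar>f (w (Suc m)) - f (w m) - A m * (q m - p m)\<bar> \<le> e * \<bar>q m - p m\<bar>" if m: "m < n" for m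
  proof -
    define g where "g s = f ((w m)(m := s))" for s
    have "w (Suc m) = (w m)(m := q m)" by (auto simp: w_def fun_eq_iff)
    moreover have "w m = (w m)(m := p m)" by (auto simp: w_def fun_eq_iff)
    ultimately have ends: "f (w (Suc m)) = g (q m)" "f (w m) = g (p m)" by (auto simp: g_def)
    have "(g has_real_derivative D m ((w m)(m := s))) (at s) \<and> \<bar>D m ((w m)(m := s)) - A m\<bar> \<le> e"
      if "min (p m) (q m) \<le> s" "s \<le> max (p m) (q m)" for s
      using d[OF m, of "(w m)(m := s)"] that by (simp add: g_def[abs_def] w_def)
    from mvt_bound[OF this] show ?thesis by (simp add: ends)
  qed
  have "\<bar>f (w m) - f p - (\<Sum>i<m. A i * (q i - p i))\<bar> \<le> e * (\<Sum>i<m. \<bar>q i - p i\<bar>)" if "m \<le> n" for m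
    using that
  proof (induction m)
    case 0
    have "w 0 = p" by (auto simp: w_def)
    then show ?case by simp
  next
    case (Suc m)
    then have "\<bar>f (w m) - f p - (\<Sum>i<m. A i * (q i - p i))\<bar> \<le> e * (\<Sum>i<m. \<bar>q i - p i\<bar>)" "m < n" by auto
    then show ?case using step[of m] by (simp add: algebra_simps abs_le_iff)
  qed
  moreover have "w n = q" using pq by (auto simp: w_def fun_eq_iff)
  ultimately show ?thesis by (metis order_refl)
qed

section \<open>Embedding of the space and coordinate cubes\<close>

lemma continuous_map_metricI:
  fixes f :: "'a \<Rightarrow> 'b::metric_space"
  assumes "\<And>x e. x \<in> topspace X \<Longrightarrow> e > 0 \<Longrightarrow> \<exists>U. openin X U \<and> x \<in> U \<and> (\<forall>y\<in>U. dist (f y) (f x) < e)"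
  shows "continuous_map X euclidean f"
  unfolding continuous_map_def
proof (intro conjI allI impI)
  fix V :: "'b set" assume V: "openin euclidean V"
  show "openin X {x \<in> topspace X. f x \<in> V}"
  proof (subst openin_subopen, intro ballI)
    fix x assume x: "x \<in> {x \<in> topspace X. f x \<in> V}"
    then obtain e where e: "e > 0" "ball (f x) e \<subseteq> V" using V open_contains_ball by (metis (mono_tags, lifting) mem_Collect_eq open_openin)
    obtain U where U: "openin X U" "x \<in> U" "\<forall>y\<in>U. dist (f y) (f x) < e" using assms x e(1) by blast
    have "U \<subseteq> {x \<in> topspace X. f x \<in> V}"
      using U(3) e(2) openin_subset[OF U(1)] by (auto simp: dist_commute subset_iff)
    then show "\<exists>T. openin X T \<and> x \<in> T \<and> T \<subseteq> {x \<in> topspace X. f x \<in> V}" using U by blast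
  qed
qed simp

text \<open>Distances to a dense sequence separate points. The space thereby becomes a subset of a
  metric type, to which the preceding results apply.\<close>

lemma compact_metrizable_embedding:
  assumes M: "compact_space M" "metrizable_space M" "topspace M \<noteq> {}"
  obtains e :: "'a \<Rightarrow> nat \<Rightarrow> real" where "homeomorphic_map M (top_of_set (e ` topspace M)) e"
    "compact (e ` topspace M)"
proof -
  obtain T d where T: "Metric_space T d" "M = Metric_space.mtopology T d"
    using M(2) unfolding metrizable_space_def by blast
  interpret Metric_space T d by (rule T)
  have TM: "topspace M = T" using T(2) by simp
  have tb: "mtotally_bounded T"
    using M(1) TM compactin_imp_mtotally_bounded unfolding compact_space_def T(2) by simp
  have "\<exists>A. finite A \<and> A \<subseteq> T \<and> T \<subseteq> (\<Union>x\<in>A. mball x (1 / Suc m))" for m :: nat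
    using tb unfolding mtotally_bounded_def by simp
  then obtain A where A: "\<And>m::nat. finite (A m) \<and> A m \<subseteq> T \<and> T \<subseteq> (\<Union>x\<in>A m. mball x (1 / Suc m))" by metis
  define Q where "Q = (\<Union>m. A m)"
  have Q: "countable Q" unfolding Q_def using A by (intro countable_UN) (auto intro: countable_finite)
  have QT: "Q \<subseteq> T" unfolding Q_def using A by blast
  have Qd: "\<exists>z\<in>Q. d z x < r" if x: "x \<in> T" and r: "r > 0" for x r
  proof -
    obtain m where m: "1 / Suc m < r" using r nat_approx_posE by metis
    obtain z where z: "z \<in> A m" "x \<in> mball z (1 / Suc m)" using A[of m] x by blast
    then have "d z x < r" using m by simp
    then show ?thesis using z(1) by (auto simp: Q_def)
  qed
  have Qne: "Q \<noteq> {}" using Qd[of _ 1] M(3) TM by fastforce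
  define q where "q = from_nat_into Q"
  have qT: "q j \<in> T" for j using from_nat_into[OF Qne] QT by (auto simp: q_def)
  define e where "e x j = d x (q j)" for x j
  have "continuous_map M euclideanreal (\<lambda>x. e x j)" for j
  proof (rule continuous_map_metricI)
    fix x and r :: real assume x: "x \<in> topspace M" and r: "r > 0"
    have "dist (e y j) (e x j) < r" if "y \<in> mball x r" for y
    proof -
      have y: "y \<in> T" "x \<in> T" "d x y < r" using that by auto
      have "d x (q j) \<le> d x y + d y (q j)" "d y (q j) \<le> d y x + d x (q j)" using triangle y qT by blast+
      then show ?thesis using y(3) commute[of x y] by (simp add: e_def dist_real_def abs_less_iff)
    qed
    then show "\<exists>U. openin M U \<and> x \<in> U \<and> (\<forall>y\<in>U. dist (e y j) (e x j) < r)"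
      using x r TM T(2) by (intro exI[of _ "mball x r"]) auto
  qed
  then have "continuous_map M (powertop_real UNIV) e"
    unfolding continuous_map_componentwise_UNIV by blast
  then have ce: "continuous_map M (euclidean :: (nat \<Rightarrow> real) topology) e" by (simp add: euclidean_product_topology)
  have inj: "inj_on e (topspace M)"
  proof (rule inj_onI)
    fix x y assume xy: "x \<in> topspace M" "y \<in> topspace M" "e x = e y"
    show "x = y"
    proof (rule ccontr)
      assume "x \<noteq> y"
      then have pos: "d x y > 0" using xy TM by simp
      have "d x y / 2 > 0" using pos by simp
      from Qd[OF _ this, of x] obtain z where z: "z \<in> Q" "d z x < d x y / 2" using xy(1) TM by blast
      obtain j where "q j = z" using z(1) from_nat_into_surj[OF Q] by (auto simp: q_def)
      then have "d x z = d y z" using fun_cong[OF xy(3), of j] by (simp add: e_def)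
      moreover have "d x z < d x y / 2" "z \<in> T" using z QT commute[of x z] by auto
      moreover have "d x y \<le> d x z + d z y" using triangle xy TM \<open>z \<in> T\<close> by blast
      ultimately show False using commute[of y z] by simp
    qed
  qed
  have "homeomorphic_map M (top_of_set (e ` topspace M)) e"
    using continuous_imp_embedding_map[OF ce M(1) _ inj] by (simp add: embedding_map_def)
  moreover have "compact (e ` topspace M)"
    using image_compactin[OF _ ce, of "topspace M"] M(1) by (simp add: compact_space_def)
  ultimately show thesis using that by blast
qed

text \<open>On functions supported below \<open>n\<close> the product topology and the supremum norm
  agree; a norm ball supplies the cube.\<close>

lemma cube_nbhd:
  fixes n :: nat
  assumes U: "openin (top_of_set C) U" "p0 \<in> U" and C: "C \<subseteq> {p. \<forall>i\<ge>n. p i = (0::real)}"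
  obtains r where "r > 0" "\<And>p. p \<in> C \<Longrightarrow> (\<And>i. i < n \<Longrightarrow> \<bar>p i - p0 i\<bar> \<le> r) \<Longrightarrow> p \<in> U"
proof -
  obtain W where W: "open W" "U = C \<inter> W" using U(1) unfolding openin_open by blast
  have app: "apply_bcontfun (toE n p) = p" if "p \<in> C" for p using that C by (auto simp: fun_eq_iff)
  have p0: "p0 \<in> C" "p0 \<in> W" using U(2) W by auto
  have "continuous_on UNIV (apply_bcontfun :: (nat \<Rightarrow>\<^sub>C real) \<Rightarrow> nat \<Rightarrow> real)"
    by (rule continuous_on_coordinatewise_then_product) (rule continuous_coord)
  then have "open (apply_bcontfun -` W)" using W(1) by (simp add: continuous_on_open_vimage)
  moreover have "toE n p0 \<in> apply_bcontfun -` W" using p0 app by simp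
  ultimately obtain r where r: "r > 0" "ball (toE n p0) r \<subseteq> apply_bcontfun -` W" using open_contains_ball by blast
  show thesis
  proof (rule that[of "r/2"])
    show "r/2 > 0" using r by simp
    fix p assume p: "p \<in> C" "\<And>i. i < n \<Longrightarrow> \<bar>p i - p0 i\<bar> \<le> r/2"
    have "norm (toE n p0 - toE n p) \<le> r/2"
      unfolding toE_diff by (rule norm_toE_le) (use r p(2) in \<open>auto simp: abs_minus_commute\<close>)
    then have "toE n p \<in> ball (toE n p0) r" using r(1) by (simp add: dist_norm)
    then have "p \<in> W" using r(2) app[OF p(1)] by auto
    then show "p \<in> U" using p(1) W(2) by simp
  qed
qed

lemma compact_cube:
  fixes n :: nat
  shows "compact {p. (\<forall>i\<ge>n. p i = (0::real)) \<and> (\<forall>i<n. \<bar>p i - p0 i\<bar> \<le> r)}"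
proof -
  define J where "J i = (if i < n then {p0 i - r .. p0 i + r} else {0})" for i
  have "compactin (powertop_real UNIV) (Pi\<^sub>E UNIV J)"
    unfolding compactin_PiE by (auto simp: J_def)
  moreover have J: "p i \<in> J i \<longleftrightarrow> (i \<ge> n \<longrightarrow> p i = 0) \<and> (i < n \<longrightarrow> \<bar>p i - p0 i\<bar> \<le> r)" for p i
    by (auto simp: J_def abs_le_iff)
  have "Pi\<^sub>E UNIV J = {p. (\<forall>i\<ge>n. p i = (0::real)) \<and> (\<forall>i<n. \<bar>p i - p0 i\<bar> \<le> r)}"
    unfolding PiE_UNIV_domain Pi_def J by blast
  then show ?thesis using calculation by (simp add: euclidean_product_topology)
qed

lemma open_open_cube: "openin (Euclidean_space n) (open_cube n)"
proof -
  have "open {p :: nat \<Rightarrow> real. -1 < p i \<and> p i < 1}" for i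
    by (intro open_Collect_conj open_Collect_less continuous_on_const continuous_on_product_coordinates)
  then have "open (\<Inter>i<n. {p :: nat \<Rightarrow> real. -1 < p i \<and> p i < 1})" by (intro open_INT) auto
  moreover have "open_cube n = {p. \<forall>i\<ge>n. p i = (0::real)} \<inter> (\<Inter>i<n. {p. -1 < p i \<and> p i < 1})"
    by (auto simp: open_cube_def topspace_Euclidean_space)
  ultimately show ?thesis unfolding Euclidean_space_eq by (simp add: openin_open_Int)
qed

section \<open>Charts of a matchbox manifold\<close>

locale matchbox =
  fixes n :: nat and M :: "'a topology" and F :: "('a, 'b) foliation_charts"
  assumes matchbox: "matchbox_manifold n M F"
begin

abbreviation "cl x \<equiv> M closure_of chart_dom F x"
abbreviation "T x \<equiv> subtopology (transversal_space F) (transversal F x)"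
abbreviation "CQ \<equiv> subtopology (Euclidean_space n) (closed_cube n)"
abbreviation "pos x y \<equiv> fst (chart F x y)"
abbreviation "tr x y \<equiv> snd (chart F x y)"

definition pnt :: "'a \<Rightarrow> (nat \<Rightarrow> real) \<Rightarrow> 'b \<Rightarrow> 'a" where
  "pnt x p w = inv_into (cl x) (chart F x) (p, w)"

lemma foliated: "foliated_space n M F"
  using matchbox by (simp add: matchbox_manifold_def smooth_foliated_space_def)

lemma cont_M: "continuum M"
  using foliated by (simp add: foliated_space_def)

lemma compact_M: "compact_space M" and connected_M: "connected_space M" and ne_M: "topspace M \<noteq> {}"
  and metr_M: "metrizable_space M"
  using cont_M by (simp_all add: continuum_def)

lemma chart_facts:
  assumes "x \<in> topspace M"
  shows "compactin (transversal_space F) (transversal F x)" "openin M (chart_dom F x)" "x \<in> chart_dom F x"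
    "homeomorphic_map (subtopology M (cl x)) (prod_topology CQ (T x)) (chart F x)"
    "pos x x = (\<lambda>i. 0)" "tr x x \<in> transversal_space F interior_of transversal F x"
    "chart_dom F x = {y \<in> cl x. chart F x y \<in> open_cube n \<times> (transversal_space F interior_of transversal F x)}"
  using foliated assms by (simp_all add: foliated_space_def)

lemma metr_T: "metrizable_space (transversal_space F)"
  using foliated by (simp add: foliated_space_def)

lemma tot_disc_T: "x \<in> topspace M \<Longrightarrow> totally_disconnected_in (transversal_space F) (transversal F x)"
  using matchbox by (simp add: matchbox_manifold_def)

lemma topspace_T: "x \<in> topspace M \<Longrightarrow> topspace (T x) = transversal F x"
  using chart_facts(1) by (auto simp: compactin_def topspace_subtopology)

lemma topspace_CQ: "topspace CQ = closed_cube n"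
  by (auto simp: closed_cube_def)

lemma CQ_eq: "CQ = top_of_set (closed_cube n)"
proof -
  have "closed_cube n \<subseteq> {p. \<forall>i\<ge>n. p i = (0::real)}" by (auto simp: closed_cube_def topspace_Euclidean_space)
  then show ?thesis unfolding Euclidean_space_eq subtopology_subtopology by (simp add: Int_absorb1)
qed

lemma cl_sub: "cl x \<subseteq> topspace M"
  by (rule closure_of_subset_topspace)

lemma topspace_cl: "topspace (subtopology M (cl x)) = cl x"
  using cl_sub by (auto simp: topspace_subtopology)

lemma chart_dom_cl: "x \<in> topspace M \<Longrightarrow> chart_dom F x \<subseteq> cl x"
  using chart_facts(7) by blast

lemma chart_bij:
  assumes x: "x \<in> topspace M"
  shows "bij_betw (chart F x) (cl x) (closed_cube n \<times> transversal F x)"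
  using homeomorphic_imp_injective_map[OF chart_facts(4)[OF x]] homeomorphic_imp_surjective_map[OF chart_facts(4)[OF x]] topspace_cl topspace_CQ topspace_T[OF x]
  by (simp add: bij_betw_def)

lemma pos_tr:
  assumes "x \<in> topspace M" "y \<in> cl x"
  shows "pos x y \<in> closed_cube n" "tr x y \<in> transversal F x" "pnt x (pos x y) (tr x y) = y"
proof -
  have "chart F x y \<in> closed_cube n \<times> transversal F x" using chart_bij[OF assms(1)] assms(2) by (auto simp: bij_betw_def)
  then show "pos x y \<in> closed_cube n" "tr x y \<in> transversal F x" by (auto simp: mem_Times_iff)
  show "pnt x (pos x y) (tr x y) = y"
    using bij_betw_imp_inj_on[OF chart_bij[OF assms(1)]] assms(2) by (simp add: pnt_def inv_into_f_f)
qed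

lemma pnt:
  assumes x: "x \<in> topspace M" and p: "p \<in> closed_cube n" and w: "w \<in> transversal F x"
  shows "pnt x p w \<in> cl x" "pos x (pnt x p w) = p" "tr x (pnt x p w) = w"
proof -
  have im: "(p, w) \<in> chart F x ` cl x" using chart_bij[OF x] p w by (simp add: bij_betw_def)
  show "pnt x p w \<in> cl x" unfolding pnt_def by (rule inv_into_into[OF im])
  have "chart F x (pnt x p w) = (p, w)" unfolding pnt_def by (rule f_inv_into_f[OF im])
  then show "pos x (pnt x p w) = p" "tr x (pnt x p w) = w" by auto
qed

lemma chart_continuous:
  assumes x: "x \<in> topspace M"
  shows "continuous_map (subtopology M (cl x)) CQ (\<lambda>y. pos x y)" "continuous_map (subtopology M (cl x)) (T x) (\<lambda>y. tr x y)"
proof -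
  have c: "continuous_map (subtopology M (cl x)) (prod_topology CQ (T x)) (chart F x)"
    using homeomorphic_imp_continuous_map[OF chart_facts(4)[OF x]] .
  show "continuous_map (subtopology M (cl x)) CQ (\<lambda>y. pos x y)" "continuous_map (subtopology M (cl x)) (T x) (\<lambda>y. tr x y)"
    using continuous_map_compose[OF c continuous_map_fst] continuous_map_compose[OF c continuous_map_snd] by (simp_all add: o_def)
qed

lemma pnt_continuous:
  assumes x: "x \<in> topspace M"
  shows "continuous_map (prod_topology CQ (T x)) (subtopology M (cl x)) (\<lambda>(p, w). pnt x p w)"
proof -
  obtain g where g: "homeomorphic_maps (subtopology M (cl x)) (prod_topology CQ (T x)) (chart F x) g"
    using chart_facts(4)[OF x] homeomorphic_map_maps by blast
  have "continuous_map (prod_topology CQ (T x)) (subtopology M (cl x)) g"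
    using g by (simp add: homeomorphic_maps_def)
  moreover have "g q = (\<lambda>(p, w). pnt x p w) q" if q: "q \<in> topspace (prod_topology CQ (T x))" for q
  proof -
    obtain p w where pw: "q = (p, w)" "p \<in> closed_cube n" "w \<in> transversal F x"
      using q topspace_CQ topspace_T[OF x] by (auto simp: topspace_prod_topology)
    have gq: "g q \<in> cl x" "chart F x (g q) = q"
      using g q topspace_cl by (auto simp: homeomorphic_maps_def continuous_map_def)
    have "g q = pnt x (pos x (g q)) (tr x (g q))" using pos_tr(3)[OF x gq(1)] by simp
    then show ?thesis using gq(2) pw(1) by simp
  qed
  ultimately show ?thesis by (rule continuous_map_eq)
qed

lemma connected_tr:
  assumes x: "x \<in> topspace M" and C: "connectedin M C" "C \<subseteq> cl x" "y \<in> C" "y' \<in> C"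
  shows "tr x y = tr x y'"
proof -
  have "connectedin (subtopology M (cl x)) C" using C by (simp add: connectedin_subtopology)
  then have "connectedin (T x) ((\<lambda>y. tr x y) ` C)"
    using connectedin_continuous_map_image[OF chart_continuous(2)[OF x]] by blast
  then have "connectedin (transversal_space F) ((\<lambda>y. tr x y) ` C)" "(\<lambda>y. tr x y) ` C \<subseteq> transversal F x"
    by (auto simp: connectedin_subtopology)
  then obtain a where "(\<lambda>y. tr x y) ` C \<subseteq> {a}" using tot_disc_T[OF x] unfolding totally_disconnected_in_def by blast
  then show ?thesis using C(3,4) by auto
qed

lemma open_in_dom:
  assumes x: "x \<in> topspace M" and U: "openin (subtopology M (cl x)) U" "U \<subseteq> chart_dom F x"
  shows "openin M U"
proof -
  obtain W where W: "openin M W" "U = W \<inter> cl x" using U(1) by (auto simp: openin_subtopology)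
  have "U = W \<inter> chart_dom F x" using W(2) U(2) chart_dom_cl[OF x] by blast
  then show ?thesis using openin_Int[OF W(1) chart_facts(2)[OF x]] by simp
qed

text \<open>The transversal is compact and its components are points, so \<open>tr x x\<close> is
  separated by a clopen set from the closed complement of the interior. Over such a piece a box can
  be at once compact and a neighbourhood.\<close>

lemma clopen_transversal:
  assumes x: "x \<in> topspace M"
  shows "\<exists>Q. tr x x \<in> Q \<and> Q \<subseteq> transversal_space F interior_of transversal F x \<and> openin (T x) Q \<and> closedin (T x) Q"
proof -
  define O1 where "O1 = transversal_space F interior_of transversal F x"
  define w where "w = tr x x"
  have xc: "x \<in> cl x" using chart_facts(3)[OF x] chart_dom_cl[OF x] by blast
  have wT: "w \<in> transversal F x" using pos_tr(2)[OF x xc] by (simp add: w_def)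
  have cs: "compact_space (T x)" using chart_facts(1)[OF x] by (simp add: compact_space_subtopology)
  have H: "Hausdorff_space (T x)" using metr_T by (simp add: Hausdorff_space_subtopology metrizable_imp_Hausdorff_space)
  have lc: "locally_compact_space (T x)" using cs by (simp add: compact_imp_locally_compact_space)
  define C where "C = connected_component_of_set (T x) w"
  have wTx: "w \<in> topspace (T x)" using wT topspace_T[OF x] by simp
  have CC: "C \<in> connected_components_of (T x)"
    unfolding C_def connected_components_of_def using wTx by simp
  have "connectedin (T x) C" using CC by (rule connectedin_connected_components_of)
  then obtain a where "C \<subseteq> {a}" using tot_disc_T[OF x] unfolding totally_disconnected_in_def connectedin_subtopology by blast
  moreover have "w \<in> C" unfolding C_def using wTx by (simp add: connected_component_of_refl)
  ultimately have Cx: "C = {w}" by auto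
  have "compactin (T x) C" using wTx by (simp add: Cx compactin_sing)
  then have qC: "C \<in> quasi_components_of (T x)"
    using compact_quasi_eq_connected_components_of[OF lc H] CC by blast
  have "openin (transversal_space F) O1" by (simp add: O1_def)
  then have oO: "openin (T x) (transversal F x \<inter> O1)" by (metis openin_subtopology_Int2)
  have sub: "O1 \<subseteq> transversal F x" unfolding O1_def by (rule interior_of_subset)
  have "closedin (T x) (topspace (T x) - (transversal F x \<inter> O1))" using oO by blast
  then have cK: "closedin (T x) (transversal F x - O1)" using topspace_T[OF x] by (simp add: Diff_Int)
  then have "compactin (T x) (transversal F x - O1)" by (rule closedin_compact_space[OF cs])
  moreover have "disjnt (transversal F x - O1) C" using chart_facts(6)[OF x] by (auto simp: Cx disjnt_def O1_def w_def)
  ultimately have "separated_between (T x) (transversal F x - O1) C"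
    using separated_between_compact_quasi_component[OF _ qC] by blast
  then obtain U Q where UQ: "openin (T x) U" "openin (T x) Q" "U \<union> Q = topspace (T x)" "disjnt U Q" "transversal F x - O1 \<subseteq> U" "C \<subseteq> Q"
    unfolding separated_between_def by auto
  have "Q = topspace (T x) - U" using UQ(3,4) by (auto simp: disjnt_def)
  then have "closedin (T x) Q" using UQ(1) by blast
  moreover have "Q \<subseteq> O1" using UQ(3-5) topspace_T[OF x] by (auto simp: disjnt_def)
  ultimately show ?thesis using UQ(2,6) Cx unfolding O1_def w_def by (intro exI[of _ Q]) simp
qed

definition Q :: "'a \<Rightarrow> 'b set" where
  "Q x = (SOME Q. tr x x \<in> Q \<and> Q \<subseteq> transversal_space F interior_of transversal F x \<and> openin (T x) Q \<and> closedin (T x) Q)"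

lemma Q:
  assumes "x \<in> topspace M"
  shows "tr x x \<in> Q x" "Q x \<subseteq> transversal_space F interior_of transversal F x" "openin (T x) (Q x)" "closedin (T x) (Q x)"
    "Q x \<subseteq> transversal F x"
proof -
  show a: "tr x x \<in> Q x" "Q x \<subseteq> transversal_space F interior_of transversal F x" "openin (T x) (Q x)" "closedin (T x) (Q x)"
    unfolding Q_def using someI_ex[OF clopen_transversal[OF assms]] by blast+
  show "Q x \<subseteq> transversal F x" using a(2) interior_of_subset by (rule subset_trans)
qed

text \<open>Rescaled coordinates: the box \<open>Bm x\<close> is the half-size cube over the clopen piece \<open>Q x\<close>, so
  that it is compact inside the open chart domain.\<close>

definition co :: "'a \<Rightarrow> 'a \<Rightarrow> (nat \<Rightarrow>\<^sub>C real)" where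
  "co x y = 2 *\<^sub>R toE n (pos x y)"

definition Bm :: "'a \<Rightarrow> 'a set" where
  "Bm x = {y \<in> cl x. norm (co x y) \<le> 1 \<and> tr x y \<in> Q x}"

lemma co_continuous:
  assumes x: "x \<in> topspace M"
  shows "continuous_map (subtopology M (cl x)) euclidean (co x)"
proof -
  have "continuous_on (closed_cube n) (\<lambda>p. 2 *\<^sub>R toE n p)"
    by (intro continuous_on_scaleR continuous_on_const continuous_toE)
  then have "continuous_map CQ euclidean (\<lambda>p. 2 *\<^sub>R toE n p)" by (simp add: CQ_eq)
  from continuous_map_compose[OF chart_continuous(1)[OF x] this] show ?thesis by (simp add: o_def co_def[abs_def])
qed

lemma co_open_cube:
  assumes "x \<in> topspace M" "y \<in> cl x" "norm (co x y) \<le> 1"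
  shows "pos x y \<in> open_cube n"
proof -
  have "\<bar>pos x y i\<bar> < 1" if "i < n" for i
    using coord_toE[OF that, of "pos x y"] assms(3) by (simp add: co_def)
  then show ?thesis using pos_tr(1)[OF assms(1,2)] by (auto simp: closed_cube_def open_cube_def abs_less_iff)
qed

lemma Bm_dom: "x \<in> topspace M \<Longrightarrow> Bm x \<subseteq> chart_dom F x"
  using co_open_cube Q(2) by (subst chart_facts(7)) (auto simp: Bm_def mem_Times_iff)

lemma Bm_cl: "Bm x \<subseteq> cl x" by (auto simp: Bm_def)

lemma x_Bm: "x \<in> topspace M \<Longrightarrow> x \<in> Bm x \<and> co x x = 0"
proof -
  assume x: "x \<in> topspace M"
  have "toE n (\<lambda>i. 0) = 0" by (intro bcontfun_eqI) simp
  then have "co x x = 0" by (simp add: co_def chart_facts(5)[OF x])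
  moreover have "x \<in> cl x" using chart_facts(3)[OF x] chart_dom_cl[OF x] by blast
  ultimately show ?thesis using Q(1)[OF x] by (simp add: Bm_def)
qed

lemma open_sub_Bm:
  assumes x: "x \<in> topspace M" and r: "r \<le> 1"
  shows "openin M {y \<in> Bm x. norm (co x y) < r}"
proof (rule open_in_dom[OF x])
  show "{y \<in> Bm x. norm (co x y) < r} \<subseteq> chart_dom F x" using Bm_dom[OF x] by blast
  have 1: "openin (subtopology M (cl x)) {y \<in> topspace (subtopology M (cl x)). tr x y \<in> Q x}"
    by (rule openin_continuous_map_preimage[OF chart_continuous(2)[OF x] Q(3)[OF x]])
  have "openin euclidean (ball (0 :: nat \<Rightarrow>\<^sub>C real) r)" by simp
  then have 2: "openin (subtopology M (cl x)) {y \<in> topspace (subtopology M (cl x)). co x y \<in> ball 0 r}"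
    by (rule openin_continuous_map_preimage[OF co_continuous[OF x]])
  have "{y \<in> Bm x. norm (co x y) < r} = {y \<in> topspace (subtopology M (cl x)). tr x y \<in> Q x} \<inter> {y \<in> topspace (subtopology M (cl x)). co x y \<in> ball 0 r}"
    using r topspace_cl by (auto simp: Bm_def)
  then show "openin (subtopology M (cl x)) {y \<in> Bm x. norm (co x y) < r}" using openin_Int[OF 1 2] by simp
qed

lemma compactin_Bm:
  assumes x: "x \<in> topspace M"
  shows "compactin M (Bm x)"
proof -
  have 1: "closedin (subtopology M (cl x)) {y \<in> topspace (subtopology M (cl x)). tr x y \<in> Q x}"
    by (rule closedin_continuous_map_preimage[OF chart_continuous(2)[OF x] Q(4)[OF x]])
  have "closedin euclidean (cball (0 :: nat \<Rightarrow>\<^sub>C real) 1)" by simp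
  then have 2: "closedin (subtopology M (cl x)) {y \<in> topspace (subtopology M (cl x)). co x y \<in> cball 0 1}"
    by (rule closedin_continuous_map_preimage[OF co_continuous[OF x]])
  have "Bm x = {y \<in> topspace (subtopology M (cl x)). tr x y \<in> Q x} \<inter> {y \<in> topspace (subtopology M (cl x)). co x y \<in> cball 0 1}"
    using topspace_cl by (auto simp: Bm_def)
  then have "closedin (subtopology M (cl x)) (Bm x)" using closedin_Int[OF 1 2] by simp
  then have "closedin M (Bm x)" using closedin_trans_full closedin_closure_of by blast
  then show ?thesis using closedin_compact_space[OF compact_M] by blast
qed

section \<open>Derivatives of the transition maps\<close>

definition der :: "'a \<Rightarrow> 'a \<Rightarrow> 'a \<Rightarrow> nat \<Rightarrow> nat \<Rightarrow> real" where
  "der x y z j i = partial_deriv i (\<lambda>p. transition M F x y z p j) (pos x z)"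

lemma transition_pnt: "transition M F x y z p = pos y (pnt x p (tr x z))"
  by (simp add: transition_def pnt_def)

lemma smoothness:
  assumes x: "x \<in> topspace M" and y: "y \<in> topspace M"
  obtains V where
    "\<And>z. z \<in> chart_dom F x \<inter> chart_dom F y \<Longrightarrow> openin M (V z) \<and> z \<in> V z \<and> V z \<subseteq> chart_dom F x \<inter> chart_dom F y \<and>
      smooth_map_on n (plaque_image M F x z (V z)) (transition M F x y z)"
    "smoothly_continuous_family n M (chart_dom F x \<inter> chart_dom F y) (\<lambda>z. plaque_image M F x z (V z)) (transition M F x y)"
proof -
  have "smooth_foliated_space n M F" using matchbox by (simp add: matchbox_manifold_def)
  then obtain V where V: "\<forall>z\<in>chart_dom F x \<inter> chart_dom F y.
           let P = plaque M F x (snd (chart F x z)); Q = plaque M F y (snd (chart F y z))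
           in openin M (V z) \<and> z \<in> V z \<and> V z \<subseteq> chart_dom F x \<inter> chart_dom F y \<and>
              connectedin M (P \<inter> V z) \<and> openin (subtopology M P) (P \<inter> V z) \<and>
              connectedin M (Q \<inter> V z) \<and> openin (subtopology M Q) (Q \<inter> V z) \<and>
              P \<inter> V z \<subseteq> Q \<inter> V z \<and>
              smooth_map_on n (plaque_image M F x z (V z)) (transition M F x y z)"
    "smoothly_continuous_family n M (chart_dom F x \<inter> chart_dom F y) (\<lambda>z. plaque_image M F x z (V z)) (transition M F x y)"
    using x y unfolding smooth_foliated_space_def by blast
  show thesis by (rule that[OF _ V(2)]) (use V(1) in \<open>simp add: Let_def\<close>)
qed

lemma pos_plaque_image:
  assumes "x \<in> topspace M" "z \<in> chart_dom F x" "z \<in> V"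
  shows "pos x z \<in> plaque_image M F x z V"
  unfolding plaque_image_def plaque_def using assms chart_dom_cl by blast

lemma der_deriv:
  assumes x: "x \<in> topspace M" and y: "y \<in> topspace M" and z: "z \<in> chart_dom F x \<inter> chart_dom F y" and ij: "i < n" "j < n"
  shows "((\<lambda>s. transition M F x y z ((pos x z)(i := s)) j) has_real_derivative der x y z j i) (at (pos x z i))"
proof -
  obtain V where V: "z \<in> V z" "smooth_map_on n (plaque_image M F x z (V z)) (transition M F x y z)"
    using smoothness[OF x y] z by metis
  have p: "pos x z \<in> plaque_image M F x z (V z)" using pos_plaque_image[OF x _ V(1)] z by blast
  \<comment> \<open>The empty list of derivatives expresses differentiability of the transition map
    itself in the variable \<open>i\<close>.\<close>
  have "(\<lambda>t. iterated_partial [] (\<lambda>q. transition M F x y z q j) ((pos x z)(i := t))) differentiable at (pos x z i)"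
    using V(2) ij p unfolding smooth_map_on_def by (metis empty_subsetI list.set(1))
  then have "(\<lambda>s. transition M F x y z ((pos x z)(i := s)) j) differentiable at (pos x z i)"
    by (simp add: iterated_partial_def)
  then show ?thesis
    unfolding der_def partial_deriv_def using DERIV_deriv_iff_real_differentiable by blast
qed

lemma closed_cube_Euclidean: "closed_cube n \<subseteq> {p. \<forall>i\<ge>n. p i = (0::real)}"
  by (auto simp: closed_cube_def topspace_Euclidean_space)

lemma co_dom_continuous:
  assumes x: "x \<in> topspace M" and U: "U \<subseteq> chart_dom F x"
  shows "continuous_map (subtopology M U) euclidean (co x)"
  using continuous_map_from_subtopology_mono[OF co_continuous[OF x]] U chart_dom_cl[OF x] by blast

lemma pos_close: "i < n \<Longrightarrow> \<bar>pos x z i - pos x z' i\<bar> \<le> norm (co x z - co x z') / 2"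
proof -
  assume i: "i < n"
  have "co x z - co x z' = 2 *\<^sub>R toE n (\<lambda>i. pos x z i - pos x z' i)"
    unfolding co_def toE_diff[symmetric] by (simp add: scaleR_diff_right)
  then show ?thesis using coord_toE[OF i, of "\<lambda>i. pos x z i - pos x z' i"] by simp
qed

lemma pos_zero: "x \<in> topspace M \<Longrightarrow> z \<in> cl x \<Longrightarrow> i \<ge> n \<Longrightarrow> pos x z i = 0"
  using pos_tr(1) closed_cube_Euclidean by blast

text \<open>What the mean value theorem needs: a full cube of parameters over every \<open>w\<close>
  in \<open>W\<close>, mapped into \<open>N\<close>, and a neighbourhood \<open>B\<close> of
  \<open>z0\<close> whose points have their coordinates there.\<close>

lemma cylinder:
  assumes x: "x \<in> topspace M" and z0: "z0 \<in> chart_dom F x" and N: "openin M N" "z0 \<in> N"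
  obtains r W B where "r > 0" "openin (T x) W" "tr x z0 \<in> W"
    "\<And>p w. (\<And>i. i \<ge> n \<Longrightarrow> p i = 0) \<Longrightarrow> (\<And>i. i < n \<Longrightarrow> \<bar>p i - pos x z0 i\<bar> \<le> r) \<Longrightarrow> w \<in> W \<Longrightarrow>
      p \<in> open_cube n \<and> pnt x p w \<in> N"
    "openin M B" "z0 \<in> B"
    "\<And>u. u \<in> B \<Longrightarrow> u \<in> chart_dom F x \<and> tr x u \<in> W \<and> (\<forall>i<n. \<bar>pos x u i - pos x z0 i\<bar> \<le> r)"
proof -
  have z0c: "z0 \<in> cl x" using z0 chart_dom_cl[OF x] by blast
  have oc: "pos x z0 \<in> open_cube n" using z0 chart_facts(7)[OF x] by (auto simp: mem_Times_iff)
  have "continuous_map (prod_topology CQ (T x)) M (\<lambda>(p, w). pnt x p w)"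
    using pnt_continuous[OF x] by (rule continuous_map_into_fulltopology)
  from openin_continuous_map_preimage[OF this N(1)]
  have "openin (prod_topology CQ (T x)) {q \<in> topspace (prod_topology CQ (T x)). (\<lambda>(p, w). pnt x p w) q \<in> N}" .
  moreover have "(pos x z0, tr x z0) \<in> {q \<in> topspace (prod_topology CQ (T x)). (\<lambda>(p, w). pnt x p w) q \<in> N}"
    unfolding topspace_prod_topology topspace_T[OF x] topspace_CQ using pos_tr[OF x z0c] N(2) by (simp del: prod.collapse)
  ultimately obtain G W where GW: "openin CQ G" "openin (T x) W" "pos x z0 \<in> G" "tr x z0 \<in> W"
    "G \<times> W \<subseteq> {q \<in> topspace (prod_topology CQ (T x)). (\<lambda>(p, w). pnt x p w) q \<in> N}"
    unfolding openin_prod_topology_alt by meson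
  obtain r1 where r1: "r1 > 0" "\<And>p. p \<in> closed_cube n \<Longrightarrow> (\<And>i. i < n \<Longrightarrow> \<bar>p i - pos x z0 i\<bar> \<le> r1) \<Longrightarrow> p \<in> G"
    by (rule cube_nbhd[OF GW(1)[unfolded CQ_eq] GW(3) closed_cube_Euclidean]) (rule that, assumption, blast)
  obtain r2 where r2: "r2 > 0" "\<And>p. p \<in> {p. \<forall>i\<ge>n. p i = (0::real)} \<Longrightarrow> (\<And>i. i < n \<Longrightarrow> \<bar>p i - pos x z0 i\<bar> \<le> r2) \<Longrightarrow> p \<in> open_cube n"
    by (rule cube_nbhd[OF open_open_cube[unfolded Euclidean_space_eq] oc order_refl]) (rule that, assumption, blast)
  define r where "r = min r1 r2"
  have r: "r > 0" "r \<le> r1" "r \<le> r2" using r1(1) r2(1) by (auto simp: r_def)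
  define B where "B = ({z \<in> topspace (subtopology M (cl x)). co x z \<in> ball (co x z0) r} \<inter> {z \<in> topspace (subtopology M (cl x)). tr x z \<in> W}) \<inter> chart_dom F x"
  have "openin (subtopology M (cl x)) ({z \<in> topspace (subtopology M (cl x)). co x z \<in> ball (co x z0) r})"
    by (rule openin_continuous_map_preimage[OF co_continuous[OF x]]) simp
  moreover have "openin (subtopology M (cl x)) {z \<in> topspace (subtopology M (cl x)). tr x z \<in> W}"
    by (rule openin_continuous_map_preimage[OF chart_continuous(2)[OF x] GW(2)])
  moreover have "openin (subtopology M (cl x)) (chart_dom F x)"
    using chart_facts(2)[OF x] chart_dom_cl[OF x] openin_subtopology_Int2[OF chart_facts(2)[OF x], of "cl x"] by (simp add: Int_absorb1)
  ultimately have "openin (subtopology M (cl x)) B" unfolding B_def by (intro openin_Int)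
  then have oB: "openin M B" by (rule open_in_dom[OF x]) (auto simp: B_def)
  have z0B: "z0 \<in> B" unfolding B_def topspace_cl using z0 z0c GW(4) r(1) by simp
  show thesis
  proof (rule that[OF r(1) GW(2,4) _ oB z0B])
    fix p w assume p: "\<And>i. i \<ge> n \<Longrightarrow> p i = (0::real)" "\<And>i. i < n \<Longrightarrow> \<bar>p i - pos x z0 i\<bar> \<le> r" and w: "w \<in> W"
    have po: "p \<in> open_cube n" by (rule r2(2)) (use p r(3) in \<open>auto intro: order_trans\<close>)
    then have "p \<in> closed_cube n" by (auto simp: open_cube_def closed_cube_def)
    then have "p \<in> G" by (rule r1(2)) (use p(2) r(2) in \<open>auto intro: order_trans\<close>)
    then show "p \<in> open_cube n \<and> pnt x p w \<in> N" using GW(5) w po by auto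
  next
    fix u assume u: "u \<in> B"
    have "\<bar>pos x u i - pos x z0 i\<bar> \<le> r" if i: "i < n" for i
    proof -
      have "norm (co x u - co x z0) < r" using u by (auto simp: B_def dist_norm norm_minus_commute)
      then show ?thesis using pos_close[OF i, of x u z0] r(1) by linarith
    qed
    then show "u \<in> chart_dom F x \<and> tr x u \<in> W \<and> (\<forall>i<n. \<bar>pos x u i - pos x z0 i\<bar> \<le> r)"
      using u by (auto simp: B_def)
  qed
qed

lemma plaque_image_cube:
  assumes x: "x \<in> topspace M" and z: "z \<in> chart_dom F x" and V: "openin M V" "z \<in> V"
  obtains r where "r > 0" "\<And>p. (\<And>i. i \<ge> n \<Longrightarrow> p i = 0) \<Longrightarrow> (\<And>i. i < n \<Longrightarrow> \<bar>p i - pos x z i\<bar> \<le> r) \<Longrightarrow> p \<in> plaque_image M F x z V"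
proof -
  have w: "tr x z \<in> transversal F x" using pos_tr(2)[OF x] z chart_dom_cl[OF x] by blast
  obtain r W where r: "r > 0" and wW: "tr x z \<in> W"
    and cyl: "\<And>p w. (\<And>i. i \<ge> n \<Longrightarrow> p i = 0) \<Longrightarrow> (\<And>i. i < n \<Longrightarrow> \<bar>p i - pos x z i\<bar> \<le> r) \<Longrightarrow> w \<in> W \<Longrightarrow>
      p \<in> open_cube n \<and> pnt x p w \<in> V"
    by (rule cylinder[OF x z V]) (rule that, assumption, assumption, blast)
  show thesis
  proof (rule that[OF r])
    fix p assume p: "\<And>i. i \<ge> n \<Longrightarrow> p i = (0::real)" "\<And>i. i < n \<Longrightarrow> \<bar>p i - pos x z i\<bar> \<le> r"
    have "p \<in> open_cube n" and pV: "pnt x p (tr x z) \<in> V" using cyl[of p "tr x z"] p wW by auto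
    then have pc: "p \<in> closed_cube n" by (auto simp: open_cube_def closed_cube_def)
    have "pnt x p (tr x z) \<in> plaque M F x (tr x z) \<inter> V" using pnt[OF x pc w] pV by (simp add: plaque_def)
    then have "pos x (pnt x p (tr x z)) \<in> plaque_image M F x z V" unfolding plaque_image_def by (rule imageI)
    then show "p \<in> plaque_image M F x z V" using pnt(2)[OF x pc w] by simp
  qed
qed

text \<open>The derivative at the moving point is continuous: convergence in the family is only required
  where the domains overlap, but the point itself always lies in its own domain.\<close>

lemma der_continuous:
  assumes x: "x \<in> topspace M" and y: "y \<in> topspace M" and ij: "i < n" "j < n"
  shows "continuous_map (subtopology M (chart_dom F x \<inter> chart_dom F y)) euclideanreal (\<lambda>z. der x y z j i)"
proof (rule continuous_map_metricI)
  let ?U = "chart_dom F x \<inter> chart_dom F y"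
  fix z0 and e :: real assume z0: "z0 \<in> topspace (subtopology M ?U)" and e: "e > 0"
  have z0U: "z0 \<in> ?U" using z0 by (simp add: topspace_subtopology)
  have oU: "openin M ?U" using chart_facts(2) x y by blast
  obtain V where V: "\<And>z. z \<in> ?U \<Longrightarrow> openin M (V z) \<and> z \<in> V z \<and> V z \<subseteq> ?U \<and> smooth_map_on n (plaque_image M F x z (V z)) (transition M F x y z)"
    "smoothly_continuous_family n M ?U (\<lambda>z. plaque_image M F x z (V z)) (transition M F x y)"
    by (rule smoothness[OF x y]) (rule that; assumption)
  define D where "D z = plaque_image M F x z (V z)" for z
  define G where "G z p = iterated_partial [i] (\<lambda>q. transition M F x y z q j) p" for z p
  have Gder: "G z (pos x z) = der x y z j i" for z by (simp add: G_def der_def iterated_partial_def)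
  obtain r where r: "r > 0" "\<And>p. (\<And>i. i \<ge> n \<Longrightarrow> p i = 0) \<Longrightarrow> (\<And>i. i < n \<Longrightarrow> \<bar>p i - pos x z0 i\<bar> \<le> r) \<Longrightarrow> p \<in> D z0"
    unfolding D_def using plaque_image_cube[OF x _ conjunct1[OF V(1)[OF z0U]]] V(1)[OF z0U] z0U by blast
  \<comment> \<open>Convergence in the family is uniform on compact parts of the domain at
    \<open>z0\<close>; this cube contains \<open>pos x z\<close> for all \<open>z\<close> near
    \<open>z0\<close>.\<close>
  define K where "K = {p. (\<forall>i\<ge>n. p i = (0::real)) \<and> (\<forall>i<n. \<bar>p i - pos x z0 i\<bar> \<le> r)}"
  have KD: "K \<subseteq> D z0" using r(2) by (auto simp: K_def)
  have "compactin (Euclidean_space n) K"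
    unfolding Euclidean_space_eq compactin_subtopology using compact_cube[of n "pos x z0" r] by (auto simp: K_def)
  moreover have "set [i] \<subseteq> {..<n}" using ij by simp
  ultimately obtain W where W: "openin M W" "z0 \<in> W" "\<And>z p. z \<in> W \<inter> ?U \<Longrightarrow> p \<in> K \<inter> D z \<Longrightarrow> \<bar>G z p - G z0 p\<bar> < e/2"
    using V(2) z0U KD ij(2) half_gt_zero[OF e] unfolding smoothly_continuous_family_def D_def G_def by meson
  have z0V: "z0 \<in> V z0" using V(1)[OF z0U] by blast
  have p0D: "pos x z0 \<in> D z0" unfolding D_def using pos_plaque_image[OF x _ z0V] z0U by blast
  have DE: "D z0 \<subseteq> {p. \<forall>i\<ge>n. p i = (0::real)}"
    unfolding D_def plaque_image_def plaque_def using pos_zero[OF x] by auto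
  have "continuous_map (subtopology (Euclidean_space n) (D z0)) euclideanreal (G z0)"
    using V(1)[OF z0U] ij unfolding smooth_map_on_def D_def G_def by auto
  then have "continuous_on (D z0) (G z0)"
    using DE unfolding Euclidean_space_eq subtopology_subtopology by (simp add: Int_absorb1)
  from continuous_openin_preimage_gen[OF this open_ball[of "G z0 (pos x z0)" "e/2"]]
  have o2: "openin (top_of_set (D z0)) (D z0 \<inter> G z0 -` ball (G z0 (pos x z0)) (e/2))" .
  have p0in: "pos x z0 \<in> D z0 \<inter> G z0 -` ball (G z0 (pos x z0)) (e/2)" using p0D e by simp
  obtain r' where r': "r' > 0" "\<And>p. p \<in> D z0 \<Longrightarrow> (\<And>i. i < n \<Longrightarrow> \<bar>p i - pos x z0 i\<bar> \<le> r') \<Longrightarrow> p \<in> D z0 \<inter> G z0 -` ball (G z0 (pos x z0)) (e/2)"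
    by (rule cube_nbhd[OF o2 p0in DE]) (rule that, assumption, blast)
  define s where "s = min r r'"
  have s: "s > 0" "s \<le> r" "s \<le> r'" using r r' by (auto simp: s_def)
  define N where "N = W \<inter> {z \<in> topspace (subtopology M ?U). co x z \<in> ball (co x z0) s}"
  have cU: "continuous_map (subtopology M ?U) euclidean (co x)" by (rule co_dom_continuous[OF x]) blast
  have "openin (subtopology M ?U) {z \<in> topspace (subtopology M ?U). co x z \<in> ball (co x z0) s}"
    by (rule openin_continuous_map_preimage[OF cU]) simp
  then have oN: "openin (subtopology M ?U) N"
  proof -
    assume a: "openin (subtopology M ?U) {z \<in> topspace (subtopology M ?U). co x z \<in> ball (co x z0) s}"
    have "N = (W \<inter> ?U) \<inter> {z \<in> topspace (subtopology M ?U). co x z \<in> ball (co x z0) s}"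
      by (auto simp: N_def topspace_subtopology)
    then show ?thesis using openin_Int[OF openin_subtopology_Int[OF W(1)] a] by simp
  qed
  have "dist (der x y z j i) (der x y z0 j i) < e" if z: "z \<in> N" for z
  proof -
    have zU: "z \<in> ?U" "z \<in> W" "norm (co x z0 - co x z) < s" using z by (auto simp: N_def dist_norm)
    have zc: "z \<in> cl x" using zU(1) chart_dom_cl[OF x] by blast
    have cl: "\<bar>pos x z i - pos x z0 i\<bar> \<le> s" if "i < n" for i
    proof -
      have "norm (co x z - co x z0) < s" using zU(3) by (simp add: norm_minus_commute)
      then show ?thesis using pos_close[OF that, of x z z0] s(1) by linarith
    qed
    have pK: "pos x z \<in> K" unfolding K_def using pos_zero[OF x zc] cl s(2) by force
    have "z \<in> V z" using V(1)[OF zU(1)] by blast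
    then have "pos x z \<in> D z" unfolding D_def using pos_plaque_image[OF x] zU(1) by blast
    then have 1: "\<bar>G z (pos x z) - G z0 (pos x z)\<bar> < e/2" using W(3) zU pK by blast
    have "pos x z \<in> D z0" using pK KD by blast
    then have "pos x z \<in> D z0 \<inter> G z0 -` ball (G z0 (pos x z0)) (e/2)" by (rule r'(2)) (use cl s(3) in force)
    then have "\<bar>G z0 (pos x z) - G z0 (pos x z0)\<bar> < e/2" by (simp add: dist_real_def abs_minus_commute)
    then show ?thesis using 1 unfolding Gder[symmetric] dist_real_def by linarith
  qed
  moreover have "z0 \<in> N" using W(2) z0 s(1) by (simp add: N_def)
  ultimately show "\<exists>N. openin (subtopology M ?U) N \<and> z0 \<in> N \<and> (\<forall>z\<in>N. dist (der x y z j i) (der x y z0 j i) < e)"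
    using oN by blast
qed

text \<open>The Jacobian matrix. Both charts are rescaled by the same factor two, so the matrix is
  also right for the coordinates \<open>co\<close>.\<close>

definition jac :: "'a \<Rightarrow> 'a \<Rightarrow> 'a \<Rightarrow> (nat \<Rightarrow>\<^sub>C real) \<Rightarrow> (nat \<Rightarrow>\<^sub>C real)" where
  "jac x y z v = toE n (\<lambda>j. \<Sum>i<n. der x y z j i * apply_bcontfun v i)"

lemma linear_jac: "linear (jac x y z)"
proof (rule linearI)
  show "jac x y z (v + w) = jac x y z v + jac x y z w" for v w
    unfolding jac_def by (intro bcontfun_eqI) (simp add: distrib_left sum.distrib)
  show "jac x y z (r *\<^sub>R v) = r *\<^sub>R jac x y z v" for r v
    unfolding jac_def by (intro bcontfun_eqI) (simp add: sum_distrib_left mult.left_commute)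
qed

lemma norm_jac: "norm (jac x y z v) \<le> (\<Sum>j<n. \<Sum>i<n. \<bar>der x y z j i\<bar>) * norm v"
  unfolding jac_def
proof (rule norm_toE_le)
  show "0 \<le> (\<Sum>j<n. \<Sum>i<n. \<bar>der x y z j i\<bar>) * norm v" by (intro mult_nonneg_nonneg sum_nonneg) auto
  fix j assume j: "j < n"
  have "\<bar>\<Sum>i<n. der x y z j i * apply_bcontfun v i\<bar> \<le> (\<Sum>i<n. \<bar>der x y z j i * apply_bcontfun v i\<bar>)" by (rule sum_abs)
  also have "\<dots> \<le> (\<Sum>i<n. \<bar>der x y z j i\<bar> * norm v)"
    by (intro sum_mono) (auto simp: abs_mult intro!: mult_left_mono coord_le_norm)
  also have "\<dots> = (\<Sum>i<n. \<bar>der x y z j i\<bar>) * norm v" by (simp add: sum_distrib_right)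
  also have "\<dots> \<le> (\<Sum>j<n. \<Sum>i<n. \<bar>der x y z j i\<bar>) * norm v"
  proof (rule mult_right_mono)
    show "(\<Sum>i<n. \<bar>der x y z j i\<bar>) \<le> (\<Sum>j<n. \<Sum>i<n. \<bar>der x y z j i\<bar>)"
      using j by (intro member_le_sum[where f = "\<lambda>j. \<Sum>i<n. \<bar>der x y z j i\<bar>"] sum_nonneg) auto
  qed simp
  finally show "\<bar>\<Sum>i<n. der x y z j i * apply_bcontfun v i\<bar> \<le> (\<Sum>j<n. \<Sum>i<n. \<bar>der x y z j i\<bar>) * norm v" .
qed

lemma der_sum_continuous:
  assumes x: "x \<in> topspace M" and y: "y \<in> topspace M"
  shows "continuous_map (subtopology M (chart_dom F x \<inter> chart_dom F y)) euclideanreal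
    (\<lambda>z. \<Sum>j<n. \<Sum>i<n. \<bar>der x y z j i - a j i\<bar>)"
proof (intro continuous_map_sum)
  fix j i assume "j \<in> {..<n}" "i \<in> {..<n}"
  then show "continuous_map (subtopology M (chart_dom F x \<inter> chart_dom F y)) euclideanreal (\<lambda>z. \<bar>der x y z j i - a j i\<bar>)"
    using der_continuous[OF x y] by (intro continuous_map_real_abs continuous_map_diff) auto
qed auto

text \<open>Near \<open>z0\<close>, on other plaques as well, the partial derivatives differ from
  those at \<open>z0\<close> by less than \<open>e1\<close> in total, so the coordinatewise mean
  value theorem gives one linear approximation valid for all plaques near \<open>z0\<close>.\<close>

lemma transition_strict_diff:
  assumes x: "x \<in> topspace M" and y: "y \<in> topspace M" and z0: "z0 \<in> chart_dom F x \<inter> chart_dom F y" and e: "e > 0"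
  obtains B where "openin M B" "z0 \<in> B" "\<And>z z'. z \<in> B \<Longrightarrow> z' \<in> B \<Longrightarrow> tr x z = tr x z' \<Longrightarrow>
    norm ((co y z - co y z') - jac x y z0 (co x z - co x z')) \<le> e * norm (co x z - co x z')"
proof -
  let ?U = "chart_dom F x \<inter> chart_dom F y"
  \<comment> \<open>Summing over \<open>n\<close> coordinates costs a factor \<open>n\<close>; the
    summand one covers \<open>n = 0\<close>.\<close>
  define e1 where "e1 = e / (real n + 1)"
  have e1: "e1 > 0" "e1 * n \<le> e" using e by (auto simp: e1_def field_simps)
  have oU: "openin M ?U" using chart_facts(2) x y by blast
  define D where "D z = (\<Sum>j<n. \<Sum>i<n. \<bar>der x y z j i - der x y z0 j i\<bar>)" for z
  define O1 where "O1 = {z \<in> topspace (subtopology M ?U). D z \<in> {..<e1}}"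
  have "openin (subtopology M ?U) O1"
    unfolding O1_def D_def by (rule openin_continuous_map_preimage[OF der_sum_continuous[OF x y]]) simp
  then have oO: "openin M O1" using oU openin_trans_full by blast
  have z0O: "z0 \<in> O1" using z0 e1 openin_subset[OF oU] by (auto simp: O1_def D_def)
  have OU: "O1 \<subseteq> ?U" by (auto simp: O1_def)
  obtain r W B where cyl: "tr x z0 \<in> W"
    "\<And>p w. (\<And>i. i \<ge> n \<Longrightarrow> p i = 0) \<Longrightarrow> (\<And>i. i < n \<Longrightarrow> \<bar>p i - pos x z0 i\<bar> \<le> r) \<Longrightarrow> w \<in> W \<Longrightarrow>
      p \<in> open_cube n \<and> pnt x p w \<in> O1"
    and oB: "openin M B" and z0B: "z0 \<in> B"
    and B: "\<And>u. u \<in> B \<Longrightarrow> u \<in> chart_dom F x \<and> tr x u \<in> W \<and> (\<forall>i<n. \<bar>pos x u i - pos x z0 i\<bar> \<le> r)"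
    by (rule cylinder[OF x IntD1[OF z0] oO z0O]) (rule that, assumption, blast, assumption, assumption, blast)
  have est: "norm ((co y z - co y z') - jac x y z0 (co x z - co x z')) \<le> e * norm (co x z - co x z')"
    if z: "z \<in> B" and z': "z' \<in> B" and t: "tr x z = tr x z'" for z z'
  proof -
    define w where "w = tr x z"
    define N where "N = norm (co x z - co x z')"
    have zc: "z \<in> cl x" "z' \<in> cl x" "w \<in> W" using B[OF z] B[OF z'] chart_dom_cl[OF x] by (auto simp: w_def)
    note p = pos_tr[OF x zc(1)] and p' = pos_tr[OF x zc(2)]
    have wT: "w \<in> transversal F x" using p(2) by (simp add: w_def)
    have comp: "\<bar>(pos y z j - pos y z' j) - (\<Sum>i<n. der x y z0 j i * (pos x z i - pos x z' i))\<bar> \<le> e * N / 2" if j: "j < n" for j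
    proof -
      define f where "f q = pos y (pnt x q w) j" for q
      have d: "((\<lambda>s. f (q(i := s))) has_real_derivative der x y (pnt x q w) j i) (at (q i)) \<and>
          \<bar>der x y (pnt x q w) j i - der x y z0 j i\<bar> \<le> e1"
        if i: "i < n" and q: "\<And>k. min (pos x z' k) (pos x z k) \<le> q k \<and> q k \<le> max (pos x z' k) (pos x z k)" for i q
      proof -
        have q0: "q k = 0" if "k \<ge> n" for k using q[of k] pos_zero[OF x zc(1) that] pos_zero[OF x zc(2) that] by simp
        have "\<bar>q k - pos x z0 k\<bar> \<le> r" if k: "k < n" for k
        proof -
          have "\<bar>pos x z k - pos x z0 k\<bar> \<le> r" "\<bar>pos x z' k - pos x z0 k\<bar> \<le> r" using B[OF z] B[OF z'] k by auto
          then show ?thesis using q[of k] by (auto simp: abs_le_iff min_def max_def split: if_splits)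
        qed
        then have u: "q \<in> open_cube n" "pnt x q w \<in> O1" using cyl(2)[of q w] q0 zc(3) by auto
        have qc: "q \<in> closed_cube n" using u(1) by (auto simp: open_cube_def closed_cube_def)
        note pu = pnt[OF x qc wT]
        have "((\<lambda>s. transition M F x y (pnt x q w) ((pos x (pnt x q w))(i := s)) j) has_real_derivative der x y (pnt x q w) j i) (at (pos x (pnt x q w) i))"
          by (rule der_deriv[OF x y _ i j]) (use u(2) OU in blast)
        then have 1: "((\<lambda>s. f (q(i := s))) has_real_derivative der x y (pnt x q w) j i) (at (q i))"
          unfolding transition_pnt pu f_def .
        have "\<bar>der x y (pnt x q w) j i - der x y z0 j i\<bar> \<le> (\<Sum>i<n. \<bar>der x y (pnt x q w) j i - der x y z0 j i\<bar>)"
          using i by (intro member_le_sum[where f = "\<lambda>i. \<bar>der x y (pnt x q w) j i - der x y z0 j i\<bar>"]) auto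
        also have "\<dots> \<le> D (pnt x q w)"
          unfolding D_def using j by (intro member_le_sum[where f = "\<lambda>j. \<Sum>i<n. \<bar>der x y (pnt x q w) j i - der x y z0 j i\<bar>"] sum_nonneg) auto
        also have "\<dots> < e1" using u(2) by (simp add: O1_def)
        finally show ?thesis using 1 by simp
      qed
      have "pos x z' k = pos x z k" if "k \<ge> n" for k using pos_zero[OF x zc(1) that] pos_zero[OF x zc(2) that] by simp
      from coordinatewise_mvt[of n "pos x z'" "pos x z" f "\<lambda>i q. der x y (pnt x q w) j i" "\<lambda>i. der x y z0 j i" e1, OF this d]
      have "\<bar>f (pos x z) - f (pos x z') - (\<Sum>i<n. der x y z0 j i * (pos x z i - pos x z' i))\<bar> \<le> e1 * (\<Sum>i<n. \<bar>pos x z i - pos x z' i\<bar>)" by blast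
      moreover have "f (pos x z) = pos y z j" "f (pos x z') = pos y z' j" using p(3) p'(3) t by (simp_all add: f_def w_def)
      moreover have "(\<Sum>i<n. \<bar>pos x z i - pos x z' i\<bar>) \<le> (\<Sum>i<n. N / 2)"
        unfolding N_def by (intro sum_mono pos_close) simp
      then have "e1 * (\<Sum>i<n. \<bar>pos x z i - pos x z' i\<bar>) \<le> e1 * (n * (N / 2))" using e1(1) by simp
      moreover have "e1 * (n * (N / 2)) \<le> e * N / 2"
        using mult_right_mono[OF e1(2), of "N / 2"] by (simp add: N_def mult.assoc)
      ultimately show ?thesis by linarith
    qed
    have "(co y z - co y z') - jac x y z0 (co x z - co x z') =
        2 *\<^sub>R toE n (\<lambda>j. (pos y z j - pos y z' j) - (\<Sum>i<n. der x y z0 j i * (pos x z i - pos x z' i)))"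
      unfolding jac_def co_def
      by (intro bcontfun_eqI) (simp add: right_diff_distrib sum_distrib_left mult.left_commute sum_subtractf)
    moreover have "norm (toE n (\<lambda>j. (pos y z j - pos y z' j) - (\<Sum>i<n. der x y z0 j i * (pos x z i - pos x z' i)))) \<le> e * N / 2"
      by (rule norm_toE_le) (use comp e in \<open>auto simp: N_def\<close>)
    ultimately show ?thesis by (simp add: N_def)
  qed
  show thesis by (rule that[OF oB z0B est])
qed

section \<open>Finitely many boxes and a common derivative bound\<close>

lemma finite_cover:
  obtains I where "finite I" "I \<subseteq> topspace M" "\<And>z. z \<in> topspace M \<Longrightarrow> \<exists>x\<in>I. z \<in> Bm x \<and> norm (co x z) < 1/2"
proof -
  define U where "U x = {y \<in> Bm x. norm (co x y) < 1/2}" for x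
  have U: "openin M (U x)" "x \<in> U x" if "x \<in> topspace M" for x
    using open_sub_Bm[OF that, of "1/2"] x_Bm[OF that] by (auto simp: U_def)
  have "topspace M \<subseteq> \<Union> (U ` topspace M)" using U(2) by blast
  then obtain \<F> where F: "finite \<F>" "\<F> \<subseteq> U ` topspace M" "topspace M \<subseteq> \<Union>\<F>"
    using compact_M U(1) unfolding compact_space_alt by (metis (no_types, lifting) imageE)
  obtain I where I: "I \<subseteq> topspace M" "finite I" "\<F> = U ` I" using finite_subset_image[OF F(1,2)] by blast
  show thesis
  proof (rule that[OF I(2,1)])
    fix z assume "z \<in> topspace M"
    then show "\<exists>x\<in>I. z \<in> Bm x \<and> norm (co x z) < 1/2" using F(3) I(3) by (auto simp: U_def)
  qed
qed

lemma jac_bound_pair: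
  assumes x: "x \<in> topspace M" and y: "y \<in> topspace M"
  shows "\<exists>L\<ge>0. \<forall>z\<in>Bm x \<inter> Bm y. \<forall>v. norm (jac x y z v) \<le> L * norm v"
proof -
  let ?U = "chart_dom F x \<inter> chart_dom F y"
  have H: "Hausdorff_space M" using metr_M by (rule metrizable_imp_Hausdorff_space)
  have "compactin M (Bm x \<inter> Bm y)" using compactin_Bm[OF x] compactin_Bm[OF y] H
    by (metis compactin_imp_closedin compact_Int_closedin)
  moreover have "Bm x \<inter> Bm y \<subseteq> ?U" using Bm_dom x y by blast
  ultimately have "compactin (subtopology M ?U) (Bm x \<inter> Bm y)" by (simp add: compactin_subtopology)
  from image_compactin[OF this der_sum_continuous[OF x y, of "\<lambda>_ _. 0"]]
  have "bounded ((\<lambda>z. \<Sum>j<n. \<Sum>i<n. \<bar>der x y z j i\<bar>) ` (Bm x \<inter> Bm y))" by (simp add: compact_imp_bounded)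
  then obtain L where L: "\<And>z. z \<in> Bm x \<inter> Bm y \<Longrightarrow> \<bar>\<Sum>j<n. \<Sum>i<n. \<bar>der x y z j i\<bar>\<bar> \<le> L" "L > 0"
    unfolding bounded_pos by auto
  have "norm (jac x y z v) \<le> L * norm v" if z: "z \<in> Bm x \<inter> Bm y" for z v
  proof -
    have "(\<Sum>j<n. \<Sum>i<n. \<bar>der x y z j i\<bar>) * norm v \<le> L * norm v" using L(1)[OF z] by (intro mult_right_mono) auto
    then show ?thesis using norm_jac[of x y z v] by linarith
  qed
  then show ?thesis using L(2) by (intro exI[of _ L]) auto
qed

lemma jac_bound:
  assumes I: "finite I" "I \<subseteq> topspace M"
  obtains L where "L \<ge> 0" "\<And>x y z v. x \<in> I \<Longrightarrow> y \<in> I \<Longrightarrow> z \<in> Bm x \<inter> Bm y \<Longrightarrow> norm (jac x y z v) \<le> L * norm v"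
proof -
  obtain l where l: "\<And>x y. x \<in> I \<Longrightarrow> y \<in> I \<Longrightarrow> l x y \<ge> 0 \<and> (\<forall>z\<in>Bm x \<inter> Bm y. \<forall>v. norm (jac x y z v) \<le> l x y * norm v)"
    using jac_bound_pair I(2) by (metis subsetD)
  define L where "L = (\<Sum>q\<in>I \<times> I. l (fst q) (snd q))"
  have le: "l x y \<le> L" if "x \<in> I" "y \<in> I" for x y
    unfolding L_def using member_le_sum[of "(x, y)" "I \<times> I" "\<lambda>q. l (fst q) (snd q)"] l that I(1) by auto
  show thesis
  proof (rule that)
    show "L \<ge> 0" unfolding L_def using l by (intro sum_nonneg) auto
    fix x y z v assume *: "x \<in> I" "y \<in> I" "z \<in> Bm x \<inter> Bm y"
    have "norm (jac x y z v) \<le> l x y * norm v" using l * by blast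
    also have "\<dots> \<le> L * norm v" using le *(1,2) by (intro mult_right_mono) auto
    finally show "norm (jac x y z v) \<le> L * norm v" .
  qed
qed

end

lemma openin_top_of_set_dist:
  assumes "openin (top_of_set S) U" "x \<in> U"
  obtains d where "d > 0" "\<And>y. y \<in> S \<Longrightarrow> dist x y < d \<Longrightarrow> y \<in> U"
proof -
  obtain W where W: "open W" "U = S \<inter> W" using assms(1) unfolding openin_open by blast
  obtain d where d: "d > 0" "ball x d \<subseteq> W" using W assms(2) open_contains_ball by blast
  show thesis by (rule that[OF d(1)]) (use d(2) W(2) in auto)
qed

locale matchbox_embedded = matchbox n M F
  for n :: nat and M :: "'a topology" and F :: "('a, 'b) foliation_charts" +
  fixes e :: "'a \<Rightarrow> nat \<Rightarrow> real"
  assumes e: "homeomorphic_map M (top_of_set (e ` topspace M)) e"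
    and compact_image: "compact (e ` topspace M)"
    and hom_M: "homogeneous M"
begin

section \<open>The charts on the embedded copy\<close>

definition S :: "(nat \<Rightarrow> real) set" where "S = e ` topspace M"

definition f :: "(nat \<Rightarrow> real) \<Rightarrow> 'a" where "f = inv_into (topspace M) e"

lemma inj_e: "inj_on e (topspace M)"
  using homeomorphic_imp_injective_map[OF e] .

lemma f_e: "y \<in> topspace M \<Longrightarrow> f (e y) = y"
  by (simp add: f_def inv_into_f_f[OF inj_e])

lemma e_f: "s \<in> S \<Longrightarrow> e (f s) = s"
  unfolding S_def f_def by (rule f_inv_into_f)

lemma f_mem: "s \<in> S \<Longrightarrow> f s \<in> topspace M"
  unfolding S_def f_def by (rule inv_into_into)

lemma continuous_e: "continuous_map M euclidean e"
  using homeomorphic_imp_continuous_map[OF e] by (rule continuous_map_into_fulltopology)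

lemma continuous_f: "continuous_map (top_of_set S) M f"
proof -
  obtain g where g: "homeomorphic_maps M (top_of_set S) e g" using e homeomorphic_map_maps by (metis S_def)
  have "g s = f s" if "s \<in> topspace (top_of_set S)" for s
  proof -
    have s: "s \<in> S" using that by simp
    then have "g s \<in> topspace M" "e (g s) = s" using g by (auto simp: homeomorphic_maps_def continuous_map_def)
    then show ?thesis using f_e by metis
  qed
  then show ?thesis using g continuous_map_eq unfolding homeomorphic_maps_def by metis
qed

lemma open_e: "openin M U \<Longrightarrow> openin (top_of_set S) (e ` U)"
  using homeomorphic_imp_open_map[OF e] by (simp add: open_map_def S_def)

lemma e_image_mem: "B \<subseteq> topspace M \<Longrightarrow> s \<in> e ` B \<Longrightarrow> f s \<in> B"
  using f_e by auto

text \<open>The retraction of a box along plaques onto its central slice. It represents the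
  transversal inside \<open>S\<close>, so that the type of the transversal space disappears from the
  lamination.\<close>

definition ctr :: "'a \<Rightarrow> (nat \<Rightarrow> real) \<Rightarrow> (nat \<Rightarrow> real)" where
  "ctr x s = e (pnt x (\<lambda>i. 0) (tr x (f s)))"

lemma zero_cube: "(\<lambda>i. 0) \<in> closed_cube n"
  by (simp add: closed_cube_def topspace_Euclidean_space)

lemma ctr_pnt:
  assumes x: "x \<in> topspace M" and s: "s \<in> e ` Bm x"
  shows "pnt x (\<lambda>i. 0) (tr x (f s)) \<in> Bm x" "tr x (pnt x (\<lambda>i. 0) (tr x (f s))) = tr x (f s)"
    "f (ctr x s) = pnt x (\<lambda>i. 0) (tr x (f s))"
proof -
  have "Bm x \<subseteq> topspace M" using Bm_cl cl_sub by blast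
  then have fs: "f s \<in> Bm x" using e_image_mem s by blast
  then have Qs: "tr x (f s) \<in> Q x" by (simp add: Bm_def)
  then have "tr x (f s) \<in> transversal F x" using Q(5)[OF x] by blast
  note p = pnt[OF x zero_cube this]
  have "toE n (\<lambda>i. 0) = 0" by (intro bcontfun_eqI) simp
  then have "co x (pnt x (\<lambda>i. 0) (tr x (f s))) = 0" by (simp add: co_def p)
  then show 1: "pnt x (\<lambda>i. 0) (tr x (f s)) \<in> Bm x" using p Qs by (simp add: Bm_def)
  show "tr x (pnt x (\<lambda>i. 0) (tr x (f s))) = tr x (f s)" by (rule p)
  show "f (ctr x s) = pnt x (\<lambda>i. 0) (tr x (f s))" unfolding ctr_def using 1 \<open>Bm x \<subseteq> topspace M\<close> f_e by blast
qed

lemma ctr_eq_iff: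
  assumes x: "x \<in> topspace M" and s: "s \<in> e ` Bm x" "s' \<in> e ` Bm x"
  shows "ctr x s = ctr x s' \<longleftrightarrow> tr x (f s) = tr x (f s')"
proof
  assume "ctr x s = ctr x s'"
  then have "pnt x (\<lambda>i. 0) (tr x (f s)) = pnt x (\<lambda>i. 0) (tr x (f s'))" using ctr_pnt(3)[OF x] s by metis
  then show "tr x (f s) = tr x (f s')" using ctr_pnt(2)[OF x] s by metis
qed (simp add: ctr_def)

lemma Bm_top: "Bm x \<subseteq> topspace M"
  using Bm_cl cl_sub by blast

lemma f_Bm: "s \<in> e ` Bm x \<Longrightarrow> f s \<in> Bm x"
  by (rule e_image_mem[OF Bm_top])

lemma continuous_f_Bm: "continuous_map (top_of_set (e ` Bm x)) (subtopology M (cl x)) f"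
proof -
  have "e ` Bm x \<subseteq> S" using Bm_top by (auto simp: S_def)
  then have "continuous_map (top_of_set (e ` Bm x)) M f"
    using continuous_map_from_subtopology_mono[OF continuous_f[unfolded S_def]] by (metis S_def continuous_f continuous_map_from_subtopology_mono)
  moreover have "f ` (e ` Bm x) \<subseteq> cl x" using f_Bm Bm_cl by blast
  ultimately show ?thesis by (simp add: continuous_map_in_subtopology image_subset_iff_funcset)
qed

lemma homog_image: "homog S"
  unfolding homog_def
proof (intro ballI)
  fix s s' assume s: "s \<in> S" "s' \<in> S"
  obtain h where h: "homeomorphic_map M M h" "h (f s) = f s'" using hom_M f_mem s unfolding homogeneous_def by blast
  define k where "k u = (if u \<in> S then e (h (f u)) else u)" for u
  have hb: "bij_betw h (topspace M) (topspace M)"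
    using homeomorphic_imp_injective_map[OF h(1)] homeomorphic_imp_surjective_map[OF h(1)] by (simp add: bij_betw_def)
  have eb: "bij_betw e (topspace M) S" using inj_e by (simp add: bij_betw_def S_def)
  have fb: "bij_betw f S (topspace M)" unfolding f_def by (rule bij_betw_inv_into[OF eb])
  have "bij_betw (e \<circ> (h \<circ> f)) S S" by (rule bij_betw_trans[OF bij_betw_trans[OF fb hb] eb])
  then have "bij_betw k S S" by (rule bij_betw_cong[THEN iffD1, rotated]) (simp add: k_def)
  moreover have "continuous_map (top_of_set S) euclidean (e \<circ> (h \<circ> f))"
    by (intro continuous_map_compose[OF _ continuous_e] continuous_map_compose[OF continuous_f] homeomorphic_imp_continuous_map h)
  then have "continuous_on S (e \<circ> (h \<circ> f))" by simp
  then have "continuous_on S k" by (rule continuous_on_eq) (simp add: k_def)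
  ultimately have "k \<in> Homeo S" by (simp add: Homeo_def k_def)
  moreover have "k s = s'" using s h(2) e_f by (simp add: k_def)
  ultimately show "\<exists>h\<in>Homeo S. h s = s'" by blast
qed

lemma lamination_image:
  assumes I: "finite I" "I \<subseteq> topspace M" "\<And>z. z \<in> topspace M \<Longrightarrow> \<exists>x\<in>I. z \<in> Bm x \<and> norm (co x z) < 1/2"
    and L: "L \<ge> 0" "\<And>x y z v. x \<in> I \<Longrightarrow> y \<in> I \<Longrightarrow> z \<in> Bm x \<inter> Bm y \<Longrightarrow> norm (jac x y z v) \<le> L * norm v"
  shows "lamination S (model n) n I (\<lambda>x. e ` Bm x) (\<lambda>x s. co x (f s)) ctr L"
proof
  note IM = subsetD[OF I(2)]
  show "compact S" using compact_image by (simp add: S_def)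
  have "connectedin M (topspace M)" using connected_M by (simp add: connectedin_topspace)
  from connectedin_continuous_map_image[OF continuous_e this] show "connected S" by (simp add: S_def)
  show "S \<noteq> {}" using ne_M by (simp add: S_def)
  show "homog S" by (rule homog_image)
  show "subspace (model n)" "closed (model n)" by (rule subspace_model, rule closed_model)
  show "\<exists>U. openin (Euclidean_space n) U \<and> top_of_set (model n \<inter> ball x r) homeomorphic_space subtopology (Euclidean_space n) U"
    if "x \<in> model n" "r > 0" for x r using model_chart[OF that] .
  show "finite I" "L \<ge> 0" using I L by auto
  show "z \<in> S \<Longrightarrow> \<exists>i\<in>I. z \<in> e ` Bm i \<and> norm (co i (f z)) < 1/2" for z
    using I(3)[OF f_mem[of z]] e_f[of z] by (metis imageI)
  fix x assume "x \<in> I"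
  then have x: "x \<in> topspace M" by (rule IM)
  show "compact (e ` Bm x)" using image_compactin[OF compactin_Bm[OF x] continuous_e] by simp
  show "e ` Bm x \<subseteq> S" using Bm_top by (auto simp: S_def)
  have "continuous_map (top_of_set (e ` Bm x)) euclidean (\<lambda>s. co x (f s))"
    using continuous_map_compose[OF continuous_f_Bm co_continuous[OF x]] by (simp add: o_def)
  then show "continuous_on (e ` Bm x) (\<lambda>s. co x (f s))" by simp
  have 1: "continuous_map (top_of_set (e ` Bm x)) (T x) (\<lambda>s. tr x (f s))"
    using continuous_map_compose[OF continuous_f_Bm chart_continuous(2)[OF x]] by (simp add: o_def)
  have "continuous_map (top_of_set (e ` Bm x)) (prod_topology CQ (T x)) (\<lambda>s. ((\<lambda>i. 0), tr x (f s)))"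
    using 1 zero_cube topspace_CQ by (intro continuous_map_pairedI) auto
  from continuous_map_compose[OF this pnt_continuous[OF x]]
  have "continuous_map (top_of_set (e ` Bm x)) (subtopology M (cl x)) (\<lambda>s. pnt x (\<lambda>i. 0) (tr x (f s)))" by (simp add: o_def)
  then have "continuous_map (top_of_set (e ` Bm x)) M (\<lambda>s. pnt x (\<lambda>i. 0) (tr x (f s)))" by (rule continuous_map_into_fulltopology)
  from continuous_map_compose[OF this continuous_e]
  show "continuous_on (e ` Bm x) (ctr x)" by (simp add: o_def ctr_def[abs_def])
  have "{z \<in> e ` Bm x. norm (co x (f z)) < 1} = e ` {y \<in> Bm x. norm (co x y) < 1}"
    using f_e Bm_top by (auto simp: subset_iff)
  then show "openin (top_of_set S) {z \<in> e ` Bm x. norm (co x (f z)) < 1}"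
    using open_e[OF open_sub_Bm[OF x order_refl]] by simp
  show "ctr x z = ctr x z'" if C: "connected C" "C \<subseteq> e ` Bm x" "z \<in> C" "z' \<in> C" for C z z'
  proof -
    have "connectedin (top_of_set (e ` Bm x)) C" using C(1,2) by (simp add: connectedin_subtopology)
    from connectedin_continuous_map_image[OF continuous_f_Bm this]
    have "connectedin M (f ` C)" "f ` C \<subseteq> cl x" by (auto simp: connectedin_subtopology)
    then have "tr x (f z) = tr x (f z')" using connected_tr[OF x] C(3,4) by blast
    then show ?thesis by (simp add: ctr_def)
  qed
  fix z assume z: "z \<in> e ` Bm x"
  note fz = f_Bm[OF z]
  have fzc: "f z \<in> cl x" using fz Bm_cl by blast
  show "co x (f z) \<in> model n" unfolding co_def by (intro subspace_scale subspace_model toE_model)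
  show "norm (co x (f z)) \<le> 1" using fz by (simp add: Bm_def)
  show "ctr x z \<in> e ` Bm x" unfolding ctr_def using ctr_pnt(1)[OF x z] by simp
  show "ctr x (ctr x z) = ctr x z" using ctr_pnt[OF x z] by (simp add: ctr_def)
  show "z = z'" if z': "z' \<in> e ` Bm x" and eq: "co x (f z) = co x (f z')" "ctr x z = ctr x z'" for z'
  proof -
    have c': "f z' \<in> cl x" using f_Bm[OF z'] Bm_cl by blast
    have "pos x (f z) i = pos x (f z') i" for i
      using pos_close[of i x "f z" "f z'"] eq(1) pos_zero[OF x fzc] pos_zero[OF x c'] by (cases "i < n") auto
    moreover have "tr x (f z) = tr x (f z')" using ctr_eq_iff[OF x z z'] eq(2) by simp
    ultimately have "f z = f z'" using pos_tr(3)[OF x fzc] pos_tr(3)[OF x c'] by presburger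
    then show ?thesis using z z' f_e Bm_top by (metis e_f imageE subsetD imageI S_def)
  qed
  show "\<exists>z'\<in>e ` Bm x. co x (f z') = v \<and> ctr x z' = ctr x z" if v: "v \<in> model n" "norm v \<le> 1" for v
  proof -
    \<comment> \<open>Halving undoes the factor two in \<open>co\<close>.\<close>
    define p where "p i = apply_bcontfun v i / 2" for i
    have "\<bar>apply_bcontfun v i\<bar> \<le> 1" for i using coord_le_norm[of v i] v(2) by linarith
    then have "- 1 \<le> p i \<and> p i \<le> 1" for i unfolding p_def by (smt (verit) field_sum_of_halves)
    moreover have "p i = 0" if "i \<ge> n" for i using v(1) that by (simp add: p_def model_def)
    ultimately have pc: "p \<in> closed_cube n" by (simp add: closed_cube_def topspace_Euclidean_space)
    have w: "tr x (f z) \<in> Q x" using fz by (simp add: Bm_def)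
    then have wT: "tr x (f z) \<in> transversal F x" using Q(5)[OF x] by blast
    note y = pnt[OF x pc wT]
    have "2 *\<^sub>R toE n p = toE n (apply_bcontfun v)" by (intro bcontfun_eqI) (simp add: p_def)
    then have cy: "co x (pnt x p (tr x (f z))) = v" using toE_apply[OF v(1)] by (simp add: co_def y)
    have yB: "pnt x p (tr x (f z)) \<in> Bm x" using y w cy v(2) by (simp add: Bm_def)
    then have "f (e (pnt x p (tr x (f z)))) = pnt x p (tr x (f z))" using f_e Bm_top by blast
    then show ?thesis using yB cy y by (intro bexI[of _ "e (pnt x p (tr x (f z)))"]) (simp_all add: ctr_def)
  qed
  fix y assume yI: "y \<in> I" and zy: "z \<in> e ` Bm y"
  have y: "y \<in> topspace M" using IM yI .
  have zB: "f z \<in> Bm x \<inter> Bm y" using fz f_Bm[OF zy] by blast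
  have zU: "f z \<in> chart_dom F x \<inter> chart_dom F y" using zB Bm_dom x y by blast
  have zS: "z \<in> S" "e (f z) = z" using z Bm_top e_f by (auto simp: S_def)
  show "\<exists>A. linear A \<and> A ` model n \<subseteq> model n \<and> (\<forall>v\<in>model n. norm (A v) \<le> L * norm v) \<and>
      (\<forall>\<epsilon>>0. \<exists>d>0. \<forall>u\<in>e ` Bm x \<inter> e ` Bm y. \<forall>u'\<in>e ` Bm x \<inter> e ` Bm y.
        dist z u < d \<longrightarrow> dist z u' < d \<longrightarrow> ctr x u = ctr x u' \<longrightarrow>
        norm ((co y (f u) - co y (f u')) - A (co x (f u) - co x (f u'))) \<le> \<epsilon> * norm (co x (f u) - co x (f u')))"
  proof (intro exI[of _ "jac x y (f z)"] conjI)
    show "linear (jac x y (f z))" by (rule linear_jac)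
    show "jac x y (f z) ` model n \<subseteq> model n" unfolding jac_def using toE_model by blast
    show "\<forall>v\<in>model n. norm (jac x y (f z) v) \<le> L * norm v" using L(2)[OF \<open>x \<in> I\<close> yI zB] by blast
    show "\<forall>\<epsilon>>0. \<exists>d>0. \<forall>u\<in>e ` Bm x \<inter> e ` Bm y. \<forall>u'\<in>e ` Bm x \<inter> e ` Bm y.
        dist z u < d \<longrightarrow> dist z u' < d \<longrightarrow> ctr x u = ctr x u' \<longrightarrow>
        norm ((co y (f u) - co y (f u')) - jac x y (f z) (co x (f u) - co x (f u'))) \<le> \<epsilon> * norm (co x (f u) - co x (f u'))"
    proof (rule allI, rule impI)
      fix \<epsilon> :: real assume "\<epsilon> > 0"
      then obtain B where B: "openin M B" "f z \<in> B" "\<And>u u'. u \<in> B \<Longrightarrow> u' \<in> B \<Longrightarrow> tr x u = tr x u' \<Longrightarrow>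
        norm ((co y u - co y u') - jac x y (f z) (co x u - co x u')) \<le> \<epsilon> * norm (co x u - co x u')"
        using transition_strict_diff[OF x y zU] by metis
      have "z \<in> e ` B" using B(2) zS(2) by (metis imageI)
      then obtain d where d: "d > 0" "\<And>u. u \<in> S \<Longrightarrow> dist z u < d \<Longrightarrow> u \<in> e ` B"
        using openin_top_of_set_dist[OF open_e[OF B(1)]] by metis
      have BM: "B \<subseteq> topspace M" using openin_subset[OF B(1)] .
      show "\<exists>d>0. \<forall>u\<in>e ` Bm x \<inter> e ` Bm y. \<forall>u'\<in>e ` Bm x \<inter> e ` Bm y.
          dist z u < d \<longrightarrow> dist z u' < d \<longrightarrow> ctr x u = ctr x u' \<longrightarrow>
          norm ((co y (f u) - co y (f u')) - jac x y (f z) (co x (f u) - co x (f u'))) \<le> \<epsilon> * norm (co x (f u) - co x (f u'))"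
      proof (intro exI[of _ d] conjI ballI impI d(1))
        fix u u' assume u: "u \<in> e ` Bm x \<inter> e ` Bm y" "u' \<in> e ` Bm x \<inter> e ` Bm y" "dist z u < d" "dist z u' < d" "ctr x u = ctr x u'"
        have "u \<in> S" "u' \<in> S" using u(1,2) Bm_top by (auto simp: S_def)
        then have "f u \<in> B" "f u' \<in> B" using d(2) u(3,4) e_image_mem[OF BM] by auto
        moreover have "tr x (f u) = tr x (f u')" using ctr_eq_iff[OF x] u by blast
        ultimately show "norm ((co y (f u) - co y (f u')) - jac x y (f z) (co x (f u) - co x (f u'))) \<le> \<epsilon> * norm (co x (f u) - co x (f u'))"
          by (rule B(3))
      qed
    qed
  qed
qed

end

section \<open>Leaves\<close>

lemma connected_product:
  fixes J :: "nat \<Rightarrow> real set"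
  assumes "\<And>i. connected (J i)"
  shows "connected {p. \<forall>i. p i \<in> J i}"
proof -
  have "connectedin (powertop_real UNIV) (Pi\<^sub>E UNIV J)" unfolding connectedin_PiE using assms by simp
  moreover have "Pi\<^sub>E UNIV J = {p. \<forall>i. p i \<in> J i}" unfolding PiE_UNIV_domain Pi_def by blast
  ultimately show ?thesis by (simp add: euclidean_product_topology)
qed

lemma open_cube_around: "open {p :: nat \<Rightarrow> real. \<forall>i<(n::nat). \<bar>p i - q i\<bar> < s}"
proof -
  have "open {p :: nat \<Rightarrow> real. \<bar>p i - q i\<bar> < s}" for i
    by (intro open_Collect_less continuous_intros continuous_on_product_coordinates)
  then have "open (\<Inter>i<n. {p :: nat \<Rightarrow> real. \<bar>p i - q i\<bar> < s})" by (intro open_INT) auto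
  moreover have "(\<Inter>i<n. {p :: nat \<Rightarrow> real. \<bar>p i - q i\<bar> < s}) = {p. \<forall>i<n. \<bar>p i - q i\<bar> < s}" by auto
  ultimately show ?thesis by simp
qed

lemma connected_open_cube: "connected (open_cube n)"
proof -
  define J where "J i = (if i < n then {-1<..<1} else {0::real})" for i
  have J: "p i \<in> J i \<longleftrightarrow> (i < n \<longrightarrow> -1 < p i \<and> p i < 1) \<and> (i \<ge> n \<longrightarrow> p i = 0)" for p i by (simp add: J_def)
  have "open_cube n = {p. \<forall>i. p i \<in> J i}"
    unfolding J open_cube_def topspace_Euclidean_space by blast
  moreover have "connected {p. \<forall>i. p i \<in> J i}" by (rule connected_product) (simp add: J_def)
  ultimately show ?thesis by simp
qed

section \<open>Plaques and leaves in the fine topology\<close>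

context matchbox
begin

abbreviation "FT \<equiv> fine_topology n M F"

lemma chart_domI:
  assumes "x \<in> topspace M" "z \<in> cl x" "pos x z \<in> open_cube n" "tr x z \<in> transversal_space F interior_of transversal F x"
  shows "z \<in> chart_dom F x"
  by (subst chart_facts(7)[OF assms(1)]) (use assms in \<open>simp add: mem_Times_iff\<close>)

lemma topspace_fine: "topspace FT = topspace M"
proof
  show "topspace FT \<subseteq> topspace M"
    unfolding fine_topology_def topology_generated_by_topspace using cl_sub by blast
  show "topspace M \<subseteq> topspace FT"
  proof
    fix x assume x: "x \<in> topspace M"
    have xc: "x \<in> cl x" using chart_facts(3)[OF x] chart_dom_cl[OF x] by blast
    have "chart F x x \<in> open_cube n \<times> {tr x x}"
      using chart_facts(3,7)[OF x] by (auto simp: mem_Times_iff)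
    then have "x \<in> {y \<in> cl x. chart F x y \<in> open_cube n \<times> {tr x x}}" using xc by simp
    moreover have "{y \<in> cl x. chart F x y \<in> open_cube n \<times> {tr x x}} \<in> {{y \<in> cl x. chart F x y \<in> V \<times> {w}} |x w V.
        x \<in> topspace M \<and> w \<in> transversal F x \<and> openin (Euclidean_space n) V \<and> V \<subseteq> open_cube n}"
      by (rule CollectI, intro exI conjI, rule refl) (use x pos_tr(2)[OF x xc] open_open_cube[of n] in auto)
    ultimately show "x \<in> topspace FT"
      unfolding fine_topology_def topology_generated_by_topspace by (rule UnionI[rotated])
  qed
qed

lemma pnt_slice:
  assumes x: "x \<in> topspace M" and w: "w \<in> transversal F x"
  shows "continuous_map CQ M (\<lambda>p. pnt x p w)"
proof -
  have "continuous_map CQ (prod_topology CQ (T x)) (\<lambda>p. (p, w))"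
    using w topspace_T[OF x] by (intro continuous_map_pairedI continuous_map_id[unfolded id_def] continuous_map_const[THEN iffD2]) auto
  from continuous_map_compose[OF this pnt_continuous[OF x]]
  have "continuous_map CQ (subtopology M (cl x)) (\<lambda>p. pnt x p w)" by (simp add: o_def)
  then show ?thesis by (rule continuous_map_into_fulltopology)
qed

lemma open_closed_cube: "open_cube n \<subseteq> closed_cube n"
  by (auto simp: open_cube_def closed_cube_def)

lemma Hausdorff_T: "Hausdorff_space (T x)"
  using metr_T by (simp add: Hausdorff_space_subtopology metrizable_imp_Hausdorff_space)

text \<open>The parameters in \<open>C\<close> whose points lie on the given plaque of chart
  \<open>y\<close> form a clopen set. It is closed because transversals are Hausdorff. It is open
  because \<open>inner\<close> and the interior position of the transverse coordinate put such
  points into the open domain of \<open>y\<close>, where \<open>tr y\<close> is constant on the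
  images of small cubes.\<close>

lemma plaque_disc:
  fixes a :: "nat \<Rightarrow> real" and r :: real
  defines "C \<equiv> {p. (\<forall>i\<ge>n. p i = 0) \<and> (\<forall>i<n. \<bar>p i - a i\<bar> \<le> r)}"
  assumes x: "x \<in> topspace M" and y: "y \<in> topspace M" and w: "w \<in> transversal F x"
    and C: "C \<subseteq> open_cube n" and inner: "\<And>p. p \<in> C \<Longrightarrow> pnt x p w \<in> cl y \<Longrightarrow> pos y (pnt x p w) \<in> open_cube n"
    and p1: "p1 \<in> C" "pnt x p1 w \<in> chart_dom F y" and p: "p \<in> C"
  shows "pnt x p w \<in> cl y \<and> tr y (pnt x p w) = tr y (pnt x p1 w)"
proof -
  define g where "g p = pnt x p w" for p
  define c where "c = tr y (g p1)"
  define K where "K = {p \<in> C. g p \<in> cl y \<and> tr y (g p) = c}"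
  have CC: "C \<subseteq> closed_cube n" using C open_closed_cube by blast
  have "continuous_map (top_of_set (closed_cube n)) M g"
    using pnt_slice[OF x w] unfolding CQ_eq g_def[abs_def] .
  then have cg: "continuous_map (top_of_set C) M g"
    using CC by (rule continuous_map_from_subtopology_mono)
  \<comment> \<open>The intersection of two cubes is again a product of intervals; with
    \<open>q = a\<close> and \<open>s = r\<close> this also gives connectedness of
    \<open>C\<close>.\<close>
  have conn: "connected {p \<in> C. \<forall>i<n. \<bar>p i - q i\<bar> \<le> s}" for q s
  proof -
    define J where "J i = (if i < n then {max (a i - r) (q i - s) .. min (a i + r) (q i + s)} else {0})" for i
    have "p \<in> {p \<in> C. \<forall>i<n. \<bar>p i - q i\<bar> \<le> s} \<longleftrightarrow> (\<forall>i. p i \<in> J i)" for p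
    proof -
      have "p i \<in> J i \<longleftrightarrow> (i \<ge> n \<longrightarrow> p i = 0) \<and> (i < n \<longrightarrow> \<bar>p i - a i\<bar> \<le> r \<and> \<bar>p i - q i\<bar> \<le> s)" for i
        by (auto simp: J_def abs_le_iff)
      then show ?thesis unfolding C_def by auto
    qed
    then have "{p \<in> C. \<forall>i<n. \<bar>p i - q i\<bar> \<le> s} = {p. \<forall>i. p i \<in> J i}" by blast
    moreover have "connected {p. \<forall>i. p i \<in> J i}" by (rule connected_product) (simp add: J_def)
    ultimately show ?thesis by simp
  qed
  have cint: "c \<in> transversal_space F interior_of transversal F y" "g p1 \<in> cl y"
    using p1(2) chart_facts(7)[OF y] by (auto simp: c_def g_def mem_Times_iff)
  have "c \<in> topspace (T y)" using pos_tr(2)[OF y cint(2)] topspace_T[OF y] by (simp add: c_def)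
  then have "closedin (T y) {c}" using Hausdorff_T by (simp add: closedin_Hausdorff_sing_eq)
  from closedin_continuous_map_preimage[OF chart_continuous(2)[OF y] this]
  have "closedin M {u \<in> topspace (subtopology M (cl y)). tr y u \<in> {c}}"
    using closedin_trans_full closedin_closure_of by blast
  from closedin_continuous_map_preimage[OF cg this]
  have "closedin (top_of_set C) K" unfolding K_def topspace_cl by (simp add: Collect_conj_eq Int_assoc)
  moreover have "openin (top_of_set C) K"
  proof (subst openin_subopen, intro ballI)
    fix q assume q: "q \<in> K"
    have qC: "q \<in> C" "g q \<in> cl y" "tr y (g q) = c" using q by (auto simp: K_def)
    have "pos y (g q) \<in> open_cube n" using inner[OF qC(1)] qC(2) by (simp add: g_def)
    then have gq: "g q \<in> chart_dom F y" using chart_domI[OF y qC(2)] qC(3) cint(1) by simp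
    have o: "openin (top_of_set C) {p \<in> C. g p \<in> chart_dom F y}"
      using openin_continuous_map_preimage[OF cg chart_facts(2)[OF y]] by simp
    have qin: "q \<in> {p \<in> C. g p \<in> chart_dom F y}" using gq qC(1) by simp
    have CE: "C \<subseteq> {p. \<forall>i\<ge>n. p i = 0}" by (auto simp: C_def)
    obtain s where s: "s > 0" "\<And>p. p \<in> C \<Longrightarrow> (\<And>i. i < n \<Longrightarrow> \<bar>p i - q i\<bar> \<le> s) \<Longrightarrow> p \<in> {p \<in> C. g p \<in> chart_dom F y}"
      by (rule cube_nbhd[OF o qin CE]) (rule that, assumption, blast)
    define D where "D = {p \<in> C. \<forall>i<n. \<bar>p i - q i\<bar> \<le> s}"
    have "connectedin (top_of_set C) D" using conn by (auto simp: D_def connectedin_subtopology)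
    from connectedin_continuous_map_image[OF cg this] have gD: "connectedin M (g ` D)" .
    have gDU: "g ` D \<subseteq> chart_dom F y" using s(2) by (auto simp: D_def)
    then have gDc: "g ` D \<subseteq> cl y" using chart_dom_cl[OF y] by blast
    have qD: "q \<in> D" using qC(1) s(1) by (simp add: D_def)
    have "D \<subseteq> K"
    proof
      fix p assume pD: "p \<in> D"
      have "tr y (g p) = tr y (g q)" by (rule connected_tr[OF y gD gDc]) (use pD qD in auto)
      then show "p \<in> K" using pD gDc qC(3) by (auto simp: K_def D_def)
    qed
    moreover have "C \<inter> {p. \<forall>i<n. \<bar>p i - q i\<bar> < s} \<subseteq> D" by (auto simp: D_def less_imp_le)
    moreover have "q \<in> C \<inter> {p. \<forall>i<n. \<bar>p i - q i\<bar> < s}" using qC(1) s(1) by simp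
    ultimately show "\<exists>T. openin (top_of_set C) T \<and> q \<in> T \<and> T \<subseteq> K"
      using openin_open_Int[OF open_cube_around[of n q s], of C] by blast
  qed
  moreover have "connected C"
  proof -
    have "C = {p \<in> C. \<forall>i<n. \<bar>p i - a i\<bar> \<le> r}" by (auto simp: C_def)
    then show ?thesis using conn[of a r] by simp
  qed
  moreover have "p1 \<in> K" using p1(1) cint(2) by (simp add: K_def c_def)
  ultimately have "K = C" unfolding connected_clopen by blast
  then show ?thesis using p by (auto simp: K_def c_def g_def)
qed

text \<open>The transverse coordinate of the other chart may lie on the boundary of its transversal,
  where the charts are not compatible by assumption. The plaques through nearby points of the open
  chart domain are compatible, and the conclusion passes to the limit.\<close>

lemma plaque_fine_continuous:
  assumes x: "x \<in> topspace M" and w: "w \<in> transversal_space F interior_of transversal F x"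
  shows "continuous_map (top_of_set (open_cube n)) FT (\<lambda>p. pnt x p w)"
  unfolding fine_topology_def
proof (rule continuous_on_generated_topo)
  have wT: "w \<in> transversal F x" by (rule subsetD[OF interior_of_subset w])
  note oc = subsetD[OF open_closed_cube]
  show "(\<lambda>p. pnt x p w) ` topspace (top_of_set (open_cube n)) \<subseteq>
      \<Union> {{y \<in> cl x. chart F x y \<in> V \<times> {w}} |x w V. x \<in> topspace M \<and> w \<in> transversal F x \<and> openin (Euclidean_space n) V \<and> V \<subseteq> open_cube n}"
    unfolding topspace_fine[unfolded fine_topology_def topology_generated_by_topspace]
  proof
    fix z assume "z \<in> (\<lambda>p. pnt x p w) ` topspace (top_of_set (open_cube n))"
    then obtain p where "p \<in> open_cube n" "z = pnt x p w" by auto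
    then show "z \<in> topspace M" using subsetD[OF cl_sub pnt(1)[OF x oc wT]] by simp
  qed
  fix U assume "U \<in> {{y \<in> cl x. chart F x y \<in> V \<times> {w}} |x w V. x \<in> topspace M \<and> w \<in> transversal F x \<and> openin (Euclidean_space n) V \<and> V \<subseteq> open_cube n}"
  then obtain y w' V where U: "U = {z \<in> cl y. chart F y z \<in> V \<times> {w'}}" and y: "y \<in> topspace M"
    and V: "openin (Euclidean_space n) V" "V \<subseteq> open_cube n" by blast
  have "\<exists>D. openin (top_of_set (open_cube n)) D \<and> p0 \<in> D \<and> D \<subseteq> {p \<in> open_cube n. pnt x p w \<in> U}"
    if p0: "p0 \<in> open_cube n" "pnt x p0 w \<in> U" for p0
  proof -
    define z0 where "z0 = pnt x p0 w"
    have z0: "z0 \<in> cl x" "pos x z0 = p0" "tr x z0 = w" using pnt[OF x oc[OF p0(1)] wT] by (auto simp: z0_def)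
    have z0U: "z0 \<in> chart_dom F x" using chart_domI[OF x z0(1)] z0 p0(1) w by simp
    have z0y: "z0 \<in> cl y" "pos y z0 \<in> V" "tr y z0 = w'" using p0(2) by (auto simp: z0_def U mem_Times_iff)
    have "continuous_map (subtopology M (cl y)) (Euclidean_space n) (\<lambda>z. pos y z)"
      using chart_continuous(1)[OF y] by (rule continuous_map_into_fulltopology)
    from openin_continuous_map_preimage[OF this V(1)]
    obtain N0 where N0: "openin M N0" "{z \<in> cl y. pos y z \<in> V} = N0 \<inter> cl y"
      unfolding topspace_cl openin_subtopology by blast
    have oN: "openin M (N0 \<inter> chart_dom F x)" using N0(1) chart_facts(2)[OF x] by blast
    have z0N: "z0 \<in> N0 \<inter> chart_dom F x" using z0y N0(2) z0U by blast
    obtain r W B where r: "r > 0" and wW: "tr x z0 \<in> W"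
      and cyl: "\<And>p w. (\<And>i. i \<ge> n \<Longrightarrow> p i = 0) \<Longrightarrow> (\<And>i. i < n \<Longrightarrow> \<bar>p i - pos x z0 i\<bar> \<le> r) \<Longrightarrow> w \<in> W \<Longrightarrow>
        p \<in> open_cube n \<and> pnt x p w \<in> N0 \<inter> chart_dom F x"
      and B: "openin M B" "z0 \<in> B"
        "\<And>u. u \<in> B \<Longrightarrow> u \<in> chart_dom F x \<and> tr x u \<in> W \<and> (\<forall>i<n. \<bar>pos x u i - pos x z0 i\<bar> \<le> r)"
      by (rule cylinder[OF x z0U oN z0N]) (rule that, assumption, assumption, blast, assumption, assumption, blast)
    define C where "C = {p. (\<forall>i\<ge>n. p i = 0) \<and> (\<forall>i<n. \<bar>p i - p0 i\<bar> \<le> r)}"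
    have CN: "p \<in> open_cube n \<and> pnt x p v \<in> N0" if "p \<in> C" "v \<in> W" for p v
      using cyl[of p v] that by (simp add: C_def z0(2))
    have lim: "pnt x p w \<in> cl y \<and> tr y (pnt x p w) = w'" if p: "p \<in> C" for p
    proof -
      define h where "h u = pnt x p (tr x u)" for u
      have hz0: "h z0 = pnt x p w" by (simp add: h_def z0)
      have pc: "p \<in> closed_cube n" using CN[OF p] wW oc by blast
      have "continuous_map (subtopology M (cl x)) (prod_topology CQ (T x)) (\<lambda>u. (p, tr x u))"
        using chart_continuous(2)[OF x] pc topspace_CQ by (intro continuous_map_pairedI) auto
      from continuous_map_compose[OF this pnt_continuous[OF x]]
      have "continuous_map (subtopology M (cl x)) (subtopology M (cl x)) h" by (simp add: o_def h_def[abs_def])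
      then have ch: "continuous_map (subtopology M (cl x)) M h" by (rule continuous_map_into_fulltopology)
      \<comment> \<open>A point \<open>u\<close> of the open domain has its transverse coordinate in
        the interior, so \<open>plaque_disc\<close> applies to the plaque through
        \<open>u\<close>.\<close>
      have near: "h u \<in> cl y \<and> tr y (h u) = tr y u" if u: "u \<in> B" "u \<in> chart_dom F y" for u
      proof -
        note Bu = B(3)[OF u(1)]
        have uc: "u \<in> cl x" using Bu chart_dom_cl[OF x] by blast
        have CC: "C \<subseteq> open_cube n" using CN wW by blast
        have inner: "pos y (pnt x q (tr x u)) \<in> open_cube n" if q: "q \<in> C" "pnt x q (tr x u) \<in> cl y" for q
          using CN[OF q(1)] Bu q(2) N0(2) V(2) by blast
        have "pos x u \<in> C" unfolding C_def using pos_zero[OF x uc] Bu z0(2) by auto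
        moreover have "pnt x (pos x u) (tr x u) = u" using pos_tr(3)[OF x uc] .
        ultimately show ?thesis
          using plaque_disc[OF x y pos_tr(2)[OF x uc], of p0 r "pos x u" p] CC inner u(2) p
          unfolding C_def h_def by simp
      qed
      \<comment> \<open>Since \<open>z0\<close> lies in the closure of the domain of
        \<open>y\<close>, there are such \<open>u\<close> with \<open>u\<close> and
        \<open>h u\<close> in prescribed neighbourhoods of \<open>z0\<close> and
        \<open>h z0\<close>; this takes the place of a convergent sequence.\<close>
      have meet: "\<exists>u. u \<in> chart_dom F y \<and> u \<in> B \<and> u \<in> G \<and> h u \<in> G'"
        if G: "openin M G" "z0 \<in> G" and G': "openin M G'" "h z0 \<in> G'" for G G'
      proof -
        have "openin (subtopology M (cl x)) {u \<in> topspace (subtopology M (cl x)). h u \<in> G'}"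
          by (rule openin_continuous_map_preimage[OF ch G'(1)])
        then obtain G1 where G1: "openin M G1" "{u \<in> cl x. h u \<in> G'} = G1 \<inter> cl x"
          unfolding topspace_cl openin_subtopology by blast
        have "openin M (G1 \<inter> (B \<inter> G))" using G1(1) B(1) G(1) by blast
        moreover have "z0 \<in> G1 \<inter> (B \<inter> G)" using G1(2) G' z0(1) B(2) G(2) by blast
        ultimately have "\<exists>u. u \<in> chart_dom F y \<and> u \<in> G1 \<inter> (B \<inter> G)"
          using conjunct2[OF z0y(1)[unfolded in_closure_of]] by metis
        then obtain u where u: "u \<in> chart_dom F y" "u \<in> G1 \<inter> (B \<inter> G)" by metis
        then have "u \<in> cl x" using B(3) chart_dom_cl[OF x] by blast
        then have "h u \<in> G'" using u(2) G1(2) by blast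
        then show ?thesis using u by blast
      qed
      have hz: "h z0 \<in> topspace M" "z0 \<in> topspace M"
        using pnt(1)[OF x pc wT] z0(1) cl_sub unfolding hz0 by auto
      have hcl: "h z0 \<in> cl y"
      proof (rule ccontr)
        assume "h z0 \<notin> cl y"
        then have "h z0 \<in> topspace M - cl y" using hz by blast
        moreover have "openin M (topspace M - cl y)" using closedin_closure_of by blast
        ultimately show False using meet[of "topspace M"] near hz(2) by blast
      qed
      have "tr y (h z0) = tr y z0"
      proof (rule ccontr)
        assume ne: "tr y (h z0) \<noteq> tr y z0"
        have "tr y (h z0) \<in> topspace (T y)" "tr y z0 \<in> topspace (T y)"
          using pos_tr(2)[OF y] hcl z0y(1) topspace_T[OF y] by auto
        then obtain A A' where A: "openin (T y) A" "openin (T y) A'" "tr y (h z0) \<in> A" "tr y z0 \<in> A'" "disjnt A A'"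
          using Hausdorff_T[of y] ne unfolding Hausdorff_space_def by metis
        have ex: "\<exists>G. openin M G \<and> {u \<in> cl y. tr y u \<in> A} = G \<inter> cl y" if "openin (T y) A" for A
          using openin_continuous_map_preimage[OF chart_continuous(2)[OF y] that] unfolding topspace_cl openin_subtopology by blast
        obtain G' where G': "openin M G'" "{u \<in> cl y. tr y u \<in> A} = G' \<inter> cl y" using ex[OF A(1)] by blast
        obtain G where G: "openin M G" "{u \<in> cl y. tr y u \<in> A'} = G \<inter> cl y" using ex[OF A(2)] by blast
        have "z0 \<in> G" "h z0 \<in> G'" using A(3,4) G(2) G'(2) hcl z0y(1) by blast+
        then obtain u where u: "u \<in> chart_dom F y" "u \<in> B" "u \<in> G" "h u \<in> G'" using meet[OF G(1) _ G'(1)] by blast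
        have "h u \<in> cl y" "tr y (h u) = tr y u" "u \<in> cl y" using near[OF u(2,1)] u(1) chart_dom_cl[OF y] by auto
        then have "h u \<in> {u \<in> cl y. tr y u \<in> A}" "u \<in> {u \<in> cl y. tr y u \<in> A'}" unfolding G(2) G'(2) using u(3,4) by simp_all
        then have "tr y u \<in> A" "tr y u \<in> A'" using \<open>tr y (h u) = tr y u\<close> by auto
        then show False using A(5) by (auto simp: disjnt_def)
      qed
      then show ?thesis using hcl z0y(3) by (simp add: hz0)
    qed
    define D where "D = open_cube n \<inter> {p. \<forall>i<n. \<bar>p i - p0 i\<bar> < r}"
    have "D \<subseteq> {p \<in> open_cube n. pnt x p w \<in> U}"
    proof
      fix p assume pD: "p \<in> D"
      then have po: "p \<in> open_cube n" by (simp add: D_def)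
      then have pC: "p \<in> C" using pD unfolding C_def D_def by (auto simp: open_cube_def topspace_Euclidean_space less_imp_le)
      have "pnt x p w \<in> N0 \<inter> cl y" "tr y (pnt x p w) = w'" using lim[OF pC] CN[OF pC] wW z0(3) by auto
      then have "pnt x p w \<in> U" using N0(2) unfolding U by (auto simp: mem_Times_iff)
      then show "p \<in> {p \<in> open_cube n. pnt x p w \<in> U}" using po by simp
    qed
    moreover have "p0 \<in> D" using p0(1) r by (simp add: D_def)
    moreover have "openin (top_of_set (open_cube n)) D" unfolding D_def by (rule openin_open_Int[OF open_cube_around])
    ultimately show ?thesis by blast
  qed
  then have "openin (top_of_set (open_cube n)) {p \<in> open_cube n. pnt x p w \<in> U}"
    by (subst openin_subopen) blast
  moreover have "(\<lambda>p. pnt x p w) -` U \<inter> topspace (top_of_set (open_cube n)) = {p \<in> open_cube n. pnt x p w \<in> U}" by auto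
  ultimately show "openin (top_of_set (open_cube n)) ((\<lambda>p. pnt x p w) -` U \<inter> topspace (top_of_set (open_cube n)))" by simp
qed

text \<open>The open plaque is the image of a connected cube under a map continuous into the fine
  topology.\<close>

lemma same_plaque_fine_component:
  assumes x: "x \<in> topspace M" and u: "u \<in> Bm x" and v: "v \<in> Bm x" and t: "tr x u = tr x v"
  shows "connected_component_of FT u v"
proof -
  define w where "w = tr x u"
  have w: "w \<in> transversal_space F interior_of transversal F x" using u Q(2)[OF x] by (auto simp: Bm_def w_def)
  have "connectedin (top_of_set (open_cube n)) (open_cube n)" using connected_open_cube by (simp add: connectedin_subtopology)
  from connectedin_continuous_map_image[OF plaque_fine_continuous[OF x w] this]
  have "connectedin FT ((\<lambda>p. pnt x p w) ` open_cube n)" .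
  moreover have "z \<in> (\<lambda>p. pnt x p w) ` open_cube n" if z: "z \<in> Bm x" "tr x z = w" for z
  proof -
    have zc: "z \<in> cl x" "norm (co x z) \<le> 1" using z by (auto simp: Bm_def)
    show ?thesis using co_open_cube[OF x zc] pos_tr(3)[OF x zc(1)] z(2) by (metis imageI)
  qed
  ultimately show ?thesis unfolding connected_component_of_def using u v t w_def by metis
qed

end

context matchbox_embedded
begin

text \<open>A leaf contains all points reached by chains of plaque steps from one of its points, and
  in \<open>S\<close> these chains come close to every point; pulled back by \<open>f\<close> they
  are dense in \<open>M\<close>.\<close>

theorem McCord_and_dense_leaves:
  "homeomorphic_to_McCord_solenoid n M \<and> (\<forall>L\<in>leaves n M F. M closure_of L = topspace M)"
proof -
  obtain I where I: "finite I" "I \<subseteq> topspace M" "\<And>z. z \<in> topspace M \<Longrightarrow> \<exists>x\<in>I. z \<in> Bm x \<and> norm (co x z) < 1/2"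
    by (rule finite_cover) (rule that, assumption, assumption, blast)
  obtain L where L: "L \<ge> 0" "\<And>x y z v. x \<in> I \<Longrightarrow> y \<in> I \<Longrightarrow> z \<in> Bm x \<inter> Bm y \<Longrightarrow> norm (jac x y z v) \<le> L * norm v"
    by (rule jac_bound[OF I(1,2)]) (rule that, assumption, blast)
  interpret lam: lamination S "model n" n I "\<lambda>x. e ` Bm x" "\<lambda>x s. co x (f s)" ctr L
    by (rule lamination_image[OF I L])
  have "M homeomorphic_space top_of_set S" using e homeomorphic_map_imp_homeomorphic_space unfolding S_def by blast
  then have 1: "homeomorphic_to_McCord_solenoid n M"
    using lam.solenoid_and_dense_chains(1) homeomorphic_space_trans unfolding homeomorphic_to_McCord_solenoid_def by blast
  have same: "connected_component_of FT (f u) (f v)" if uv: "lam.same_plaque u v" for u v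
  proof -
    obtain x where x: "x \<in> I" "u \<in> e ` Bm x" "v \<in> e ` Bm x" "ctr x u = ctr x v"
      using uv unfolding lam.same_plaque_def lam.box_def by blast
    have xM: "x \<in> topspace M" using x(1) I(2) by blast
    have "tr x (f u) = tr x (f v)" using ctr_eq_iff[OF xM x(2,3)] x(4) by simp
    then show ?thesis by (rule same_plaque_fine_component[OF xM f_Bm[OF x(2)] f_Bm[OF x(3)]])
  qed
  have "M closure_of C = topspace M" if C: "C \<in> leaves n M F" for C
  proof -
    obtain x where x: "x \<in> topspace M" "C = connected_component_of_set FT x"
      using C topspace_fine unfolding leaves_def connected_components_of_def by auto
    have inC: "y \<in> S \<and> f y \<in> C" if "lam.same_plaque\<^sup>*\<^sup>* (e x) y" for y
      using that
    proof (induction rule: rtranclp_induct)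
      case base
      have "connected_component_of FT x x" using x(1) topspace_fine by (simp add: connected_component_of_refl)
      then show ?case using x f_e[OF x(1)] by (simp add: S_def)
    next
      case (step y z)
      have "z \<in> S" using step.hyps(2) lam.box_S unfolding lam.same_plaque_def by blast
      moreover have "connected_component_of FT x (f z)"
        by (rule connected_component_of_trans[OF _ same[OF step.hyps(2)]]) (use step.IH x(2) in simp)
      ultimately show ?case using x(2) by simp
    qed
    have dns: "u \<in> M closure_of C" if u: "u \<in> topspace M" for u
      unfolding in_closure_of
    proof (intro conjI allI impI u)
      fix G assume G: "u \<in> G \<and> openin M G"
      have "openin (top_of_set S) (e ` G)" "e u \<in> e ` G" using open_e G by auto
      then obtain d where d: "d > 0" "\<And>y. y \<in> S \<Longrightarrow> dist (e u) y < d \<Longrightarrow> y \<in> e ` G"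
        by (rule openin_top_of_set_dist) (rule that, assumption, blast)
      have "e x \<in> S" "e u \<in> S" using x(1) u by (auto simp: S_def)
      from lam.solenoid_and_dense_chains(2)[OF this d(1)] obtain y where y: "lam.same_plaque\<^sup>*\<^sup>* (e x) y" "dist y (e u) < d" by blast
      have "y \<in> e ` G" using d(2) inC[OF y(1)] y(2) by (simp add: dist_commute)
      then have "f y \<in> G" by (rule e_image_mem[OF openin_subset[OF conjunct2[OF G]]])
      then show "\<exists>y. y \<in> C \<and> y \<in> G" using inC[OF y(1)] by blast
    qed
    show ?thesis by (rule equalityI[OF closure_of_subset_topspace subsetI[OF dns]])
  qed
  then show ?thesis using 1 by blast
qed

end

theorem theorem1p2:
  fixes n :: nat
    and M :: "'a topology"
    and F :: "('a, 'b) foliation_charts"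
  assumes "matchbox_manifold n M F"
    and "homogeneous M"
  shows "homeomorphic_to_McCord_solenoid n M \<and>
         (\<forall>L\<in>leaves n M F. M closure_of L = topspace M)"
proof -
  interpret matchbox n M F by standard (rule assms(1))
  obtain e :: "'a \<Rightarrow> nat \<Rightarrow> real" where "homeomorphic_map M (top_of_set (e ` topspace M)) e" "compact (e ` topspace M)"
    using compact_metrizable_embedding[OF compact_M metr_M ne_M] by blast
  then interpret matchbox_embedded n M F e by unfold_locales (use assms(2) in auto)
  show ?thesis by (rule McCord_and_dense_leaves)
qed

end
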